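(* Let $Q(\zeta)=|\zeta|^2$, let $t\in\mathbb R$, $\theta_N=t/\sqrt N$, and $p_N=\sqrt2\,e^{i\theta_N}$ or $p_N=-\sqrt2\,e^{i\theta_N}$. Let $R_{N,k}$ be the rescaled $k$-point correlation function at $p_N$ of the planar symplectic ensemble with potential $Q$. Then, as $N\to\infty$, $R_{N,k}(z_1,\dots,z_k)$ converges, uniformly for $z_1,\dots,z_k$ in compact subsets of $\mathbb C$, to $$R_k^t(z_1,\dots,z_k)=\prod_{j=1}^k(\bar z_j-z_j-2it)\,\operatorname{Pf}\big[K_{\rm edge}^t(z_j,z_l)\big]_{j,l=1}^k,$$ where $$K_{\rm edge}^t(z,w)=e^{-|z+it|^2-|w+it|^2}\begin{pmatrix}\kappa_{\rm edge}^{\mathbb R}(z+it,w+it)&\kappa_{\rm edge}^{\mathbb R}(z+it,\bar w-it)\\ \kappa_{\rm edge}^{\mathbb R}(\bar z-it,w+it)&\kappa_{\rm edge}^{\mathbb R}(\bar z-it,\bar w-it)\end{pmatrix}.$$ Moreover, as $t\to\infty$, $$R_k^t(z_1,\dots,z_k)=\det\big[K_{\rm edge}^{\mathbb C}(z_j,z_l)\big]_{j,l=1}^k\cdot(1+o(1)),$$ where the $o(1)$-term is uniform for $z_1,\dots,z_k$ in compact subsets of $\mathbb C$ and $$K_{\rm edge}^{\mathbb C}(z,w)=e^{-|z|^2-|w|^2+2z\bar w}\,\tfrac12\operatorname{erfc}(z+\bar w).$$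
   Context: Write $dA(\zeta)=\frac1\pi d^2\zeta$. The planar symplectic ensemble with potential $Q$ is the probability measure on $\mathbb C^N$ $$d\mathbf P_N(\zeta_1,\dots,\zeta_N)=\frac1{Z_N}e^{-\mathbf H_N(\zeta_1,\dots,\zeta_N)}\prod_{j=1}^NdA(\zeta_j),$$ $$\mathbf H_N=\sum_{j\ne k}\log\frac1{|\zeta_j-\zeta_k||\zeta_j-\bar\zeta_k|}+\sum_{j=1}^N\Big(\log\frac1{|\zeta_j-\bar\zeta_j|^2}+NQ(\zeta_j)\Big),$$ where the first sum is over ordered pairs and $Z_N$ is the normalising constant. Its $k$-point correlation function is $$\mathbf R_{N,k}(\zeta_1,\dots,\zeta_k)=\frac1{Z_N}\frac{N!}{(N-k)!}\int_{\mathbb C^{N-k}}e^{-\mathbf H_N}\prod_{j=k+1}^NdA(\zeta_j).$$ For $Q(\zeta)=|\zeta|^2$ the limiting support (droplet) is the disc $S$ of centre $0$ and radius $\sqrt2$, and the micro-scale is $r_N=\sqrt{2/N}$. For a boundary point $p_N\in\partial S$, with $n_N=p_N/|p_N|$ the outer unit normal to $\partial S$ at $p_N$, the rescaled $k$-point function is $R_{N,k}(z_1,\dots,z_k)=r_N^{2k}\,\mathbf R_{N,k}(\zeta_1,\dots,\zeta_k)$ with $\zeta_j=p_N+n_Nr_Nz_j$. The function $\kappa_{\rm edge}^{\mathbb R}$ is $$\kappa_{\rm edge}^{\mathbb R}(z,w)=\sqrt\pi\,e^{z^2+w^2}\int_{-\infty}^0W(f_w,f_z)(u)\,du,\qquad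 f_z(u)=\tfrac12\operatorname{erfc}\big(\sqrt2(z-u)\big),$$ with the Wronskian $W(f,g)=fg'-f'g$ (derivatives with respect to $u$). $\operatorname{Pf}[K(z_j,z_l)]_{j,l=1}^k$ is the Pfaffian of the $2k\times2k$ skew-symmetric matrix with $2\times2$ blocks $K(z_j,z_l)$. *)

theory Defs
  imports "HOL-Complex_Analysis.Complex_Analysis" "Jordan_Normal_Form.Determinant"
begin

(* Configurations of N particles are functions nat => complex, read at the indices j < N. *)

definition area_measure :: "complex measure" where
  "area_measure = density lborel (\<lambda>_. ennreal (1 / pi))"

(* log (1/x) for x >= 0.  At x = 0 the value is infinity, so that exp (- H) vanishes at colliding
   or real particles; the real logarithm, with ln 0 = 0, would give a wrong nonzero value there. *)
definition log_inv :: "real \<Rightarrow> ereal" where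
  "log_inv x = (if x = 0 then \<infinity> else ereal (ln (1 / x)))"

(* No summand is minus infinity, hence neither is the Hamiltonian. *)
definition hamiltonian :: "(complex \<Rightarrow> real) \<Rightarrow> nat \<Rightarrow> (nat \<Rightarrow> complex) \<Rightarrow> ereal" where
  "hamiltonian Q N \<zeta> =
     (\<Sum>j<N. \<Sum>l\<in>{..<N} - {j}. log_inv (cmod (\<zeta> j - \<zeta> l) * cmod (\<zeta> j - cnj (\<zeta> l))))
     + (\<Sum>j<N. log_inv ((cmod (\<zeta> j - cnj (\<zeta> j)))\<^sup>2) + ereal (real N * Q (\<zeta> j)))"

definition exp_neg :: "ereal \<Rightarrow> real" where
  "exp_neg h = (if h = \<infinity> then 0 else exp (- real_of_ereal h))"

definition partition_fun :: "(complex \<Rightarrow> real) \<Rightarrow> nat \<Rightarrow> real" where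
  "partition_fun Q N =
     (\<integral>\<zeta>. exp_neg (hamiltonian Q N \<zeta>) \<partial>(\<Pi>\<^sub>M j\<in>{..<N}. area_measure))"

(* Meaningful for k <= N only. *)
definition correlation_fun ::
  "(complex \<Rightarrow> real) \<Rightarrow> nat \<Rightarrow> nat \<Rightarrow> (nat \<Rightarrow> complex) \<Rightarrow> real" where
  "correlation_fun Q N k \<zeta> =
     1 / partition_fun Q N * (fact N / fact (N - k)) *
     (\<integral>\<eta>. exp_neg (hamiltonian Q N (\<lambda>j. if j < k then \<zeta> j else \<eta> j))
        \<partial>(\<Pi>\<^sub>M j\<in>{k..<N}. area_measure))"

definition micro_scale :: "nat \<Rightarrow> real" where
  "micro_scale N = sqrt (2 / real N)"

(* The droplet is a disc centred at 0, so its outer unit normal at p is p / |p|. *)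
definition rescaled_correlation ::
  "(complex \<Rightarrow> real) \<Rightarrow> complex \<Rightarrow> nat \<Rightarrow> nat \<Rightarrow> (nat \<Rightarrow> complex) \<Rightarrow> real" where
  "rescaled_correlation Q p N k z =
     micro_scale N ^ (2 * k) *
     correlation_fun Q N k
       (\<lambda>j. p + p / complex_of_real (cmod p) * complex_of_real (micro_scale N) * z j)"

(* exp (- s^2) is entire, so the path is immaterial; no complex erfc exists in these libraries. *)
definition erfc :: "complex \<Rightarrow> complex" where
  "erfc z =
     1 - 2 / complex_of_real (sqrt pi) * contour_integral (linepath 0 z) (\<lambda>s. exp (- s\<^sup>2))"

definition wronskian :: "(real \<Rightarrow> complex) \<Rightarrow> (real \<Rightarrow> complex) \<Rightarrow> real \<Rightarrow> complex" where
  "wronskian f g u =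
     f u * vector_derivative g (at u) - vector_derivative f (at u) * g u"

definition edge_fun :: "complex \<Rightarrow> real \<Rightarrow> complex" where
  "edge_fun z u = 1 / 2 * erfc (complex_of_real (sqrt 2) * (z - complex_of_real u))"

definition kappa_edge :: "complex \<Rightarrow> complex \<Rightarrow> complex" where
  "kappa_edge z w =
     complex_of_real (sqrt pi) * exp (z\<^sup>2 + w\<^sup>2) *
     (LINT u:{..0}|lborel. wronskian (edge_fun w) (edge_fun z) u)"

(* Intended for skew-symmetric A of even dimension. *)
definition pfaffian :: "complex mat \<Rightarrow> complex" where
  "pfaffian A =
     (let n = dim_row A div 2 in
       1 / (2 ^ n * fact n) *
       (\<Sum>s | s permutes {..<2 * n}. of_int (sign s) * (\<Prod>i<n. A $$ (s (2 * i), s (2 * i + 1)))))"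

definition block_mat :: "nat \<Rightarrow> (nat \<Rightarrow> nat \<Rightarrow> complex mat) \<Rightarrow> complex mat" where
  "block_mat k B =
     Matrix.mat (2 * k) (2 * k) (\<lambda>(a, b). B (a div 2) (b div 2) $$ (a mod 2, b mod 2))"

definition K_edge :: "real \<Rightarrow> complex \<Rightarrow> complex \<Rightarrow> complex mat" where
  "K_edge t z w =
     (let \<tau> = \<i> * complex_of_real t in
       complex_of_real (exp (- (cmod (z + \<tau>))\<^sup>2 - (cmod (w + \<tau>))\<^sup>2)) \<cdot>\<^sub>m
       mat_of_rows_list 2
         [[kappa_edge (z + \<tau>) (w + \<tau>), kappa_edge (z + \<tau>) (cnj w - \<tau>)],
          [kappa_edge (cnj z - \<tau>) (w + \<tau>), kappa_edge (cnj z - \<tau>) (cnj w - \<tau>)]])"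

definition R_edge :: "real \<Rightarrow> nat \<Rightarrow> (nat \<Rightarrow> complex) \<Rightarrow> complex" where
  "R_edge t k z =
     (\<Prod>j<k. cnj (z j) - z j - 2 * \<i> * complex_of_real t) *
     pfaffian (block_mat k (\<lambda>j l. K_edge t (z j) (z l)))"

definition K_edge_complex :: "complex \<Rightarrow> complex \<Rightarrow> complex" where
  "K_edge_complex z w =
     exp (- complex_of_real ((cmod z)\<^sup>2) - complex_of_real ((cmod w)\<^sup>2) + 2 * z * cnj w) *
     (1 / 2) * erfc (z + cnj w)"

end

theory Submission imports Defs "HOL-Probability.Distributions" "HOL-Probability.Sinc_Integral" "HOL-Real_Asymp.Real_Asymp" "Jordan_Normal_Form.Char_Poly"
begin

text \<open>
  For finite \<open>N\<close> the density is a Vandermonde determinant in the \<open>2 * N\<close> variables \<open>z j\<close>, \<open>cnj (z j)\<close>.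
  Written in skew-orthogonal polynomials, it can be integrated out variable by variable, which leaves
  a Pfaffian of a pre-kernel. That pre-kernel vanishes on the diagonal and solves a first order
  differential equation whose inhomogeneity consists of truncated exponential series. Laplace's method
  turns these into complementary error functions, and integrating from the diagonal yields the edge kernel.

  For \<open>t\<close> tending to infinity, \<open>scaled_erfc x \<approx> 1 / x\<close> shows that the entries of the Pfaffian pairing
  \<open>z j\<close> with \<open>z l\<close>, or \<open>cnj (z j)\<close> with \<open>cnj (z l)\<close>, disappear, and the Pfaffian tends to a determinant
  with an error that is uniformly small. A relative error is needed although the determinant vanishes
  at coinciding points. Treat \<open>z\<close> and \<open>cnj z\<close> as independent variables: the error is entire and vanishes
  whenever two variables of the same kind coincide, so by the maximum principle it is small compared
  with the squared modulus of the Vandermonde product. The determinant is, up to an explicit factor, the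
  Gram determinant of the functions \<open>exp (- 2 * (z j - u)\<^sup>2)\<close> in \<open>L\<^sup>2\<close> of the negative half-line,
  which is bounded below by a multiple of the same product.
\<close>

section \<open>Pfaffians\<close>

text \<open>The ensemble is not invariant under rotations, because particles are repelled by the
  real axis; what matters at the edge is the distance to that axis. In units of the micro-scale,
  \<open>p N\<close> lies at height \<open>t\<close> above the real edge point. The kernels are
  therefore studied in a coordinate based at that point, and the angle enters only through
  \<open>sqrt N * (cis (t / sqrt N) - 1)\<close>, which tends to \<open>\<i> * t\<close>. The edge
  point on the negative axis costs nothing, since the weight and the pre-kernel are both odd. A
  particle at height \<open>t\<close> has a mirror image at height \<open>- t\<close>. For large
  \<open>t\<close> the entries of the Pfaffian grow like Gaussians in \<open>t\<close>. A rescaling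
  of rows and columns, \<open>edge_osc\<close>, removes this growth; its total factor is supplied by
  the weight \<open>exp ((Z - cnj Z)\<^sup>2)\<close>. The entries pairing a point with an image are
  then of order \<open>1 / t\<close>, which is offset by the prefactor \<open>cnj Z - Z\<close>,
  about \<open>- 2 * \<i> * t\<close>.\<close>

definition pf :: "nat \<Rightarrow> (nat \<Rightarrow> nat \<Rightarrow> complex) \<Rightarrow> complex" where
  "pf n A = 1 / (2 ^ n * fact n) *
     (\<Sum>s | s permutes {..<2 * n}. of_int (sign s) * (\<Prod>i<n. A (s (2 * i)) (s (2 * i + 1))))"

lemma pfaffian_block_mat:
  "pfaffian (block_mat k B) = pf k (\<lambda>a b. B (a div 2) (b div 2) $$ (a mod 2, b mod 2))"
proof -
  have "block_mat k B $$ (s (2*i), s (2*i+1)) =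
      B (s (2*i) div 2) (s (2*i+1) div 2) $$ (s (2*i) mod 2, s (2*i+1) mod 2)"
    if "s permutes {..<2*k}" "i < k" for s i
  proof -
    have "s (2*i) < 2*k" "s (2*i+1) < 2*k"
      using permutes_in_image[OF that(1), of "2*i"] permutes_in_image[OF that(1), of "2*i+1"] that(2)
      by auto
    then show ?thesis by (simp add: block_mat_def)
  qed
  moreover have "dim_row (block_mat k B) div 2 = k" by (simp add: block_mat_def)
  ultimately show ?thesis
    unfolding pfaffian_def pf_def Let_def by (auto intro!: sum.cong prod.cong)
qed

lemma permutes_lessThan_pair:
  assumes "s permutes {..<2*n}" "i < n"
  shows "s (2*i) < 2*n" "s (2*i+1) < 2*n" "s (Suc (2*i)) < 2*n"
  using permutes_in_image[OF assms(1), of "2*i"] permutes_in_image[OF assms(1), of "2*i+1"] assms(2)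
  by auto

lemma pf_cong:
  assumes "\<And>a b. a < 2*n \<Longrightarrow> b < 2*n \<Longrightarrow> A a b = B a b"
  shows "pf n A = pf n B"
  unfolding pf_def using assms permutes_lessThan_pair
  by (auto intro!: arg_cong2[where f="(*)"] sum.cong prod.cong)

lemma prod_pairs:
  fixes f :: "nat \<Rightarrow> 'a :: comm_monoid_mult"
  shows "(\<Prod>a<2*n. f a) = (\<Prod>i<n. f (2*i) * f (2*i+1))"
  by (induction n) (simp_all add: mult.assoc)

text \<open>Each index occurs exactly once in every summand, so the weights leave as one product.
  All Gaussian prefactors below are moved into and out of Pfaffians in this way.\<close>

lemma pf_scale: "pf n (\<lambda>a b. c a * c b * A a b) = (\<Prod>a<2*n. c a) * pf n A"
proof -
  have *: "(\<Prod>i<n. c (s (2*i)) * c (s (2*i+1)) * A (s (2*i)) (s (2*i+1))) =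
      (\<Prod>a<2*n. c a) * (\<Prod>i<n. A (s (2*i)) (s (2*i+1)))" if "s permutes {..<2*n}" for s
    using prod.permute[OF that, of c] prod_pairs[of "c \<circ> s" n] by (simp add: o_def prod.distrib)
  show ?thesis
    unfolding pf_def sum_distrib_left by (intro sum.cong refl) (simp add: * del: One_nat_def)
qed

lemma pf_permute:
  assumes p: "p permutes {..<2*n}"
  shows "pf n (\<lambda>a b. A (p a) (p b)) = of_int (sign p) * pf n A"
proof -
  let ?f = "\<lambda>s. of_int (sign s) * (\<Prod>i<n. A (s (2 * i)) (s (2 * i + 1)))"
  have "(\<Sum>s | s permutes {..<2 * n}. of_int (sign s) * (\<Prod>i<n. A (p (s (2*i))) (p (s (2*i+1)))))
      = (\<Sum>s | s permutes {..<2 * n}. of_int (sign p) * ?f (p \<circ> s))"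
  proof (rule sum.cong[OF refl])
    fix s assume "s \<in> {s. s permutes {..<2*n}}"
    then have "sign (p \<circ> s) = sign p * sign s"
      using p by (intro sign_compose) (auto simp: permutation_permutes)
    then have "of_int (sign s) = (of_int (sign p) * of_int (sign (p \<circ> s)) :: complex)"
      by (metis sign_left_idempotent of_int_mult)
    then show "of_int (sign s) * (\<Prod>i<n. A (p (s (2*i))) (p (s (2*i+1)))) = of_int (sign p) * ?f (p \<circ> s)"
      by (simp add: mult.assoc)
  qed
  also have "\<dots> = of_int (sign p) * (\<Sum>s | s permutes {..<2 * n}. ?f s)"
    unfolding setum_permutations_compose_left[OF p, of ?f] sum_distrib_left ..
  finally show ?thesis unfolding pf_def by (simp add: mult_ac)
qed

lemma finite_perms[simp]: "finite A \<Longrightarrow> finite {s. s permutes A}"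
  by (rule finite_permutations)

text \<open>Interchanging the two entries of pair \<open>i\<close> flips the sign of
  \<open>s\<close> and exchanges the two terms of its antisymmetrised factor, so both terms
  contribute the same; every pair in \<open>J\<close> yields a factor 2. The hypothesis on
  \<open>G\<close> says that the remaining factors do not notice the interchange.\<close>

lemma sum_sign_antisym:
  fixes G :: "(nat \<Rightarrow> nat) \<Rightarrow> complex"
  assumes "finite J" "J \<subseteq> {..<n}"
    and "\<And>s i. s permutes {..<2*n} \<Longrightarrow> i \<in> J \<Longrightarrow> G (s \<circ> Transposition.transpose (2*i) (2*i+1)) = G s"
  shows "(\<Sum>s | s permutes {..<2*n}. of_int (sign s) * (G s *
            (\<Prod>i\<in>J. X i (s (2*i)) (s (2*i+1)) - X i (s (2*i+1)) (s (2*i)))))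
       = 2 ^ card J * (\<Sum>s | s permutes {..<2*n}. of_int (sign s) * (G s *
            (\<Prod>i\<in>J. X i (s (2*i)) (s (2*i+1)))))"
  using assms
proof (induction J arbitrary: G rule: finite_induct)
  case empty
  then show ?case by simp
next
  case (insert i J)
  define p where "p = Transposition.transpose (2*i) (2*i+1)"
  have i: "i < n" using insert.prems by auto
  have p: "p permutes {..<2*n}" unfolding p_def using i by (intro permutes_swap_id) auto
  have pi: "p (2*i) = 2*i+1" "p (2*i+1) = 2*i" by (auto simp: p_def)
  have pj: "p (2*j) = 2*j" "p (2*j+1) = 2*j+1" if "j \<in> J" for j
  proof -
    have "j \<noteq> i" using that insert.hyps by auto
    then have "2*j \<noteq> 2*i" "2*j \<noteq> 2*i+1" "2*j+1 \<noteq> 2*i" "2*j+1 \<noteq> 2*i+1" by presburger+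
    then show "p (2*j) = 2*j" "p (2*j+1) = 2*j+1" unfolding p_def by (auto intro!: transpose_apply_other)
  qed
  let ?S = "{s. s permutes {..<2*n}}"
  let ?P = "\<lambda>s. \<Prod>j\<in>J. X j (s (2*j)) (s (2*j+1))"
  \<comment> \<open>The difference belonging to \<open>i\<close> is handed to the induction
    hypothesis as part of \<open>G\<close>, which is why \<open>G\<close> is arbitrary, and is split
    only afterwards.\<close>
  let ?G = "\<lambda>s. G s * (X i (s (2*i)) (s (2*i+1)) - X i (s (2*i+1)) (s (2*i)))"
  let ?F = "\<lambda>s. of_int (sign s) * (G s * X i (s (2*i)) (s (2*i+1)) * ?P s)"
  let ?F' = "\<lambda>s. of_int (sign s) * (G s * X i (s (2*i+1)) (s (2*i)) * ?P s)"
  have 1: "?G (s \<circ> Transposition.transpose (2*j) (2*j+1)) = ?G s" if "s permutes {..<2*n}" "j \<in> J" for s j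
  proof -
    have "j \<noteq> i" using that insert.hyps by auto
    then have "2*i \<noteq> 2*j" "2*i \<noteq> 2*j+1" "2*i+1 \<noteq> 2*j" "2*i+1 \<noteq> 2*j+1" by presburger+
    then have "Transposition.transpose (2*j) (2*j+1) (2*i) = 2*i" "Transposition.transpose (2*j) (2*j+1) (2*i+1) = 2*i+1"
      by (auto intro!: transpose_apply_other)
    moreover have "G (s \<circ> Transposition.transpose (2*j) (2*j+1)) = G s"
      using insert.prems(2)[OF that(1), of j] that(2) by blast
    ultimately show ?thesis by (simp only: o_apply)
  qed
  have 2: "?F' s = - ?F (s \<circ> p)" if "s permutes {..<2*n}" for s
  proof -
    have "sign (s \<circ> p) = sign s * sign p"
      using p that by (intro sign_compose) (auto simp: permutation_permutes)
    moreover have "sign p = -1" unfolding p_def by (simp add: sign_swap_id)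
    moreover have "G (s \<circ> p) = G s" unfolding p_def using insert.prems(2)[OF that] by blast
    moreover have "?P (s \<circ> p) = ?P s" using pj by (intro prod.cong) (auto simp del: add_Suc_right)
    ultimately show ?thesis using pi by simp
  qed
  have "(\<Sum>s\<in>?S. of_int (sign s) * (G s *
            (\<Prod>i\<in>insert i J. X i (s (2*i)) (s (2*i+1)) - X i (s (2*i+1)) (s (2*i)))))
     = (\<Sum>s\<in>?S. of_int (sign s) * (?G s *
            (\<Prod>i\<in>J. X i (s (2*i)) (s (2*i+1)) - X i (s (2*i+1)) (s (2*i)))))"
    using insert.hyps by (simp add: mult.assoc)
  also have "\<dots> = 2 ^ card J * (\<Sum>s\<in>?S. of_int (sign s) * (?G s * ?P s))"
    by (rule insert.IH) (use insert.prems(1) 1 in blast)+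
  also have "(\<Sum>s\<in>?S. of_int (sign s) * (?G s * ?P s)) = (\<Sum>s\<in>?S. ?F s) - (\<Sum>s\<in>?S. ?F' s)"
    by (simp add: sum_subtractf[symmetric] algebra_simps)
  also have "(\<Sum>s\<in>?S. ?F' s) = - (\<Sum>s\<in>?S. ?F (s \<circ> p))"
    unfolding sum_negf[symmetric] using 2 by (intro sum.cong) auto
  also have "(\<Sum>s\<in>?S. ?F (s \<circ> p)) = (\<Sum>s\<in>?S. ?F s)"
    using sum_permutations_compose_right[OF p, of ?F] by simp
  finally show ?case using insert.hyps by (simp add: mult_ac)
qed

text \<open>An expansion of Cauchy-Binet type: \<open>c\<close> selects one of the \<open>N\<close>
  rank-two summands for each of the \<open>n\<close> pairs, and \<open>sum_sign_antisym\<close>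
  folds the two terms of each summand together.\<close>

lemma pf_rank_two_sum:
  fixes N :: nat
  shows "pf n (\<lambda>a b. \<Sum>i<N. r i * (g i a * h i b - h i a * g i b)) =
     1 / fact n * (\<Sum>c\<in>{..<n} \<rightarrow>\<^sub>E {..<N}. (\<Prod>j<n. r (c j)) *
        (\<Sum>s | s permutes {..<2*n}. of_int (sign s) * (\<Prod>j<n. g (c j) (s (2*j)) * h (c j) (s (2*j+1)))))"
proof -
  let ?S = "{s. s permutes {..<2*n}}"
  define X where "X = (\<lambda>a b. \<Sum>i<N. r i * (g i a * h i b))"
  have A: "(\<Sum>i<N. r i * (g i a * h i b - h i a * g i b)) = X a b - X b a" for a b
    unfolding X_def sum_subtractf[symmetric] by (intro sum.cong) (auto simp: algebra_simps)
  have "(\<Sum>s\<in>?S. of_int (sign s) * (\<Prod>i<n. X (s (2*i)) (s (2*i+1)) - X (s (2*i+1)) (s (2*i))))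
     = 2 ^ n * (\<Sum>s\<in>?S. of_int (sign s) * (\<Prod>i<n. X (s (2*i)) (s (2*i+1))))"
    using sum_sign_antisym[of "{..<n}" n "\<lambda>_. 1" "\<lambda>_. X"] by simp
  also have "(\<Sum>s\<in>?S. of_int (sign s) * (\<Prod>i<n. X (s (2*i)) (s (2*i+1)))) =
     (\<Sum>s\<in>?S. \<Sum>c\<in>{..<n} \<rightarrow>\<^sub>E {..<N}. (\<Prod>j<n. r (c j)) * (of_int (sign s) * (\<Prod>j<n. g (c j) (s (2*j)) * h (c j) (s (2*j+1)))))"
    unfolding X_def by (intro sum.cong refl, subst prod_sum_PiE) (simp_all add: sum_distrib_left prod.distrib mult_ac)
  also have "\<dots> = (\<Sum>c\<in>{..<n} \<rightarrow>\<^sub>E {..<N}. (\<Prod>j<n. r (c j)) *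
        (\<Sum>s\<in>?S. of_int (sign s) * (\<Prod>j<n. g (c j) (s (2*j)) * h (c j) (s (2*j+1)))))"
    by (subst sum.swap) (simp add: sum_distrib_left)
  finally show ?thesis unfolding pf_def A by simp
qed

section \<open>Integrating out variables in pairs\<close>

lemma permutes_extension:
  assumes "finite S" "K \<subseteq> S" "inj_on d K" "d ` K \<subseteq> S"
  obtains \<sigma> where "\<sigma> permutes S" "\<And>x. x \<in> K \<Longrightarrow> \<sigma> x = d x"
proof -
  have "card (S - K) = card (S - d ` K)"
    using assms by (simp add: card_Diff_subset card_image finite_subset)
  then obtain e where e: "bij_betw e (S - K) (S - d ` K)"
    using finite_same_card_bij[of "S - K" "S - d ` K"] assms(1) by auto
  define \<sigma> where "\<sigma> = (\<lambda>x. if x \<in> K then d x else if x \<in> S then e x else x)"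
  have "bij_betw \<sigma> (K \<union> (S - K)) (d ` K \<union> (S - d ` K))"
  proof (rule bij_betw_combine)
    show "bij_betw \<sigma> K (d ` K)"
      using assms(3) by (auto simp: bij_betw_def \<sigma>_def inj_on_def image_def)
    show "bij_betw \<sigma> (S - K) (S - d ` K)"
      using bij_betw_cong[of "S - K" \<sigma> e] e by (auto simp: \<sigma>_def)
  qed auto
  moreover have "K \<union> (S - K) = S" "d ` K \<union> (S - d ` K) = S" using assms by auto
  ultimately have "\<sigma> permutes S"
    using assms(2) by (intro bij_imp_permutes) (auto simp: \<sigma>_def)
  then show ?thesis using that[of \<sigma>] by (auto simp: \<sigma>_def)
qed

text \<open>These permutations form a coset of those that fix \<open>K\<close> pointwise: compose
  the latter with one extension of \<open>d\<close>.\<close>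

lemma card_permutes_agree:
  assumes "finite S" "K \<subseteq> S" "inj_on d K" "d ` K \<subseteq> S"
  shows "card {\<sigma>. \<sigma> permutes S \<and> (\<forall>x\<in>K. \<sigma> x = d x)} = fact (card (S - K))"
proof -
  obtain \<sigma>0 where s0: "\<sigma>0 permutes S" "\<And>x. x \<in> K \<Longrightarrow> \<sigma>0 x = d x"
    using permutes_extension[OF assms] by metis
  have "bij_betw (\<lambda>p. \<sigma>0 \<circ> p) {p. p permutes (S - K)} {\<sigma>. \<sigma> permutes S \<and> (\<forall>x\<in>K. \<sigma> x = d x)}"
  proof (rule bij_betw_byWitness[where f' = "\<lambda>\<sigma>. Hilbert_Choice.inv \<sigma>0 \<circ> \<sigma>"])
    show "\<forall>a\<in>{p. p permutes S - K}. Hilbert_Choice.inv \<sigma>0 \<circ> (\<sigma>0 \<circ> a) = a"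
      using permutes_inv_o[OF s0(1)] by (simp add: o_assoc)
    show "\<forall>a'\<in>{\<sigma>. \<sigma> permutes S \<and> (\<forall>x\<in>K. \<sigma> x = d x)}. \<sigma>0 \<circ> (Hilbert_Choice.inv \<sigma>0 \<circ> a') = a'"
      using permutes_inv_o[OF s0(1)] by (simp add: o_assoc)
    show "(\<circ>) \<sigma>0 ` {p. p permutes S - K} \<subseteq> {\<sigma>. \<sigma> permutes S \<and> (\<forall>x\<in>K. \<sigma> x = d x)}"
    proof safe
      fix p assume p: "p permutes S - K"
      have "p permutes S" by (rule permutes_subset[OF p]) auto
      then show "\<sigma>0 \<circ> p permutes S" by (rule permutes_compose[OF _ s0(1)])
      fix x assume "x \<in> K"
      then show "(\<sigma>0 \<circ> p) x = d x" using s0(2) permutes_not_in[OF p, of x] by auto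
    qed
    show "(\<lambda>\<sigma>. Hilbert_Choice.inv \<sigma>0 \<circ> \<sigma>) ` {\<sigma>. \<sigma> permutes S \<and> (\<forall>x\<in>K. \<sigma> x = d x)} \<subseteq> {p. p permutes S - K}"
    proof safe
      fix \<sigma> assume s: "\<sigma> permutes S" "\<forall>x\<in>K. \<sigma> x = d x"
      have *: "Hilbert_Choice.inv \<sigma>0 \<circ> \<sigma> permutes S" by (rule permutes_compose[OF s(1) permutes_inv[OF s0(1)]])
      have "(Hilbert_Choice.inv \<sigma>0 \<circ> \<sigma>) x = x" if "x \<in> K" for x
        using that s(2) s0(2) permutes_inverses(2)[OF s0(1)] by (metis o_apply)
      then show "Hilbert_Choice.inv \<sigma>0 \<circ> \<sigma> permutes S - K"
        by (intro permutes_superset[OF *]) auto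
    qed
  qed
  then have "card {\<sigma>. \<sigma> permutes S \<and> (\<forall>x\<in>K. \<sigma> x = d x)} = card {p. p permutes (S - K)}"
    by (rule bij_betw_same_card[symmetric])
  then show ?thesis using card_permutations[of "S - K" "card (S - K)"] assms(1) by auto
qed

text \<open>\<open>c\<close> acting on the blocks \<open>{2 * i, 2 * i + 1}\<close>, with the order
  inside each block kept.\<close>

definition pair_perm :: "(nat \<Rightarrow> nat) \<Rightarrow> nat \<Rightarrow> nat" where
  "pair_perm c a = 2 * c (a div 2) + a mod 2"

lemma pair_perm_simps[simp]: "pair_perm c (2*i) = 2 * c i" "pair_perm c (Suc (2*i)) = Suc (2 * c i)"
  by (auto simp: pair_perm_def)

lemma pair_perm_comp: "pair_perm (p \<circ> q) = pair_perm p \<circ> pair_perm q"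
  by (auto simp: pair_perm_def fun_eq_iff)

lemma pair_perm_id: "pair_perm id = id"
  by (auto simp: pair_perm_def fun_eq_iff)

lemma pair_perm_permutes:
  assumes "p permutes {..<n}"
  shows "pair_perm p permutes {..<2*n}"
proof -
  have "pair_perm p (pair_perm (Hilbert_Choice.inv p) a) = a" "pair_perm (Hilbert_Choice.inv p) (pair_perm p a) = a" for a
    using permutes_inv_o[OF assms] by (metis pair_perm_comp pair_perm_id o_apply id_apply)+
  moreover have "pair_perm p a = a" if "a \<notin> {..<2*n}" for a
    using that permutes_not_in[OF assms, of "a div 2"] by (auto simp: pair_perm_def)
  ultimately show ?thesis unfolding permutes_def by metis
qed

lemma pair_perm_transpose:
  "pair_perm (Transposition.transpose a b) = Transposition.transpose (2*a) (2*b) \<circ> Transposition.transpose (2*a+1) (2*b+1)"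
proof
  fix x :: nat
  consider i where "x = 2*i" | i where "x = 2*i+1" by (metis evenE oddE)
  then show "pair_perm (Transposition.transpose a b) x = (Transposition.transpose (2*a) (2*b) \<circ> Transposition.transpose (2*a+1) (2*b+1)) x"
  proof cases
    case 1
    have "2*i \<noteq> 2*a+1" "2*i \<noteq> 2*b+1" by presburger+
    then show ?thesis unfolding 1 by (auto simp: Transposition.transpose_def)
  next
    case 2
    have "2*i+1 \<noteq> 2*a" "2*i+1 \<noteq> 2*b" "2*b+1 \<noteq> 2*a" "2*a+1 \<noteq> 2*b" by presburger+
    then show ?thesis unfolding 2 by (auto simp: Transposition.transpose_def)
  qed
qed

text \<open>Interchanging two blocks of size two is a product of two transpositions, hence
  even.\<close>

lemma sign_pair_perm:
  assumes "p permutes {..<n}"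
  shows "sign (pair_perm p) = 1"
  using assms finite_lessThan
proof (induction rule: permutes_induct)
  case id
  then show ?case unfolding pair_perm_id by simp
next
  case (swap a b p)
  have pp: "permutation (pair_perm p)"
    using pair_perm_permutes[of p n] swap by (auto simp: permutation_permutes)
  have "sign (pair_perm (Transposition.transpose a b)) = 1"
    unfolding pair_perm_transpose using swap
    by (subst sign_compose) (auto simp: permutation_swap_id sign_swap_id)
  moreover have "permutation (pair_perm (Transposition.transpose a b))"
    unfolding pair_perm_transpose by (intro permutation_compose permutation_swap_id)
  ultimately show ?case unfolding pair_perm_comp using pp swap by (subst sign_compose) auto
qed

text \<open>The left side is what remains of a determinant of size \<open>2 * N\<close> with rows
  \<open>Y\<close> when its columns from \<open>2 * k\<close> on have been integrated in pairs
  against the skew form \<open>S\<close>. Since \<open>S\<close> couples only the indices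
  \<open>2 * i\<close> and \<open>2 * i + 1\<close>, a surviving permutation maps each integrated
  pair onto such a block; the sum over the blocks left for the first \<open>2 * k\<close> columns is
  the expansion in \<open>pf_rank_two_sum\<close>.\<close>

lemma pf_integrate_out:
  fixes N k :: nat and Y :: "nat \<Rightarrow> nat \<Rightarrow> complex"
  assumes k: "k \<le> N" and rho: "\<And>i. i < N \<Longrightarrow> \<rho> i \<noteq> 0"
    and S: "\<And>a b. a < 2*N \<Longrightarrow> b < 2*N \<Longrightarrow>
      S a b = (if even a \<and> b = a + 1 then \<rho> (a div 2) else 0) - (if even b \<and> a = b + 1 then \<rho> (b div 2) else 0)"
  shows "(\<Sum>s | s permutes {..<2*N}. of_int (sign s) * ((\<Prod>j<2*k. Y (s j) j) *
            (\<Prod>j\<in>{k..<N}. S (s (2*j)) (s (2*j+1))))) =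
      2 ^ (N - k) * fact (N - k) * (\<Prod>i<N. \<rho> i) *
        pf k (\<lambda>a b. \<Sum>i<N. (1 / \<rho> i) * (Y (2*i) a * Y (2*i+1) b - Y (2*i+1) a * Y (2*i) b))"
proof -
  define X where "X = (\<lambda>a b. if even a \<and> b = a + 1 then \<rho> (a div 2) else (0::complex))"
  define PN where "PN = {s. s permutes {..<2*N}}"
  define Q where "Q = {t. t permutes {..<2*k}}"
  define P where "P = {s. s permutes {..<N}}"
  define G where "G = (\<lambda>s. \<Prod>j<2*k. Y (s j) j)"
  define F where "F = (\<lambda>s. of_int (sign s) * (G s * (\<Prod>j\<in>{k..<N}. X (s (2*j)) (s (2*j+1)))))"
  define W where "W = (\<lambda>c. \<Sum>t\<in>Q. of_int (sign t) * (\<Prod>a<2*k. Y (pair_perm c (t a)) a))"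
  have fin: "finite PN" "finite Q" "finite P" unfolding PN_def Q_def P_def by auto
  have "(\<Sum>s\<in>PN. of_int (sign s) * (G s * (\<Prod>j\<in>{k..<N}. S (s (2*j)) (s (2*j+1))))) =
        (\<Sum>s\<in>PN. of_int (sign s) * (G s * (\<Prod>j\<in>{k..<N}. X (s (2*j)) (s (2*j+1)) - X (s (2*j+1)) (s (2*j)))))"
    using permutes_lessThan_pair[of _ N] S unfolding PN_def X_def
    by (intro sum.cong refl arg_cong2[where f="(*)"] prod.cong) auto
  also have "\<dots> = 2 ^ (N - k) * (\<Sum>s\<in>PN. F s)"
  proof -
    have "G (s \<circ> Transposition.transpose (2*i) (2*i+1)) = G s" if "i \<in> {k..<N}" for s i
      unfolding G_def
    proof (intro prod.cong refl)
      fix j assume "j \<in> {..<2*k}"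
      then have "j \<noteq> 2*i" "j \<noteq> 2*i+1" using that by auto
      then show "Y ((s \<circ> Transposition.transpose (2*i) (2*i+1)) j) j = Y (s j) j"
        by (metis o_apply transpose_apply_other)
    qed
    moreover have "{k..<N} \<subseteq> {..<N}" by auto
    ultimately show ?thesis
      unfolding PN_def F_def using sum_sign_antisym[of "{k..<N}" N G "\<lambda>_. X"]
      by (simp only: finite_atLeastLessThan card_atLeastLessThan simp_thms)
  qed
  finally have 1: "(\<Sum>s\<in>PN. of_int (sign s) * (G s * (\<Prod>j\<in>{k..<N}. S (s (2*j)) (s (2*j+1))))) =
      2 ^ (N - k) * (\<Sum>s\<in>PN. F s)" .

  \<comment> \<open>The permutations that survive: each pair from \<open>k\<close> on goes to a
    block, and in the right order, since \<open>X\<close> keeps only one of the two terms of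
    \<open>S\<close>.\<close>
  define A where "A = {s \<in> PN. \<forall>j\<in>{k..<N}. even (s (2*j)) \<and> s (2*j+1) = s (2*j) + 1}"
  have FA: "(\<Sum>s\<in>PN. F s) = (\<Sum>s\<in>A. F s)"
  proof (rule sum.mono_neutral_right)
    show "\<forall>s\<in>PN - A. F s = 0"
    proof
      fix s assume "s \<in> PN - A"
      then obtain j where "j \<in> {k..<N}" "\<not> (even (s (2*j)) \<and> s (2*j+1) = s (2*j) + 1)"
        unfolding A_def by auto
      then have "(\<Prod>j\<in>{k..<N}. X (s (2*j)) (s (2*j+1))) = 0"
        unfolding X_def by (intro prod_zero) auto
      then show "F s = 0" unfolding F_def by simp
    qed
  qed (auto simp: fin A_def)
  have tfix: "t (2*j) = 2*j" "t (2*j+1) = 2*j+1" if "t \<in> Q" "j \<in> {k..<N}" for j and t :: "nat \<Rightarrow> nat"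
    using that permutes_not_in[of t "{..<2*k}"] unfolding Q_def by auto
  have Q2: "t permutes {..<2*N}" if "t \<in> Q" for t
    using that k unfolding Q_def by (auto intro: permutes_subset)
  have comp: "pair_perm \<sigma> \<circ> t \<in> A" if "\<sigma> \<in> P" "t \<in> Q" for \<sigma> t
    using that tfix[OF that(2)] permutes_compose[OF Q2[OF that(2)] pair_perm_permutes[of \<sigma> N]]
    unfolding A_def PN_def P_def by auto
  \<comment> \<open>Writing \<open>s\<close> as a block permutation applied after a permutation of
    the first \<open>2 * k\<close> indices leaves \<open>\<sigma>\<close> free on the first
    \<open>k\<close> blocks, whence \<open>fact k\<close>; once \<open>\<sigma>\<close> is chosen,
    the other factor is determined.\<close>
  have fib: "card {x \<in> P \<times> Q. pair_perm (fst x) \<circ> snd x = s} = fact k" if s: "s \<in> A" for s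
  proof -
    define d where "d = (\<lambda>j. s (2*j) div 2)"
    have sp: "s permutes {..<2*N}" using s unfolding A_def PN_def by auto
    have sd: "s (2*j) = 2 * d j" "s (2*j+1) = 2 * d j + 1" if "j \<in> {k..<N}" for j
      using s that unfolding A_def d_def by auto
    define C where "C = {\<sigma>. \<sigma> permutes {..<N} \<and> (\<forall>j\<in>{k..<N}. \<sigma> j = d j)}"
    have "card C = fact (card ({..<N} - {k..<N}))"
      unfolding C_def
    proof (rule card_permutes_agree)
      show "inj_on d {k..<N}"
      proof
        fix i j assume "i \<in> {k..<N}" "j \<in> {k..<N}" "d i = d j"
        then have "s (2*i) = s (2*j)" using sd by simp
        then show "i = j" using permutes_inj[OF sp] by (simp add: inj_eq)
      qed
      show "d ` {k..<N} \<subseteq> {..<N}"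
        using permutes_lessThan_pair[OF sp] unfolding d_def by (auto simp: less_mult_imp_div_less mult.commute)
    qed auto
    also have "{..<N} - {k..<N} = {..<k}" using k by auto
    finally have cC: "card C = fact k" by simp
    have bb: "bij_betw fst {x \<in> P \<times> Q. pair_perm (fst x) \<circ> snd x = s} C"
    proof (rule bij_betw_byWitness[where f' = "\<lambda>\<sigma>. (\<sigma>, pair_perm (Hilbert_Choice.inv \<sigma>) \<circ> s)"])
      have cancel: "pair_perm (Hilbert_Choice.inv \<sigma>) \<circ> (pair_perm \<sigma> \<circ> t) = t"
          "pair_perm \<sigma> \<circ> (pair_perm (Hilbert_Choice.inv \<sigma>) \<circ> t) = t" if "\<sigma> permutes {..<N}" for \<sigma> t
        using permutes_inv_o[OF that] unfolding o_assoc pair_perm_comp[symmetric] by (simp_all add: pair_perm_id del: id_apply)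
      show "\<forall>a\<in>{x \<in> P \<times> Q. pair_perm (fst x) \<circ> snd x = s}. (fst a, pair_perm (Hilbert_Choice.inv (fst a)) \<circ> s) = a"
        using cancel(1) unfolding P_def by auto
      show "\<forall>a'\<in>C. fst (a', pair_perm (Hilbert_Choice.inv a') \<circ> s) = a'" by simp
      show "fst ` {x \<in> P \<times> Q. pair_perm (fst x) \<circ> snd x = s} \<subseteq> C"
      proof safe
        fix \<sigma> t assume st: "\<sigma> \<in> P" "t \<in> Q" "s = pair_perm (fst (\<sigma>, t)) \<circ> snd (\<sigma>, t)"
        have "\<sigma> j = d j" if "j \<in> {k..<N}" for j
          using st(3) tfix[OF st(2) that] sd[OF that] by auto
        then show "fst (\<sigma>, t) \<in> C" using st(1) unfolding C_def P_def by auto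
      qed
      show "(\<lambda>\<sigma>. (\<sigma>, pair_perm (Hilbert_Choice.inv \<sigma>) \<circ> s)) ` C \<subseteq> {x \<in> P \<times> Q. pair_perm (fst x) \<circ> snd x = s}"
      proof
        fix x assume "x \<in> (\<lambda>\<sigma>. (\<sigma>, pair_perm (Hilbert_Choice.inv \<sigma>) \<circ> s)) ` C"
        then obtain \<sigma> where x: "x = (\<sigma>, pair_perm (Hilbert_Choice.inv \<sigma>) \<circ> s)" "\<sigma> \<in> C" by auto
        then have sg: "\<sigma> permutes {..<N}" "\<And>j. j \<in> {k..<N} \<Longrightarrow> \<sigma> j = d j" unfolding C_def by auto
        let ?t = "pair_perm (Hilbert_Choice.inv \<sigma>) \<circ> s"
        have *: "?t permutes {..<2*N}"
          by (rule permutes_compose[OF sp pair_perm_permutes[OF permutes_inv[OF sg(1)]]])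
        have "?t a = a" if "a \<in> {..<2*N} - {..<2*k}" for a
        proof -
          have j: "a div 2 \<in> {k..<N}" using that by auto
          then have "Hilbert_Choice.inv \<sigma> (d (a div 2)) = a div 2"
            using sg permutes_inverses(2)[OF sg(1)] by metis
          then have "?t (2 * (a div 2)) = 2 * (a div 2)" "?t (2 * (a div 2) + 1) = 2 * (a div 2) + 1"
            using sd[OF j] by (simp_all only: o_apply pair_perm_simps Suc_eq_plus1[symmetric])
          moreover have "a = 2 * (a div 2) \<or> a = 2 * (a div 2) + 1" by linarith
          ultimately show ?thesis by metis
        qed
        then have "?t permutes {..<2*k}" by (intro permutes_superset[OF *]) auto
        then show "x \<in> {x \<in> P \<times> Q. pair_perm (fst x) \<circ> snd x = s}"
          unfolding x(1) mem_Collect_eq fst_conv snd_conv cancel(2)[OF sg(1)] P_def Q_def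
          using sg(1) by simp
      qed
    qed
    show ?thesis unfolding bij_betw_same_card[OF bb] by (rule cC)
  qed
  have "fact k * (\<Sum>s\<in>A. F s) = (\<Sum>s\<in>A. \<Sum>x\<in>{x \<in> P \<times> Q. pair_perm (fst x) \<circ> snd x = s}. F (pair_perm (fst x) \<circ> snd x))"
    using fib by (simp add: sum_distrib_left)
  also have "\<dots> = (\<Sum>x\<in>P \<times> Q. F (pair_perm (fst x) \<circ> snd x))"
    by (rule sum.group) (use fin comp in \<open>auto simp: A_def\<close>)
  also have "\<dots> = (\<Sum>\<sigma>\<in>P. \<Sum>t\<in>Q. F (pair_perm \<sigma> \<circ> t))"
    by (simp add: sum.cartesian_product case_prod_beta)
  also have "\<dots> = (\<Sum>\<sigma>\<in>P. (\<Prod>j\<in>{k..<N}. \<rho> (\<sigma> j)) * W \<sigma>)"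
  proof (rule sum.cong[OF refl])
    fix \<sigma> assume \<sigma>: "\<sigma> \<in> P"
    have "F (pair_perm \<sigma> \<circ> t) = (\<Prod>j\<in>{k..<N}. \<rho> (\<sigma> j)) * (of_int (sign t) * (\<Prod>a<2*k. Y (pair_perm \<sigma> (t a)) a))"
      if t: "t \<in> Q" for t
    proof -
      have "sign (pair_perm \<sigma> \<circ> t) = sign (pair_perm \<sigma>) * sign t"
        using \<sigma> Q2[OF t] pair_perm_permutes[of \<sigma> N] unfolding P_def
        by (intro sign_compose) (auto simp: permutation_permutes)
      also have "sign (pair_perm \<sigma>) = 1" using \<sigma> sign_pair_perm unfolding P_def by auto
      finally have "sign (pair_perm \<sigma> \<circ> t) = sign t" by (simp only: mult_1_left)
      moreover have "(\<Prod>j\<in>{k..<N}. X ((pair_perm \<sigma> \<circ> t) (2*j)) ((pair_perm \<sigma> \<circ> t) (2*j+1))) = (\<Prod>j\<in>{k..<N}. \<rho> (\<sigma> j))"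
        using tfix[OF t] unfolding X_def by (intro prod.cong) auto
      ultimately show ?thesis unfolding F_def G_def by (simp only: mult_ac o_apply)
    qed
    then show "(\<Sum>t\<in>Q. F (pair_perm \<sigma> \<circ> t)) = (\<Prod>j\<in>{k..<N}. \<rho> (\<sigma> j)) * W \<sigma>"
      unfolding W_def sum_distrib_left by (intro sum.cong refl) auto
  qed
  also have "\<dots> = (\<Sum>\<sigma>\<in>P. (\<Prod>i<N. \<rho> i) * ((\<Prod>j<k. 1 / \<rho> (\<sigma> j)) * W \<sigma>))"
  proof (rule sum.cong[OF refl])
    fix \<sigma> assume \<sigma>: "\<sigma> \<in> P"
    have "(\<Prod>i<N. \<rho> i) = (\<Prod>j\<in>{..<k} \<union> {k..<N}. \<rho> (\<sigma> j))"
      using prod.permute[of \<sigma> "{..<N}" \<rho>] \<sigma> k ivl_disj_un_one(2)[of k N] unfolding P_def by (simp add: o_def)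
    also have "\<dots> = (\<Prod>j<k. \<rho> (\<sigma> j)) * (\<Prod>j\<in>{k..<N}. \<rho> (\<sigma> j))"
      by (rule prod.union_disjoint) auto
    finally have "(\<Prod>i<N. \<rho> i) = (\<Prod>j<k. \<rho> (\<sigma> j)) * (\<Prod>j\<in>{k..<N}. \<rho> (\<sigma> j))" .
    moreover have "(\<Prod>j<k. 1 / \<rho> (\<sigma> j)) * (\<Prod>j<k. \<rho> (\<sigma> j)) = 1"
    proof -
      have "\<rho> (\<sigma> j) \<noteq> 0" if "j < k" for j
        using \<sigma> that k permutes_in_image[of \<sigma> "{..<N}" j] rho unfolding P_def by auto
      then have "(\<Prod>j<k. 1 / \<rho> (\<sigma> j) * \<rho> (\<sigma> j)) = (\<Prod>j<k. 1)" by (intro prod.cong) auto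
      then show ?thesis by (simp only: prod.distrib prod.neutral_const)
    qed
    ultimately have "(\<Prod>i<N. \<rho> i) * (\<Prod>j<k. 1 / \<rho> (\<sigma> j)) = (\<Prod>j\<in>{k..<N}. \<rho> (\<sigma> j))"
      by (simp only: mult.assoc mult.commute[of _ "\<Prod>j<k. 1 / \<rho> (\<sigma> j)"] mult.assoc[symmetric] mult_1_left)
    then show "(\<Prod>j\<in>{k..<N}. \<rho> (\<sigma> j)) * W \<sigma> = (\<Prod>i<N. \<rho> i) * ((\<Prod>j<k. 1 / \<rho> (\<sigma> j)) * W \<sigma>)"
      by (simp only: mult.assoc[symmetric])
  qed
  finally have 2: "fact k * (\<Sum>s\<in>A. F s) = (\<Prod>i<N. \<rho> i) * (\<Sum>\<sigma>\<in>P. (\<Prod>j<k. 1 / \<rho> (\<sigma> j)) * W \<sigma>)"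
    by (simp add: sum_distrib_left)

  define w where "w = (\<lambda>c. (\<Prod>j<k. 1 / \<rho> (c j)) * W c)"
  have Wcong: "W c = W c'" if "\<And>j. j < k \<Longrightarrow> c j = c' j" for c c'
    unfolding W_def
  proof (intro sum.cong refl arg_cong2[where f="(*)"] prod.cong)
    fix t a assume "t \<in> Q" "a \<in> {..<2*k}"
    then have "t a < 2*k" using permutes_in_image[of t "{..<2*k}" a] unfolding Q_def by auto
    then have "t a div 2 < k" by auto
    then show "Y (pair_perm c (t a)) a = Y (pair_perm c' (t a)) a" using that by (simp add: pair_perm_def)
  qed
  define R where "R = {..<k} \<rightarrow>\<^sub>E {..<N}"
  \<comment> \<open>A repeated choice gives two equal rows, hence 0. So the sum over injective
    choices, which is what the permutations provide, may be extended to all maps in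
    \<open>R\<close>.\<close>
  have W0: "W c = 0" if "c i = c j" "i < k" "j < k" "i \<noteq> j" for c i j
  proof -
    define p where "p = Transposition.transpose (2*i) (2*j)"
    have p: "p permutes {..<2*k}" unfolding p_def using that by (intro permutes_swap_id) auto
    let ?f = "\<lambda>t. of_int (sign t) * (\<Prod>a<2*k. Y (pair_perm c (t a)) a)"
    have pc: "pair_perm c (p b) = pair_perm c b" for b
      using that(1) unfolding p_def Transposition.transpose_def by auto
    have "W c = (\<Sum>t\<in>Q. ?f (p \<circ> t))"
      unfolding W_def Q_def by (rule setum_permutations_compose_left[OF p])
    also have "\<dots> = (\<Sum>t\<in>Q. - ?f t)"
    proof (rule sum.cong[OF refl])
      fix t assume "t \<in> Q"
      then have "sign (p \<circ> t) = sign p * sign t"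
        using p unfolding Q_def by (intro sign_compose) (auto simp: permutation_permutes)
      also have "sign p = -1" unfolding p_def using that(4) by (simp add: sign_swap_id)
      finally have "sign (p \<circ> t) = - sign t" by (simp only: mult_minus_left mult_1_left)
      then show "?f (p \<circ> t) = - ?f t" by (simp only: pc o_apply of_int_minus mult_minus_left)
    qed
    also have "\<dots> = - W c" unfolding W_def by (simp add: sum_negf)
    finally show ?thesis by simp
  qed
  have "(\<Sum>\<sigma>\<in>P. w \<sigma>) = (\<Sum>\<sigma>\<in>P. w (restrict \<sigma> {..<k}))"
    unfolding w_def by (intro sum.cong refl arg_cong2[where f="(*)"] prod.cong Wcong) auto
  also have "\<dots> = (\<Sum>c\<in>R. \<Sum>\<sigma>\<in>{\<sigma>\<in>P. restrict \<sigma> {..<k} = c}. w (restrict \<sigma> {..<k}))"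
  proof (rule sum.group[symmetric])
    show "(\<lambda>\<sigma>. restrict \<sigma> {..<k}) ` P \<subseteq> R"
    proof safe
      fix \<sigma> assume "\<sigma> \<in> P"
      then have "\<sigma> j < N" if "j < k" for j
        using permutes_in_image[of \<sigma> "{..<N}" j] that k unfolding P_def by auto
      then show "restrict \<sigma> {..<k} \<in> R" unfolding R_def by auto
    qed
  qed (auto simp: fin R_def intro!: finite_PiE)
  \<comment> \<open>An injective \<open>c\<close> is the restriction of exactly
    \<open>fact (N - k)\<close> permutations.\<close>
  also have "\<dots> = (\<Sum>c\<in>R. fact (N - k) * w c)"
  proof (rule sum.cong[OF refl])
    fix c assume c: "c \<in> R"
    show "(\<Sum>\<sigma>\<in>{\<sigma>\<in>P. restrict \<sigma> {..<k} = c}. w (restrict \<sigma> {..<k})) = fact (N - k) * w c"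
    proof (cases "inj_on c {..<k}")
      case True
      have "{\<sigma>\<in>P. restrict \<sigma> {..<k} = c} = {\<sigma>. \<sigma> permutes {..<N} \<and> (\<forall>j\<in>{..<k}. \<sigma> j = c j)}"
      proof (intro Collect_cong conj_cong)
        fix \<sigma>
        have "restrict \<sigma> {..<k} = c \<longleftrightarrow> (\<forall>j\<in>{..<k}. restrict \<sigma> {..<k} j = c j)"
          using c unfolding R_def by (intro iffI ballI) (auto intro!: PiE_ext[of _ "{..<k}" "\<lambda>_. UNIV"])
        then show "(restrict \<sigma> {..<k} = c) = (\<forall>j\<in>{..<k}. \<sigma> j = c j)" by simp
      qed (simp add: P_def)
      also have "card \<dots> = fact (card ({..<N} - {..<k}))"
        using c k True unfolding R_def by (intro card_permutes_agree) auto
      also have "card ({..<N} - {..<k}) = N - k"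
        using k by (simp add: card_Diff_subset)
      finally have card: "card {\<sigma>\<in>P. restrict \<sigma> {..<k} = c} = fact (N - k)" .
      have "(\<Sum>\<sigma>\<in>{\<sigma>\<in>P. restrict \<sigma> {..<k} = c}. w (restrict \<sigma> {..<k})) = (\<Sum>\<sigma>\<in>{\<sigma>\<in>P. restrict \<sigma> {..<k} = c}. w c)"
        by (intro sum.cong refl) (simp only: mem_Collect_eq)
      then show ?thesis by (simp only: sum_constant card of_nat_fact)
    next
      case False
      then have "w c = 0" unfolding w_def inj_on_def using W0[of c] by auto
      moreover have "(\<Sum>\<sigma>\<in>{\<sigma>\<in>P. restrict \<sigma> {..<k} = c}. w (restrict \<sigma> {..<k})) = (\<Sum>\<sigma>\<in>{\<sigma>\<in>P. restrict \<sigma> {..<k} = c}. w c)"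
        by (intro sum.cong refl) (simp only: mem_Collect_eq)
      ultimately show ?thesis by (simp only: sum.neutral_const mult_zero_right)
    qed
  qed
  finally have 3: "(\<Sum>\<sigma>\<in>P. w \<sigma>) = fact (N - k) * (\<Sum>c\<in>R. w c)" by (simp add: sum_distrib_left)

  \<comment> \<open>Replacing \<open>t\<close> by its inverse moves the permutation from the rows to
    the columns, which is the form produced by \<open>pf_rank_two_sum\<close>.\<close>
  have Winv: "W c = (\<Sum>s\<in>Q. of_int (sign s) * (\<Prod>j<k. Y (2 * c j) (s (2*j)) * Y (2 * c j + 1) (s (2*j+1))))" for c
  proof -
    have "W c = (\<Sum>t\<in>Q. of_int (sign (Hilbert_Choice.inv t)) * (\<Prod>a<2*k. Y (pair_perm c (Hilbert_Choice.inv t a)) a))"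
      unfolding W_def Q_def by (rule sum_permutations_inverse)
    also have "\<dots> = (\<Sum>s\<in>Q. of_int (sign s) * (\<Prod>a<2*k. Y (pair_perm c a) (s a)))"
    proof (intro sum.cong refl arg_cong2[where f="(*)"])
      fix t assume "t \<in> Q"
      then have t: "t permutes {..<2*k}" unfolding Q_def by simp
      show "of_int (sign (Hilbert_Choice.inv t)) = (of_int (sign t) :: complex)"
        using t by (subst sign_inverse) (auto simp: permutation_permutes)
      show "(\<Prod>a<2*k. Y (pair_perm c (Hilbert_Choice.inv t a)) a) = (\<Prod>a<2*k. Y (pair_perm c a) (t a))"
        using prod.permute[OF t, of "\<lambda>a. Y (pair_perm c (Hilbert_Choice.inv t a)) a"] permutes_inverses(2)[OF t]
        by (simp add: o_def)
    qed
    finally show ?thesis unfolding prod_pairs by simp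
  qed
  have "pf k (\<lambda>a b. \<Sum>i<N. (1 / \<rho> i) * (Y (2*i) a * Y (2*i+1) b - Y (2*i+1) a * Y (2*i) b)) = 1 / fact k * (\<Sum>c\<in>R. w c)"
    unfolding pf_rank_two_sum R_def w_def Winv Q_def ..
  then have "(\<Sum>\<sigma>\<in>P. w \<sigma>) = fact (N - k) * (fact k * pf k (\<lambda>a b. \<Sum>i<N. (1 / \<rho> i) * (Y (2*i) a * Y (2*i+1) b - Y (2*i+1) a * Y (2*i) b)))"
    unfolding 3 by simp
  then have "fact k * (\<Sum>s\<in>A. F s) = fact k * ((\<Prod>i<N. \<rho> i) * fact (N - k) * pf k (\<lambda>a b. \<Sum>i<N. (1 / \<rho> i) * (Y (2*i) a * Y (2*i+1) b - Y (2*i+1) a * Y (2*i) b)))"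
    unfolding 2 w_def by (simp add: mult_ac)
  then have "(\<Sum>s\<in>A. F s) = (\<Prod>i<N. \<rho> i) * fact (N - k) * pf k (\<lambda>a b. \<Sum>i<N. (1 / \<rho> i) * (Y (2*i) a * Y (2*i+1) b - Y (2*i+1) a * Y (2*i) b))"
    by simp
  then show ?thesis using 1[unfolded FA] unfolding G_def PN_def by (simp only: mult_ac)
qed

text \<open>Apply \<open>pf_integrate_out\<close> with \<open>k = N\<close>, so that nothing is
  integrated: it then says that the Pfaffian of a congruence transform of the standard symplectic
  form is a determinant. The determinant of \<open>Y\<close> collapses to that of \<open>M\<close>
  because the even rows of \<open>Y\<close> are unit vectors.\<close>

lemma pf_eq_det:
  fixes A M :: "nat \<Rightarrow> nat \<Rightarrow> complex"
  assumes "\<And>i j. i < n \<Longrightarrow> j < n \<Longrightarrow> A (2*i) (2*j) = 0"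
    and "\<And>i j. i < n \<Longrightarrow> j < n \<Longrightarrow> A (2*i+1) (2*j+1) = 0"
    and "\<And>i j. i < n \<Longrightarrow> j < n \<Longrightarrow> A (2*i) (2*j+1) = M i j"
    and "\<And>i j. i < n \<Longrightarrow> j < n \<Longrightarrow> A (2*j+1) (2*i) = - M i j"
  shows "pf n A = Determinant.det (Matrix.mat n n (\<lambda>(i, j). M i j))"
proof -
  define Y where "Y = (\<lambda>a b. if even a then (if b = a then 1 else 0)
     else (if odd b then M (a div 2) (b div 2) else (0::complex)))"
  define PN where "PN = {s. s permutes {..<2*n}}"
  define f where "f = (\<lambda>i::nat. 2*i+1)"
  define Od where "Od = f ` {..<n}"
  let ?K = "\<lambda>a b. \<Sum>i<n. (1 / (1::complex)) * (Y (2*i) a * Y (2*i+1) b - Y (2*i+1) a * Y (2*i) b)"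
  have "pf n A = pf n ?K"
  proof (rule pf_cong)
    fix a b assume ab: "a < 2*n" "b < 2*n"
    have sel: "(\<Sum>i<n. if j = i then x i else 0) = (x j :: complex)" if "j < n" for j x
      using that by simp
    have e: "(2*j = 2*i) = (j = i)" for i j :: nat by simp
    consider i j where "a = 2*i" "b = 2*j" | i j where "a = 2*i+1" "b = 2*j+1"
      | i j where "a = 2*i" "b = 2*j+1" | i j where "a = 2*j+1" "b = 2*i"
      by (metis evenE oddE)
    then show "A a b = ?K a b"
    proof cases
      case 1
      then show ?thesis using assms(1)[of i j] ab by (simp add: Y_def)
    next
      case 2
      have "2*i+1 \<noteq> 2*l" for l by presburger
      moreover have "2*j+1 \<noteq> 2*l" for l by presburger
      ultimately show ?thesis using assms(2)[of i j] 2 ab by (simp add: Y_def)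
    next
      case 3
      then have "?K a b = (\<Sum>l<n. if i = l then M l j else 0)"
        by (intro sum.cong) (auto simp: Y_def)
      then show ?thesis using assms(3)[of i j] 3 ab by (simp add: sel)
    next
      case 4
      have "2*j+1 \<noteq> 2*l" for l by presburger
      with 4 have "?K a b = (\<Sum>l<n. if i = l then - M l j else 0)"
        by (intro sum.cong) (auto simp: Y_def)
      then show ?thesis using assms(4)[of i j] 4 ab by (simp add: sel)
    qed
  qed
  also have "\<dots> = (\<Sum>s\<in>PN. of_int (sign s) * (\<Prod>j<2*n. Y (s j) j))"
    using pf_integrate_out[of n n "\<lambda>_. 1" "\<lambda>a b. (if even a \<and> b = a + 1 then 1 else 0) - (if even b \<and> a = b + 1 then 1 else 0)" Y]
    unfolding PN_def by simp
  \<comment> \<open>A permutation contributes only if it fixes every even index.\<close>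
  also have "\<dots> = (\<Sum>s | s permutes Od. of_int (sign s) * (\<Prod>j<2*n. Y (s j) j))"
  proof (rule sum.mono_neutral_right)
    show "{s. s permutes Od} \<subseteq> PN"
      unfolding PN_def Od_def f_def by (auto intro: permutes_subset)
    show "\<forall>s\<in>PN - {s. s permutes Od}. of_int (sign s) * (\<Prod>j<2*n. Y (s j) j) = 0"
    proof
      fix s assume s: "s \<in> PN - {s. s permutes Od}"
      then have sp: "s permutes {..<2*n}" unfolding PN_def by simp
      have "\<exists>x\<in>{..<2*n} - Od. s x \<noteq> x"
        using s permutes_superset[OF sp, of Od] unfolding PN_def by blast
      then obtain x where x: "x < 2*n" "x \<notin> Od" "s x \<noteq> x" by auto
      have "even x"
      proof (rule ccontr)
        assume "odd x"
        then obtain i where "x = 2*i+1" by (metis oddE)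
        then show False using x unfolding Od_def f_def by auto
      qed
      then have "Y (s x) x = 0" using x by (auto simp: Y_def)
      then have "(\<Prod>j<2*n. Y (s j) j) = 0" using x by (intro prod_zero) auto
      then show "of_int (sign s) * (\<Prod>j<2*n. Y (s j) j) = 0" by simp
    qed
  qed (auto simp: PN_def)
  also have "\<dots> = (\<Sum>t | t permutes {..<n}. of_int (sign t) * (\<Prod>i<n. M (t i) i))"
  proof (rule sum.reindex_bij_witness[where i = "map_permutation {..<n} f" and j = "map_permutation Od (\<lambda>a. a div 2)"])
    have b: "bij_betw f {..<n} Od" unfolding Od_def f_def by (auto simp: bij_betw_def inj_on_def)
    have b': "bij_betw (\<lambda>a. a div 2) Od {..<n}"
      unfolding Od_def f_def by (auto simp: bij_betw_def inj_on_def image_image)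
    show "map_permutation {..<n} f (map_permutation Od (\<lambda>a. a div 2) s) = s" if "s \<in> {s. s permutes Od}" for s
      by (rule map_permutation_compose_inv[OF b']) (use that in \<open>auto simp: Od_def f_def\<close>)
    show "map_permutation Od (\<lambda>a. a div 2) s \<in> {t. t permutes {..<n}}" if "s \<in> {s. s permutes Od}" for s
      using map_permutation_permutes[OF b'] that by auto
    show "map_permutation Od (\<lambda>a. a div 2) (map_permutation {..<n} f t) = t" if "t \<in> {t. t permutes {..<n}}" for t
      by (rule map_permutation_compose_inv[OF b]) (use that in \<open>auto simp: f_def\<close>)
    show "map_permutation {..<n} f t \<in> {s. s permutes Od}" if "t \<in> {t. t permutes {..<n}}" for t
      using map_permutation_permutes[OF b] that by auto
    show "of_int (sign (map_permutation Od (\<lambda>a. a div 2) s)) * (\<Prod>i<n. M (map_permutation Od (\<lambda>a. a div 2) s i) i)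
        = of_int (sign s) * (\<Prod>j<2*n. Y (s j) j)" if "s \<in> {s. s permutes Od}" for s
    proof -
      have s: "s permutes Od" using that by simp
      have "sign (map_permutation Od (\<lambda>a. a div 2) s) = sign s"
        by (rule sign_map_permutation) (use b' s in \<open>auto simp: bij_betw_def Od_def\<close>)
      moreover have "(\<Prod>j<2*n. Y (s j) j) = (\<Prod>i<n. M (map_permutation Od (\<lambda>a. a div 2) s i) i)"
        unfolding prod_pairs
      proof (rule prod.cong[OF refl])
        fix i assume "i \<in> {..<n}"
        then have i: "2*i+1 \<in> Od" unfolding Od_def f_def by auto
        have "s (2*i) = 2*i" by (rule permutes_not_in[OF s]) (auto simp: Od_def f_def, presburger)
        moreover have "s (2*i+1) \<in> Od" using permutes_in_image[OF s] i by blast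
        then have "odd (s (2*i+1))" unfolding Od_def f_def by auto
        moreover have "map_permutation Od (\<lambda>a. a div 2) s ((2*i+1) div 2) = s (2*i+1) div 2"
          by (rule map_permutation_apply) (use b' i in \<open>auto simp: bij_betw_def\<close>)
        ultimately show "Y (s (2*i)) (2*i) * Y (s (2*i+1)) (2*i+1) = M (map_permutation Od (\<lambda>a. a div 2) s i) i"
          by (simp add: Y_def)
      qed
      ultimately show ?thesis by simp
    qed
  qed
  also have "\<dots> = (\<Sum>t | t permutes {0..<n}. of_int (sign t) * (\<Prod>j<n. Matrix.mat n n (\<lambda>(i, j). M i j) $$ (t j, j)))"
    unfolding atLeast0LessThan
  proof (intro sum.cong refl arg_cong2[where f="(*)"] prod.cong)
    fix t j assume "t \<in> {t. t permutes {..<n}}" "j \<in> {..<n}"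
    then have "t j < n" "j < n" using permutes_in_image[of t "{..<n}" j] by auto
    then show "M (t j) j = Matrix.mat n n (\<lambda>(i, j). M i j) $$ (t j, j)" by simp
  qed
  also have "\<dots> = Determinant.det (Matrix.mat n n (\<lambda>(i, j). M i j))"
    by (rule det_col[symmetric]) simp
  finally show ?thesis .
qed

section \<open>The Hamiltonian as a Vandermonde determinant\<close>

text \<open>The matrix factors through the lower triangular matrix of coefficients, so replacing
  monomials by polynomials of matching degree costs only the leading coefficients.\<close>

lemma det_poly_mat:
  fixes p :: "nat \<Rightarrow> complex poly" and y :: "nat \<Rightarrow> complex"
  assumes "\<And>a. a < n \<Longrightarrow> degree (p a) \<le> a"
  shows "Determinant.det (Matrix.mat n n (\<lambda>(a, j). poly (p a) (y j))) =
     (\<Prod>a<n. coeff (p a) a) * Determinant.det (Matrix.mat n n (\<lambda>(a, j). y j ^ a))"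
proof -
  let ?P = "Matrix.mat n n (\<lambda>(a, b). coeff (p a) b)" and ?V = "Matrix.mat n n (\<lambda>(a, j). y j ^ a)"
  have "Matrix.mat n n (\<lambda>(a, j). poly (p a) (y j)) = ?P * ?V"
  proof (rule eq_matI)
    fix a j assume "a < dim_row (?P * ?V)" "j < dim_col (?P * ?V)"
    then have aj: "a < n" "j < n" by auto
    have "poly (p a) (y j) = (\<Sum>b\<in>{0..<n}. coeff (p a) b * y j ^ b)"
      unfolding poly_altdef using assms[OF aj(1)] aj
      by (intro sum.mono_neutral_left) (auto simp: coeff_eq_0)
    then show "Matrix.mat n n (\<lambda>(a, j). poly (p a) (y j)) $$ (a, j) = (?P * ?V) $$ (a, j)"
      using aj by (simp add: scalar_prod_def)
  qed auto
  then have "Determinant.det (Matrix.mat n n (\<lambda>(a, j). poly (p a) (y j))) = Determinant.det ?P * Determinant.det ?V"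
    by (simp add: det_mult[of _ n])
  also have "Determinant.det ?P = prod_list (diag_mat ?P)"
  proof (rule det_lower_triangular[of n])
    fix i j assume "i < j" "j < n"
    then have "coeff (p i) j = 0" using assms[of i] by (intro coeff_eq_0) auto
    then show "?P $$ (i, j) = 0" using \<open>i < j\<close> \<open>j < n\<close> by simp
  qed simp
  also have "\<dots> = (\<Prod>a<n. coeff (p a) a)"
    by (simp add: prod_list_diag_prod atLeast0LessThan)
  finally show ?thesis .
qed

text \<open>In the Newton basis, where \<open>p a\<close> vanishes at the \<open>y i\<close> with
  \<open>i < a\<close>, the evaluation matrix is upper triangular with products of differences on
  its diagonal.\<close>

lemma vandermonde_det:
  fixes y :: "nat \<Rightarrow> complex"
  shows "Determinant.det (Matrix.mat n n (\<lambda>(a, j). y j ^ a)) = (\<Prod>j<n. \<Prod>i<j. y j - y i)"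
proof -
  define p where "p = (\<lambda>a. \<Prod>i<a. [:- y i, 1:])"
  have deg: "degree (p a) = a" for a
    unfolding p_def by (subst degree_prod_eq_sum_degree) auto
  have lead: "coeff (p a) a = 1" for a
  proof (induction a)
    case (Suc a)
    have "p (Suc a) = p a * [:- y a, 1:]" by (simp add: p_def)
    then show ?case using Suc coeff_mult_degree_sum[of "p a" "[:- y a, 1:]"] deg[of a] by simp
  qed (simp add: p_def)
  have ev: "poly (p a) x = (\<Prod>i<a. x - y i)" for a x
    unfolding p_def by (simp add: poly_prod)
  let ?U = "Matrix.mat n n (\<lambda>(a, j). poly (p a) (y j))"
  have "Determinant.det (Matrix.mat n n (\<lambda>(a, j). y j ^ a)) = Determinant.det ?U"
    by (subst det_poly_mat) (simp_all add: deg lead)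
  also have "\<dots> = prod_list (diag_mat ?U)"
    by (rule det_upper_triangular[of _ n]) (auto simp: upper_triangular_def ev)
  also have "\<dots> = (\<Prod>j<n. \<Prod>i<j. y j - y i)"
    by (simp add: prod_list_diag_prod atLeast0LessThan ev)
  finally show ?thesis .
qed

lemma det_poly_vandermonde:
  fixes p :: "nat \<Rightarrow> complex poly" and y :: "nat \<Rightarrow> complex"
  assumes "\<And>a. a < n \<Longrightarrow> degree (p a) \<le> a"
  shows "(\<Sum>s | s permutes {..<n}. of_int (sign s) * (\<Prod>j<n. poly (p (s j)) (y j))) =
     (\<Prod>a<n. coeff (p a) a) * (\<Prod>j<n. \<Prod>i<j. y j - y i)"
proof -
  let ?A = "Matrix.mat n n (\<lambda>(a, j). poly (p a) (y j))"
  have "Determinant.det ?A = (\<Sum>s | s permutes {..<n}. of_int (sign s) * (\<Prod>j<n. ?A $$ (s j, j)))"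
    using det_col[of ?A n] by (simp add: atLeast0LessThan)
  also have "\<dots> = (\<Sum>s | s permutes {..<n}. of_int (sign s) * (\<Prod>j<n. poly (p (s j)) (y j)))"
  proof (intro sum.cong refl arg_cong2[where f="(*)"] prod.cong)
    fix s j assume "s \<in> {s. s permutes {..<n}}" "j \<in> {..<n}"
    then have "s j < n" "j < n" using permutes_in_image[of s "{..<n}" j] by auto
    then show "?A $$ (s j, j) = poly (p (s j)) (y j)" by simp
  qed
  finally show ?thesis using det_poly_mat[OF assms, where y = y] vandermonde_det by simp
qed

section \<open>Exponentials of extended real energies\<close>

lemma exp_neg_0: "exp_neg 0 = 1"
  by (simp add: exp_neg_def)

lemma exp_neg_add:
  assumes "a \<noteq> -\<infinity>" "b \<noteq> -\<infinity>"
  shows "exp_neg (a + b) = exp_neg a * exp_neg b"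
  using assms by (cases a; cases b) (auto simp: exp_neg_def exp_add exp_minus divide_simps exp_diff)

text \<open>The second conjunct is what lets \<open>exp_neg_add\<close> be applied to the next
  summand.\<close>

lemma exp_neg_sum:
  fixes f :: "'a \<Rightarrow> ereal"
  assumes "finite A" "\<And>i. i \<in> A \<Longrightarrow> f i \<noteq> -\<infinity>"
  shows "exp_neg (\<Sum>i\<in>A. f i) = (\<Prod>i\<in>A. exp_neg (f i)) \<and> (\<Sum>i\<in>A. f i) \<noteq> -\<infinity>"
  using assms by (induction A rule: finite_induct) (auto simp: exp_neg_0 exp_neg_add)

lemma exp_neg_log_inv: "x \<ge> 0 \<Longrightarrow> exp_neg (log_inv x) = x"
  by (auto simp: exp_neg_def log_inv_def ln_div exp_minus)

lemma log_inv_not_MInf[simp]: "log_inv x \<noteq> -\<infinity>"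
  by (simp add: log_inv_def)

lemma exp_neg_hamiltonian:
  "exp_neg (hamiltonian Q N \<zeta>) =
     (\<Prod>j<N. \<Prod>l\<in>{..<N} - {j}. cmod (\<zeta> j - \<zeta> l) * cmod (\<zeta> j - cnj (\<zeta> l))) *
     (\<Prod>j<N. (cmod (\<zeta> j - cnj (\<zeta> j)))\<^sup>2 * exp (- (real N * Q (\<zeta> j))))"
proof -
  have a: "exp_neg (\<Sum>l\<in>{..<N} - {j}. log_inv (cmod (\<zeta> j - \<zeta> l) * cmod (\<zeta> j - cnj (\<zeta> l)))) =
      (\<Prod>l\<in>{..<N} - {j}. cmod (\<zeta> j - \<zeta> l) * cmod (\<zeta> j - cnj (\<zeta> l)))"
    "(\<Sum>l\<in>{..<N} - {j}. log_inv (cmod (\<zeta> j - \<zeta> l) * cmod (\<zeta> j - cnj (\<zeta> l)))) \<noteq> -\<infinity>" for j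
    using exp_neg_sum[of "{..<N} - {j}" "\<lambda>l. log_inv (cmod (\<zeta> j - \<zeta> l) * cmod (\<zeta> j - cnj (\<zeta> l)))"]
    by (auto simp: exp_neg_log_inv)
  have b: "exp_neg (log_inv ((cmod (\<zeta> j - cnj (\<zeta> j)))\<^sup>2) + ereal (real N * Q (\<zeta> j))) =
      (cmod (\<zeta> j - cnj (\<zeta> j)))\<^sup>2 * exp (- (real N * Q (\<zeta> j)))"
    "log_inv ((cmod (\<zeta> j - cnj (\<zeta> j)))\<^sup>2) + ereal (real N * Q (\<zeta> j)) \<noteq> -\<infinity>" for j
  proof -
    show "exp_neg (log_inv ((cmod (\<zeta> j - cnj (\<zeta> j)))\<^sup>2) + ereal (real N * Q (\<zeta> j))) =
      (cmod (\<zeta> j - cnj (\<zeta> j)))\<^sup>2 * exp (- (real N * Q (\<zeta> j)))"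
      by (subst exp_neg_add) (auto simp: exp_neg_log_inv, simp add: exp_neg_def)
    show "log_inv ((cmod (\<zeta> j - cnj (\<zeta> j)))\<^sup>2) + ereal (real N * Q (\<zeta> j)) \<noteq> -\<infinity>"
      by (simp add: log_inv_def)
  qed
  show ?thesis
  proof -
    let ?S = "\<Sum>j<N. \<Sum>l\<in>{..<N} - {j}. log_inv (cmod (\<zeta> j - \<zeta> l) * cmod (\<zeta> j - cnj (\<zeta> l)))"
    let ?T = "\<Sum>j<N. log_inv ((cmod (\<zeta> j - cnj (\<zeta> j)))\<^sup>2) + ereal (real N * Q (\<zeta> j))"
    have S: "exp_neg ?S = (\<Prod>j<N. exp_neg (\<Sum>l\<in>{..<N} - {j}. log_inv (cmod (\<zeta> j - \<zeta> l) * cmod (\<zeta> j - cnj (\<zeta> l)))))"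
      "?S \<noteq> -\<infinity>"
      using exp_neg_sum[OF finite_lessThan, of N "\<lambda>j. \<Sum>l\<in>{..<N} - {j}. log_inv (cmod (\<zeta> j - \<zeta> l) * cmod (\<zeta> j - cnj (\<zeta> l)))"] a(2)
      by blast+
    have T: "exp_neg ?T = (\<Prod>j<N. exp_neg (log_inv ((cmod (\<zeta> j - cnj (\<zeta> j)))\<^sup>2) + ereal (real N * Q (\<zeta> j))))"
      "?T \<noteq> -\<infinity>"
      using exp_neg_sum[OF finite_lessThan, of N "\<lambda>j. log_inv ((cmod (\<zeta> j - cnj (\<zeta> j)))\<^sup>2) + ereal (real N * Q (\<zeta> j))"] b(2)
      by blast+
    show ?thesis
      unfolding hamiltonian_def exp_neg_add[OF S(2) T(2)] S(1) T(1) a(1) b(1) ..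
  qed
qed

text \<open>The list \<open>\<zeta> 0, cnj (\<zeta> 0), \<zeta> 1, cnj (\<zeta> 1), ...\<close>: in
  the Pfaffians below an even index stands for a point and the next odd index for its mirror
  image.\<close>

definition with_conj :: "(nat \<Rightarrow> complex) \<Rightarrow> nat \<Rightarrow> complex" where
  "with_conj \<zeta> a = (if even a then \<zeta> (a div 2) else cnj (\<zeta> (a div 2)))"

lemma with_conj_simps[simp]: "with_conj \<zeta> (2*i) = \<zeta> i" "with_conj \<zeta> (Suc (2*i)) = cnj (\<zeta> i)"
  by (auto simp: with_conj_def)

text \<open>For two points \<open>a\<close> and \<open>b\<close> the four differences multiply to
  \<open>(|a - b| * |a - cnj b|)\<^sup>2\<close>, which is what the two ordered pairs contribute to
  the interaction; a point and its own image give the linear factor.\<close>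

lemma vandermonde_with_conj:
  "(\<Prod>b<2*N. \<Prod>a<b. with_conj \<zeta> b - with_conj \<zeta> a) =
   (\<Prod>j<N. cnj (\<zeta> j) - \<zeta> j) *
   complex_of_real (\<Prod>j<N. \<Prod>l\<in>{..<N} - {j}. cmod (\<zeta> j - \<zeta> l) * cmod (\<zeta> j - cnj (\<zeta> l)))"
proof (induction N)
  case 0
  then show ?case by simp
next
  case (Suc N)
  let ?z = "\<zeta> N" and ?y = "with_conj \<zeta>"
  let ?g = "\<lambda>j l. cmod (\<zeta> j - \<zeta> l) * cmod (\<zeta> j - cnj (\<zeta> l))"
  have g: "complex_of_real (?g N l * ?g l N) = (?z - \<zeta> l) * (?z - cnj (\<zeta> l)) * ((cnj ?z - \<zeta> l) * (cnj ?z - cnj (\<zeta> l)))" for l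
  proof -
    have 1: "cmod (\<zeta> l - ?z) = cmod (?z - \<zeta> l)" by (rule norm_minus_commute)
    have 2: "cmod (\<zeta> l - cnj ?z) = cmod (?z - cnj (\<zeta> l))"
      by (metis complex_cnj_cnj complex_cnj_diff complex_mod_cnj norm_minus_commute)
    have "?g N l * ?g l N = (cmod (?z - \<zeta> l))\<^sup>2 * (cmod (?z - cnj (\<zeta> l)))\<^sup>2"
      unfolding 1 2 by (simp add: power2_eq_square)
    then have "complex_of_real (?g N l * ?g l N) = complex_of_real ((cmod (?z - \<zeta> l))\<^sup>2) * complex_of_real ((cmod (?z - cnj (\<zeta> l)))\<^sup>2)"
      by (simp only: of_real_mult)
    then show ?thesis unfolding complex_norm_square by simp
  qed
  have ev: "(\<Prod>j<Suc N. \<Prod>l\<in>{..<Suc N} - {j}. ?g j l) =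
      (\<Prod>j<N. \<Prod>l\<in>{..<N} - {j}. ?g j l) * (\<Prod>l<N. ?g N l * ?g l N)"
  proof -
    have i: "{..<Suc N} - {N} = {..<N}" by auto
    have ii: "(\<Prod>l\<in>{..<Suc N} - {j}. ?g j l) = ?g j N * (\<Prod>l\<in>{..<N} - {j}. ?g j l)" if "j \<in> {..<N}" for j
    proof -
      have "{..<Suc N} - {j} = insert N ({..<N} - {j})" using that by auto
      then show ?thesis by simp
    qed
    have "(\<Prod>j<N. \<Prod>l\<in>{..<Suc N} - {j}. ?g j l) = (\<Prod>j<N. ?g j N * (\<Prod>l\<in>{..<N} - {j}. ?g j l))"
      using ii by (rule prod.cong[OF refl])
    also have "\<dots> = (\<Prod>j<N. ?g j N) * (\<Prod>j<N. \<Prod>l\<in>{..<N} - {j}. ?g j l)"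
      by (rule prod.distrib)
    finally have "(\<Prod>j<Suc N. \<Prod>l\<in>{..<Suc N} - {j}. ?g j l) =
        ((\<Prod>j<N. ?g j N) * (\<Prod>j<N. \<Prod>l\<in>{..<N} - {j}. ?g j l)) * (\<Prod>l<N. ?g N l)"
      unfolding prod.lessThan_Suc[of "\<lambda>j. \<Prod>l\<in>{..<Suc N} - {j}. ?g j l"] i by (rule arg_cong)
    moreover have "(\<Prod>l<N. ?g N l * ?g l N) = (\<Prod>l<N. ?g N l) * (\<Prod>l<N. ?g l N)"
      by (rule prod.distrib)
    moreover have "(a * b) * c = b * (c * a)" for a b c :: real by simp
    ultimately show ?thesis by (simp only:)
  qed
  have "(\<Prod>b<2*Suc N. \<Prod>a<b. ?y b - ?y a) =
     (\<Prod>b<2*N. \<Prod>a<b. ?y b - ?y a) * (\<Prod>a<2*N. ?z - ?y a) * ((\<Prod>a<2*N. cnj ?z - ?y a) * (cnj ?z - ?z))"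
    by simp
  also have "(\<Prod>a<2*N. ?z - ?y a) = (\<Prod>l<N. (?z - \<zeta> l) * (?z - cnj (\<zeta> l)))"
    unfolding prod_pairs by simp
  also have "(\<Prod>a<2*N. cnj ?z - ?y a) = (\<Prod>l<N. (cnj ?z - \<zeta> l) * (cnj ?z - cnj (\<zeta> l)))"
    unfolding prod_pairs by simp
  finally have 1: "(\<Prod>b<2*Suc N. \<Prod>a<b. ?y b - ?y a) =
     (\<Prod>b<2*N. \<Prod>a<b. ?y b - ?y a) * (\<Prod>l<N. (?z - \<zeta> l) * (?z - cnj (\<zeta> l))) *
     ((\<Prod>l<N. (cnj ?z - \<zeta> l) * (cnj ?z - cnj (\<zeta> l))) * (cnj ?z - ?z))" .
  have 2: "(\<Prod>l<N. (?z - \<zeta> l) * (?z - cnj (\<zeta> l))) * (\<Prod>l<N. (cnj ?z - \<zeta> l) * (cnj ?z - cnj (\<zeta> l)))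
      = complex_of_real (\<Prod>l<N. ?g N l * ?g l N)"
    unfolding prod.distrib[symmetric, of "\<lambda>l. (?z - \<zeta> l) * (?z - cnj (\<zeta> l))"] of_real_prod g ..
  have alg: "A * B * (C * d) = P * d * (G * H)" if "A = P * G" "B * C = H" for A B C d P G H :: complex
  proof -
    have "A * B * (C * d) = A * (B * C) * d" by (simp only: mult.assoc)
    also have "\<dots> = P * G * H * d" unfolding that ..
    finally show ?thesis by (simp only: mult_ac)
  qed
  show ?case unfolding 1 ev of_real_mult prod.lessThan_Suc[of "\<lambda>j. cnj (\<zeta> j) - \<zeta> j"]
    by (rule alg[OF Suc.IH 2])
qed

text \<open>Since \<open>|z - cnj z|\<^sup>2 = - (cnj z - z)\<^sup>2\<close>, one linear factor per
  particle is used up in the Vandermonde product and one remains as a weight; the minus signs give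
  \<open>(-1) ^ N\<close>.\<close>

lemma exp_neg_hamiltonian_vandermonde:
  "complex_of_real (exp_neg (hamiltonian Q N \<zeta>)) =
     (-1) ^ N * (\<Prod>j<N. (cnj (\<zeta> j) - \<zeta> j) * complex_of_real (exp (- (real N * Q (\<zeta> j))))) *
     (\<Prod>b<2*N. \<Prod>a<b. with_conj \<zeta> b - with_conj \<zeta> a)"
proof -
  have "complex_of_real ((cmod (z - cnj z))\<^sup>2) = (-1) * ((cnj z - z) * (cnj z - z))" for z
    unfolding complex_norm_square by (simp add: algebra_simps)
  then have "complex_of_real (\<Prod>j<N. (cmod (\<zeta> j - cnj (\<zeta> j)))\<^sup>2 * exp (- (real N * Q (\<zeta> j)))) =
     (\<Prod>j<N. (-1) * ((cnj (\<zeta> j) - \<zeta> j) * (cnj (\<zeta> j) - \<zeta> j)) * complex_of_real (exp (- (real N * Q (\<zeta> j)))))"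
    by (simp only: of_real_prod of_real_mult)
  also have "\<dots> = (-1) ^ N * ((\<Prod>j<N. cnj (\<zeta> j) - \<zeta> j) * (\<Prod>j<N. cnj (\<zeta> j) - \<zeta> j)) *
      (\<Prod>j<N. complex_of_real (exp (- (real N * Q (\<zeta> j)))))"
    by (simp only: prod.distrib prod_constant card_lessThan)
  finally have 1: "complex_of_real (\<Prod>j<N. (cmod (\<zeta> j - cnj (\<zeta> j)))\<^sup>2 * exp (- (real N * Q (\<zeta> j)))) = \<dots>" .
  have alg: "V * (m * (c * c) * w) = m * (c * w) * (c * V)" for V m c w :: complex
    by (simp add: algebra_simps)
  show ?thesis unfolding exp_neg_hamiltonian vandermonde_with_conj of_real_mult 1[unfolded of_real_mult]
    unfolding prod.distrib[of "\<lambda>j. cnj (\<zeta> j) - \<zeta> j"] by (rule alg)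
qed

section \<open>Gaussian moments in the plane\<close>

lemma gaussian_integral_real:
  assumes "c > (0::real)"
  shows "integrable lborel (\<lambda>x::real. exp (- (c * x\<^sup>2)))" "(LBINT x::real. exp (- (c * x\<^sup>2))) = sqrt (pi / c)"
proof -
  define \<sigma> where "\<sigma> = 1 / sqrt (2 * c)"
  have \<sigma>: "\<sigma> > 0" "\<sigma>\<^sup>2 = 1 / (2 * c)" using assms by (auto simp: \<sigma>_def power_divide)
  have e: "exp (- (c * x\<^sup>2)) = sqrt (pi / c) * normal_density 0 \<sigma> x" for x
  proof -
    have "2 * pi * (1 / (2 * c)) = pi / c" "- (x - 0)\<^sup>2 / (2 * (1 / (2 * c))) = - (c * x\<^sup>2)"
      using assms by (auto simp: field_simps)
    moreover have "sqrt (pi / c) * (1 / sqrt (pi / c) * e) = e" for e using assms by simp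
    ultimately show ?thesis unfolding normal_density_def \<sigma>(2) by metis
  qed
  show "integrable lborel (\<lambda>x::real. exp (- (c * x\<^sup>2)))"
    unfolding e using integrable_normal_density[OF \<sigma>(1)] by simp
  show "(LBINT x::real. exp (- (c * x\<^sup>2))) = sqrt (pi / c)"
    unfolding e using integral_normal_density[OF \<sigma>(1)] by simp
qed

text \<open>Identifies the planar measure with a product, so that Fubini is available in real
  coordinates.\<close>

lemma lborel_complex: "(lborel :: complex measure) = distr (lborel \<Otimes>\<^sub>M lborel) borel (\<lambda>(x, y). Complex x y)"
proof (rule lborel_eqI)
  have m: "(\<lambda>(x, y). Complex x y) \<in> borel_measurable (lborel \<Otimes>\<^sub>M lborel)"
    by (simp add: lborel_prod) (auto simp: case_prod_beta Complex_eq intro!: borel_measurable_continuous_onI continuous_intros)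
  fix l u :: complex assume lu: "\<And>b. b \<in> Basis \<Longrightarrow> l \<bullet> b \<le> u \<bullet> b"
  have l: "Re l \<le> Re u" "Im l \<le> Im u" using lu[of 1] lu[of \<i>] by (auto simp: Basis_complex_def inner_complex_def)
  have "(\<lambda>(x, y). Complex x y) -` box l u \<inter> space (lborel \<Otimes>\<^sub>M lborel) = {Re l<..<Re u} \<times> {Im l<..<Im u}"
    by (auto simp: box_def Basis_complex_def inner_complex_def space_pair_measure)
  then have "emeasure (distr (lborel \<Otimes>\<^sub>M lborel) borel (\<lambda>(x, y). Complex x y)) (box l u) =
      emeasure (lborel \<Otimes>\<^sub>M lborel) ({Re l<..<Re u} \<times> {Im l<..<Im u})"
    using m by (subst emeasure_distr) auto
  also have "\<dots> = emeasure lborel {Re l<..<Re u} * emeasure lborel {Im l<..<Im u}"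
    by (rule lborel.emeasure_pair_measure_Times) auto
  also have "\<dots> = ennreal (prod ((\<bullet>) (u - l)) Basis)"
    using l by (simp add: Basis_complex_def inner_complex_def ennreal_mult complex_eq_iff)
  finally show "emeasure (distr (lborel \<Otimes>\<^sub>M lborel) borel (\<lambda>(x, y). Complex x y)) (box l u) = ennreal (prod ((\<bullet>) (u - l)) Basis)" .
qed auto

lemma measurable_Complex[measurable]: "(\<lambda>(x, y). Complex x y) \<in> borel_measurable (lborel \<Otimes>\<^sub>M lborel)"
  by (simp add: lborel_prod) (auto simp: case_prod_beta Complex_eq intro!: borel_measurable_continuous_onI continuous_intros)

lemma integrable_lborel_complex:
  fixes F :: "complex \<Rightarrow> 'b :: {banach, second_countable_topology}"
  assumes "F \<in> borel_measurable borel"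
  shows "integrable lborel F \<longleftrightarrow> integrable (lborel \<Otimes>\<^sub>M lborel) (\<lambda>(x, y). F (Complex x y))"
  unfolding lborel_complex using integrable_distr_eq[OF measurable_Complex, of F] assms
  by (simp add: case_prod_beta')

lemma integral_lborel_complex:
  fixes F :: "complex \<Rightarrow> 'b :: {banach, second_countable_topology}"
  assumes "integrable lborel F"
  shows "(\<integral>z. F z \<partial>lborel) = (LBINT y. LBINT x. F (Complex x y))"
    "(\<integral>z. F z \<partial>lborel) = (LBINT x. LBINT y. F (Complex x y))"
proof -
  have F: "F \<in> borel_measurable borel" using assms by (auto dest: borel_measurable_integrable)
  have "(\<integral>z. F z \<partial>lborel) = (LINT (x, y)|(lborel \<Otimes>\<^sub>M lborel). F (Complex x y))"
    unfolding lborel_complex using integral_distr[OF measurable_Complex, of F] F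
    by (simp add: case_prod_beta')
  moreover have "integrable (lborel \<Otimes>\<^sub>M lborel) (\<lambda>(x, y). F (Complex x y))"
    using assms integrable_lborel_complex[OF F] by blast
  ultimately show "(\<integral>z. F z \<partial>lborel) = (LBINT y. LBINT x. F (Complex x y))"
    "(\<integral>z. F z \<partial>lborel) = (LBINT x. LBINT y. F (Complex x y))"
    using lborel_pair.integral_snd[of "\<lambda>x y. F (Complex x y)"] lborel_pair.integral_fst[of "\<lambda>x y. F (Complex x y)"]
    by simp_all
qed

lemma gaussian_complex:
  assumes "c > (0::real)"
  shows "integrable lborel (\<lambda>z::complex. exp (- (c * (cmod z)\<^sup>2)))"
    "(\<integral>z. exp (- (c * (cmod z)\<^sup>2)) \<partial>lborel) = pi / c"
proof -
  have e: "exp (- (c * (cmod (Complex x y))\<^sup>2)) = exp (- (c * x\<^sup>2)) * exp (- (c * y\<^sup>2))" for x y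
    by (simp add: cmod_power2 exp_add[symmetric] algebra_simps)
  note [measurable] = measurable_Complex
  have i: "integrable (lborel \<Otimes>\<^sub>M lborel) (\<lambda>(x, y). exp (- (c * (cmod (Complex x y))\<^sup>2)))"
    unfolding e
  proof (rule lborel_pair.Fubini_integrable)
    show "integrable lborel (\<lambda>x. LBINT y. norm (case (x, y) of (x, y) \<Rightarrow> exp (- (c * x\<^sup>2)) * exp (- (c * y\<^sup>2))))"
      using gaussian_integral_real[OF assms] by simp
    show "AE x in lborel. integrable lborel (\<lambda>y. case (x, y) of (x, y) \<Rightarrow> exp (- (c * x\<^sup>2)) * exp (- (c * y\<^sup>2)))"
      using gaussian_integral_real[OF assms] by simp
  qed measurable
  show I: "integrable lborel (\<lambda>z::complex. exp (- (c * (cmod z)\<^sup>2)))"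
    by (subst integrable_lborel_complex) (use i in auto)
  show "(\<integral>z. exp (- (c * (cmod z)\<^sup>2)) \<partial>lborel) = pi / c"
    unfolding integral_lborel_complex(1)[OF I] e
    using gaussian_integral_real[OF assms] assms by simp
qed

lemma power_mult_gaussian_le:
  assumes "c > (0::real)"
  obtains K where "K > 0" "\<And>r. 0 \<le> r \<Longrightarrow> r ^ n * exp (- (c * r\<^sup>2)) \<le> K * exp (- (c / 2 * r\<^sup>2))"
proof
  \<comment> \<open>With \<open>s = c / 2 * r\<^sup>2\<close>, the bound
    \<open>s ^ n / fact n \<le> exp s\<close> controls \<open>r ^ n * r ^ n\<close>, and
    \<open>r ^ n \<le> 1 + r ^ n * r ^ n\<close>.\<close>
  let ?K = "1 + fact n * (2 / c) ^ n"
  show "?K > 0" using assms by (simp add: add_pos_pos)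
  fix r :: real assume r: "0 \<le> r"
  let ?s = "c / 2 * r\<^sup>2"
  have s: "?s \<ge> 0" using assms by simp
  have ex: "u ^ n / fact n \<le> exp u" if "u \<ge> 0" for u :: real
  proof -
    have "sum (\<lambda>k. u ^ k /\<^sub>R fact k) {n} \<le> exp u"
      unfolding exp_def by (rule sum_le_suminf[OF summable_exp_generic[of u]]) (use that in simp_all)
    then show ?thesis by (simp add: divide_inverse mult.commute)
  qed
  from ex[OF s]
  have "?s ^ n \<le> exp ?s * fact n" by (simp only: divide_le_eq fact_gt_zero if_True)
  then have "(c / 2) ^ n * (r\<^sup>2) ^ n \<le> exp ?s * fact n" by (simp only: power_mult_distrib)
  then have "(2 / c) ^ n * ((c / 2) ^ n * (r\<^sup>2) ^ n) \<le> (2 / c) ^ n * (exp ?s * fact n)"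
    using assms by (intro mult_left_mono) auto
  also have "(2 / c) ^ n * ((c / 2) ^ n * (r\<^sup>2) ^ n) = r ^ n * r ^ n"
    using assms by (simp add: power_divide power_mult[symmetric] power_add[symmetric] mult_2)
  finally have 1: "r ^ n * r ^ n \<le> fact n * (2 / c) ^ n * exp ?s" by (simp add: mult_ac)
  have "r ^ n \<le> 1 + r ^ n * r ^ n"
  proof (cases "r ^ n \<le> 1")
    case False
    then have "r ^ n * 1 \<le> r ^ n * r ^ n" using r by (intro mult_left_mono) auto
    then show ?thesis by simp
  qed (simp add: add_increasing2)
  also have "\<dots> \<le> exp ?s + fact n * (2 / c) ^ n * exp ?s" using 1 s by (intro add_mono) auto
  finally have "r ^ n \<le> ?K * exp ?s" by (simp add: algebra_simps)
  then have "r ^ n * exp (- (c * r\<^sup>2)) \<le> ?K * exp ?s * exp (- (c * r\<^sup>2))" by (intro mult_right_mono) auto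
  also have "\<dots> = ?K * exp (- ?s)" by (simp add: mult.assoc exp_add[symmetric])
  finally show "r ^ n * exp (- (c * r\<^sup>2)) \<le> ?K * exp (- (c / 2 * r\<^sup>2))" by simp
qed

definition gauss_monom :: "real \<Rightarrow> nat \<Rightarrow> nat \<Rightarrow> complex \<Rightarrow> complex" where
  "gauss_monom c a b z = z ^ a * cnj z ^ b * complex_of_real (exp (- (c * (cmod z)\<^sup>2)))"

lemma gauss_monom_bound:
  assumes "c > 0"
  obtains K where "K > 0" "\<And>z. cmod (gauss_monom c a b z) \<le> K * exp (- (c / 2 * (cmod z)\<^sup>2))"
proof -
  obtain K where K: "K > 0" "\<And>r. 0 \<le> r \<Longrightarrow> r ^ (a + b) * exp (- (c * r\<^sup>2)) \<le> K * exp (- (c / 2 * r\<^sup>2))"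
    using power_mult_gaussian_le[OF assms] by metis
  then show ?thesis using that[of K] by (simp add: gauss_monom_def norm_mult norm_power power_add)
qed

lemma gauss_monom_continuous[continuous_intros]:
  "continuous_on A f \<Longrightarrow> continuous_on A (\<lambda>x. gauss_monom c a b (f x))"
  unfolding gauss_monom_def by (intro continuous_intros)

lemma integrable_gauss_monom:
  assumes "c > 0"
  shows "integrable lborel (gauss_monom c a b)"
proof -
  obtain K where K: "K > 0" "\<And>z. cmod (gauss_monom c a b z) \<le> K * exp (- (c / 2 * (cmod z)\<^sup>2))"
    using gauss_monom_bound[OF assms] by metis
  have "integrable lborel (\<lambda>z::complex. K * exp (- (c / 2 * (cmod z)\<^sup>2)))"
    using gaussian_complex(1)[of "c/2"] assms by (intro integrable_mult_right) auto
  then show ?thesis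
    by (rule Bochner_Integration.integrable_bound)
       (use K in \<open>auto intro!: borel_measurable_continuous_onI continuous_intros\<close>)
qed

lemma integral_derivative_eq_0:
  fixes f :: "real \<Rightarrow> complex"
  assumes "\<And>x. (f has_vector_derivative f' x) (at x)" "\<And>x. isCont f' x" "integrable lborel f'"
    "(f \<longlongrightarrow> 0) at_top" "(f \<longlongrightarrow> 0) at_bot"
  shows "(LBINT x. f' x) = 0"
proof -
  have "interval_lebesgue_integral lborel (-\<infinity>) \<infinity> f' = 0 - 0"
    by (rule interval_integral_FTC_integrable[where F = f])
       (use assms in \<open>auto simp: ereal_tendsto_simps1 set_integrable_def\<close>)
  then show ?thesis by (simp add: interval_lebesgue_integral_def set_lebesgue_integral_def)
qed

lemma gauss_monom_lines:
  assumes "c > 0"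
  shows "integrable lborel (\<lambda>x. gauss_monom c a b (Complex x y))"
    "integrable lborel (\<lambda>x. gauss_monom c a b (Complex y x))"
    "((\<lambda>x. gauss_monom c a b (Complex x y)) \<longlongrightarrow> 0) at_top"
    "((\<lambda>x. gauss_monom c a b (Complex x y)) \<longlongrightarrow> 0) at_bot"
    "((\<lambda>x. gauss_monom c a b (Complex y x)) \<longlongrightarrow> 0) at_top"
    "((\<lambda>x. gauss_monom c a b (Complex y x)) \<longlongrightarrow> 0) at_bot"
proof -
  obtain K where K: "K > 0" "\<And>z. cmod (gauss_monom c a b z) \<le> K * exp (- (c / 2 * (cmod z)\<^sup>2))"
    using gauss_monom_bound[OF assms] by metis
  have b: "cmod (gauss_monom c a b (Complex x y)) \<le> K * exp (- (c / 2 * x\<^sup>2))" for x y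
  proof -
    have "c / 2 * x\<^sup>2 \<le> c / 2 * (cmod (Complex x y))\<^sup>2"
      using assms by (intro mult_left_mono) (auto simp: cmod_power2)
    then have "K * exp (- (c / 2 * (cmod (Complex x y))\<^sup>2)) \<le> K * exp (- (c / 2 * x\<^sup>2))"
      using K(1) by (intro mult_left_mono) (simp_all only: exp_le_cancel_iff neg_le_iff_le less_imp_le)
    then show ?thesis using K(2) order_trans by blast
  qed
  have b': "cmod (gauss_monom c a b (Complex y x)) \<le> K * exp (- (c / 2 * x\<^sup>2))" for x y
  proof -
    have "c / 2 * x\<^sup>2 \<le> c / 2 * (cmod (Complex y x))\<^sup>2"
      using assms by (intro mult_left_mono) (auto simp: cmod_power2)
    then have "K * exp (- (c / 2 * (cmod (Complex y x))\<^sup>2)) \<le> K * exp (- (c / 2 * x\<^sup>2))"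
      using K(1) by (intro mult_left_mono) (simp_all only: exp_le_cancel_iff neg_le_iff_le less_imp_le)
    then show ?thesis using K(2) order_trans by blast
  qed
  have i: "integrable lborel (\<lambda>x::real. K * exp (- (c / 2 * x\<^sup>2)))"
    using gaussian_integral_real(1)[of "c/2"] assms by (intro integrable_mult_right) auto
  have c: "continuous_on UNIV (\<lambda>x. gauss_monom c a b (Complex x y))" "continuous_on UNIV (\<lambda>x. gauss_monom c a b (Complex y x))"
    unfolding Complex_eq by (intro continuous_intros)+
  show "integrable lborel (\<lambda>x. gauss_monom c a b (Complex x y))" "integrable lborel (\<lambda>x. gauss_monom c a b (Complex y x))"
    by (rule Bochner_Integration.integrable_bound[OF i];
        use b b' K(1) c in \<open>simp add: borel_measurable_continuous_onI abs_mult\<close>)+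
  have t: "((\<lambda>x::real. K * exp (- (c / 2 * x\<^sup>2))) \<longlongrightarrow> 0) at_top" "((\<lambda>x::real. K * exp (- (c / 2 * x\<^sup>2))) \<longlongrightarrow> 0) at_bot"
    using assms by real_asymp+
  show "((\<lambda>x. gauss_monom c a b (Complex x y)) \<longlongrightarrow> 0) at_top"
    "((\<lambda>x. gauss_monom c a b (Complex x y)) \<longlongrightarrow> 0) at_bot"
    "((\<lambda>x. gauss_monom c a b (Complex y x)) \<longlongrightarrow> 0) at_top"
    "((\<lambda>x. gauss_monom c a b (Complex y x)) \<longlongrightarrow> 0) at_bot"
    by (rule Lim_null_comparison[OF always_eventually t(1)] Lim_null_comparison[OF always_eventually t(2)]; intro allI b b')+
qed

lemma gauss_monom_deriv:
  "((\<lambda>x. gauss_monom c a b (Complex x y)) has_vector_derivative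
     (of_nat a * gauss_monom c (a - 1) b (Complex x y) + of_nat b * gauss_monom c a (b - 1) (Complex x y)
      - of_real c * (gauss_monom c (Suc a) b (Complex x y) + gauss_monom c a (Suc b) (Complex x y)))) (at x)"
  "((\<lambda>y. gauss_monom c a b (Complex x y)) has_vector_derivative
     \<i> * (of_nat a * gauss_monom c (a - 1) b (Complex x y) - of_nat b * gauss_monom c a (b - 1) (Complex x y)
      + of_real c * (gauss_monom c (Suc a) b (Complex x y) - gauss_monom c a (Suc b) (Complex x y)))) (at y)"
proof -
  define f where "f = (\<lambda>(x::complex) (y::complex). (x + \<i> * y) ^ a * (x - \<i> * y) ^ b * exp (- (of_real c * (x\<^sup>2 + y\<^sup>2))))"
  have gf: "gauss_monom c a' b' (Complex x y) =
     (of_real x + \<i> * of_real y) ^ a' * (of_real x - \<i> * of_real y) ^ b' * exp (- (of_real c * ((of_real x)\<^sup>2 + (of_real y)\<^sup>2)))" for a' b' x y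
  proof -
    have "cnj (Complex x y) = of_real x - \<i> * of_real y" "Complex x y = of_real x + \<i> * of_real y"
      by (auto simp: complex_eq_iff)
    moreover have "complex_of_real (exp (- (c * (cmod (Complex x y))\<^sup>2))) = exp (- (of_real c * ((of_real x)\<^sup>2 + (of_real y)\<^sup>2)))"
      by (simp add: cmod_power2 exp_of_real[symmetric])
    ultimately show ?thesis by (simp add: gauss_monom_def)
  qed
  have fx: "((\<lambda>w. f w y) has_field_derivative
      ((of_nat a * (x + \<i> * y) ^ (a - 1) * (x - \<i> * y) ^ b + of_nat b * (x + \<i> * y) ^ a * (x - \<i> * y) ^ (b - 1)
      - of_real c * (2 * x) * ((x + \<i> * y) ^ a * (x - \<i> * y) ^ b)) * exp (- (of_real c * (x\<^sup>2 + y\<^sup>2))))) (at x)" for x y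
  proof -
    have A: "((\<lambda>w. (w + \<i> * y) ^ a) has_field_derivative of_nat a * (x + \<i> * y) ^ (a - 1)) (at x)"
      "((\<lambda>w. (w - \<i> * y) ^ b) has_field_derivative of_nat b * (x - \<i> * y) ^ (b - 1)) (at x)"
      "((\<lambda>w. exp (- (of_real c * (w\<^sup>2 + y\<^sup>2)))) has_field_derivative (- of_real c * (2 * x)) * exp (- (of_real c * (x\<^sup>2 + y\<^sup>2)))) (at x)"
      by (auto intro!: derivative_eq_intros)
    show ?thesis unfolding f_def
      by (rule DERIV_cong[OF DERIV_mult[OF DERIV_mult[OF A(1,2)] A(3)]]) (simp add: algebra_simps)
  qed
  have fy: "((\<lambda>w. f x w) has_field_derivative
      ((\<i> * of_nat a * (x + \<i> * y) ^ (a - 1) * (x - \<i> * y) ^ b - \<i> * of_nat b * (x + \<i> * y) ^ a * (x - \<i> * y) ^ (b - 1)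
      - of_real c * (2 * y) * ((x + \<i> * y) ^ a * (x - \<i> * y) ^ b)) * exp (- (of_real c * (x\<^sup>2 + y\<^sup>2))))) (at y)" for x y
  proof -
    have A: "((\<lambda>w. (x + \<i> * w) ^ a) has_field_derivative \<i> * of_nat a * (x + \<i> * y) ^ (a - 1)) (at y)"
      "((\<lambda>w. (x - \<i> * w) ^ b) has_field_derivative - \<i> * of_nat b * (x - \<i> * y) ^ (b - 1)) (at y)"
      "((\<lambda>w. exp (- (of_real c * (x\<^sup>2 + w\<^sup>2)))) has_field_derivative (- of_real c * (2 * y)) * exp (- (of_real c * (x\<^sup>2 + y\<^sup>2)))) (at y)"
      by (auto intro!: derivative_eq_intros)
    show ?thesis unfolding f_def
      by (rule DERIV_cong[OF DERIV_mult[OF DERIV_mult[OF A(1,2)] A(3)]]) (simp add: algebra_simps)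
  qed
  have x2: "2 * x = (x + \<i> * y) + (x - \<i> * y)" and y2: "2 * y = - \<i> * ((x + \<i> * y) - (x - \<i> * y))" for x y :: complex
    by (auto simp: algebra_simps)
  show "((\<lambda>x. gauss_monom c a b (Complex x y)) has_vector_derivative
     (of_nat a * gauss_monom c (a - 1) b (Complex x y) + of_nat b * gauss_monom c a (b - 1) (Complex x y)
      - of_real c * (gauss_monom c (Suc a) b (Complex x y) + gauss_monom c a (Suc b) (Complex x y)))) (at x)"
    using has_vector_derivative_real_field[OF fx[of "of_real y" "of_real x"]]
    unfolding gf f_def x2[of "of_real x" "of_real y"] by (rule has_vector_derivative_eq_rhs) (simp add: algebra_simps)
  show "((\<lambda>y. gauss_monom c a b (Complex x y)) has_vector_derivative
     \<i> * (of_nat a * gauss_monom c (a - 1) b (Complex x y) - of_nat b * gauss_monom c a (b - 1) (Complex x y)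
      + of_real c * (gauss_monom c (Suc a) b (Complex x y) - gauss_monom c a (Suc b) (Complex x y)))) (at y)"
    using has_vector_derivative_real_field[OF fy[of "of_real x" "of_real y"]]
    unfolding gf f_def y2[of "of_real y" "of_real x"] by (rule has_vector_derivative_eq_rhs) (simp add: algebra_simps)
qed

definition gauss_moment :: "real \<Rightarrow> nat \<Rightarrow> nat \<Rightarrow> complex" where
  "gauss_moment c a b = (\<integral>z. gauss_monom c a b z \<partial>lborel)"

text \<open>The \<open>x\<close>- and the \<open>y\<close>-derivative of a Gaussian monomial both
  integrate to 0. Their combinations are the two Wirtinger derivatives, and each of these gives one
  recursion. This replaces polar coordinates.\<close>

lemma gauss_moment_rec:
  assumes "c > 0"
  shows "of_real c * gauss_moment c a (Suc b) = of_nat a * gauss_moment c (a - 1) b"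
    "of_real c * gauss_moment c (Suc a) b = of_nat b * gauss_moment c a (b - 1)"
proof -
  note i = integrable_gauss_monom[OF assms] and l = gauss_monom_lines[OF assms]
  define Fx where "Fx = (\<lambda>z. of_nat a * gauss_monom c (a - 1) b z + of_nat b * gauss_monom c a (b - 1) z
      - of_real c * (gauss_monom c (Suc a) b z + gauss_monom c a (Suc b) z))"
  define Fy where "Fy = (\<lambda>z. \<i> * (of_nat a * gauss_monom c (a - 1) b z - of_nat b * gauss_monom c a (b - 1) z
      + of_real c * (gauss_monom c (Suc a) b z - gauss_monom c a (Suc b) z)))"
  have "(\<integral>z. Fx z \<partial>lborel) = (LBINT y. LBINT x. Fx (Complex x y))"
    by (rule integral_lborel_complex) (unfold Fx_def, intro Bochner_Integration.integrable_diff Bochner_Integration.integrable_add integrable_mult_right i)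
  also have "(\<lambda>y. LBINT x. Fx (Complex x y)) = (\<lambda>y. 0)"
  proof
    fix y
    have "continuous_on UNIV (\<lambda>x. Fx (Complex x y))"
      unfolding Fx_def Complex_eq by (intro continuous_intros)
    then show "(LBINT x. Fx (Complex x y)) = 0"
      using gauss_monom_deriv(1)[of c a b y] l unfolding Fx_def
      by (intro integral_derivative_eq_0[where f = "\<lambda>x. gauss_monom c a b (Complex x y)"])
         (auto simp: continuous_on_eq_continuous_at)
  qed
  finally have 1: "of_nat a * gauss_moment c (a - 1) b + of_nat b * gauss_moment c a (b - 1)
      - of_real c * (gauss_moment c (Suc a) b + gauss_moment c a (Suc b)) = 0"
    unfolding Fx_def gauss_moment_def using i by simp
  have "(\<integral>z. Fy z \<partial>lborel) = (LBINT x. LBINT y. Fy (Complex x y))"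
    by (rule integral_lborel_complex) (unfold Fy_def, intro Bochner_Integration.integrable_diff Bochner_Integration.integrable_add integrable_mult_right i)
  also have "(\<lambda>x. LBINT y. Fy (Complex x y)) = (\<lambda>x. 0)"
  proof
    fix x
    have "continuous_on UNIV (\<lambda>y. Fy (Complex x y))"
      unfolding Fy_def Complex_eq by (intro continuous_intros)
    then show "(LBINT y. Fy (Complex x y)) = 0"
      using gauss_monom_deriv(2)[of c a b x] l unfolding Fy_def
      by (intro integral_derivative_eq_0[where f = "\<lambda>y. gauss_monom c a b (Complex x y)"])
         (auto simp: continuous_on_eq_continuous_at)
  qed
  finally have 2: "of_nat a * gauss_moment c (a - 1) b - of_nat b * gauss_moment c a (b - 1)
      + of_real c * (gauss_moment c (Suc a) b - gauss_moment c a (Suc b)) = 0"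
    unfolding Fy_def gauss_moment_def using i by simp
  have alg: "C * V = A \<and> C * U = B" if "A + B - C * (U + V) = 0" "A - B + C * (U - V) = 0" for A B C U V :: complex
  proof -
    have "2 * (C * V) = 2 * A - ((A + B - C * (U + V)) + (A - B + C * (U - V)))" by (simp add: algebra_simps)
    moreover have "2 * (C * U) = 2 * B - ((A + B - C * (U + V)) - (A - B + C * (U - V)))" by (simp add: algebra_simps)
    ultimately show ?thesis unfolding that by simp
  qed
  show "of_real c * gauss_moment c a (Suc b) = of_nat a * gauss_moment c (a - 1) b"
    "of_real c * gauss_moment c (Suc a) b = of_nat b * gauss_moment c a (b - 1)"
    using alg[OF 1 2] by blast+
qed

text \<open>The recursions lower both indices at once; if the indices differ, one of them reaches 0
  first and the moment vanishes.\<close>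

lemma gauss_moment_eq:
  assumes "c > 0"
  shows "gauss_moment c a b = (if a = b then of_real (pi * fact a / c ^ Suc a) else 0)"
proof (induction a arbitrary: b)
  case 0
  have "gauss_moment c 0 0 = complex_of_real (pi / c)"
    using gaussian_complex[OF assms] unfolding gauss_moment_def gauss_monom_def by simp
  moreover have "gauss_moment c 0 (Suc b) = 0" for b
    using gauss_moment_rec(1)[OF assms, of 0 b] assms by simp
  ultimately show ?case by (cases b) auto
next
  case (Suc a)
  show ?case
  proof (cases b)
    case 0
    then show ?thesis using gauss_moment_rec(2)[OF assms, of a 0] assms by simp
  next
    case (Suc b')
    have "gauss_moment c (Suc a) (Suc b') = of_nat (Suc b') / of_real c * gauss_moment c a b'"
      using gauss_moment_rec(2)[OF assms, of a "Suc b'"] assms by (simp add: field_simps)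
    also have "\<dots> = (if a = b' then of_real (real (Suc a) / c * (pi * fact a / c ^ Suc a)) else 0)"
      unfolding Suc.IH by simp
    also have "real (Suc a) / c * (pi * fact a / c ^ Suc a) = pi * fact (Suc a) / c ^ Suc (Suc a)"
      by (simp add: divide_simps mult_ac)
    finally show ?thesis unfolding Suc by simp
  qed
qed

lemma area_measure_integral:
  fixes f :: "complex \<Rightarrow> complex"
  assumes "integrable lborel f"
  shows "integrable area_measure f" "(\<integral>z. f z \<partial>area_measure) = (\<integral>z. f z \<partial>lborel) / of_real pi"
proof -
  have m: "f \<in> borel_measurable lborel" using assms by (rule borel_measurable_integrable)
  show "integrable area_measure f"
    unfolding area_measure_def using m assms by (subst integrable_density) auto
  show "(\<integral>z. f z \<partial>area_measure) = (\<integral>z. f z \<partial>lborel) / of_real pi"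
    unfolding area_measure_def using m by (subst integral_density) (auto simp: scaleR_conv_of_real divide_simps)
qed

lemma sigma_finite_area_measure: "sigma_finite_measure area_measure"
  unfolding area_measure_def by (subst sigma_finite_measure.sigma_finite_iff_density_finite[OF sigma_finite_lborel]) auto

section \<open>Correlation functions as Pfaffians\<close>

text \<open>The polynomials \<open>skew_poly c a\<close> are skew-orthogonal for the pairing
  \<open>\<integral>z. f z * g (cnj z) * gauss_weight c z\<close>, which is \<open>skew_form\<close> below.\<close>

definition skew_coeff :: "real \<Rightarrow> nat \<Rightarrow> nat \<Rightarrow> real" where
  "skew_coeff c a l = (if odd a then (if l = a then 1 else 0)
     else if even l then (c / 2) ^ (l div 2) / fact (l div 2) else 0)"

definition skew_poly :: "real \<Rightarrow> nat \<Rightarrow> complex poly" where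
  "skew_poly c a = (\<Sum>l\<le>a. monom (complex_of_real (skew_coeff c a l)) l)"

lemma coeff_skew_poly: "coeff (skew_poly c a) n = (if n \<le> a then complex_of_real (skew_coeff c a n) else 0)"
proof -
  have "coeff (skew_poly c a) n = (\<Sum>l\<le>a. if n = l then complex_of_real (skew_coeff c a l) else 0)"
    unfolding skew_poly_def coeff_sum coeff_monom by (intro sum.cong) auto
  then show ?thesis by simp
qed

lemma degree_skew_poly: "degree (skew_poly c a) \<le> a"
  by (rule degree_le) (simp add: coeff_skew_poly)

lemma poly_skew_poly: "poly (skew_poly c a) z = (\<Sum>l\<le>a. complex_of_real (skew_coeff c a l) * z ^ l)"
  unfolding skew_poly_def by (simp add: poly_sum poly_monom)

lemma sum_even_atMost:
  fixes f :: "nat \<Rightarrow> 'a :: comm_monoid_add"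
  assumes "\<And>l. odd l \<Longrightarrow> f l = 0"
  shows "(\<Sum>l\<le>2*i. f l) = (\<Sum>p\<le>i. f (2*p))"
  using assms by (induction i) simp_all

lemma poly_skew_poly_even: "poly (skew_poly c (2*i)) z = (\<Sum>p\<le>i. complex_of_real ((c / 2) ^ p / fact p) * z ^ (2*p))"
  unfolding poly_skew_poly by (subst sum_even_atMost) (auto simp: skew_coeff_def)

lemma poly_skew_poly_odd: "poly (skew_poly c (2*i+1)) z = z ^ (2*i+1)"
proof -
  have "poly (skew_poly c (2*i+1)) z = (\<Sum>l\<le>2*i+1. if l = 2*i+1 then z ^ l else 0)"
    unfolding poly_skew_poly by (intro sum.cong) (auto simp: skew_coeff_def)
  then show ?thesis by simp
qed

text \<open>The linear factor per particle that the Vandermonde product does not use, together with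
  the Gaussian. It changes sign under conjugation, and this makes the pairing skew.\<close>

definition gauss_weight :: "real \<Rightarrow> complex \<Rightarrow> complex" where
  "gauss_weight c z = (cnj z - z) * complex_of_real (exp (- (c * (cmod z)\<^sup>2)))"

definition skew_moment :: "real \<Rightarrow> nat \<Rightarrow> nat \<Rightarrow> real" where
  "skew_moment c l m = (if l = m + 1 then fact l / c ^ Suc l else 0) - (if m = l + 1 then fact m / c ^ Suc m else 0)"

lemma skew_moment_integral:
  assumes "c > 0"
  shows "integrable area_measure (\<lambda>z. z ^ l * cnj z ^ m * gauss_weight c z)"
    "(\<integral>z. z ^ l * cnj z ^ m * gauss_weight c z \<partial>area_measure) = complex_of_real (skew_moment c l m)"
proof -
  have e: "z ^ l * cnj z ^ m * gauss_weight c z = gauss_monom c l (Suc m) z - gauss_monom c (Suc l) m z" for z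
    unfolding gauss_weight_def gauss_monom_def by (simp add: algebra_simps)
  note i = integrable_gauss_monom[OF assms]
  have I: "integrable lborel (\<lambda>z. z ^ l * cnj z ^ m * gauss_weight c z)"
    unfolding e by (intro Bochner_Integration.integrable_diff i)
  show "integrable area_measure (\<lambda>z. z ^ l * cnj z ^ m * gauss_weight c z)"
    by (rule area_measure_integral(1)[OF I])
  have "(\<integral>z. z ^ l * cnj z ^ m * gauss_weight c z \<partial>lborel) = gauss_moment c l (Suc m) - gauss_moment c (Suc l) m"
    unfolding e gauss_moment_def by (rule Bochner_Integration.integral_diff[OF i i])
  then show "(\<integral>z. z ^ l * cnj z ^ m * gauss_weight c z \<partial>area_measure) = complex_of_real (skew_moment c l m)"
    unfolding area_measure_integral(2)[OF I] gauss_moment_eq[OF assms] skew_moment_def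
    by (auto simp: diff_divide_distrib)
qed

definition skew_form :: "real \<Rightarrow> nat \<Rightarrow> nat \<Rightarrow> real" where
  "skew_form c a b = (\<Sum>l\<le>a. \<Sum>m\<le>b. skew_coeff c a l * skew_coeff c b m * skew_moment c l m)"

lemma skew_form_integral:
  assumes "c > 0"
  shows "integrable area_measure (\<lambda>z. poly (skew_poly c a) z * poly (skew_poly c b) (cnj z) * gauss_weight c z)"
    "(\<integral>z. poly (skew_poly c a) z * poly (skew_poly c b) (cnj z) * gauss_weight c z \<partial>area_measure) = complex_of_real (skew_form c a b)"
proof -
  have e: "poly (skew_poly c a) z * poly (skew_poly c b) (cnj z) * gauss_weight c z =
    (\<Sum>l\<le>a. \<Sum>m\<le>b. complex_of_real (skew_coeff c a l * skew_coeff c b m) * (z ^ l * cnj z ^ m * gauss_weight c z))" for z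
    unfolding poly_skew_poly unfolding sum_product unfolding sum_distrib_right
    by (intro sum.cong refl) (simp add: mult_ac)
  note i = skew_moment_integral[OF assms]
  show "integrable area_measure (\<lambda>z. poly (skew_poly c a) z * poly (skew_poly c b) (cnj z) * gauss_weight c z)"
    unfolding e by (intro Bochner_Integration.integrable_sum integrable_mult_right i)
  show "(\<integral>z. poly (skew_poly c a) z * poly (skew_poly c b) (cnj z) * gauss_weight c z \<partial>area_measure) = complex_of_real (skew_form c a b)"
    unfolding e skew_form_def
    by (subst Bochner_Integration.integral_sum, intro Bochner_Integration.integrable_sum integrable_mult_right i,
        subst Bochner_Integration.integral_sum, intro integrable_mult_right i)
       (simp add: i(2))
qed

definition skew_norm :: "real \<Rightarrow> nat \<Rightarrow> real" where
  "skew_norm c i = - ((c / 2) ^ i / fact i * (fact (2*i+1) / c ^ (2*i+2)))"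

lemma skew_form_antisym: "skew_form c b a = - skew_form c a b"
proof -
  have "skew_form c b a = (\<Sum>l\<le>a. \<Sum>m\<le>b. skew_coeff c b m * skew_coeff c a l * skew_moment c m l)"
    unfolding skew_form_def by (rule sum.swap)
  also have "\<dots> = (\<Sum>l\<le>a. \<Sum>m\<le>b. - (skew_coeff c a l * skew_coeff c b m * skew_moment c l m))"
    by (intro sum.cong refl) (simp add: skew_moment_def algebra_simps)
  finally show ?thesis unfolding skew_form_def by (simp add: sum_negf)
qed

lemma skew_form_even_even: "skew_form c (2*i) (2*j) = 0"
  unfolding skew_form_def by (intro sum.neutral ballI) (auto simp: skew_coeff_def skew_moment_def)

lemma skew_form_odd_odd: "skew_form c (2*i+1) (2*j+1) = 0"
  unfolding skew_form_def
proof (intro sum.neutral ballI)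
  fix l m
  have "skew_coeff c (2*i+1) l = 0 \<or> skew_coeff c (2*j+1) m = 0 \<or> (l = 2*i+1 \<and> m = 2*j+1)"
    by (auto simp: skew_coeff_def)
  moreover have "2*i+1 \<noteq> (2*j+1)+1" "2*j+1 \<noteq> (2*i+1)+1" by presburger+
  then have "skew_moment c (2*i+1) (2*j+1) = 0" unfolding skew_moment_def by (simp only: if_False diff_0_right)
  ultimately show "skew_coeff c (2*i+1) l * skew_coeff c (2*j+1) m * skew_moment c l m = 0"
    by (metis mult_zero_left mult_zero_right)
qed

text \<open>Against \<open>z ^ (2 * j + 1)\<close> only the monomials of degree \<open>2 * j\<close>
  and \<open>2 * j + 2\<close> of an even polynomial count, and the coefficients are chosen so that
  their contributions cancel. If \<open>i = j\<close>, the upper monomial is missing and the lower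
  one remains.\<close>

lemma skew_form_even_odd:
  assumes "c > 0"
  shows "skew_form c (2*i) (2*j+1) = (if i = j then skew_norm c i else 0)"
proof -
  let ?\<kappa> = "\<lambda>p. (c / 2) ^ p / fact p" and ?h = "\<lambda>n. fact n / c ^ Suc n"
  have "skew_form c (2*i) (2*j+1) = (\<Sum>l\<le>2*i. skew_coeff c (2*i) l * skew_moment c l (2*j+1))"
    unfolding skew_form_def
  proof (intro sum.cong refl)
    fix l
    have "(\<Sum>m\<le>2*j+1. skew_coeff c (2*i) l * skew_coeff c (2*j+1) m * skew_moment c l m) =
      (\<Sum>m\<le>2*j+1. if m = 2*j+1 then skew_coeff c (2*i) l * skew_moment c l m else 0)"
      by (intro sum.cong) (auto simp: skew_coeff_def)
    then show "(\<Sum>m\<le>2*j+1. skew_coeff c (2*i) l * skew_coeff c (2*j+1) m * skew_moment c l m) = skew_coeff c (2*i) l * skew_moment c l (2*j+1)"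
      by simp
  qed
  also have "\<dots> = (\<Sum>p\<le>i. ?\<kappa> p * skew_moment c (2*p) (2*j+1))"
    by (subst sum_even_atMost) (auto simp: skew_coeff_def)
  also have "\<dots> = (\<Sum>p\<le>i. (if p = j + 1 then ?\<kappa> p * ?h (2*p) else 0) - (if p = j then ?\<kappa> p * ?h (2*p+1) else 0))"
    by (intro sum.cong refl) (auto simp: skew_moment_def)
  also have "\<dots> = (if j + 1 \<le> i then ?\<kappa> (j+1) * ?h (2*(j+1)) else 0) - (if j \<le> i then ?\<kappa> j * ?h (2*j+1) else 0)"
    by (simp add: sum_subtractf)
  \<comment> \<open>This cancellation, read as a recursion in \<open>j\<close>, is the origin of the
    coefficients \<open>(c / 2) ^ p / fact p\<close>.\<close>
  also have "?\<kappa> (j+1) * ?h (2*(j+1)) = ?\<kappa> j * ?h (2*j+1)"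
  proof -
    have f: "fact (2*(j+1)) = 2 * (real j + 1) * (fact (2*j+1) :: real)" "fact (j+1) = (real j + 1) * (fact j :: real)"
      by (simp_all add: algebra_simps)
    have p: "c ^ Suc (2*(j+1)) = c * c ^ Suc (2*j+1)" "(c / 2) ^ (j+1) = (c / 2) * (c / 2) ^ j" by simp_all
    have alg: "(c / 2) * A / (m * F) * (2 * m * H / (c * P)) = A / F * (H / P)" if "m > 0" "F > 0" "P > 0" for A m F H P :: real
      using that assms by (simp add: field_simps)
    show ?thesis unfolding f p by (rule alg) (use assms in auto)
  qed
  finally show ?thesis by (auto simp: skew_norm_def)
qed

lemma skew_form_eq:
  assumes "c > 0"
  shows "complex_of_real (skew_form c a b) =
    (if even a \<and> b = a + 1 then complex_of_real (skew_norm c (a div 2)) else 0) -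
    (if even b \<and> a = b + 1 then complex_of_real (skew_norm c (b div 2)) else 0)"
proof -
  consider i j where "a = 2*i" "b = 2*j" | i j where "a = 2*i+1" "b = 2*j+1"
    | i j where "a = 2*i" "b = 2*j+1" | i j where "a = 2*j+1" "b = 2*i"
    by (metis evenE oddE)
  then show ?thesis
  proof cases
    case 1
    have "2*m \<noteq> Suc (2*n)" for m n :: nat by presburger
    with 1 show ?thesis using skew_form_even_even[of c i j] by auto
  next
    case 2 then show ?thesis using skew_form_odd_odd[of c i j] by auto
  next
    case 3 then show ?thesis using skew_form_even_odd[OF assms, of i j] by auto
  next
    case 4 then show ?thesis using skew_form_even_odd[OF assms, of i j] skew_form_antisym[of c a b] by auto
  qed
qed

lemma skew_norm_nonzero: "c > 0 \<Longrightarrow> skew_norm c i \<noteq> 0"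
  by (simp add: skew_norm_def)

lemma lead_skew_poly_nonzero: "c > 0 \<Longrightarrow> coeff (skew_poly c a) a \<noteq> 0"
  by (auto simp: coeff_skew_poly skew_coeff_def)

text \<open>Expanded in the polynomials \<open>skew_poly c a\<close>, the determinant has summands
  that are products over particles, so Fubini turns each integral into a product of values of
  \<open>skew_form\<close>; the sum over permutations is then carried out by
  \<open>pf_integrate_out\<close>. The case \<open>k = 0\<close> is the partition function.\<close>

lemma ginibre_weight_integral:
  fixes N k :: nat and \<zeta> :: "nat \<Rightarrow> complex"
  assumes N: "N > 0" and k: "k \<le> N"
  defines "c \<equiv> real N" and "y \<equiv> with_conj \<zeta>"
  defines "K \<equiv> (-1) ^ N / (\<Prod>a<2*N. coeff (skew_poly c a) a)"
  shows "complex_of_real (\<integral>\<eta>. exp_neg (hamiltonian (\<lambda>\<zeta>. (cmod \<zeta>)\<^sup>2) N (\<lambda>j. if j < k then \<zeta> j else \<eta> j))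
        \<partial>(\<Pi>\<^sub>M j\<in>{k..<N}. area_measure)) =
     K * (\<Prod>j<k. gauss_weight c (\<zeta> j)) * (2 ^ (N - k) * fact (N - k) * (\<Prod>i<N. complex_of_real (skew_norm c i)) *
       pf k (\<lambda>a b. \<Sum>i<N. (1 / complex_of_real (skew_norm c i)) *
         (poly (skew_poly c (2*i)) (y a) * poly (skew_poly c (2*i+1)) (y b)
          - poly (skew_poly c (2*i+1)) (y a) * poly (skew_poly c (2*i)) (y b))))"
proof -
  have c: "c > 0" using N by (simp add: c_def)
  interpret product_sigma_finite "\<lambda>_::nat. area_measure"
    by (simp add: product_sigma_finite_def sigma_finite_area_measure)
  let ?S = "{s. s permutes {..<2*N}}"
  let ?q = "\<lambda>a. poly (skew_poly c a)"
  define G where "G = (\<lambda>s. \<Prod>j<2*k. ?q (s j) (y j))"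
  define \<phi> where "\<phi> = (\<lambda>(s :: nat \<Rightarrow> nat) j z. ?q (s (2*j)) z * ?q (s (2*j+1)) (cnj z) * gauss_weight c z)"
  have Cn: "(\<Prod>a<2*N. coeff (skew_poly c a) a) \<noteq> 0"
    unfolding prod_zero_iff[OF finite_lessThan] using lead_skew_poly_nonzero[OF c] by blast
  have E: "complex_of_real (exp_neg (hamiltonian (\<lambda>\<zeta>. (cmod \<zeta>)\<^sup>2) N (\<lambda>j. if j < k then \<zeta> j else \<eta> j))) =
     (\<Sum>s\<in>?S. K * (\<Prod>j<k. gauss_weight c (\<zeta> j)) * (of_int (sign s) * G s) * (\<Prod>j\<in>{k..<N}. \<phi> s j (\<eta> j)))" for \<eta>
  proof -
    define \<xi> where "\<xi> = (\<lambda>j. if j < k then \<zeta> j else \<eta> j)"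
    have split: "(\<Prod>j<N. f j) = (\<Prod>j<k. f j) * (\<Prod>j\<in>{k..<N}. f j)" for f :: "nat \<Rightarrow> complex"
      unfolding ivl_disj_un_one(2)[OF k, symmetric] by (rule prod.union_disjoint) auto
    have V: "(\<Prod>b<2*N. \<Prod>a<b. with_conj \<xi> b - with_conj \<xi> a) =
        (\<Sum>s\<in>?S. of_int (sign s) * (\<Prod>j<2*N. ?q (s j) (with_conj \<xi> j))) / (\<Prod>a<2*N. coeff (skew_poly c a) a)"
      using det_poly_vandermonde[of "2*N" "skew_poly c" "with_conj \<xi>", OF degree_skew_poly]
        nonzero_mult_div_cancel_left[OF Cn] by metis
    have Gs: "(\<Prod>j<2*N. ?q (s j) (with_conj \<xi> j)) = G s * (\<Prod>j\<in>{k..<N}. ?q (s (2*j)) (\<eta> j) * ?q (s (2*j+1)) (cnj (\<eta> j)))" for s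
    proof -
      have "(\<Prod>j<k. ?q (s (2*j)) (with_conj \<xi> (2*j)) * ?q (s (2*j+1)) (with_conj \<xi> (2*j+1))) = G s"
        unfolding G_def prod_pairs by (intro prod.cong) (auto simp: y_def \<xi>_def)
      moreover have "(\<Prod>j\<in>{k..<N}. ?q (s (2*j)) (with_conj \<xi> (2*j)) * ?q (s (2*j+1)) (with_conj \<xi> (2*j+1))) =
          (\<Prod>j\<in>{k..<N}. ?q (s (2*j)) (\<eta> j) * ?q (s (2*j+1)) (cnj (\<eta> j)))"
        by (intro prod.cong) (auto simp: \<xi>_def)
      ultimately show ?thesis unfolding prod_pairs split by simp
    qed
    have W: "(\<Prod>j<N. (cnj (\<xi> j) - \<xi> j) * complex_of_real (exp (- (real N * (cmod (\<xi> j))\<^sup>2)))) =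
        (\<Prod>j<k. gauss_weight c (\<zeta> j)) * (\<Prod>j\<in>{k..<N}. gauss_weight c (\<eta> j))"
      unfolding split gauss_weight_def c_def \<xi>_def by (intro arg_cong2[where f="(*)"] prod.cong) auto
    have "complex_of_real (exp_neg (hamiltonian (\<lambda>\<zeta>. (cmod \<zeta>)\<^sup>2) N \<xi>)) =
      (\<Sum>s\<in>?S. (-1) ^ N * ((\<Prod>j<k. gauss_weight c (\<zeta> j)) * (\<Prod>j\<in>{k..<N}. gauss_weight c (\<eta> j))) *
        ((of_int (sign s) * (G s * (\<Prod>j\<in>{k..<N}. ?q (s (2*j)) (\<eta> j) * ?q (s (2*j+1)) (cnj (\<eta> j))))) / (\<Prod>a<2*N. coeff (skew_poly c a) a)))"
      unfolding exp_neg_hamiltonian_vandermonde W V Gs by (simp only: sum_distrib_left sum_divide_distrib)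
    also have "\<dots> = (\<Sum>s\<in>?S. K * (\<Prod>j<k. gauss_weight c (\<zeta> j)) * (of_int (sign s) * G s) * (\<Prod>j\<in>{k..<N}. \<phi> s j (\<eta> j)))"
    proof (rule sum.cong[OF refl])
      fix s
      have p: "(\<Prod>j\<in>{k..<N}. \<phi> s j (\<eta> j)) = (\<Prod>j\<in>{k..<N}. ?q (s (2*j)) (\<eta> j) * ?q (s (2*j+1)) (cnj (\<eta> j))) * (\<Prod>j\<in>{k..<N}. gauss_weight c (\<eta> j))"
        unfolding \<phi>_def by (rule prod.distrib)
      have alg: "m * (u * v) * ((sg * (g * q)) / d) = (m / d) * u * (sg * g) * (q * v)" for m u v sg g q d :: complex
        by (simp add: mult_ac)
      show "(-1) ^ N * ((\<Prod>j<k. gauss_weight c (\<zeta> j)) * (\<Prod>j\<in>{k..<N}. gauss_weight c (\<eta> j))) *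
        ((of_int (sign s) * (G s * (\<Prod>j\<in>{k..<N}. ?q (s (2*j)) (\<eta> j) * ?q (s (2*j+1)) (cnj (\<eta> j))))) / (\<Prod>a<2*N. coeff (skew_poly c a) a))
        = K * (\<Prod>j<k. gauss_weight c (\<zeta> j)) * (of_int (sign s) * G s) * (\<Prod>j\<in>{k..<N}. \<phi> s j (\<eta> j))"
        unfolding p K_def by (rule alg)
    qed
    finally show ?thesis unfolding \<xi>_def .
  qed
  have int: "integrable (\<Pi>\<^sub>M j\<in>{k..<N}. area_measure) (\<lambda>\<eta>. \<Prod>j\<in>{k..<N}. \<phi> s j (\<eta> j))" for s
    unfolding \<phi>_def by (rule product_integrable_prod) (auto intro!: skew_form_integral(1)[OF c])
  have val: "(\<integral>\<eta>. (\<Prod>j\<in>{k..<N}. \<phi> s j (\<eta> j)) \<partial>(\<Pi>\<^sub>M j\<in>{k..<N}. area_measure)) = (\<Prod>j\<in>{k..<N}. complex_of_real (skew_form c (s (2*j)) (s (2*j+1))))" for s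
    unfolding \<phi>_def
    by (subst product_integral_prod) (auto intro!: skew_form_integral(1)[OF c] prod.cong skew_form_integral(2)[OF c] simp del: of_real_prod)
  have "complex_of_real (\<integral>\<eta>. exp_neg (hamiltonian (\<lambda>\<zeta>. (cmod \<zeta>)\<^sup>2) N (\<lambda>j. if j < k then \<zeta> j else \<eta> j))
        \<partial>(\<Pi>\<^sub>M j\<in>{k..<N}. area_measure)) =
     (\<integral>\<eta>. complex_of_real (exp_neg (hamiltonian (\<lambda>\<zeta>. (cmod \<zeta>)\<^sup>2) N (\<lambda>j. if j < k then \<zeta> j else \<eta> j)))
        \<partial>(\<Pi>\<^sub>M j\<in>{k..<N}. area_measure))"
    by (rule integral_complex_of_real[symmetric])
  also have "\<dots> = (\<Sum>s\<in>?S. K * (\<Prod>j<k. gauss_weight c (\<zeta> j)) * (of_int (sign s) * G s) * (\<Prod>j\<in>{k..<N}. complex_of_real (skew_form c (s (2*j)) (s (2*j+1)))))"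
    unfolding E by (subst Bochner_Integration.integral_sum) (simp_all only: integrable_mult_right[OF int] integral_mult_right_zero val)
  also have "\<dots> = K * (\<Prod>j<k. gauss_weight c (\<zeta> j)) * (\<Sum>s\<in>?S. of_int (sign s) * ((\<Prod>j<2*k. ?q (s j) (y j)) * (\<Prod>j\<in>{k..<N}. complex_of_real (skew_form c (s (2*j)) (s (2*j+1))))))"
    unfolding sum_distrib_left G_def by (simp only: mult.assoc)
  also have "(\<Sum>s\<in>?S. of_int (sign s) * ((\<Prod>j<2*k. ?q (s j) (y j)) * (\<Prod>j\<in>{k..<N}. complex_of_real (skew_form c (s (2*j)) (s (2*j+1)))))) =
      2 ^ (N - k) * fact (N - k) * (\<Prod>i<N. complex_of_real (skew_norm c i)) *
        pf k (\<lambda>a b. \<Sum>i<N. (1 / complex_of_real (skew_norm c i)) * (?q (2*i) (y a) * ?q (2*i+1) (y b) - ?q (2*i+1) (y a) * ?q (2*i) (y b)))"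
    by (rule pf_integrate_out[OF k, where Y = "\<lambda>a j. ?q a (y j)"])
       (use skew_norm_nonzero[OF c] skew_form_eq[OF c] in auto)
  finally show ?thesis .
qed

lemma pf_0: "pf 0 A = 1"
  by (simp add: pf_def)

text \<open>In the quotient by the case \<open>k = 0\<close> the leading coefficients, the product
  of the skew norms and the factorials cancel; of the powers of 2 there remains \<open>2 ^ k\<close>
  in the denominator.\<close>

lemma correlation_fun_pf:
  fixes N k :: nat and \<zeta> :: "nat \<Rightarrow> complex"
  assumes N: "N > 0" and k: "k \<le> N"
  defines "c \<equiv> real N" and "y \<equiv> with_conj \<zeta>"
  shows "complex_of_real (correlation_fun (\<lambda>\<zeta>. (cmod \<zeta>)\<^sup>2) N k \<zeta>) =
     (\<Prod>j<k. gauss_weight c (\<zeta> j)) / 2 ^ k *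
       pf k (\<lambda>a b. \<Sum>i<N. (1 / complex_of_real (skew_norm c i)) *
         (poly (skew_poly c (2*i)) (y a) * poly (skew_poly c (2*i+1)) (y b)
          - poly (skew_poly c (2*i+1)) (y a) * poly (skew_poly c (2*i)) (y b)))"
proof -
  have c: "c > 0" using N by (simp add: c_def)
  define K :: complex where "K = (-1) ^ N / (\<Prod>a<2*N. coeff (skew_poly c a) a)"
  define \<rho> where "\<rho> = (\<Prod>i<N. complex_of_real (skew_norm c i))"
  have nz: "K \<noteq> 0" "\<rho> \<noteq> 0"
  proof -
    have "(\<Prod>a<2*N. coeff (skew_poly c a) a) \<noteq> 0"
      unfolding prod_zero_iff[OF finite_lessThan] using lead_skew_poly_nonzero[OF c] by blast
    then show "K \<noteq> 0" unfolding K_def by simp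
    show "\<rho> \<noteq> 0" unfolding \<rho>_def prod_zero_iff[OF finite_lessThan] using skew_norm_nonzero[OF c] by simp
  qed
  have Z: "complex_of_real (partition_fun (\<lambda>\<zeta>. (cmod \<zeta>)\<^sup>2) N) = K * (2 ^ N * fact N * \<rho>)"
    using ginibre_weight_integral[OF N, of 0 \<zeta>] unfolding partition_fun_def K_def \<rho>_def c_def
    by (simp add: pf_0 atLeast0LessThan)
  have alg: "1 / (K * (2 ^ N * F * r)) * (F / f) * (K * g * (2 ^ (N - k) * f * r * P)) = g / 2 ^ k * P"
    if "K \<noteq> 0" "r \<noteq> 0" "F \<noteq> 0" "f \<noteq> 0" for K F r f g P :: complex
  proof -
    have "(2::complex) ^ N = 2 ^ (N - k) * 2 ^ k" using k by (simp add: power_add[symmetric])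
    then show ?thesis using that by (simp add: field_simps)
  qed
  show ?thesis
    unfolding correlation_fun_def of_real_mult of_real_divide Z
    unfolding ginibre_weight_integral[OF N k] of_real_fact of_real_1 c_def[symmetric] y_def[symmetric] K_def[symmetric] \<rho>_def[symmetric]
    by (rule alg) (use nz in auto)
qed

section \<open>The pre-kernel in rescaled coordinates\<close>

definition exp_trunc :: "nat \<Rightarrow> complex \<Rightarrow> complex" where
  "exp_trunc n s = (\<Sum>l<n. s ^ l / fact l)"

text \<open>The sum of rank-two terms in the variable scaled by \<open>sqrt (2 / N)\<close>, up to a
  constant: there the even skew-orthogonal polynomials become truncations of
  \<open>exp (z\<^sup>2)\<close>, and \<open>N\<close> survives only as the number of terms. The
  coefficient is \<open>2 ^ i\<close> divided by the double factorial of
  \<open>2 * i + 1\<close>.\<close>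

definition pre_kernel :: "nat \<Rightarrow> complex \<Rightarrow> complex \<Rightarrow> complex" where
  "pre_kernel N z w = (\<Sum>i<N. 4 ^ i * fact i / fact (2*i+1) *
     (z ^ (2*i+1) * exp_trunc (Suc i) (w\<^sup>2) - exp_trunc (Suc i) (z\<^sup>2) * w ^ (2*i+1)))"

lemma pre_kernel_minus: "pre_kernel N (-z) (-w) = - pre_kernel N z w"
  unfolding pre_kernel_def sum_negf[symmetric] by (intro sum.cong) (auto simp: algebra_simps)

lemma skew_kernel_eq_pre_kernel:
  assumes N: "N > 0"
  defines "c \<equiv> real N" and "r \<equiv> complex_of_real (sqrt (2 / real N))"
  shows "(\<Sum>i<N. (1 / complex_of_real (skew_norm c i)) *
         (poly (skew_poly c (2*i)) (r * z) * poly (skew_poly c (2*i+1)) (r * w)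
          - poly (skew_poly c (2*i+1)) (r * z) * poly (skew_poly c (2*i)) (r * w))) =
      of_nat N ^ 2 * r * pre_kernel N z w"
proof -
  have r2: "r ^ 2 = 2 / of_nat N" unfolding r_def using N by (simp flip: of_real_power)
  have e: "poly (skew_poly c (2*i)) (r * z) = exp_trunc (Suc i) (z\<^sup>2)" for i z
  proof -
    have "complex_of_real ((c / 2) ^ p / fact p) * (r * z) ^ (2*p) = (z\<^sup>2) ^ p / fact p" for p
    proof -
      have "(r * z) ^ (2*p) = (2 / of_nat N) ^ p * (z\<^sup>2) ^ p"
        unfolding power_mult power_mult_distrib r2 ..
      moreover have "complex_of_real ((c / 2) ^ p / fact p) = (of_nat N / 2) ^ p / fact p" by (simp add: c_def)
      moreover have "(of_nat N / 2) ^ p * (2 / of_nat N) ^ p = (1::complex)"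
        using N by (simp flip: power_mult_distrib)
      ultimately show ?thesis by (simp add: mult.assoc[symmetric])
    qed
    then show ?thesis unfolding poly_skew_poly_even exp_trunc_def lessThan_Suc_atMost by simp
  qed
  have o: "poly (skew_poly c (2*i+1)) (r * z) = (2 / of_nat N) ^ i * r * z ^ (2*i+1)" for i z
    unfolding poly_skew_poly_odd power_mult_distrib power_add power_mult r2 by simp
  have k: "1 / complex_of_real (skew_norm c i) * ((2 / of_nat N) ^ i * r) = - (of_nat N ^ 2 * r * (4 ^ i * fact i / fact (2*i+1)))" for i
  proof -
    have "complex_of_real (skew_norm c i) = - ((of_nat N / 2) ^ i / fact i * (fact (2*i+1) / of_nat N ^ (2*i+2)))"
      unfolding skew_norm_def c_def by simp
    moreover have "1 / (- (P / T / F * (H / (P * P * n * n)))) * (T / P * r) = - (n * n * r * (T * T * F / H))"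
      if "P \<noteq> 0" "T \<noteq> 0" "F \<noteq> 0" "H \<noteq> 0" "n \<noteq> 0" for P T F H n r :: complex
      using that by (simp add: field_simps)
    from this[of "of_nat N ^ i" "2 ^ i" "fact i" "fact (2*i+1)" "of_nat N" r]
    have "1 / (- (of_nat N ^ i / 2 ^ i / fact i * (fact (2*i+1) / (of_nat N ^ i * of_nat N ^ i * of_nat N * of_nat N)))) * (2 ^ i / of_nat N ^ i * r)
      = - (of_nat N * of_nat N * r * (2 ^ i * 2 ^ i * fact i / fact (2*i+1)))" using N by simp
    moreover have "(4::complex) ^ i = 2 ^ i * 2 ^ i" by (simp flip: power_mult_distrib)
    moreover have "(of_nat N :: complex) ^ (2*i+2) = of_nat N ^ i * of_nat N ^ i * of_nat N * of_nat N"
      by (simp add: power_add mult_2 power2_eq_square mult.assoc)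
    ultimately show ?thesis unfolding power_divide power2_eq_square by (simp only:)
  qed
  have "(1 / complex_of_real (skew_norm c i)) *
         (poly (skew_poly c (2*i)) (r * z) * poly (skew_poly c (2*i+1)) (r * w)
          - poly (skew_poly c (2*i+1)) (r * z) * poly (skew_poly c (2*i)) (r * w)) =
      of_nat N ^ 2 * r * (4 ^ i * fact i / fact (2*i+1) *
     (z ^ (2*i+1) * exp_trunc (Suc i) (w\<^sup>2) - exp_trunc (Suc i) (z\<^sup>2) * w ^ (2*i+1)))" for i
  proof -
    have "(1 / complex_of_real (skew_norm c i)) *
         (poly (skew_poly c (2*i)) (r * z) * poly (skew_poly c (2*i+1)) (r * w)
          - poly (skew_poly c (2*i+1)) (r * z) * poly (skew_poly c (2*i)) (r * w)) =
       (1 / complex_of_real (skew_norm c i) * ((2 / of_nat N) ^ i * r)) *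
         (exp_trunc (Suc i) (z\<^sup>2) * w ^ (2*i+1) - z ^ (2*i+1) * exp_trunc (Suc i) (w\<^sup>2))"
      unfolding e o by (simp only: algebra_simps)
    also have "\<dots> = - (of_nat N ^ 2 * r * (4 ^ i * fact i / fact (2*i+1))) *
         (exp_trunc (Suc i) (z\<^sup>2) * w ^ (2*i+1) - z ^ (2*i+1) * exp_trunc (Suc i) (w\<^sup>2))"
      unfolding k ..
    also have "- (u * v) * (x - y) = u * (v * (y - x))" for u v x y :: complex by (simp add: algebra_simps)
    finally show ?thesis .
  qed
  then show ?thesis unfolding pre_kernel_def sum_distrib_left by simp
qed

text \<open>The powers of \<open>r = sqrt (2 / N)\<close> from the rescaling, the weights and the
  kernels combine with the powers of \<open>N\<close> and of 2 to 1. For the point on the other side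
  the weights and the kernels each contribute \<open>k\<close> signs, and these cancel.\<close>

lemma rescaled_correlation_pf:
  fixes N k :: nat and z :: "nat \<Rightarrow> complex" and e p :: complex
  assumes N: "N > 0" and k: "k \<le> N" and e: "cmod e = 1"
    and p: "p = complex_of_real (sqrt 2) * e \<or> p = - (complex_of_real (sqrt 2) * e)"
  defines "x \<equiv> (\<lambda>j. e * (complex_of_real (sqrt (real N)) + z j))"
  shows "complex_of_real (rescaled_correlation (\<lambda>\<zeta>. (cmod \<zeta>)\<^sup>2) p N k z) =
     (\<Prod>j<k. gauss_weight 2 (x j)) * pf k (\<lambda>a b. 2 * pre_kernel N (with_conj x a) (with_conj x b))"
proof -
  define r where "r = complex_of_real (sqrt (2 / real N))"
  obtain \<sigma> :: complex where \<sigma>: "\<sigma> = 1 \<or> \<sigma> = -1" "p = \<sigma> * (complex_of_real (sqrt 2) * e)"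
    using p by (metis mult_1 mult_minus1)
  have s2: "\<sigma> * \<sigma> = 1" "cnj \<sigma> = \<sigma>" "cmod \<sigma> = 1" using \<sigma>(1) by auto
  define \<zeta> where "\<zeta> = (\<lambda>j. p + p / complex_of_real (cmod p) * complex_of_real (micro_scale N) * z j)"
  have cp: "cmod p = sqrt 2" unfolding \<sigma>(2) norm_mult s2(3) e by simp
  have r_sqrt: "r * complex_of_real (sqrt (real N)) = complex_of_real (sqrt 2)"
    unfolding r_def using N by (simp flip: of_real_mult real_sqrt_mult)
  have z: "\<zeta> j = r * (\<sigma> * x j)" for j
  proof -
    have "p / complex_of_real (cmod p) = \<sigma> * e" unfolding cp unfolding \<sigma>(2) by simp
    then have "\<zeta> j = \<sigma> * e * complex_of_real (sqrt 2) + \<sigma> * e * r * z j"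
      unfolding \<zeta>_def micro_scale_def r_def[symmetric] \<sigma>(2) by simp
    then show ?thesis unfolding x_def r_sqrt[symmetric] by (simp add: algebra_simps)
  qed
  have r2: "r ^ 2 = 2 / of_nat N" unfolding r_def using N by (simp flip: of_real_power)
  have rr: "cnj r = r" unfolding r_def by simp
  have wc: "with_conj \<zeta> a = r * (\<sigma> * with_conj x a)" for a
    unfolding with_conj_def using z rr s2 by auto
  have w: "gauss_weight (real N) (\<zeta> j) = \<sigma> * r * gauss_weight 2 (x j)" for j
  proof -
    have "(cmod (\<zeta> j))\<^sup>2 = 2 / real N * (cmod (x j))\<^sup>2"
      unfolding z norm_mult s2(3) r_def using N by (simp add: power_mult_distrib)
    then have "real N * (cmod (\<zeta> j))\<^sup>2 = 2 * (cmod (x j))\<^sup>2" using N by simp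
    then show ?thesis unfolding gauss_weight_def unfolding z by (simp add: rr s2 algebra_simps)
  qed
  have pk: "pre_kernel N (\<sigma> * u) (\<sigma> * v) = \<sigma> * pre_kernel N u v" for u v
    using \<sigma>(1) pre_kernel_minus by auto
  have "complex_of_real (rescaled_correlation (\<lambda>\<zeta>. (cmod \<zeta>)\<^sup>2) p N k z) =
     r ^ (2*k) * ((\<Prod>j<k. gauss_weight (real N) (\<zeta> j)) / 2 ^ k *
       pf k (\<lambda>a b. of_nat N ^ 2 * r * pre_kernel N (\<sigma> * with_conj x a) (\<sigma> * with_conj x b)))"
    unfolding rescaled_correlation_def of_real_mult \<zeta>_def[symmetric] correlation_fun_pf[OF N k] wc
    unfolding r_def skew_kernel_eq_pre_kernel[OF N] by (simp add: micro_scale_def)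
  also have "pf k (\<lambda>a b. of_nat N ^ 2 * r * pre_kernel N (\<sigma> * with_conj x a) (\<sigma> * with_conj x b)) =
     (of_nat N ^ 2 * r * \<sigma> / 2) ^ k * pf k (\<lambda>a b. 2 * pre_kernel N (with_conj x a) (with_conj x b))"
  proof -
    have "pf k (\<lambda>a b. C * A a b) = C ^ k * pf k A" for C A
      unfolding pf_def by (simp add: prod.distrib sum_distrib_left mult_ac)
    from this[of "of_nat N ^ 2 * r * \<sigma> / 2" "\<lambda>a b. 2 * pre_kernel N (with_conj x a) (with_conj x b)"]
    show ?thesis unfolding pk by (simp add: mult_ac)
  qed
  also have "(\<Prod>j<k. gauss_weight (real N) (\<zeta> j)) = (\<sigma> * r) ^ k * (\<Prod>j<k. gauss_weight 2 (x j))"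
    unfolding w by (simp add: prod.distrib)
  also have "r ^ (2*k) * ((\<sigma> * r) ^ k * (\<Prod>j<k. gauss_weight 2 (x j)) / 2 ^ k * ((of_nat N ^ 2 * r * \<sigma> / 2) ^ k * P)) =
      (r ^ 2 * (\<sigma> * r) / 2 * (of_nat N ^ 2 * r * \<sigma> / 2)) ^ k * (\<Prod>j<k. gauss_weight 2 (x j)) * P" for P
    unfolding power_mult[of r 2 k]
    by (simp only: power_mult_distrib power_divide times_divide_eq_left times_divide_eq_right mult_ac)
  also have "r ^ 2 * (\<sigma> * r) / 2 * (of_nat N ^ 2 * r * \<sigma> / 2) = 1"
  proof -
    have "r ^ 2 * (\<sigma> * r) / 2 * (of_nat N ^ 2 * r * \<sigma> / 2) = (\<sigma> * \<sigma>) * (r ^ 2 * of_nat N) ^ 2 / 4"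
      by (simp add: power2_eq_square)
    also have "r ^ 2 * of_nat N = 2" using r2 N by simp
    finally show ?thesis using s2 by simp
  qed
  finally show ?thesis by simp
qed

section \<open>The complementary error function\<close>

lemma erfc_0: "erfc 0 = 1"
  by (simp add: erfc_def)

text \<open>An entire function has a primitive on the whole plane, so the contour integral in
  \<open>erfc\<close> is a difference of its values.\<close>

lemma erfc_has_field_derivative:
  "(erfc has_field_derivative - (2 / complex_of_real (sqrt pi)) * exp (- z\<^sup>2)) (at z)"
proof -
  have "(\<lambda>s::complex. exp (- s\<^sup>2)) holomorphic_on UNIV" by (intro holomorphic_intros)
  then obtain G :: "complex \<Rightarrow> complex" where G: "\<And>s. (G has_field_derivative exp (- s\<^sup>2)) (at s)"
    using holomorphic_convex_primitive'[of UNIV "\<lambda>s::complex. exp (- s\<^sup>2)"] by auto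
  have "erfc = (\<lambda>z. 1 - 2 / complex_of_real (sqrt pi) * (G z - G 0))"
  proof
    fix z
    have "((\<lambda>s::complex. exp (- s\<^sup>2)) has_contour_integral (G z - G 0)) (linepath 0 z)"
      using contour_integral_primitive[of UNIV G "\<lambda>s. exp (- s\<^sup>2)" "linepath 0 z"] G by (simp add: has_field_derivative_at_within)
    then show "erfc z = 1 - 2 / complex_of_real (sqrt pi) * (G z - G 0)"
      unfolding erfc_def by (simp add: contour_integral_unique)
  qed
  moreover have "((\<lambda>z. 1 - 2 / complex_of_real (sqrt pi) * (G z - G 0)) has_field_derivative
      - (2 / complex_of_real (sqrt pi)) * exp (- z\<^sup>2)) (at z)"
    by (auto intro!: derivative_eq_intros G)
  ultimately show ?thesis by simp
qed

lemma erfc_has_field_derivative_chain[derivative_intros]: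
  assumes "(f has_field_derivative f') (at z within A)"
  shows "((\<lambda>z. erfc (f z)) has_field_derivative - (2 / complex_of_real (sqrt pi)) * exp (- (f z)\<^sup>2) * f') (at z within A)"
  using DERIV_chain2[OF erfc_has_field_derivative assms] .

lemma holomorphic_erfc: "erfc holomorphic_on A"
  unfolding holomorphic_on_def field_differentiable_def
  using has_field_derivative_at_within[OF erfc_has_field_derivative] by blast

lemma holomorphic_on_erfc[holomorphic_intros]: "f holomorphic_on A \<Longrightarrow> (\<lambda>z. erfc (f z)) holomorphic_on A"
  using holomorphic_on_compose[OF _ holomorphic_erfc[of "f ` A"]] by (simp add: o_def)

lemma continuous_on_erfc[continuous_intros]: "continuous_on A f \<Longrightarrow> continuous_on A (\<lambda>z. erfc (f z))"
  using continuous_on_compose2[OF holomorphic_on_imp_continuous_on[OF holomorphic_erfc[of UNIV]]] by auto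

lemma exp_minus_square_bound:
  fixes w :: complex
  shows "cmod (exp (- w\<^sup>2)) = exp ((Im w)\<^sup>2 - (Re w)\<^sup>2)"
  by (simp add: norm_exp_eq_Re Re_power2)

text \<open>The normalisation \<open>2 / sqrt pi\<close> enters here: the Gaussian integral over the
  positive half-line is \<open>sqrt pi / 2\<close>.\<close>

lemma erfc_real_tendsto: "((\<lambda>L. erfc (complex_of_real L)) \<longlongrightarrow> 0) at_top"
proof -
  have i: "set_integrable lborel {0..} (\<lambda>x::real. exp (- x\<^sup>2))"
    using gaussian_moment_0 unfolding set_integrable_def has_bochner_integral_iff by simp
  have v: "(LBINT x:{0..}. exp (- x\<^sup>2)) = sqrt pi / 2"
    using gaussian_moment_0 unfolding set_lebesgue_integral_def has_bochner_integral_iff by simp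
  have t: "((\<lambda>L. (LBINT x:{0..L}. exp (- x\<^sup>2))) \<longlongrightarrow> sqrt pi / 2) at_top"
    using tendsto_set_lebesgue_integral_at_top[OF _ i] v by simp
  have e: "erfc (complex_of_real L) = 1 - 2 / complex_of_real (sqrt pi) * complex_of_real (LBINT x:{0..L}. exp (- x\<^sup>2))" if "L \<ge> 0" for L
  proof -
    have h1: "((\<lambda>x. exp (- (complex_of_real x)\<^sup>2)) has_integral
        (- (complex_of_real (sqrt pi) / 2) * erfc (complex_of_real L) - (- (complex_of_real (sqrt pi) / 2) * erfc (complex_of_real 0)))) {0..L}"
    proof (rule fundamental_theorem_of_calculus[OF that])
      fix x
      have "((\<lambda>z. - (complex_of_real (sqrt pi) / 2) * erfc z) has_field_derivative exp (- (complex_of_real x)\<^sup>2)) (at (complex_of_real x))"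
        by (auto intro!: derivative_eq_intros)
      then show "((\<lambda>x. - (complex_of_real (sqrt pi) / 2) * erfc (complex_of_real x)) has_vector_derivative exp (- (complex_of_real x)\<^sup>2)) (at x within {0..L})"
        using has_vector_derivative_real_field has_vector_derivative_at_within by blast
    qed
    have h2: "((\<lambda>x. exp (- (complex_of_real x)\<^sup>2)) has_integral complex_of_real (LBINT x:{0..L}. exp (- x\<^sup>2))) {0..L}"
    proof -
      have s: "set_integrable lborel {0..L} (\<lambda>x::real. exp (- x\<^sup>2))"
        by (rule set_integrable_subset[OF i]) auto
      have "((\<lambda>x::real. exp (- x\<^sup>2)) has_integral (LBINT x:{0..L}. exp (- x\<^sup>2))) {0..L}"
        using set_borel_integral_eq_integral[OF s] integrable_integral by metis
      then have "((\<lambda>x. complex_of_real (exp (- x\<^sup>2))) has_integral complex_of_real (LBINT x:{0..L}. exp (- x\<^sup>2))) {0..L}"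
        by (rule has_integral_of_real)
      then show ?thesis unfolding exp_of_real[symmetric] of_real_minus of_real_power .
    qed
    have "complex_of_real (LBINT x:{0..L}. exp (- x\<^sup>2)) = complex_of_real (sqrt pi) / 2 * (1 - erfc (complex_of_real L))"
      unfolding has_integral_unique[OF h2 h1] by (simp add: erfc_0 algebra_simps)
    then show ?thesis by (simp add: field_simps)
  qed
  have "((\<lambda>L. 1 - 2 / complex_of_real (sqrt pi) * complex_of_real (LBINT x:{0..L}. exp (- x\<^sup>2))) \<longlongrightarrow>
      1 - 2 / complex_of_real (sqrt pi) * complex_of_real (sqrt pi / 2)) at_top"
    by (intro tendsto_intros t)
  then have "((\<lambda>L. 1 - 2 / complex_of_real (sqrt pi) * complex_of_real (LBINT x:{0..L}. exp (- x\<^sup>2))) \<longlongrightarrow> 0) at_top"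
    by simp
  then show ?thesis
  proof (rule Lim_transform_eventually)
    show "\<forall>\<^sub>F L in at_top. 1 - 2 / complex_of_real (sqrt pi) * complex_of_real (LBINT x:{0..L}. exp (- x\<^sup>2)) = erfc (complex_of_real L)"
      using eventually_ge_at_top[of "0::real"] by (rule eventually_mono) (rule e[symmetric])
  qed
qed

text \<open>On the disc of radius \<open>R = cmod z\<close> around \<open>L\<close> the derivative
  of \<open>erfc\<close> is at most a constant times
  \<open>exp (R\<^sup>2 - (L - R)\<^sup>2)\<close>, so the limit along the real axis carries over to
  a parallel line.\<close>

lemma erfc_shift_tendsto: "((\<lambda>L. erfc (complex_of_real L + z)) \<longlongrightarrow> 0) at_top"
proof -
  define R where "R = cmod z"
  have *: "cmod (erfc (complex_of_real L + z) - erfc (complex_of_real L)) \<le> 2 / sqrt pi * exp (R\<^sup>2 - (L - R)\<^sup>2) * R" if L: "L \<ge> R" for L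
  proof -
    have "norm (erfc (complex_of_real L + z) - erfc (complex_of_real L)) \<le> 2 / sqrt pi * exp (R\<^sup>2 - (L - R)\<^sup>2) * norm ((complex_of_real L + z) - complex_of_real L)"
    proof (rule field_differentiable_bound[where S = "cball (complex_of_real L) R"])
      fix w assume "w \<in> cball (complex_of_real L) R"
      then have w: "cmod (w - complex_of_real L) \<le> R" by (simp add: dist_norm norm_minus_commute)
      show "(erfc has_field_derivative - (2 / complex_of_real (sqrt pi)) * exp (- w\<^sup>2)) (at w within cball (complex_of_real L) R)"
        using erfc_has_field_derivative has_field_derivative_at_within by blast
      have "\<bar>Im w\<bar> \<le> R" using abs_Im_le_cmod[of "w - complex_of_real L"] w by simp
      moreover have "\<bar>Re w - L\<bar> \<le> R" using abs_Re_le_cmod[of "w - complex_of_real L"] w by simp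
      then have "L - R \<le> Re w" by linarith
      ultimately have "(Im w)\<^sup>2 \<le> R\<^sup>2" "(L - R)\<^sup>2 \<le> (Re w)\<^sup>2" using L abs_le_square_iff[of "Im w" R] by (auto intro: power_mono)
      then show "norm (- (2 / complex_of_real (sqrt pi)) * exp (- w\<^sup>2)) \<le> 2 / sqrt pi * exp (R\<^sup>2 - (L - R)\<^sup>2)"
        unfolding norm_mult exp_minus_square_bound by (simp add: norm_divide divide_right_mono)
    qed (auto simp: R_def dist_norm)
    then show ?thesis by (simp add: R_def)
  qed
  have "((\<lambda>L. erfc (complex_of_real L + z) - erfc (complex_of_real L)) \<longlongrightarrow> 0) at_top"
  proof (rule Lim_null_comparison)
    show "((\<lambda>L. 2 / sqrt pi * exp (R\<^sup>2 - (L - R)\<^sup>2) * R) \<longlongrightarrow> 0) at_top" by real_asymp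
    show "\<forall>\<^sub>F L in at_top. norm (erfc (complex_of_real L + z) - erfc (complex_of_real L)) \<le> 2 / sqrt pi * exp (R\<^sup>2 - (L - R)\<^sup>2) * R"
      using eventually_ge_at_top[of R] by (rule eventually_mono) (rule *)
  qed
  from tendsto_add[OF this erfc_real_tendsto] show ?thesis by simp
qed

section \<open>The scaled complementary error function\<close>

lemma set_integrable_exp_quadratic:
  "set_integrable lborel {0..} (\<lambda>s::real. exp (- s\<^sup>2 + b * s))"
proof -
  have "integrable lborel (\<lambda>s::real. exp (b\<^sup>2) * exp (- (1/2 * s\<^sup>2)))"
    using gaussian_integral_real(1)[of "1/2"] by (intro integrable_mult_right) auto
  then have "integrable lborel (\<lambda>s::real. exp (- s\<^sup>2 + b * s))"
  proof (rule Bochner_Integration.integrable_bound)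
    have "norm (exp (- s\<^sup>2 + b * s)) \<le> norm (exp (b\<^sup>2) * exp (- (1/2 * s\<^sup>2)))" for s :: real
    proof -
      have "0 \<le> (s / 2 - b)\<^sup>2 + (s / 2)\<^sup>2" by simp
      then have "- s\<^sup>2 + b * s \<le> b\<^sup>2 - 1/2 * s\<^sup>2" by (simp add: power2_eq_square algebra_simps)
      then show ?thesis by (simp flip: exp_add)
    qed
    then show "AE s in lborel. norm (exp (- s\<^sup>2 + b * s)) \<le> norm (exp (b\<^sup>2) * exp (- (1/2 * s\<^sup>2)))" by simp
  qed measurable
  then show ?thesis unfolding set_integrable_def by (intro integrable_mult_indicator) auto
qed

text \<open>Up to the factor \<open>sqrt pi\<close>, the Faddeeva function at
  \<open>\<i> * z\<close>. In contrast to \<open>erfc\<close> it is bounded on each half-plane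
  \<open>Re z \<ge> - R\<close>, which is what the estimates at large height rest on.\<close>

definition scaled_erfc :: "complex \<Rightarrow> complex" where
  "scaled_erfc z = complex_of_real (sqrt pi) * exp (z\<^sup>2) * erfc z"

lemma erfc_eq_scaled: "erfc z = exp (- z\<^sup>2) * scaled_erfc z / complex_of_real (sqrt pi)"
  by (simp add: scaled_erfc_def exp_minus)

lemma holomorphic_scaled_erfc: "scaled_erfc holomorphic_on A"
  unfolding scaled_erfc_def by (intro holomorphic_intros)

text \<open>Run the path of integration of \<open>erfc\<close> along \<open>z + s\<close> with
  \<open>s \<ge> 0\<close> and cancel \<open>exp (z\<^sup>2)\<close>. The modulus of the resulting
  integrand depends on \<open>Re z\<close> only.\<close>

lemma scaled_erfc_integral:
  "set_integrable lborel {0..} (\<lambda>s. exp (- (complex_of_real s)\<^sup>2 - 2 * z * complex_of_real s))"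
  "scaled_erfc z = 2 * (LBINT s:{0..}. exp (- (complex_of_real s)\<^sup>2 - 2 * z * complex_of_real s))"
proof -
  let ?f = "\<lambda>s. exp (- (complex_of_real s)\<^sup>2 - 2 * z * complex_of_real s)"
  have n: "cmod (?f s) = exp (- s\<^sup>2 + (- 2 * Re z) * s)" for s
    by (simp add: norm_exp_eq_Re flip: of_real_power)
  have "integrable lborel (\<lambda>s. indicat_real {0..} s *\<^sub>R exp (- s\<^sup>2 + (- 2 * Re z) * s))"
    using set_integrable_exp_quadratic[of "- 2 * Re z"] unfolding set_integrable_def .
  then show i: "set_integrable lborel {0..} ?f"
    unfolding set_integrable_def
  proof (rule Bochner_Integration.integrable_bound)
    show "(\<lambda>s. indicat_real {0..} s *\<^sub>R ?f s) \<in> borel_measurable lborel"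
      by (intro borel_measurable_scaleR borel_measurable_indicator) (auto intro!: borel_measurable_continuous_onI continuous_intros)
    show "AE s in lborel. norm (indicat_real {0..} s *\<^sub>R ?f s) \<le> norm (indicat_real {0..} s *\<^sub>R exp (- s\<^sup>2 + (- 2 * Re z) * s))"
      unfolding norm_scaleR n by simp
  qed
  have t: "((\<lambda>L. LBINT s:{0..L}. ?f s) \<longlongrightarrow> (LBINT s:{0..}. ?f s)) at_top"
    by (rule tendsto_set_lebesgue_integral_at_top[OF _ i]) auto
  have e: "(LBINT s:{0..L}. ?f s) = scaled_erfc z / 2 - complex_of_real (sqrt pi) / 2 * exp (z\<^sup>2) * erfc (complex_of_real L + z)" if "L \<ge> 0" for L
  proof -
    have s: "set_integrable lborel {0..L} ?f" by (rule set_integrable_subset[OF i]) auto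
    have h: "(?f has_integral
       (- (complex_of_real (sqrt pi) / 2) * exp (z\<^sup>2) * erfc (complex_of_real L + z) - (- (complex_of_real (sqrt pi) / 2) * exp (z\<^sup>2) * erfc (complex_of_real 0 + z)))) {0..L}"
    proof (rule fundamental_theorem_of_calculus[OF that])
      fix x
      have "((\<lambda>w. - (complex_of_real (sqrt pi) / 2) * exp (z\<^sup>2) * erfc (w + z)) has_field_derivative ?f x) (at (complex_of_real x))"
        by (auto intro!: derivative_eq_intros simp: mult_exp_exp power2_sum algebra_simps)
      then show "((\<lambda>x. - (complex_of_real (sqrt pi) / 2) * exp (z\<^sup>2) * erfc (complex_of_real x + z)) has_vector_derivative ?f x) (at x within {0..L})"
        using has_vector_derivative_real_field has_vector_derivative_at_within by blast
    qed
    show ?thesis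
      unfolding set_borel_integral_eq_integral(2)[OF s] integral_unique[OF h] by (simp add: scaled_erfc_def)
  qed
  have t2: "((\<lambda>L. scaled_erfc z / 2 - complex_of_real (sqrt pi) / 2 * exp (z\<^sup>2) * erfc (complex_of_real L + z)) \<longlongrightarrow>
      scaled_erfc z / 2 - complex_of_real (sqrt pi) / 2 * exp (z\<^sup>2) * 0) at_top"
    by (intro tendsto_intros erfc_shift_tendsto)
  have "eventually (\<lambda>L. (LBINT s:{0..L}. ?f s) = scaled_erfc z / 2 - complex_of_real (sqrt pi) / 2 * exp (z\<^sup>2) * erfc (complex_of_real L + z)) at_top"
    using eventually_ge_at_top[of "0::real"] by (rule eventually_mono) (rule e)
  then have "((\<lambda>L. LBINT s:{0..L}. ?f s) \<longlongrightarrow> scaled_erfc z / 2 - complex_of_real (sqrt pi) / 2 * exp (z\<^sup>2) * 0) at_top"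
    using t2 tendsto_cong by (simp only: tendsto_cong)
  from tendsto_unique[OF trivial_limit_at_top_linorder t this]
  have half: "(LBINT s:{0..}. ?f s) = scaled_erfc z / 2" by simp
  show "scaled_erfc z = 2 * (LBINT s:{0..}. ?f s)" unfolding half by simp
qed

text \<open>The value of \<open>scaled_erfc\<close> at the real point \<open>- R\<close>, where its
  modulus is largest on the half-plane \<open>Re z \<ge> - R\<close>.\<close>

definition scaled_erfc_max :: "real \<Rightarrow> real" where
  "scaled_erfc_max R = 2 * (LBINT s:{0..}. exp (- s\<^sup>2 + 2 * R * s))"

lemma scaled_erfc_max_nonneg: "scaled_erfc_max R \<ge> 0"
  unfolding scaled_erfc_max_def set_lebesgue_integral_def
  by (intro mult_nonneg_nonneg Bochner_Integration.integral_nonneg) (auto simp: indicator_def)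

lemma scaled_erfc_bound:
  assumes "Re z \<ge> - R"
  shows "cmod (scaled_erfc z) \<le> scaled_erfc_max R"
proof -
  let ?f = "\<lambda>s. exp (- (complex_of_real s)\<^sup>2 - 2 * z * complex_of_real s)"
  have n: "cmod (?f s) = exp (- s\<^sup>2 - 2 * Re z * s)" for s
    by (simp add: norm_exp_eq_Re flip: of_real_power)
  have "norm (LBINT s:{0..}. ?f s) \<le> (LBINT s:{0..}. exp (- s\<^sup>2 + 2 * R * s))"
    unfolding set_lebesgue_integral_def
  proof (rule Bochner_Integration.integral_norm_bound_integral)
    show "integrable lborel (\<lambda>s. indicat_real {0..} s *\<^sub>R ?f s)"
      using scaled_erfc_integral(1)[of z] unfolding set_integrable_def .
    show "integrable lborel (\<lambda>s. indicat_real {0..} s *\<^sub>R exp (- s\<^sup>2 + 2 * R * s))"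
      using set_integrable_exp_quadratic[of "2 * R"] unfolding set_integrable_def .
    fix s :: real
    show "norm (indicat_real {0..} s *\<^sub>R ?f s) \<le> indicat_real {0..} s *\<^sub>R exp (- s\<^sup>2 + 2 * R * s)"
    proof (cases "s \<ge> 0")
      case True
      have "0 \<le> (R + Re z) * s" using assms True by simp
      then show ?thesis unfolding norm_scaleR n using True by (simp add: algebra_simps)
    qed simp
  qed
  then show ?thesis unfolding scaled_erfc_integral(2)[of z] scaled_erfc_max_def by (simp add: norm_mult)
qed

lemma scaled_erfc_deriv: "(scaled_erfc has_field_derivative 2 * z * scaled_erfc z - 2) (at z)"
proof -
  have "((\<lambda>z. complex_of_real (sqrt pi) * exp (z\<^sup>2) * erfc z) has_field_derivative 2 * z * scaled_erfc z - 2) (at z)"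
    by (auto intro!: derivative_eq_intros simp: scaled_erfc_def exp_minus algebra_simps)
  then show ?thesis unfolding scaled_erfc_def[abs_def] .
qed

text \<open>Write \<open>f\<close> for \<open>scaled_erfc\<close>. By the equation
  \<open>f' = 2 * z * f - 2\<close> the error \<open>f - 1 / z\<close> equals
  \<open>f' / (2 * z)\<close>. Differentiating once more, \<open>2 * z * f' = f'' - 2 * f\<close>,
  and \<open>f''\<close> is bounded by Cauchy's estimate on the unit disc around \<open>z\<close>;
  this disc is the reason for \<open>R + 1\<close>.\<close>

lemma scaled_erfc_asymptotic:
  assumes "Re z \<ge> - R" "z \<noteq> 0"
  shows "cmod (scaled_erfc z - 1 / z) \<le> scaled_erfc_max (R + 1) / (cmod z)\<^sup>2"
proof -
  let ?C = "scaled_erfc_max (R + 1)"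
  have d1: "deriv scaled_erfc = (\<lambda>z. 2 * z * scaled_erfc z - 2)"
    using scaled_erfc_deriv DERIV_imp_deriv by blast
  have d2: "(deriv ^^ 2) scaled_erfc z = 2 * scaled_erfc z + 2 * z * deriv scaled_erfc z"
  proof -
    have "((\<lambda>z. 2 * z * scaled_erfc z - 2) has_field_derivative 2 * scaled_erfc z + 2 * z * (2 * z * scaled_erfc z - 2)) (at z)"
      by (auto intro!: derivative_eq_intros scaled_erfc_deriv)
    then have "deriv (deriv scaled_erfc) z = 2 * scaled_erfc z + 2 * z * (2 * z * scaled_erfc z - 2)"
      unfolding d1 by (rule DERIV_imp_deriv)
    moreover have "(deriv ^^ 2) scaled_erfc = deriv (deriv scaled_erfc)"
      by (simp add: numeral_2_eq_2)
    ultimately show ?thesis using d1 by simp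
  qed
  have b: "cmod (scaled_erfc w) \<le> ?C" if "cmod (z - w) \<le> 1" for w
  proof (rule scaled_erfc_bound)
    have "\<bar>Re (z - w)\<bar> \<le> 1" using abs_Re_le_cmod[of "z - w"] that by linarith
    then show "- (R + 1) \<le> Re w" using assms by simp
  qed
  have "cmod ((deriv ^^ 2) scaled_erfc z) \<le> fact 2 * ?C / 1 ^ 2"
    by (rule Cauchy_inequality) (auto intro!: holomorphic_scaled_erfc holomorphic_on_imp_continuous_on b)
  then have "cmod ((deriv ^^ 2) scaled_erfc z) \<le> 2 * ?C" by (simp add: fact_numeral)
  moreover have "2 * z * deriv scaled_erfc z = (deriv ^^ 2) scaled_erfc z - 2 * scaled_erfc z" using d2 by simp
  moreover have "cmod (scaled_erfc z) \<le> ?C" by (rule b) simp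
  ultimately have 1: "cmod (2 * z * deriv scaled_erfc z) \<le> 4 * ?C"
    using norm_triangle_ineq4[of "(deriv ^^ 2) scaled_erfc z" "2 * scaled_erfc z"] by (simp add: norm_mult)
  have "scaled_erfc z - 1 / z = (2 * z * deriv scaled_erfc z) / (4 * z ^ 2)"
    unfolding d1 using assms(2) by (simp add: field_simps power2_eq_square)
  then have "cmod (scaled_erfc z - 1 / z) = cmod (2 * z * deriv scaled_erfc z) / (4 * (cmod z)\<^sup>2)"
    by (simp add: norm_divide norm_mult norm_power)
  also have "\<dots> \<le> 4 * ?C / (4 * (cmod z)\<^sup>2)" using 1 by (intro divide_right_mono) auto
  finally show ?thesis by simp
qed

section \<open>The edge kernel\<close>

definition edge_gauss :: "complex \<Rightarrow> real \<Rightarrow> complex" where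
  "edge_gauss z u = complex_of_real (sqrt (2 / pi)) * exp (- 2 * (z - complex_of_real u)\<^sup>2)"

text \<open>\<open>kappa_edge\<close> without its Gaussian factor, which \<open>pf_scale\<close>
  will absorb.\<close>

definition edge_int :: "complex \<Rightarrow> complex \<Rightarrow> complex" where
  "edge_int z w = complex_of_real (sqrt pi) * (LINT u:{..0}|lborel. wronskian (edge_fun w) (edge_fun z) u)"

lemma kappa_edge_eq: "kappa_edge z w = exp (z\<^sup>2 + w\<^sup>2) * edge_int z w"
  by (simp add: kappa_edge_def edge_int_def)

lemma sqrt2_square: "(complex_of_real (sqrt 2))\<^sup>2 = 2" "(complex_of_real (sqrt 2) * a)\<^sup>2 = 2 * a\<^sup>2"
  by (simp_all add: power_mult_distrib flip: of_real_power)

lemma edge_fun_field_derivative: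
  "((\<lambda>v. 1 / 2 * erfc (complex_of_real (sqrt 2) * (z - v))) has_field_derivative
     complex_of_real (sqrt (2 / pi)) * exp (- 2 * (z - v)\<^sup>2)) (at v)"
  by (auto intro!: derivative_eq_intros simp: sqrt2_square real_sqrt_divide)

lemma edge_fun_vector_derivative: "(edge_fun z has_vector_derivative edge_gauss z u) (at u within A)"
proof -
  have "((\<lambda>u. 1 / 2 * erfc (complex_of_real (sqrt 2) * (z - complex_of_real u))) has_vector_derivative edge_gauss z u) (at u)"
    using has_vector_derivative_real_field[OF edge_fun_field_derivative[of z "complex_of_real u"]] unfolding edge_gauss_def .
  then show ?thesis unfolding edge_fun_def[abs_def] by (rule has_vector_derivative_at_within)
qed

lemma edge_fun_deriv_first: "((\<lambda>z. edge_fun z u) has_field_derivative - edge_gauss z u) (at z within A)"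
  unfolding edge_fun_def edge_gauss_def
  by (auto intro!: derivative_eq_intros simp: sqrt2_square real_sqrt_divide)

lemma edge_gauss_deriv_first:
  "((\<lambda>z. edge_gauss z u) has_field_derivative - 4 * (z - complex_of_real u) * edge_gauss z u) (at z within A)"
  unfolding edge_gauss_def by (auto intro!: derivative_eq_intros)

lemma edge_gauss_vector_derivative:
  "((\<lambda>u. edge_gauss z u) has_vector_derivative 4 * (z - complex_of_real u) * edge_gauss z u) (at u within A)"
proof -
  have "((\<lambda>v. complex_of_real (sqrt (2 / pi)) * exp (- 2 * (z - v)\<^sup>2)) has_field_derivative
      4 * (z - v) * (complex_of_real (sqrt (2 / pi)) * exp (- 2 * (z - v)\<^sup>2))) (at v)" for v
    by (auto intro!: derivative_eq_intros)
  from has_vector_derivative_real_field[OF this[of "complex_of_real u"]]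
  show ?thesis unfolding edge_gauss_def[abs_def] by (rule has_vector_derivative_at_within)
qed

lemma wronskian_edge:
  "wronskian (edge_fun w) (edge_fun z) u = edge_fun w u * edge_gauss z u - edge_gauss w u * edge_fun z u"
  unfolding wronskian_def vector_derivative_at[OF edge_fun_vector_derivative] ..

definition edge_pair :: "complex \<Rightarrow> complex \<Rightarrow> real \<Rightarrow> complex" where
  "edge_pair z w u = exp (- 2 * (z - complex_of_real u)\<^sup>2 - 2 * (w - complex_of_real u)\<^sup>2)"

lemma edge_pair_bound:
  assumes "cmod z \<le> R" "cmod w \<le> R"
  shows "cmod (edge_pair z w u) \<le> exp (12 * R\<^sup>2) * exp (- (2 * u\<^sup>2))"
proof -
  have R: "R \<ge> 0" using assms norm_ge_zero order_trans by blast
  have b: "Re (- 2 * (z - complex_of_real u)\<^sup>2) \<le> 6 * R\<^sup>2 - u\<^sup>2" if "cmod z \<le> R" for z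
  proof -
    have i: "(Im z)\<^sup>2 \<le> R\<^sup>2" "(Re z)\<^sup>2 \<le> R\<^sup>2"
      using abs_Im_le_cmod[of z] abs_Re_le_cmod[of z] that R by (auto simp: abs_le_square_iff[symmetric])
    \<comment> \<open>This square gives up half of the decay in \<open>u\<close> to absorb the mixed
      term \<open>4 * Re z * u\<close>.\<close>
    have "0 \<le> (2 * Re z - u)\<^sup>2" by simp
    then have "- 2 * (Re z - u)\<^sup>2 \<le> - (u\<^sup>2) + 2 * (Re z)\<^sup>2" by (simp add: power2_eq_square algebra_simps)
    moreover have "2 * (Im z)\<^sup>2 + 2 * (Re z)\<^sup>2 \<le> 6 * R\<^sup>2" using i zero_le_power2[of R] by linarith
    moreover have "Re (- 2 * (z - complex_of_real u)\<^sup>2) = 2 * (Im z)\<^sup>2 - 2 * (Re z - u)\<^sup>2" by (simp add: Re_power2)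
    ultimately show ?thesis by linarith
  qed
  have "cmod (edge_pair z w u) = exp (Re (- 2 * (z - complex_of_real u)\<^sup>2) + Re (- 2 * (w - complex_of_real u)\<^sup>2))"
    unfolding edge_pair_def norm_exp_eq_Re by simp
  also have "\<dots> \<le> exp ((6 * R\<^sup>2 - u\<^sup>2) + (6 * R\<^sup>2 - u\<^sup>2))"
    using b[OF assms(1)] b[OF assms(2)] by (intro exp_le_cancel_iff[THEN iffD2] add_mono)
  also have "\<dots> = exp (12 * R\<^sup>2) * exp (- (2 * u\<^sup>2))" by (simp flip: exp_add)
  finally show ?thesis .
qed

lemma edge_fun_scaled:
  "edge_fun z u = exp (- 2 * (z - complex_of_real u)\<^sup>2) * scaled_erfc (complex_of_real (sqrt 2) * (z - complex_of_real u)) / (2 * complex_of_real (sqrt pi))"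
  unfolding edge_fun_def erfc_eq_scaled sqrt2_square by simp

lemma edge_fun_gauss:
  "edge_fun w u * edge_gauss z u = edge_pair z w u * scaled_erfc (complex_of_real (sqrt 2) * (w - complex_of_real u)) / (complex_of_real (sqrt 2) * complex_of_real pi)"
proof -
  have e: "exp (- 2 * (w - complex_of_real u)\<^sup>2) * exp (- 2 * (z - complex_of_real u)\<^sup>2) = edge_pair z w u"
    unfolding edge_pair_def mult_exp_exp by (rule arg_cong[where f=exp]) simp
  have "sqrt (2 / pi) / (2 * sqrt pi) = 1 / (sqrt 2 * pi)"
    by (simp add: real_sqrt_divide field_simps)
  then have c: "complex_of_real (sqrt (2 / pi)) / (2 * complex_of_real (sqrt pi)) = 1 / (complex_of_real (sqrt 2) * complex_of_real pi)"
    by (metis of_real_1 of_real_divide of_real_mult of_real_numeral)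
  have "edge_fun w u * edge_gauss z u = (exp (- 2 * (w - complex_of_real u)\<^sup>2) * exp (- 2 * (z - complex_of_real u)\<^sup>2)) *
      scaled_erfc (complex_of_real (sqrt 2) * (w - complex_of_real u)) * (complex_of_real (sqrt (2 / pi)) / (2 * complex_of_real (sqrt pi)))"
    unfolding edge_fun_scaled edge_gauss_def by simp
  then show ?thesis unfolding e c by simp
qed

lemma edge_pair_commute: "edge_pair z w u = edge_pair w z u"
  unfolding edge_pair_def by (rule arg_cong[where f=exp]) simp

text \<open>Separates the Gaussian, which carries the decay in \<open>u\<close>, from the two scaled
  functions; for \<open>u \<le> 0\<close> the latter stay bounded, because their arguments remain in
  a fixed right half-plane (\<open>Re_edge_arg\<close>).\<close>

lemma wronskian_edge_pair:
  "wronskian (edge_fun w) (edge_fun z) u = edge_pair z w u *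
     (scaled_erfc (complex_of_real (sqrt 2) * (w - complex_of_real u)) - scaled_erfc (complex_of_real (sqrt 2) * (z - complex_of_real u)))
     / (complex_of_real (sqrt 2) * complex_of_real pi)"
  unfolding wronskian_edge edge_fun_gauss mult.commute[of "edge_gauss w u"] edge_pair_commute[of w z]
  by (simp add: diff_divide_distrib algebra_simps)

lemma Re_edge_arg:
  assumes "cmod z \<le> R" "u \<le> 0"
  shows "Re (complex_of_real (sqrt 2) * (z - complex_of_real u)) \<ge> - (sqrt 2 * R)"
proof -
  have "- R \<le> Re z - u" using assms abs_Re_le_cmod[of z] by linarith
  then have "sqrt 2 * (- R) \<le> sqrt 2 * (Re z - u)" by (intro mult_left_mono) auto
  then show ?thesis by simp
qed

lemma continuous_scaled_erfc[continuous_intros]: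
  "continuous_on A f \<Longrightarrow> continuous_on A (\<lambda>x. scaled_erfc (f x))"
  unfolding scaled_erfc_def by (intro continuous_intros)

lemma gauss_dominated_integrable:
  fixes f :: "real \<Rightarrow> complex"
  assumes "continuous_on UNIV f" "\<And>u. u \<le> 0 \<Longrightarrow> cmod (f u) \<le> K * exp (- (2 * u\<^sup>2))"
  shows "set_integrable lborel {..0} f"
proof -
  have "integrable lborel (\<lambda>u::real. K * exp (- (2 * u\<^sup>2)))"
    using gaussian_integral_real(1)[of 2] by (intro integrable_mult_right) auto
  then show ?thesis unfolding set_integrable_def
  proof (rule Bochner_Integration.integrable_bound)
    show "(\<lambda>u. indicat_real {..0} u *\<^sub>R f u) \<in> borel_measurable lborel"
      using assms(1) by (intro borel_measurable_scaleR borel_measurable_indicator) (auto intro!: borel_measurable_continuous_onI)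
    have "K \<ge> 0" using order_trans[OF norm_ge_zero assms(2)[of 0]] by simp
    then show "AE u in lborel. norm (indicat_real {..0} u *\<^sub>R f u) \<le> norm (K * exp (- (2 * u\<^sup>2)))"
      using assms(2) by (auto simp: indicator_def)
  qed
qed

lemma wronskian_edge_integrable: "set_integrable lborel {..0} (wronskian (edge_fun w) (edge_fun z))"
proof -
  define R where "R = max (cmod z) (cmod w)"
  have R: "cmod z \<le> R" "cmod w \<le> R" by (auto simp: R_def)
  let ?M = "scaled_erfc_max (sqrt 2 * R)"
  show ?thesis
  proof (rule gauss_dominated_integrable)
    show "continuous_on UNIV (wronskian (edge_fun w) (edge_fun z))"
      unfolding wronskian_edge_pair[abs_def] edge_pair_def by (intro continuous_intros) auto
    fix u :: real assume u: "u \<le> 0"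
    have s: "cmod (scaled_erfc (complex_of_real (sqrt 2) * (w - complex_of_real u)) - scaled_erfc (complex_of_real (sqrt 2) * (z - complex_of_real u))) \<le> ?M + ?M"
      by (intro order_trans[OF norm_triangle_ineq4] add_mono scaled_erfc_bound Re_edge_arg R u)
    have "cmod (wronskian (edge_fun w) (edge_fun z) u) = cmod (edge_pair z w u) *
       cmod (scaled_erfc (complex_of_real (sqrt 2) * (w - complex_of_real u)) - scaled_erfc (complex_of_real (sqrt 2) * (z - complex_of_real u))) / (sqrt 2 * pi)"
      unfolding wronskian_edge_pair norm_divide norm_mult by simp
    also have "\<dots> \<le> (exp (12 * R\<^sup>2) * exp (- (2 * u\<^sup>2))) * (?M + ?M) / (sqrt 2 * pi)"
      using edge_pair_bound[OF R, of u] s by (intro divide_right_mono mult_mono) auto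
    finally show "cmod (wronskian (edge_fun w) (edge_fun z) u) \<le> exp (12 * R\<^sup>2) * (?M + ?M) / (sqrt 2 * pi) * exp (- (2 * u\<^sup>2))"
      by (simp add: mult_ac)
  qed
qed

section \<open>Antisymmetry and derivative of the edge integral\<close>

lemma edge_int_refl: "edge_int w w = 0"
  by (simp add: edge_int_def wronskian_edge set_lebesgue_integral_def)

lemma edge_int_antisym: "edge_int w z = - edge_int z w"
proof -
  have "wronskian (edge_fun z) (edge_fun w) u = - wronskian (edge_fun w) (edge_fun z) u" for u
    by (simp add: wronskian_edge)
  then show ?thesis by (simp add: edge_int_def set_lebesgue_integral_def)
qed

text \<open>The \<open>z\<close>-derivative of \<open>edge_int\<close> in closed form. Its two terms
  will be the limits of the two inhomogeneous terms in the equation of the pre-kernel.\<close>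

definition edge_int_deriv :: "complex \<Rightarrow> complex \<Rightarrow> complex" where
  "edge_int_deriv z w = exp (- (z - w)\<^sup>2) * erfc (z + w) -
     exp (- 2 * z\<^sup>2) * erfc (complex_of_real (sqrt 2) * w) / complex_of_real (sqrt 2)"

text \<open>Antiderivative in \<open>u\<close> of the \<open>z\<close>-derivative of the Wronskian.\<close>

definition edge_prim :: "complex \<Rightarrow> complex \<Rightarrow> real \<Rightarrow> complex" where
  "edge_prim z w u = - edge_fun w u * edge_gauss z u +
     exp (- (z - w)\<^sup>2) * erfc (z + w - 2 * complex_of_real u) / complex_of_real (sqrt pi)"

lemma edge_prim_0: "complex_of_real (sqrt pi) * edge_prim z w 0 = edge_int_deriv z w"
proof -
  have "sqrt pi * sqrt (2 / pi) / 2 = 1 / sqrt 2" by (simp add: real_sqrt_divide field_simps)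
  then have c: "complex_of_real (sqrt pi) * complex_of_real (sqrt (2 / pi)) / 2 = 1 / complex_of_real (sqrt 2)"
    by (metis of_real_1 of_real_divide of_real_mult of_real_numeral)
  have "complex_of_real (sqrt pi) * edge_prim z w 0 =
      - (complex_of_real (sqrt pi) * complex_of_real (sqrt (2 / pi)) / 2) * (erfc (complex_of_real (sqrt 2) * w) * exp (- 2 * z\<^sup>2))
      + exp (- (z - w)\<^sup>2) * erfc (z + w)"
    by (simp add: edge_prim_def edge_fun_def edge_gauss_def algebra_simps)
  then show ?thesis unfolding c edge_int_deriv_def by simp
qed

lemma edge_prim_bound:
  assumes "cmod z \<le> R" "cmod w \<le> R" "u \<le> 0"
  shows "cmod (edge_prim z w u) \<le> (scaled_erfc_max (sqrt 2 * R) / (sqrt 2 * pi) + scaled_erfc_max (2 * R) / pi) * exp (12 * R\<^sup>2) * exp (- (2 * u\<^sup>2))"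
proof -
  have 2: "exp (- (z - w)\<^sup>2) * erfc (z + w - 2 * complex_of_real u) / complex_of_real (sqrt pi) =
      edge_pair z w u * scaled_erfc (z + w - 2 * complex_of_real u) / complex_of_real pi"
  proof -
    have "exp (- (z - w)\<^sup>2) * exp (- (z + w - 2 * complex_of_real u)\<^sup>2) = edge_pair z w u"
      unfolding edge_pair_def mult_exp_exp by (rule arg_cong[where f=exp]) (simp add: power2_eq_square algebra_simps)
    moreover have "complex_of_real (sqrt pi) * complex_of_real (sqrt pi) = complex_of_real pi" by (simp flip: of_real_mult)
    ultimately show ?thesis unfolding erfc_eq_scaled by (simp add: mult.assoc[symmetric])
  qed
  have "- (2 * R) \<le> Re (z + w - 2 * complex_of_real u)"
    using assms abs_Re_le_cmod[of z] abs_Re_le_cmod[of w] by simp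
  then have s2: "cmod (scaled_erfc (z + w - 2 * complex_of_real u)) \<le> scaled_erfc_max (2 * R)" by (rule scaled_erfc_bound)
  have s1: "cmod (scaled_erfc (complex_of_real (sqrt 2) * (w - complex_of_real u))) \<le> scaled_erfc_max (sqrt 2 * R)"
    by (intro scaled_erfc_bound Re_edge_arg assms)
  let ?b = "exp (12 * R\<^sup>2) * exp (- (2 * u\<^sup>2))"
  have "cmod (edge_prim z w u) \<le> cmod (edge_pair z w u) * cmod (scaled_erfc (complex_of_real (sqrt 2) * (w - complex_of_real u))) / (sqrt 2 * pi)
      + cmod (edge_pair z w u) * cmod (scaled_erfc (z + w - 2 * complex_of_real u)) / pi"
    unfolding edge_prim_def mult_minus_left edge_fun_gauss 2
    by (rule order_trans[OF norm_triangle_ineq]) (simp add: norm_mult norm_divide)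
  also have "\<dots> \<le> ?b * scaled_erfc_max (sqrt 2 * R) / (sqrt 2 * pi) + ?b * scaled_erfc_max (2 * R) / pi"
    using edge_pair_bound[OF assms(1,2), of u] s1 s2
    by (intro add_mono divide_right_mono mult_mono) auto
  finally show ?thesis by (simp add: algebra_simps)
qed

definition edge_wronskian_deriv :: "complex \<Rightarrow> complex \<Rightarrow> real \<Rightarrow> complex" where
  "edge_wronskian_deriv z w u = edge_fun w u * (- 4 * (z - complex_of_real u) * edge_gauss z u) + edge_gauss w u * edge_gauss z u"

lemma wronskian_deriv_first:
  "((\<lambda>z. wronskian (edge_fun w) (edge_fun z) u) has_field_derivative edge_wronskian_deriv z w u) (at z within A)"
  unfolding wronskian_edge edge_wronskian_deriv_def
  by (auto intro!: derivative_eq_intros edge_fun_deriv_first edge_gauss_deriv_first)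

text \<open>The product of the two Gaussians depends on \<open>u\<close> only through
  \<open>z + w - 2 * u\<close>, so the \<open>erfc\<close> term of \<open>edge_prim\<close> has
  twice this product as its derivative: one copy cancels against the product rule, the other is the
  second term of \<open>edge_wronskian_deriv\<close>.\<close>

lemma edge_prim_deriv: "(edge_prim z w has_vector_derivative edge_wronskian_deriv z w u) (at u within A)"
proof -
  have g: "edge_gauss w u * edge_gauss z u = 2 / complex_of_real pi * (exp (- (z - w)\<^sup>2) * exp (- (z + w - 2 * complex_of_real u)\<^sup>2))" for u
  proof -
    have "exp (- 2 * (w - complex_of_real u)\<^sup>2) * exp (- 2 * (z - complex_of_real u)\<^sup>2) = exp (- (z - w)\<^sup>2) * exp (- (z + w - 2 * complex_of_real u)\<^sup>2)"
      unfolding mult_exp_exp by (rule arg_cong[where f=exp]) (simp add: power2_eq_square algebra_simps)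
    moreover have "complex_of_real (sqrt (2 / pi)) * complex_of_real (sqrt (2 / pi)) = 2 / complex_of_real pi" by (simp flip: of_real_mult)
    moreover have "(c * a) * (c * b) = (c * c) * (a * b)" for a b c :: complex by simp
    ultimately show ?thesis unfolding edge_gauss_def by (simp only:)
  qed
  have sp: "complex_of_real (sqrt pi) * complex_of_real (sqrt pi) = complex_of_real pi" by (simp flip: of_real_mult)
  have e: "((\<lambda>v. exp (- (z - w)\<^sup>2) * erfc (z + w - 2 * v) / complex_of_real (sqrt pi)) has_field_derivative
      4 / complex_of_real pi * (exp (- (z - w)\<^sup>2) * exp (- (z + w - 2 * v)\<^sup>2))) (at v)" for v
    unfolding sp[symmetric] by (auto intro!: derivative_eq_intros)
  have "(edge_prim z w has_vector_derivative
      ((- edge_fun w u * (4 * (z - complex_of_real u) * edge_gauss z u) + - edge_gauss w u * edge_gauss z u) +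
      4 / complex_of_real pi * (exp (- (z - w)\<^sup>2) * exp (- (z + w - 2 * complex_of_real u)\<^sup>2)))) (at u)"
    unfolding edge_prim_def[abs_def]
    by (intro has_vector_derivative_add has_vector_derivative_mult has_vector_derivative_minus
        edge_fun_vector_derivative edge_gauss_vector_derivative has_vector_derivative_real_field e)
  also have "(- edge_fun w u * (4 * (z - complex_of_real u) * edge_gauss z u) + - edge_gauss w u * edge_gauss z u) +
      4 / complex_of_real pi * (exp (- (z - w)\<^sup>2) * exp (- (z + w - 2 * complex_of_real u)\<^sup>2)) = edge_wronskian_deriv z w u"
  proof -
    have "4 / complex_of_real pi * (exp (- (z - w)\<^sup>2) * exp (- (z + w - 2 * complex_of_real u)\<^sup>2)) = 2 * (edge_gauss w u * edge_gauss z u)"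
      unfolding g by simp
    then show ?thesis unfolding edge_wronskian_deriv_def by (simp add: algebra_simps)
  qed
  finally show ?thesis by (rule has_vector_derivative_at_within)
qed

text \<open>Differentiate under the integral over \<open>{- n..0}\<close>, where
  \<open>edge_prim\<close> evaluates the result, and let \<open>n\<close> grow: the boundary term at
  \<open>- n\<close> decays uniformly for \<open>z\<close> in a ball, so the derivatives converge
  uniformly and the limit can be differentiated.\<close>

lemma edge_int_has_field_derivative:
  "((\<lambda>z. edge_int z w) has_field_derivative edge_int_deriv z w) (at z)"
proof -
  define R where "R = max (cmod z) (cmod w) + 1"
  define B where "B = ball (0::complex) R"
  have zB: "z \<in> B" "w \<in> B" by (auto simp: B_def R_def)
  define I where "I = (\<lambda>n z. integral (cbox (- real n) 0) (wronskian (edge_fun w) (edge_fun z)))"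
  define I' where "I' = (\<lambda>n z. edge_prim z w 0 - edge_prim z w (- real n))"
  define K where "K = (scaled_erfc_max (sqrt 2 * R) / (sqrt 2 * pi) + scaled_erfc_max (2 * R) / pi) * exp (12 * R\<^sup>2)"
  have wc: "continuous_on A (wronskian (edge_fun w) (edge_fun x))" for A x
    unfolding wronskian_edge_pair[abs_def] edge_pair_def by (intro continuous_intros) auto
  have IT: "(\<lambda>n. I n x) \<longlonglongrightarrow> (LINT u:{..0}|lborel. wronskian (edge_fun w) (edge_fun x) u)" for x
  proof -
    have s: "set_integrable lborel {- real n..0} (wronskian (edge_fun w) (edge_fun x))" for n
      by (rule set_integrable_subset[OF wronskian_edge_integrable]) auto
    have "((\<lambda>a. set_lebesgue_integral lborel {a..0} (wronskian (edge_fun w) (edge_fun x))) \<longlongrightarrow>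
        (LINT u:{..0}|lborel. wronskian (edge_fun w) (edge_fun x) u)) at_bot"
      by (rule tendsto_set_lebesgue_integral_at_bot[OF _ wronskian_edge_integrable]) auto
    moreover have "filterlim (\<lambda>n. - real n) at_bot sequentially"
      by (intro filterlim_uminus_at_bot_at_top[THEN filterlim_compose] filterlim_real_sequentially)
    ultimately have "(\<lambda>n. set_lebesgue_integral lborel {- real n..0} (wronskian (edge_fun w) (edge_fun x))) \<longlonglongrightarrow>
        (LINT u:{..0}|lborel. wronskian (edge_fun w) (edge_fun x) u)"
      by (rule filterlim_compose)
    then show ?thesis unfolding I_def set_borel_integral_eq_integral(2)[OF s] by simp
  qed
  have "\<exists>g. \<forall>x\<in>B. (\<lambda>n. I n x) \<longlonglongrightarrow> g x \<and> (g has_field_derivative edge_prim x w 0) (at x within B)"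
  proof (rule has_complex_derivative_sequence)
    show "convex B" by (simp add: B_def)
    show "(I n has_field_derivative I' n x) (at x within B)" if x: "x \<in> B" for n x
    proof -
      have "(I n has_field_derivative integral (cbox (- real n) 0) (edge_wronskian_deriv x w)) (at x within B)"
        unfolding I_def
      proof (rule leibniz_rule_field_derivative[where fx = "\<lambda>x. edge_wronskian_deriv x w"])
        show "((\<lambda>z. wronskian (edge_fun w) (edge_fun z) u) has_field_derivative edge_wronskian_deriv x w u) (at x within B)" for x u
          by (rule wronskian_deriv_first)
        show "wronskian (edge_fun w) (edge_fun x) integrable_on cbox (- real n) 0" for x
          by (rule integrable_continuous[OF wc])
        show "continuous_on (B \<times> cbox (- real n) 0) (\<lambda>(x, t). edge_wronskian_deriv x w t)"
          unfolding edge_wronskian_deriv_def edge_fun_def edge_gauss_def case_prod_beta by (intro continuous_intros)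
      qed (use x in \<open>auto simp: B_def\<close>)
      moreover have "integral (cbox (- real n) 0) (edge_wronskian_deriv x w) = I' n x"
        unfolding I'_def cbox_interval
        by (intro integral_unique fundamental_theorem_of_calculus edge_prim_deriv) auto
      ultimately show ?thesis by simp
    qed
    show "\<exists>N. \<forall>n x. N \<le> n \<longrightarrow> x \<in> B \<longrightarrow> cmod (I' n x - edge_prim x w 0) \<le> e" if e: "0 < e" for e
    proof -
      have "(\<lambda>n. K * exp (- (2 * (- real n)\<^sup>2))) \<longlonglongrightarrow> 0" by real_asymp
      from order_tendstoD(2)[OF this e] obtain N where N: "\<And>n. n \<ge> N \<Longrightarrow> K * exp (- (2 * (- real n)\<^sup>2)) < e"
        unfolding eventually_sequentially by blast
      have "cmod (I' n x - edge_prim x w 0) \<le> e" if "N \<le> n" "x \<in> B" for n x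
      proof -
        have "cmod (I' n x - edge_prim x w 0) = cmod (edge_prim x w (- real n))" by (simp add: I'_def)
        also have "\<dots> \<le> K * exp (- (2 * (- real n)\<^sup>2))"
          unfolding K_def using that zB(2) by (intro edge_prim_bound) (auto simp: B_def)
        finally show ?thesis using N[OF that(1)] by simp
      qed
      then show ?thesis by blast
    qed
    show "\<exists>x l. x \<in> B \<and> (\<lambda>n. I n x) \<longlonglongrightarrow> l" using IT zB by blast
  qed
  then obtain g where g: "\<And>x. x \<in> B \<Longrightarrow> (\<lambda>n. I n x) \<longlonglongrightarrow> g x" "\<And>x. x \<in> B \<Longrightarrow> (g has_field_derivative edge_prim x w 0) (at x within B)"
    by blast
  have gI: "complex_of_real (sqrt pi) * g x = edge_int x w" if "x \<in> B" for x
    unfolding edge_int_def using LIMSEQ_unique[OF g(1)[OF that] IT] by simp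
  have "((\<lambda>x. complex_of_real (sqrt pi) * g x) has_field_derivative complex_of_real (sqrt pi) * edge_prim z w 0) (at z within B)"
    by (intro DERIV_cmult g zB)
  then have "((\<lambda>x. complex_of_real (sqrt pi) * g x) has_field_derivative edge_int_deriv z w) (at z)"
    unfolding edge_prim_0 using at_within_open[of z B] zB by (simp add: B_def)
  then show ?thesis
    by (rule has_field_derivative_transform_within_open[of _ _ _ B]) (use zB gI in \<open>auto simp: B_def\<close>)
qed

lemma edge_int_holomorphic: "(\<lambda>z. edge_int z w) holomorphic_on A" "(\<lambda>z. edge_int w z) holomorphic_on A"
proof -
  show 1: "(\<lambda>z. edge_int z w) holomorphic_on A"
    unfolding holomorphic_on_def field_differentiable_def
    using has_field_derivative_at_within[OF edge_int_has_field_derivative] by blast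
  have "(\<lambda>z. - edge_int z w) holomorphic_on A" by (intro holomorphic_on_minus 1)
  then show "(\<lambda>z. edge_int w z) holomorphic_on A" by (subst edge_int_antisym)
qed

section \<open>The limit of large particle number\<close>

lemma Ln_quadratic_approx:
  fixes x :: complex
  assumes "cmod x \<le> 1 / 2"
  shows "cmod (Ln (1 + x) - x + x\<^sup>2 / 2) \<le> 2 * cmod x ^ 3"
proof -
  define r where "r = cmod x"
  define h where "h = (\<lambda>x. Ln (1 + x) - x + x\<^sup>2 / 2)"
  have r: "0 \<le> r" "r \<le> 1 / 2" using assms by (auto simp: r_def)
  have "norm (h x - h 0) \<le> (2 * r ^ 2) * norm (x - 0)"
  proof (rule field_differentiable_bound[where S = "cball 0 r"])
    fix z :: complex assume z: "z \<in> cball 0 r"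
    then have cz: "cmod z \<le> r" by simp
    then have "Re (1 + z) > 0" using abs_Re_le_cmod[of z] r by auto
    then have nn: "1 + z \<notin> \<real>\<^sub>\<le>\<^sub>0" by (auto simp: complex_nonpos_Reals_iff)
    then have nz: "1 + z \<noteq> 0" by auto
    have "(h has_field_derivative (1 / (1 + z) - 1 + z)) (at z)"
      unfolding h_def using nn by (auto intro!: derivative_eq_intros simp: inverse_eq_divide)
    also have "1 / (1 + z) - 1 + z = z\<^sup>2 / (1 + z)" using nz by (simp add: field_simps power2_eq_square)
    finally show "(h has_field_derivative z\<^sup>2 / (1 + z)) (at z within cball 0 r)" by (rule has_field_derivative_at_within)
    have "1 / 2 \<le> cmod (1 + z)" using norm_triangle_ineq4[of "1 + z" z] cz r by simp
    then have "cmod (z\<^sup>2 / (1 + z)) \<le> (cmod z)\<^sup>2 / (1 / 2)"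
      unfolding norm_divide norm_power by (intro divide_left_mono) auto
    also have "\<dots> \<le> 2 * r ^ 2" using cz by (simp add: power_mono)
    finally show "norm (z\<^sup>2 / (1 + z)) \<le> 2 * r ^ 2" .
  qed (auto simp: r_def)
  then show ?thesis by (simp add: h_def r_def power2_eq_square power3_eq_cube)
qed

text \<open>At \<open>s = laplace_point n v\<close>, the derivative of \<open>poisson_tail (Suc n)\<close> is a constant multiple of \<open>laplace_fun n v\<close>.\<close>

definition laplace_fun :: "nat \<Rightarrow> complex \<Rightarrow> complex" where
  "laplace_fun n v = (1 + complex_of_real (sqrt (2 / real n)) * v) ^ n * exp (- (complex_of_real (sqrt (2 * real n)) * v))"

lemma sqrt_scale: "real n * sqrt (2 / real n) = sqrt (2 * real n)"
  by (cases "n = 0") (auto simp: real_sqrt_divide real_sqrt_mult field_simps)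

text \<open>The logarithm is \<open>n * (Ln (1 + x) - x)\<close> with
  \<open>x = sqrt (2 / n) * v\<close>. Its quadratic term is exactly \<open>- v\<^sup>2\<close>, and
  the cubic remainder is of order \<open>1 / sqrt n\<close>.\<close>

lemma laplace_fun_uniform_limit:
  assumes R: "R > 0"
  shows "uniform_limit (cball 0 R) laplace_fun (\<lambda>v. exp (- v\<^sup>2)) sequentially"
proof -
  define x where "x = (\<lambda>n v. complex_of_real (sqrt (2 / real n)) * v)"
  define g where "g = (\<lambda>n v. of_nat n * (Ln (1 + x n v) - x n v))"
  have small: "eventually (\<lambda>n. sqrt (2 / real n) * R \<le> 1 / 2 \<and> n > 0) sequentially"
  proof -
    have "(\<lambda>n. sqrt (2 / real n) * R) \<longlonglongrightarrow> 0" by real_asymp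
    then have "\<forall>\<^sub>F n in sequentially. sqrt (2 / real n) * R < 1 / 2" by (rule order_tendstoD(2)) simp
    then show ?thesis using eventually_gt_at_top[of 0] by eventually_elim auto
  qed
  have xb: "cmod (x n v) \<le> sqrt (2 / real n) * R" if "v \<in> cball 0 R" for n v
    using that unfolding x_def norm_mult by (auto intro!: mult_left_mono)
  have lim_g: "uniform_limit (cball 0 R) g (\<lambda>v. - v\<^sup>2) sequentially"
  proof (rule uniform_limitI)
    fix e :: real assume e: "e > 0"
    have "(\<lambda>n. real n * (2 * (sqrt (2 / real n) * R) ^ 3)) \<longlonglongrightarrow> 0" using R by real_asymp
    from order_tendstoD(2)[OF this e] small
    show "\<forall>\<^sub>F n in sequentially. \<forall>v\<in>cball 0 R. dist (g n v) (- v\<^sup>2) < e"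
    proof eventually_elim
      case (elim n)
      show ?case
      proof
        fix v :: complex assume v: "v \<in> cball 0 R"
        have "(complex_of_real (sqrt (2 / real n)))\<^sup>2 = 2 / of_nat n"
          using elim by (simp flip: of_real_power)
        then have "of_nat n * ((x n v)\<^sup>2 / 2) = v\<^sup>2" using elim by (simp add: x_def power_mult_distrib)
        then have "g n v - (- v\<^sup>2) = of_nat n * (Ln (1 + x n v) - x n v + (x n v)\<^sup>2 / 2)"
          unfolding g_def by (simp only: distrib_left diff_minus_eq_add)
        then have "dist (g n v) (- v\<^sup>2) = real n * cmod (Ln (1 + x n v) - x n v + (x n v)\<^sup>2 / 2)"
          by (simp add: dist_norm norm_mult)
        also have "\<dots> \<le> real n * (2 * cmod (x n v) ^ 3)"
          using Ln_quadratic_approx[of "x n v"] xb[OF v, of n] elim by (intro mult_left_mono) auto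
        also have "\<dots> \<le> real n * (2 * (sqrt (2 / real n) * R) ^ 3)"
          using xb[OF v, of n] by (intro mult_left_mono power_mono) auto
        finally show "dist (g n v) (- v\<^sup>2) < e" using elim by linarith
      qed
    qed
  qed
  have "uniform_limit (cball 0 R) (\<lambda>n v. exp (g n v)) (\<lambda>v. exp (- v\<^sup>2)) sequentially"
  proof (rule uniform_limit_compose_uniformly_continuous_on[OF lim_g, where B = "cball 0 (R\<^sup>2 + 1)"])
    show "uniformly_continuous_on (cball 0 (R\<^sup>2 + 1)) (exp :: complex \<Rightarrow> complex)"
      by (intro compact_uniformly_continuous continuous_intros) auto
    have "\<forall>\<^sub>F n in sequentially. \<forall>v\<in>cball 0 R. dist (g n v) (- v\<^sup>2) < 1"
      by (rule uniform_limitD[OF lim_g]) simp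
    then show "\<forall>\<^sub>F n in sequentially. \<forall>v\<in>cball 0 R. g n v \<in> cball 0 (R\<^sup>2 + 1)"
    proof eventually_elim
      case (elim n)
      have "cmod (g n v) \<le> R\<^sup>2 + 1" if v: "v \<in> cball 0 R" for v
      proof -
        have "cmod (g n v) \<le> cmod (g n v - (- v\<^sup>2)) + cmod (- v\<^sup>2)"
          by (metis diff_add_cancel norm_triangle_ineq)
        moreover have "cmod (g n v - (- v\<^sup>2)) < 1" using elim v by (simp add: dist_norm)
        moreover have "cmod (- v\<^sup>2) \<le> R\<^sup>2" using v by (simp add: norm_power power_mono)
        ultimately show ?thesis by linarith
      qed
      then show ?case by simp
    qed
  qed simp
  then show ?thesis
  proof (rule uniform_limit_cong[THEN iffD1, rotated 2])
    show "\<forall>\<^sub>F n in sequentially. \<forall>v\<in>cball 0 R. exp (g n v) = laplace_fun n v"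
      using small
    proof eventually_elim
      case (elim n)
      show ?case
      proof
        fix v :: complex assume v: "v \<in> cball 0 R"
        have "cmod (x n v) \<le> 1 / 2" using xb[OF v, of n] elim by linarith
        then have nz: "1 + x n v \<noteq> 0"
          by (metis add.commute add_eq_0_iff le_divide_eq_1_pos norm_minus_cancel norm_one not_le numeral_le_one_iff semiring_norm(69) zero_less_numeral)
        have "of_nat n * x n v = complex_of_real (sqrt (2 * real n)) * v"
          unfolding x_def sqrt_scale[symmetric] by simp
        then have "exp (g n v) = exp (of_nat n * Ln (1 + x n v)) * exp (- (complex_of_real (sqrt (2 * real n)) * v))"
          unfolding g_def by (simp add: right_diff_distrib exp_diff exp_minus inverse_eq_divide)
        also have "exp (of_nat n * Ln (1 + x n v)) = (1 + x n v) ^ n"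
          using nz by (simp add: exp_of_nat_mult)
        finally show "exp (g n v) = laplace_fun n v" unfolding laplace_fun_def x_def .
      qed
    qed
  qed simp
qed

definition laplace_real :: "nat \<Rightarrow> real \<Rightarrow> real" where
  "laplace_real n v = (1 + sqrt (2 / real n) * v) ^ n * exp (- (sqrt (2 * real n) * v))"

lemma laplace_fun_of_real: "laplace_fun n (complex_of_real v) = complex_of_real (laplace_real n v)"
  by (simp add: laplace_fun_def laplace_real_def exp_of_real[symmetric])

lemma laplace_real_tendsto: "(\<lambda>n. laplace_real n v) \<longlonglongrightarrow> exp (- v\<^sup>2)"
proof -
  have "(\<lambda>n. laplace_fun n (complex_of_real v)) \<longlonglongrightarrow> exp (- (complex_of_real v)\<^sup>2)"
    by (rule tendsto_uniform_limitI[OF laplace_fun_uniform_limit[of "\<bar>v\<bar> + 1"]]) auto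
  then have "(\<lambda>n. complex_of_real (laplace_real n v)) \<longlonglongrightarrow> complex_of_real (exp (- v\<^sup>2))"
    unfolding laplace_fun_of_real by (simp add: exp_of_real[symmetric])
  then show ?thesis by (simp only: tendsto_of_real_iff)
qed

lemma one_plus_le_exp_neg:
  assumes "- 1 \<le> x" "x \<le> (0::real)"
  shows "1 + x \<le> exp (x - x\<^sup>2 / 2)"
proof (cases "x = -1")
  case False
  then have x: "- 1 < x" using assms by simp
  have "(\<lambda>x. x - x\<^sup>2 / 2 - ln (1 + x)) x \<ge> (\<lambda>x. x - x\<^sup>2 / 2 - ln (1 + x)) 0"
  proof (rule DERIV_nonpos_imp_nonincreasing[OF assms(2)])
    fix y assume y: "x \<le> y" "y \<le> 0"
    have "((\<lambda>x. x - x\<^sup>2 / 2 - ln (1 + x)) has_real_derivative (1 - y - 1 / (1 + y))) (at y)"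
      using x y by (auto intro!: derivative_eq_intros)
    moreover have "1 - y - 1 / (1 + y) = - (y\<^sup>2) / (1 + y)" using x y by (simp add: field_simps power2_eq_square)
    moreover have "- (y\<^sup>2) / (1 + y) \<le> 0" using x y by (intro divide_nonpos_pos) auto
    ultimately show "\<exists>z. ((\<lambda>x. x - x\<^sup>2 / 2 - ln (1 + x)) has_real_derivative z) (at y) \<and> z \<le> 0" by metis
  qed
  then have "ln (1 + x) \<le> x - x\<^sup>2 / 2" by simp
  then have "exp (ln (1 + x)) \<le> exp (x - x\<^sup>2 / 2)" by (simp only: exp_le_cancel_iff)
  then show ?thesis using x by simp
qed simp

text \<open>The full gain \<open>x\<^sup>2 / 2\<close> is impossible for \<open>x > 0\<close>, where
  \<open>x - ln (1 + x)\<close> grows only linearly; the denominator accounts for this.\<close>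

lemma one_plus_le_exp_pos:
  assumes "0 \<le> (x::real)"
  shows "1 + x \<le> exp (x - x\<^sup>2 / (2 * (1 + x)))"
proof -
  have "(\<lambda>x. x - x\<^sup>2 / (2 * (1 + x)) - ln (1 + x)) 0 \<le> (\<lambda>x. x - x\<^sup>2 / (2 * (1 + x)) - ln (1 + x)) x"
  proof (rule DERIV_nonneg_imp_nondecreasing[OF assms])
    fix y assume y: "0 \<le> y" "y \<le> x"
    have "((\<lambda>x. x - x\<^sup>2 / (2 * (1 + x)) - ln (1 + x)) has_real_derivative
        (1 - (2 * y * (2 * (1 + y)) - y\<^sup>2 * 2) / (2 * (1 + y))\<^sup>2 - 1 / (1 + y))) (at y)"
      using y by (auto intro!: derivative_eq_intros simp: power2_eq_square)
    moreover have "1 - (2 * y * (2 * (1 + y)) - y\<^sup>2 * 2) / (2 * (1 + y))\<^sup>2 - 1 / (1 + y) = y\<^sup>2 / (2 * (1 + y)\<^sup>2)"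
    proof -
      have "1 + y \<noteq> 0" using y by simp
      then show ?thesis by (simp add: divide_simps) (simp add: power2_eq_square algebra_simps)
    qed
    moreover have "y\<^sup>2 / (2 * (1 + y)\<^sup>2) \<ge> 0" by simp
    ultimately show "\<exists>z. ((\<lambda>x. x - x\<^sup>2 / (2 * (1 + x)) - ln (1 + x)) has_real_derivative z) (at y) \<and> 0 \<le> z" by metis
  qed
  then have "ln (1 + x) \<le> x - x\<^sup>2 / (2 * (1 + x))" by simp
  then have "exp (ln (1 + x)) \<le> exp (x - x\<^sup>2 / (2 * (1 + x)))" by (simp only: exp_le_cancel_iff)
  then show ?thesis using assms by simp
qed

lemma laplace_real_le_exp:
  assumes "1 + sqrt (2 / real n) * v \<le> exp (sqrt (2 / real n) * v - r)" "0 \<le> 1 + sqrt (2 / real n) * v"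
  shows "laplace_real n v \<le> exp (- (real n * r))"
proof -
  let ?x = "sqrt (2 / real n) * v"
  have "laplace_real n v \<le> exp (?x - r) ^ n * exp (- (sqrt (2 * real n) * v))"
    unfolding laplace_real_def using assms by (intro mult_right_mono power_mono) auto
  also have "exp (?x - r) ^ n = exp (sqrt (2 * real n) * v - real n * r)"
    unfolding sqrt_scale[symmetric] by (simp add: exp_of_nat_mult[symmetric] right_diff_distrib mult.assoc)
  finally show ?thesis by (simp add: mult_exp_exp)
qed

text \<open>An integrable majorant independent of \<open>n\<close>. On the left, where
  \<open>v \<ge> - sqrt (n / 2)\<close> keeps the base non-negative, the decay is Gaussian; on the
  right it is \<open>exp (1 - v / 2)\<close>. Both lie below the stated rational function.\<close>

lemma laplace_real_bound:
  assumes n: "n > 0" and v: "v \<ge> - sqrt (real n / 2)"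
  shows "\<bar>laplace_real n v\<bar> \<le> 8 * exp 1 * inverse (1 + v\<^sup>2)"
proof -
  let ?x = "sqrt (2 / real n) * v"
  have x2: "?x\<^sup>2 = 2 / real n * v\<^sup>2" using n by (simp add: power_mult_distrib)
  have "sqrt (2 / real n) * (- sqrt (real n / 2)) \<le> ?x" using v by (intro mult_left_mono) auto
  then have x1: "- 1 \<le> ?x" using n by (simp flip: real_sqrt_mult)
  have e1: "(1::real) \<le> 8 * exp 1"
    using one_le_exp_iff[of "1::real"] by linarith
  have "laplace_real n v \<le> 8 * exp 1 * inverse (1 + v\<^sup>2)"
  proof (cases "v \<le> 0")
    case True
    then have "?x \<le> 0" by (simp add: mult_nonneg_nonpos)
    then have "laplace_real n v \<le> exp (- (real n * (?x\<^sup>2 / 2)))"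
      using x1 by (intro laplace_real_le_exp one_plus_le_exp_neg) auto
    also have "\<dots> = exp (- (v\<^sup>2))" unfolding x2 using n by simp
    also have "\<dots> \<le> inverse (1 + v\<^sup>2)"
      using exp_ge_add_one_self[of "v\<^sup>2"] by (simp add: exp_minus le_imp_inverse_le add_pos_nonneg)
    also have "\<dots> \<le> 8 * exp 1 * inverse (1 + v\<^sup>2)"
      using mult_right_mono[OF e1, of "inverse (1 + v\<^sup>2)"] by (simp add: add_nonneg_nonneg)
    finally show ?thesis .
  next
    case False
    then have v0: "v > 0" by simp
    then have x0: "?x \<ge> 0" by simp
    then have "laplace_real n v \<le> exp (- (real n * (?x\<^sup>2 / (2 * (1 + ?x)))))"
      by (intro laplace_real_le_exp one_plus_le_exp_pos) auto
    also have "real n * (?x\<^sup>2 / (2 * (1 + ?x))) = v\<^sup>2 / (1 + ?x)"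
      unfolding x2 using n x0 by (simp add: divide_simps)
    \<comment> \<open>As \<open>n \<ge> 1\<close>, \<open>?x \<le> 2 * v\<close>, and
      \<open>v\<^sup>2 / (1 + 2 * v)\<close> is at least \<open>v / 2 - 1\<close>.\<close>
    also have "exp (- (v\<^sup>2 / (1 + ?x))) \<le> exp (1 - v / 2)"
    proof -
      have "2 / real n \<le> 2" using n by (simp add: divide_le_eq)
      then have "sqrt (2 / real n) \<le> sqrt 2" by (rule real_sqrt_le_mono)
      then have "?x \<le> sqrt 2 * v" using v0 by (intro mult_right_mono) auto
      also have "\<dots> \<le> 2 * v" using v0 sqrt2_less_2 by (intro mult_right_mono) auto
      finally have "?x \<le> 2 * v" .
      then have "(v / 2 - 1) * (1 + ?x) \<le> v\<^sup>2"
      proof (cases "v / 2 - 1 \<ge> 0")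
        case True
        then have "(v / 2 - 1) * (1 + ?x) \<le> (v / 2 - 1) * (1 + 2 * v)" using \<open>?x \<le> 2 * v\<close> by (intro mult_left_mono) auto
        also have "\<dots> \<le> v\<^sup>2" using v0 by (simp add: algebra_simps power2_eq_square)
        finally show ?thesis .
      next
        case False
        then have "(v / 2 - 1) * (1 + ?x) \<le> 0" using x0 by (intro mult_nonpos_nonneg) auto
        then show ?thesis using zero_le_power2[of v] by linarith
      qed
      then have "v / 2 - 1 \<le> v\<^sup>2 / (1 + ?x)" using x0 by (simp add: le_divide_eq)
      then show ?thesis by simp
    qed
    also have "\<dots> = exp 1 * inverse (exp (v / 2))" by (simp only: exp_diff divide_inverse)
    \<comment> \<open>The constant 8 comes from the quadratic Taylor bound
      \<open>exp (v / 2) \<ge> 1 + v / 2 + v\<^sup>2 / 8\<close>.\<close>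
    also have "\<dots> \<le> exp 1 * inverse ((1 + v\<^sup>2) / 8)"
    proof -
      have "(1 + v\<^sup>2) / 8 \<le> 1 + v / 2 + (v / 2)\<^sup>2 / 2" using v0 by (simp add: power2_eq_square)
      also have "\<dots> \<le> exp (v / 2)" using v0 by (intro exp_lower_Taylor_quadratic) auto
      finally show ?thesis by (intro mult_left_mono le_imp_inverse_le) (auto simp: add_pos_nonneg)
    qed
    also have "\<dots> = 8 * exp 1 * inverse (1 + v\<^sup>2)" by (simp add: inverse_eq_divide)
    finally show ?thesis .
  qed
  moreover have "laplace_real n v \<ge> 0" unfolding laplace_real_def using x1 by auto
  ultimately show ?thesis by simp
qed

section \<open>Poisson tails and Stirling's formula\<close>

lemma integrable_inverse_one_plus_square: "integrable lborel (\<lambda>v::real. inverse (1 + v\<^sup>2))"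
  using integrable_inverse_1_plus_square by (simp add: set_integrable_def)

text \<open>For \<open>s \<ge> 0\<close> the probability that a Poisson variable of mean
  \<open>s\<close> is less than \<open>n\<close>; in other words, a regularised upper incomplete
  gamma function.\<close>

definition poisson_tail :: "nat \<Rightarrow> complex \<Rightarrow> complex" where
  "poisson_tail n s = exp (- s) * exp_trunc n s"

text \<open>The constant in front of \<open>laplace_fun\<close> in the derivative of the tail.
  Stirling's formula says that it tends to \<open>1 / sqrt pi\<close>.\<close>

definition laplace_coeff :: "nat \<Rightarrow> real" where
  "laplace_coeff n = sqrt (2 * real n) * real n ^ n * exp (- real n) / fact n"

lemma exp_trunc_deriv: "(exp_trunc (Suc n) has_field_derivative exp_trunc n s) (at s within A)"
proof (induction n)
  case 0
  then show ?case by (simp add: exp_trunc_def[abs_def])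
next
  case (Suc n)
  have e: "exp_trunc (Suc (Suc n)) = (\<lambda>s. exp_trunc (Suc n) s + s ^ Suc n / fact (Suc n))"
    by (auto simp: exp_trunc_def)
  have "((\<lambda>s. s ^ Suc n / fact (Suc n)) has_field_derivative (of_nat (Suc n) * s ^ n / fact (Suc n))) (at s within A)" for s :: complex
    by (intro DERIV_cdivide DERIV_cong[OF DERIV_power[OF DERIV_ident]]) simp
  moreover have "of_nat (Suc n) * s ^ n / fact (Suc n) = s ^ n / fact n" for s :: complex
    by (simp add: divide_simps del: of_nat_Suc)
  ultimately show ?case unfolding e using DERIV_add[OF Suc] by (auto simp: exp_trunc_def)
qed

lemma poisson_tail_deriv: "(poisson_tail (Suc n) has_field_derivative - (exp (- s) * s ^ n / fact n)) (at s within A)"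
proof -
  have "((\<lambda>s. exp (- s) * exp_trunc (Suc n) s) has_field_derivative (exp (- s) * (- 1) * exp_trunc (Suc n) s + exp (- s) * exp_trunc n s)) (at s within A)"
    by (auto intro!: derivative_eq_intros exp_trunc_deriv)
  moreover have "exp_trunc (Suc n) s = exp_trunc n s + s ^ n / fact n" by (simp add: exp_trunc_def)
  ultimately show ?thesis unfolding poisson_tail_def[abs_def] by (simp add: algebra_simps)
qed

definition laplace_point :: "nat \<Rightarrow> complex \<Rightarrow> complex" where
  "laplace_point n v = of_nat n + complex_of_real (sqrt (2 * real n)) * v"

lemma exp_power_laplace:
  assumes "n > 0"
  shows "exp (- laplace_point n v) * laplace_point n v ^ n = complex_of_real (real n ^ n * exp (- real n)) * laplace_fun n v"
proof -
  have "laplace_point n v = of_nat n * (1 + complex_of_real (sqrt (2 / real n)) * v)"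
    unfolding laplace_point_def sqrt_scale[symmetric] by (simp add: algebra_simps)
  then have p: "laplace_point n v ^ n = of_nat n ^ n * (1 + complex_of_real (sqrt (2 / real n)) * v) ^ n"
    by (simp only: power_mult_distrib)
  have "exp (- laplace_point n v) = exp (- of_nat n) * exp (- (complex_of_real (sqrt (2 * real n)) * v))"
    by (simp add: laplace_point_def mult_exp_exp)
  then show ?thesis unfolding p laplace_fun_def by (simp add: exp_of_real[symmetric] mult_ac)
qed

lemma poisson_tail_laplace_deriv:
  assumes "n > 0"
  shows "((\<lambda>v. poisson_tail (Suc n) (laplace_point n v)) has_field_derivative - (complex_of_real (laplace_coeff n) * laplace_fun n v)) (at v within A)"
proof -
  have "(laplace_point n has_field_derivative complex_of_real (sqrt (2 * real n))) (at v within A)"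
    unfolding laplace_point_def[abs_def] by (auto intro!: derivative_eq_intros)
  then have "((\<lambda>v. poisson_tail (Suc n) (laplace_point n v)) has_field_derivative
      - (exp (- laplace_point n v) * laplace_point n v ^ n / fact n) * complex_of_real (sqrt (2 * real n))) (at v within A)"
    by (rule DERIV_chain2[OF poisson_tail_deriv])
  then show ?thesis unfolding exp_power_laplace[OF assms] laplace_coeff_def by (simp add: mult_ac)
qed

lemma poisson_tail_at_top: "((\<lambda>x. poisson_tail n (complex_of_real x)) \<longlongrightarrow> 0) at_top"
proof -
  have "((\<lambda>x. complex_of_real (x ^ m / exp x) / fact m) \<longlongrightarrow> complex_of_real 0 / fact m) at_top" for m
    by (intro tendsto_intros tendsto_of_real tendsto_power_div_exp_0) simp
  then have "((\<lambda>x. \<Sum>m<n. complex_of_real (x ^ m / exp x) / fact m) \<longlongrightarrow> (\<Sum>m<n. complex_of_real 0 / fact m)) at_top"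
    by (intro tendsto_sum)
  moreover have "(\<Sum>m<n. complex_of_real (x ^ m / exp x) / fact m) = poisson_tail n (complex_of_real x)" for x
    unfolding poisson_tail_def exp_trunc_def sum_distrib_left
    by (intro sum.cong refl) (simp add: exp_minus inverse_eq_divide exp_of_real[symmetric] mult_ac)
  ultimately show ?thesis by simp
qed

lemma laplace_real_set_integrable:
  assumes n: "n > 0" and a: "a \<ge> - sqrt (real n / 2)"
  shows "set_integrable lborel {a..} (laplace_real n)"
proof -
  have "integrable lborel (\<lambda>v::real. 8 * exp 1 * inverse (1 + v\<^sup>2))"
    by (intro integrable_mult_right integrable_inverse_one_plus_square)
  then show ?thesis unfolding set_integrable_def
  proof (rule Bochner_Integration.integrable_bound)
    show "(\<lambda>v. indicat_real {a..} v *\<^sub>R laplace_real n v) \<in> borel_measurable lborel"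
      unfolding laplace_real_def by measurable
    show "AE v in lborel. norm (indicat_real {a..} v *\<^sub>R laplace_real n v) \<le> norm (8 * exp 1 * inverse (1 + v\<^sup>2))"
    proof (intro AE_I2)
      fix v :: real
      show "norm (indicat_real {a..} v *\<^sub>R laplace_real n v) \<le> norm (8 * exp 1 * inverse (1 + v\<^sup>2))"
        using laplace_real_bound[OF n, of v] a by (cases "v \<ge> a") (auto simp: abs_mult)
    qed
  qed
qed

text \<open>The tail vanishes at infinity, so it is minus the integral of its derivative. The
  condition on \<open>a\<close> means that the starting point \<open>laplace_point n a\<close> is
  non-negative.\<close>

lemma laplace_real_integral:
  assumes n: "n > 0" and a: "a \<ge> - sqrt (real n / 2)"
  shows "complex_of_real (laplace_coeff n * (LBINT v:{a..}. laplace_real n v)) = poisson_tail (Suc n) (laplace_point n (complex_of_real a))"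
proof -
  note i = laplace_real_set_integrable[OF n a]
  let ?b = "complex_of_real (laplace_coeff n)"
  have e: "complex_of_real (laplace_coeff n * (LBINT v:{a..L}. laplace_real n v)) =
      poisson_tail (Suc n) (laplace_point n (complex_of_real a)) - poisson_tail (Suc n) (laplace_point n (complex_of_real L))" if L: "L \<ge> a" for L
  proof -
    have h1: "((\<lambda>v. complex_of_real (laplace_coeff n * laplace_real n v)) has_integral
        (- poisson_tail (Suc n) (laplace_point n (complex_of_real L)) - (- poisson_tail (Suc n) (laplace_point n (complex_of_real a))))) {a..L}"
    proof (rule fundamental_theorem_of_calculus[OF L])
      fix v
      have "((\<lambda>v. - poisson_tail (Suc n) (laplace_point n v)) has_field_derivative ?b * laplace_fun n (complex_of_real v)) (at (complex_of_real v))"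
        using DERIV_minus[OF poisson_tail_laplace_deriv[OF n, of "complex_of_real v" UNIV]] by simp
      then have "((\<lambda>v. - poisson_tail (Suc n) (laplace_point n (complex_of_real v))) has_vector_derivative ?b * laplace_fun n (complex_of_real v)) (at v)"
        by (rule has_vector_derivative_real_field)
      then show "((\<lambda>v. - poisson_tail (Suc n) (laplace_point n (complex_of_real v))) has_vector_derivative complex_of_real (laplace_coeff n * laplace_real n v)) (at v within {a..L})"
        unfolding laplace_fun_of_real of_real_mult[symmetric] by (rule has_vector_derivative_at_within)
    qed
    have s: "set_integrable lborel {a..L} (laplace_real n)" by (rule set_integrable_subset[OF i]) auto
    have "(laplace_real n has_integral (LBINT v:{a..L}. laplace_real n v)) {a..L}"
      unfolding set_borel_integral_eq_integral(2)[OF s] by (rule integrable_integral[OF set_borel_integral_eq_integral(1)[OF s]])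
    then have "((\<lambda>v. laplace_coeff n * laplace_real n v) has_integral laplace_coeff n * (LBINT v:{a..L}. laplace_real n v)) {a..L}"
      by (rule has_integral_mult_right)
    then have h2: "((\<lambda>v. complex_of_real (laplace_coeff n * laplace_real n v)) has_integral complex_of_real (laplace_coeff n * (LBINT v:{a..L}. laplace_real n v))) {a..L}"
      by (rule has_integral_of_real)
    show ?thesis using has_integral_unique[OF h2 h1] by simp
  qed
  have t1: "((\<lambda>L. complex_of_real (laplace_coeff n * (LBINT v:{a..L}. laplace_real n v))) \<longlongrightarrow> complex_of_real (laplace_coeff n * (LBINT v:{a..}. laplace_real n v))) at_top"
    by (intro tendsto_intros tendsto_set_lebesgue_integral_at_top i) auto
  have t2: "((\<lambda>L. poisson_tail (Suc n) (laplace_point n (complex_of_real a)) - poisson_tail (Suc n) (laplace_point n (complex_of_real L))) \<longlongrightarrow>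
      poisson_tail (Suc n) (laplace_point n (complex_of_real a)) - 0) at_top"
  proof (intro tendsto_intros)
    have "filterlim (\<lambda>L. real n + sqrt (2 * real n) * L) at_top at_top" using n by real_asymp
    from filterlim_compose[OF poisson_tail_at_top this]
    show "((\<lambda>L. poisson_tail (Suc n) (laplace_point n (complex_of_real L))) \<longlongrightarrow> 0) at_top"
      by (simp add: laplace_point_def)
  qed
  have ev: "\<forall>\<^sub>F L in at_top. poisson_tail (Suc n) (laplace_point n (complex_of_real a)) - poisson_tail (Suc n) (laplace_point n (complex_of_real L)) =
      complex_of_real (laplace_coeff n * (LBINT v:{a..L}. laplace_real n v))"
    using eventually_ge_at_top[of a] by (rule eventually_mono) (rule e[symmetric])
  show ?thesis
    using tendsto_unique[OF trivial_limit_at_top_linorder t1 Lim_transform_eventually[OF t2 ev]] by (simp only: diff_zero)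
qed

text \<open>Dominated convergence on sets that may move with \<open>n\<close>. The index
  \<open>Suc n\<close> makes \<open>laplace_real_bound\<close> applicable for every
  \<open>n\<close>.\<close>

lemma laplace_integral_limit:
  assumes A: "\<And>n v. v \<in> A n \<Longrightarrow> v \<ge> - sqrt (real (Suc n) / 2)" "\<And>n. A n \<in> sets borel" "B \<in> sets borel"
    and lim: "\<And>v. \<forall>\<^sub>F n in sequentially. v \<in> A n \<longleftrightarrow> v \<in> B"
  shows "(\<lambda>n. LBINT v:A n. laplace_real (Suc n) v) \<longlonglongrightarrow> (LBINT v:B. exp (- v\<^sup>2))"
  unfolding set_lebesgue_integral_def
proof (rule integral_dominated_convergence[where w = "\<lambda>v. 8 * exp 1 * inverse (1 + v\<^sup>2)"])
  show "integrable lborel (\<lambda>v::real. 8 * exp 1 * inverse (1 + v\<^sup>2))"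
    by (intro integrable_mult_right integrable_inverse_one_plus_square)
  show "AE v in lborel. (\<lambda>n. indicat_real (A n) v *\<^sub>R laplace_real (Suc n) v) \<longlonglongrightarrow> indicat_real B v *\<^sub>R exp (- v\<^sup>2)"
  proof (intro AE_I2)
    fix v :: real
    have "(\<lambda>n. indicat_real B v *\<^sub>R laplace_real (Suc n) v) \<longlonglongrightarrow> indicat_real B v *\<^sub>R exp (- v\<^sup>2)"
      by (intro tendsto_intros LIMSEQ_Suc laplace_real_tendsto)
    moreover have "\<forall>\<^sub>F n in sequentially. indicat_real B v *\<^sub>R laplace_real (Suc n) v = indicat_real (A n) v *\<^sub>R laplace_real (Suc n) v"
      using lim[of v] by eventually_elim (simp add: indicator_def)
    ultimately show "(\<lambda>n. indicat_real (A n) v *\<^sub>R laplace_real (Suc n) v) \<longlonglongrightarrow> indicat_real B v *\<^sub>R exp (- v\<^sup>2)"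
      by (rule Lim_transform_eventually)
  qed
  show "AE v in lborel. norm (indicat_real (A n) v *\<^sub>R laplace_real (Suc n) v) \<le> 8 * exp 1 * inverse (1 + v\<^sup>2)" for n
  proof (intro AE_I2)
    fix v :: real
    show "norm (indicat_real (A n) v *\<^sub>R laplace_real (Suc n) v) \<le> 8 * exp 1 * inverse (1 + v\<^sup>2)"
      using laplace_real_bound[of "Suc n" v] A(1)[of v n] by (cases "v \<in> A n") (auto simp: add_nonneg_nonneg)
  qed
  show "(\<lambda>v. indicat_real (A n) v *\<^sub>R laplace_real (Suc n) v) \<in> borel_measurable lborel" for n
    unfolding laplace_real_def using A(2)[of n] by measurable
  show "(\<lambda>v. indicat_real B v *\<^sub>R exp (- v\<^sup>2)) \<in> borel_measurable lborel"
    using A(3) by measurable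
qed

text \<open>Stirling's formula as a by-product. The left end \<open>v = - sqrt (n / 2)\<close>
  corresponds to \<open>s = 0\<close>, where the tail is 1, so \<open>laplace_real_integral\<close>
  exhibits \<open>laplace_coeff\<close> as the reciprocal of an integral that tends to
  \<open>sqrt pi\<close>.\<close>

lemma laplace_coeff_tendsto: "laplace_coeff \<longlonglongrightarrow> 1 / sqrt pi"
proof -
  have "(\<lambda>n. LBINT v:{- sqrt (real (Suc n) / 2)..}. laplace_real (Suc n) v) \<longlonglongrightarrow> (LBINT v:UNIV. exp (- v\<^sup>2))"
  proof (rule laplace_integral_limit)
    fix v :: real
    have "filterlim (\<lambda>n. - sqrt (real (Suc n) / 2)) at_bot sequentially" by real_asymp
    then have "\<forall>\<^sub>F n in sequentially. - sqrt (real (Suc n) / 2) \<le> v" by (simp add: filterlim_at_bot)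
    then show "\<forall>\<^sub>F n in sequentially. v \<in> {- sqrt (real (Suc n) / 2)..} \<longleftrightarrow> v \<in> UNIV" by eventually_elim simp
  qed auto
  also have "(LBINT v:UNIV. exp (- v\<^sup>2)) = sqrt pi"
    using gaussian_integral_real(2)[of 1] by (simp add: set_lebesgue_integral_def)
  finally have "(\<lambda>n. inverse (LBINT v:{- sqrt (real (Suc n) / 2)..}. laplace_real (Suc n) v)) \<longlonglongrightarrow> inverse (sqrt pi)"
    by (rule tendsto_inverse) simp
  moreover have "inverse (LBINT v:{- sqrt (real (Suc n) / 2)..}. laplace_real (Suc n) v) = laplace_coeff (Suc n)" for n
  proof -
    have "sqrt (2 * real (Suc n)) * sqrt (real (Suc n) / 2) = real (Suc n)"
    proof -
      have "2 * real (Suc n) * (real (Suc n) / 2) = (real (Suc n))\<^sup>2" by (simp add: power2_eq_square)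
      then show ?thesis unfolding real_sqrt_mult[symmetric] by (simp only: real_sqrt_abs abs_of_nat)
    qed
    then have "complex_of_real (sqrt (2 * real (Suc n))) * complex_of_real (sqrt (real (Suc n) / 2)) = of_nat (Suc n)"
      by (metis of_real_mult of_real_of_nat_eq)
    then have "laplace_point (Suc n) (complex_of_real (- sqrt (real (Suc n) / 2))) = 0"
      unfolding laplace_point_def by (simp only: of_real_minus mult_minus_right add.right_inverse)
    moreover have "poisson_tail (Suc (Suc n)) 0 = 1"
      unfolding poisson_tail_def exp_trunc_def by (subst sum.lessThan_Suc_shift) simp
    ultimately have "complex_of_real (laplace_coeff (Suc n) * (LBINT v:{- sqrt (real (Suc n) / 2)..}. laplace_real (Suc n) v)) = 1"
      by (subst laplace_real_integral) auto
    then have "laplace_coeff (Suc n) * (LBINT v:{- sqrt (real (Suc n) / 2)..}. laplace_real (Suc n) v) = 1"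
      by (simp only: of_real_eq_1_iff)
    then show ?thesis by (metis inverse_unique mult.commute)
  qed
  ultimately have "(\<lambda>n. laplace_coeff (Suc n)) \<longlonglongrightarrow> inverse (sqrt pi)" by simp
  then show ?thesis unfolding inverse_eq_divide by (rule LIMSEQ_imp_Suc)
qed

text \<open>The half-line \<open>v \<ge> 0\<close> carries half of the Gaussian mass. The limit is
  the initial value \<open>erfc 0 / 2\<close> for the comparison of derivatives in
  \<open>poisson_tail_Suc_uniform_limit\<close>.\<close>

lemma poisson_tail_center: "(\<lambda>n. poisson_tail (Suc n) (of_nat n)) \<longlonglongrightarrow> 1 / 2"
proof -
  have "(\<lambda>n. LBINT v:{0..}. laplace_real (Suc n) v) \<longlonglongrightarrow> (LBINT v:{0..}. exp (- v\<^sup>2))"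
  proof (rule laplace_integral_limit)
    show "- sqrt (real (Suc n) / 2) \<le> v" if "v \<in> {0..}" for n v
    proof -
      have "0 \<le> sqrt (real (Suc n) / 2)" by simp
      then show ?thesis using that by (simp only: atLeast_iff)
    qed
  qed auto
  also have "(LBINT v:{0..}. exp (- v\<^sup>2)) = sqrt pi / 2"
    using gaussian_moment_0 unfolding set_lebesgue_integral_def has_bochner_integral_iff by simp
  finally have "(\<lambda>n. complex_of_real (laplace_coeff (Suc n) * (LBINT v:{0..}. laplace_real (Suc n) v))) \<longlonglongrightarrow> complex_of_real (1 / sqrt pi * (sqrt pi / 2))"
    by (intro tendsto_intros LIMSEQ_Suc[OF laplace_coeff_tendsto])
  moreover have "complex_of_real (laplace_coeff (Suc n) * (LBINT v:{0..}. laplace_real (Suc n) v)) = poisson_tail (Suc (Suc n)) (of_nat (Suc n))" for n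
    by (subst laplace_real_integral) (auto simp: laplace_point_def)
  ultimately have "(\<lambda>n. poisson_tail (Suc (Suc n)) (of_nat (Suc n))) \<longlonglongrightarrow> 1 / 2" by simp
  then show ?thesis by (rule LIMSEQ_imp_Suc)
qed

lemma tendsto_imp_uniform_limit: "(c \<longlongrightarrow> l) F \<Longrightarrow> uniform_limit X (\<lambda>n x. c n) (\<lambda>x. l) F"
  by (rule uniform_limitI) (auto dest: tendstoD elim: eventually_mono)

text \<open>For compositions in which the function and its argument both move with the
  index.\<close>

lemma uniform_limit_compose_both:
  fixes f :: "'b::metric_space \<Rightarrow> 'c::metric_space"
  assumes F: "uniform_limit B F f G" and f: "uniformly_continuous_on B f" and B: "closed B"
    and g: "uniform_limit X g h G" "eventually (\<lambda>n. \<forall>x\<in>X. g n x \<in> B) G"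
  shows "uniform_limit X (\<lambda>n x. F n (g n x)) (\<lambda>x. f (h x)) G"
proof (rule uniform_limitI)
  fix e :: real assume e: "e > 0"
  have 1: "uniform_limit X (\<lambda>n x. f (g n x)) (\<lambda>x. f (h x)) G"
    by (rule uniform_limit_compose_uniformly_continuous_on[OF g(1) f g(2) B])
  have e2: "e / 2 > 0" using e by simp
  show "\<forall>\<^sub>F n in G. \<forall>x\<in>X. dist (F n (g n x)) (f (h x)) < e"
    using uniform_limitD[OF 1 e2] uniform_limitD[OF F e2] g(2)
  proof eventually_elim
    case (elim n)
    show ?case
    proof
      fix x assume x: "x \<in> X"
      have "dist (F n (g n x)) (f (g n x)) < e / 2" "dist (f (g n x)) (f (h x)) < e / 2" using elim x by auto
      then show "dist (F n (g n x)) (f (h x)) < e"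
        using dist_triangle[of "F n (g n x)" "f (h x)" "f (g n x)"] by linarith
    qed
  qed
qed

lemma uniform_lim_mult_compact:
  fixes f :: "'a \<Rightarrow> 'b::topological_space \<Rightarrow> complex"
  assumes "uniform_limit X f l F" "uniform_limit X g m F" "compact X" "continuous_on X l" "continuous_on X m"
  shows "uniform_limit X (\<lambda>a b. f a b * g a b) (\<lambda>a. l a * m a) F"
  using assms by (intro uniform_lim_mult compact_imp_bounded compact_continuous_image)

lemma laplace_coeff_fun_uniform_limit:
  assumes "R > 0"
  shows "uniform_limit (cball 0 R) (\<lambda>n v. complex_of_real (laplace_coeff n) * laplace_fun n v) (\<lambda>v. complex_of_real (1 / sqrt pi) * exp (- v\<^sup>2)) sequentially"
  by (intro uniform_lim_mult_compact tendsto_imp_uniform_limit tendsto_of_real laplace_coeff_tendsto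
      laplace_fun_uniform_limit assms continuous_intros) auto

text \<open>Both sides have nearly equal derivatives on the disc, by
  \<open>laplace_coeff_fun_uniform_limit\<close>, and nearly equal values at its centre.\<close>

lemma poisson_tail_Suc_uniform_limit:
  assumes R: "R > 0"
  shows "uniform_limit (cball 0 R) (\<lambda>n v. poisson_tail (Suc n) (laplace_point n v)) (\<lambda>v. erfc v / 2) sequentially"
proof (rule uniform_limitI)
  fix e :: real assume e: "e > 0"
  have 1: "\<forall>\<^sub>F n in sequentially. dist (poisson_tail (Suc n) (of_nat n)) (1 / 2) < e / 2"
    using poisson_tail_center e by (intro tendstoD) auto
  have 2: "\<forall>\<^sub>F n in sequentially. \<forall>v\<in>cball 0 R. dist (complex_of_real (laplace_coeff n) * laplace_fun n v) (complex_of_real (1 / sqrt pi) * exp (- v\<^sup>2)) < e / (2 * R)"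
    using e R by (intro uniform_limitD[OF laplace_coeff_fun_uniform_limit]) auto
  show "\<forall>\<^sub>F n in sequentially. \<forall>v\<in>cball 0 R. dist (poisson_tail (Suc n) (laplace_point n v)) (erfc v / 2) < e"
    using 1 2 eventually_gt_at_top[of 0]
  proof eventually_elim
    case (elim n)
    define h where "h = (\<lambda>v. poisson_tail (Suc n) (laplace_point n v) - erfc v / 2)"
    show ?case
    proof
      fix v :: complex assume v: "v \<in> cball 0 R"
      have "norm (h v - h 0) \<le> e / (2 * R) * norm (v - 0)"
      proof (rule field_differentiable_bound[where S = "cball 0 R"])
        fix z :: complex assume z: "z \<in> cball 0 R"
        have "((\<lambda>v. erfc v / 2) has_field_derivative - (complex_of_real (1 / sqrt pi) * exp (- z\<^sup>2))) (at z within cball 0 R)"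
          by (auto intro!: derivative_eq_intros)
        then show "(h has_field_derivative - (complex_of_real (laplace_coeff n) * laplace_fun n z) - (- (complex_of_real (1 / sqrt pi) * exp (- z\<^sup>2)))) (at z within cball 0 R)"
          unfolding h_def by (intro DERIV_diff poisson_tail_laplace_deriv elim)
        have "norm (- (complex_of_real (laplace_coeff n) * laplace_fun n z) - (- (complex_of_real (1 / sqrt pi) * exp (- z\<^sup>2)))) =
            dist (complex_of_real (laplace_coeff n) * laplace_fun n z) (complex_of_real (1 / sqrt pi) * exp (- z\<^sup>2))"
          by (simp only: dist_norm minus_diff_minus norm_minus_cancel)
        then show "norm (- (complex_of_real (laplace_coeff n) * laplace_fun n z) - (- (complex_of_real (1 / sqrt pi) * exp (- z\<^sup>2)))) \<le> e / (2 * R)"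
          using elim z by (auto simp: less_imp_le)
      qed (use v R in auto)
      also have "\<dots> \<le> e / (2 * R) * R" using v e R by (intro mult_left_mono) auto
      also have "\<dots> = e / 2" using R by simp
      finally have "norm (h v - h 0) \<le> e / 2" .
      moreover have "norm (h 0) < e / 2" using elim by (simp add: h_def laplace_point_def erfc_0 dist_norm)
      ultimately have "norm (h v) < e" using norm_triangle_sub[of "h v" "h 0"] by linarith
      then show "dist (poisson_tail (Suc n) (laplace_point n v)) (erfc v / 2) < e" by (simp add: h_def dist_norm)
    qed
  qed
qed

text \<open>The two tails differ by the summand with index \<open>n\<close>, which is of order
  \<open>1 / sqrt n\<close> at these points.\<close>

lemma poisson_tail_uniform_limit:
  assumes R: "R > 0"
  shows "uniform_limit (cball 0 R) (\<lambda>n v. poisson_tail n (laplace_point n v)) (\<lambda>v. erfc v / 2) sequentially"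
proof -
  have c: "(\<lambda>n. laplace_coeff n * (1 / sqrt (2 * real n))) \<longlonglongrightarrow> 1 / sqrt pi * 0"
  proof (intro tendsto_mult laplace_coeff_tendsto)
    show "(\<lambda>n. 1 / sqrt (2 * real n)) \<longlonglongrightarrow> 0" by real_asymp
  qed
  have "uniform_limit (cball 0 R) (\<lambda>n v. poisson_tail (Suc n) (laplace_point n v) - complex_of_real (laplace_coeff n * (1 / sqrt (2 * real n))) * laplace_fun n v)
      (\<lambda>v. erfc v / 2 - complex_of_real (1 / sqrt pi * 0) * exp (- v\<^sup>2)) sequentially"
    by (intro uniform_limit_minus poisson_tail_Suc_uniform_limit R uniform_lim_mult_compact tendsto_imp_uniform_limit
        tendsto_of_real[OF c] laplace_fun_uniform_limit continuous_intros) auto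
  moreover have "poisson_tail (Suc n) (laplace_point n v) - complex_of_real (laplace_coeff n * (1 / sqrt (2 * real n))) * laplace_fun n v =
      poisson_tail n (laplace_point n v)" if "n > 0" for n v
  proof -
    have "laplace_coeff n * (1 / sqrt (2 * real n)) = real n ^ n * exp (- real n) / fact n"
      using that by (simp add: laplace_coeff_def)
    then have "complex_of_real (laplace_coeff n * (1 / sqrt (2 * real n))) * laplace_fun n v = exp (- laplace_point n v) * laplace_point n v ^ n / fact n"
      unfolding exp_power_laplace[OF that] by simp
    then show ?thesis by (simp add: poisson_tail_def exp_trunc_def distrib_left)
  qed
  ultimately show ?thesis
    by (elim uniform_limit_cong[THEN iffD1, rotated 2]) (auto intro: eventually_mono[OF eventually_gt_at_top[of 0]])
qed

text \<open>Differentiation nearly reproduces \<open>2 * z\<close> times the sum: the derivative of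
  the odd power of index \<open>i\<close> is \<open>2 * z\<close> times that of index
  \<open>i - 1\<close>, coefficient included, and the derivative of a truncated exponential is
  \<open>2 * z\<close> times the same series with its last term missing. The mismatches are the even
  and the odd terms of the series of \<open>exp (2 * z * w)\<close>; the shift of index leaves one
  term at the upper end.\<close>

lemma pre_kernel_deriv:
  "((\<lambda>z. pre_kernel N z w) has_field_derivative 2 * z * pre_kernel N z w + exp_trunc (2*N) (2 * z * w)
     - 4 ^ N * fact N / fact (2*N) * z ^ (2*N) * exp_trunc N (w\<^sup>2)) (at z)"
proof (induction N)
  case 0
  then show ?case by (simp add: pre_kernel_def exp_trunc_def)
next
  case (Suc N)
  define a :: complex where "a = 4 ^ N * fact N / fact (2*N+1)"
  have pk: "pre_kernel (Suc N) z w = pre_kernel N z w + a * (z ^ (2*N+1) * exp_trunc (Suc N) (w\<^sup>2) - exp_trunc (Suc N) (z\<^sup>2) * w ^ (2*N+1))" for z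
    by (simp add: pre_kernel_def a_def)
  have dE: "((\<lambda>z. exp_trunc (Suc N) (z\<^sup>2)) has_field_derivative exp_trunc N (z\<^sup>2) * (2 * z)) (at z)"
    by (rule DERIV_chain2[OF exp_trunc_deriv]) (auto intro!: derivative_eq_intros)
  have dz: "((\<lambda>z. z ^ (2*N+1)) has_field_derivative of_nat (2*N+1) * z ^ (2*N)) (at z)"
    by (rule DERIV_cong[OF DERIV_power[OF DERIV_ident]]) simp
  have "((\<lambda>z. pre_kernel (Suc N) z w) has_field_derivative
      (2 * z * pre_kernel N z w + exp_trunc (2*N) (2 * z * w) - 4 ^ N * fact N / fact (2*N) * z ^ (2*N) * exp_trunc N (w\<^sup>2))
      + a * (of_nat (2*N+1) * z ^ (2*N) * exp_trunc (Suc N) (w\<^sup>2) - exp_trunc N (z\<^sup>2) * (2 * z) * w ^ (2*N+1))) (at z)"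
    unfolding pk by (intro DERIV_add Suc.IH DERIV_cmult DERIV_diff DERIV_cmult_right dE dz)
  moreover have "(2 * z * pre_kernel N z w + exp_trunc (2*N) (2 * z * w) - 4 ^ N * fact N / fact (2*N) * z ^ (2*N) * exp_trunc N (w\<^sup>2))
      + a * (of_nat (2*N+1) * z ^ (2*N) * exp_trunc (Suc N) (w\<^sup>2) - exp_trunc N (z\<^sup>2) * (2 * z) * w ^ (2*N+1))
    = 2 * z * pre_kernel (Suc N) z w + exp_trunc (2 * Suc N) (2 * z * w) - 4 ^ Suc N * fact (Suc N) / fact (2 * Suc N) * z ^ (2 * Suc N) * exp_trunc (Suc N) (w\<^sup>2)"
  proof -
    have f: "fact (2*N+1) = of_nat (2*N+1) * (fact (2*N) :: complex)" "fact (2 * Suc N) = of_nat (2*N+2) * (fact (2*N+1) :: complex)"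
      "fact (Suc N) = of_nat (N+1) * (fact N :: complex)"
      by (simp_all add: algebra_simps)
    have nz: "of_nat (2*N+1) \<noteq> (0::complex)" "of_nat (2*N+2) = 2 * (of_nat (N+1) :: complex)" "of_nat (N+1) \<noteq> (0::complex)"
      by (metis add_is_0 of_nat_eq_0_iff one_neq_zero, simp, metis add_is_0 of_nat_eq_0_iff one_neq_zero)
    \<comment> \<open>\<open>c1\<close> and \<open>c2\<close> express the boundary coefficients at
      \<open>N\<close> and \<open>Suc N\<close> through the coefficient \<open>a\<close> of the new
      summand, so that the boundary terms telescope.\<close>
    have c1: "4 ^ N * fact N / fact (2*N) = of_nat (2*N+1) * a"
      unfolding a_def f(1) using nz(1) by simp
    have c2: "4 ^ Suc N * fact (Suc N) / fact (2 * Suc N) = 2 * a"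
    proof -
      have "4 * A * (n * F) / (2 * n * H) = 2 * (A * F / H)" if "n \<noteq> 0" for A n F H :: complex
        using that by simp
      from this[OF nz(3)] show ?thesis unfolding a_def f(2,3) nz(2) power_Suc .
    qed
    have Es: "exp_trunc (Suc N) (w\<^sup>2) = exp_trunc N (w\<^sup>2) + w ^ (2*N) / fact N" "exp_trunc (Suc N) (z\<^sup>2) = exp_trunc N (z\<^sup>2) + z ^ (2*N) / fact N"
      by (simp_all add: exp_trunc_def power_mult)
    have p4: "(2 * z * w) ^ (2*N) = 4 ^ N * (z ^ (2*N) * w ^ (2*N))"
      by (simp add: power_mult_distrib power_mult)
    have E2: "exp_trunc (2 * Suc N) (2 * z * w) = exp_trunc (2*N) (2 * z * w) + (of_nat (2*N+1) * a) * z ^ (2*N) * (w ^ (2*N) / fact N)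
        + 2 * z * w * a * (z ^ (2*N) * (w ^ (2*N) / fact N))"
    proof -
      have "exp_trunc (2 * Suc N) (2 * z * w) = exp_trunc (2*N) (2 * z * w) + (2 * z * w) ^ (2*N) / fact (2*N) + (2 * z * w) * (2 * z * w) ^ (2*N) / fact (2*N+1)"
        by (simp add: exp_trunc_def)
      also have "(2 * z * w) ^ (2*N) / fact (2*N) = (of_nat (2*N+1) * a) * z ^ (2*N) * (w ^ (2*N) / fact N)"
        unfolding c1[symmetric] p4 by simp
      also have "(2 * z * w) * (2 * z * w) ^ (2*N) / fact (2*N+1) = 2 * z * w * a * (z ^ (2*N) * (w ^ (2*N) / fact N))"
        unfolding a_def p4 by simp
      finally show ?thesis .
    qed
    have alg: "(2*z*K + E - c * Z * A) + a * (c' * Z * (A + W) - B * (2*z) * (w*V)) =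
        2*z*(K + a * (z*Z*(A + W) - (B + U) * (w*V))) + (E + c * Z * W + 2*z*w*a*(Z*W)) - 2*a * (z*z*Z) * (A + W)"
      if "c = c' * a" "Z * W = U * V" for K E c c' Z A W B U V :: complex
    proof -
      have "a * (c' * Z * (A + W)) = c * Z * (A + W)" using that(1) by simp
      then show ?thesis using that(2) by (simp add: algebra_simps)
    qed
    have pz: "z ^ (2*N+1) = z * z ^ (2*N)" "w ^ (2*N+1) = w * w ^ (2*N)" "z ^ (2 * Suc N) = z * z * z ^ (2*N)" by simp_all
    show ?thesis unfolding pk c1 c2 E2 Es pz
      by (rule alg) simp_all
  qed
  ultimately show ?case by simp
qed

lemma pre_kernel_refl: "pre_kernel N z z = 0"
  by (simp add: pre_kernel_def mult.commute)

text \<open>The pre-kernel in the coordinate at the real edge point. The Gaussian is an integrating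
  factor: it removes \<open>2 * z * pre_kernel N z w\<close> from the equation and leaves only the
  inhomogeneous terms.\<close>

definition edge_pre_kernel :: "nat \<Rightarrow> complex \<Rightarrow> complex \<Rightarrow> complex" where
  "edge_pre_kernel N \<zeta> \<eta> =
    (let z = complex_of_real (sqrt (real N)) + \<zeta>; w = complex_of_real (sqrt (real N)) + \<eta> in
      2 * (exp (- z\<^sup>2 - w\<^sup>2) * pre_kernel N z w))"

definition edge_pre_kernel_deriv :: "nat \<Rightarrow> complex \<Rightarrow> complex \<Rightarrow> complex" where
  "edge_pre_kernel_deriv N \<zeta> \<eta> =
    (let z = complex_of_real (sqrt (real N)) + \<zeta>; w = complex_of_real (sqrt (real N)) + \<eta> in
      2 * (exp (- (\<zeta> - \<eta>)\<^sup>2) * poisson_tail (2*N) (2 * z * w)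
        - 4 ^ N * fact N / fact (2*N) * (exp (- z\<^sup>2) * (z\<^sup>2) ^ N) * poisson_tail N (w\<^sup>2)))"

lemma edge_pre_kernel_has_derivative:
  "((\<lambda>\<zeta>. edge_pre_kernel N \<zeta> \<eta>) has_field_derivative edge_pre_kernel_deriv N \<zeta> \<eta>) (at \<zeta> within A)"
proof -
  define w where "w = complex_of_real (sqrt (real N)) + \<eta>"
  define z where "z = complex_of_real (sqrt (real N)) + \<zeta>"
  have "((\<lambda>z. 2 * (exp (- z\<^sup>2 - w\<^sup>2) * pre_kernel N z w)) has_field_derivative
     2 * (exp (- z\<^sup>2 - w\<^sup>2) * (- 2 * z) * pre_kernel N z w + exp (- z\<^sup>2 - w\<^sup>2) * (2 * z * pre_kernel N z w + exp_trunc (2*N) (2 * z * w)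
     - 4 ^ N * fact N / fact (2*N) * z ^ (2*N) * exp_trunc N (w\<^sup>2)))) (at z)"
    by (auto intro!: derivative_eq_intros pre_kernel_deriv)
  moreover have "2 * (exp (- z\<^sup>2 - w\<^sup>2) * (- 2 * z) * pre_kernel N z w + exp (- z\<^sup>2 - w\<^sup>2) * (2 * z * pre_kernel N z w + exp_trunc (2*N) (2 * z * w)
     - 4 ^ N * fact N / fact (2*N) * z ^ (2*N) * exp_trunc N (w\<^sup>2))) = edge_pre_kernel_deriv N \<zeta> \<eta>"
  proof -
    have e1: "exp (- (\<zeta> - \<eta>)\<^sup>2) * exp (- (2 * z * w)) = exp (- z\<^sup>2 - w\<^sup>2)"
      unfolding mult_exp_exp by (rule arg_cong[where f=exp]) (simp add: z_def w_def power2_eq_square algebra_simps)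
    have e2: "exp (- z\<^sup>2) * exp (- w\<^sup>2) = exp (- z\<^sup>2 - w\<^sup>2)" by (simp add: mult_exp_exp)
    have "edge_pre_kernel_deriv N \<zeta> \<eta> = 2 * ((exp (- (\<zeta> - \<eta>)\<^sup>2) * exp (- (2 * z * w))) * exp_trunc (2*N) (2 * z * w)
        - 4 ^ N * fact N / fact (2*N) * (exp (- z\<^sup>2) * exp (- w\<^sup>2)) * (z\<^sup>2) ^ N * exp_trunc N (w\<^sup>2))"
      unfolding edge_pre_kernel_deriv_def Let_def z_def[symmetric] w_def[symmetric] poisson_tail_def by simp
    then show ?thesis unfolding e1 e2 power_mult by (simp add: algebra_simps)
  qed
  ultimately have "((\<lambda>z. 2 * (exp (- z\<^sup>2 - w\<^sup>2) * pre_kernel N z w)) has_field_derivative edge_pre_kernel_deriv N \<zeta> \<eta>) (at (complex_of_real (sqrt (real N)) + \<zeta>))"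
    unfolding z_def by simp
  moreover have "((\<lambda>\<zeta>. complex_of_real (sqrt (real N)) + \<zeta>) has_field_derivative 1) (at \<zeta> within A)"
    by (auto intro!: derivative_eq_intros)
  ultimately have "((\<lambda>\<zeta>. (\<lambda>z. 2 * (exp (- z\<^sup>2 - w\<^sup>2) * pre_kernel N z w)) (complex_of_real (sqrt (real N)) + \<zeta>)) has_field_derivative
      edge_pre_kernel_deriv N \<zeta> \<eta> * 1) (at \<zeta> within A)"
    by (rule DERIV_chain2[where g = "\<lambda>\<zeta>. complex_of_real (sqrt (real N)) + \<zeta>"])
  then show ?thesis unfolding edge_pre_kernel_def Let_def w_def by (simp only: mult_1_right)
qed

text \<open>The coefficient of the boundary term becomes a quotient of two Stirling coefficients,
  hence tends to \<open>1 / sqrt 2\<close>, the factor in the second term of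
  \<open>edge_int_deriv\<close>.\<close>

lemma laplace_coeff_ratio:
  assumes "N > 0"
  shows "4 ^ N * fact N / fact (2*N) * (real N ^ N * exp (- real N)) = laplace_coeff (2*N) / (sqrt 2 * laplace_coeff N)"
proof -
  have s: "sqrt (2 * real (2*N)) = sqrt 2 * sqrt (2 * real N)" by (simp flip: real_sqrt_mult)
  have p: "real (2*N) ^ (2*N) = 4 ^ N * (real N ^ N * real N ^ N)"
  proof -
    have "real (2*N) ^ (2*N) = (real (2*N) ^ N) * (real (2*N) ^ N)" by (simp only: mult_2 power_add)
    also have "\<dots> = (2 ^ N * 2 ^ N) * (real N ^ N * real N ^ N)" by (simp add: power_mult_distrib)
    also have "(2::real) ^ N * 2 ^ N = 4 ^ N" by (simp flip: power_mult_distrib)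
    finally show ?thesis .
  qed
  have e: "exp (- real (2*N)) = exp (- real N) * exp (- real N)" by (simp flip: exp_add)
  have alg: "f4 * F / G * (P * E) = (r * q * (f4 * (P * P)) * (E * E) / G) / (r * (q * P * E / F))"
    if "r \<noteq> 0" "q \<noteq> 0" "P \<noteq> 0" "E \<noteq> 0" "F \<noteq> 0" "G \<noteq> 0" for f4 F G P E r q :: real
    using that by (simp add: field_simps)
  show ?thesis unfolding laplace_coeff_def s p e by (rule alg) (use assms in auto)
qed

lemma edge_pre_kernel_deriv_uniform_limit:
  assumes R: "R > 0"
  shows "uniform_limit (cball 0 R \<times> cball 0 R) (\<lambda>N p. edge_pre_kernel_deriv N (fst p) (snd p)) (\<lambda>p. edge_int_deriv (fst p) (snd p)) sequentially"
proof -
  let ?X = "cball (0::complex) R \<times> cball (0::complex) R"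
  \<comment> \<open>A radius that contains \<open>v1\<close> and \<open>v2\<close> for every
    \<open>N \<ge> 1\<close>.\<close>
  define B where "B = 2 * R + R\<^sup>2"
  have B: "B > 0" using R by (simp add: B_def add_pos_nonneg)
  have X: "compact ?X" by (intro compact_Times compact_cball)
  \<comment> \<open>With \<open>z = sqrt N + \<zeta>\<close> and \<open>w = sqrt N + \<eta>\<close>,
    these are the solutions of \<open>laplace_point (2 * N) v = 2 * z * w\<close> and of
    \<open>laplace_point N v = z\<^sup>2\<close>; their quadratic parts disappear in the
    limit.\<close>
  define v1 where "v1 = (\<lambda>N p. fst p + snd p + complex_of_real (1 / sqrt (real N)) * (fst p * snd p))"
  define v2 where "v2 = (\<lambda>N \<zeta>. complex_of_real (sqrt 2) * \<zeta> + complex_of_real (1 / sqrt (2 * real N)) * \<zeta>\<^sup>2)"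
  have s0: "(\<lambda>N. complex_of_real (1 / sqrt (real N))) \<longlonglongrightarrow> complex_of_real 0" "(\<lambda>N. complex_of_real (1 / sqrt (2 * real N))) \<longlonglongrightarrow> complex_of_real 0"
    by (intro tendsto_of_real; real_asymp)+
  have u1: "uniform_limit ?X v1 (\<lambda>p. fst p + snd p + complex_of_real 0 * (fst p * snd p)) sequentially"
    unfolding v1_def
    by (intro uniform_limit_add uniform_limit_const uniform_lim_mult_compact tendsto_imp_uniform_limit s0 X continuous_intros)
  have u2: "uniform_limit ?X (\<lambda>N p. v2 N (f p)) (\<lambda>p. complex_of_real (sqrt 2) * f p + complex_of_real 0 * (f p)\<^sup>2) sequentially"
    if "continuous_on ?X f" for f
    unfolding v2_def
    by (intro uniform_limit_add uniform_limit_const uniform_lim_mult_compact tendsto_imp_uniform_limit s0 X continuous_intros that)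
  have sN: "1 / sqrt (real N) \<le> 1" "1 / sqrt (2 * real N) \<le> 1" if "N > 0" for N
  proof -
    have "1 \<le> real N" using that by simp
    then have "1 \<le> sqrt (real N)" "1 \<le> sqrt (2 * real N)" by (simp_all add: real_le_rsqrt)
    then show "1 / sqrt (real N) \<le> 1" "1 / sqrt (2 * real N) \<le> 1" by simp_all
  qed
  have b1: "v1 N p \<in> cball 0 B" if "N > 0" "p \<in> ?X" for N p
  proof -
    have p: "cmod (fst p) \<le> R" "cmod (snd p) \<le> R" using that by auto
    have "cmod (v1 N p) \<le> cmod (fst p) + cmod (snd p) + 1 / sqrt (real N) * (cmod (fst p) * cmod (snd p))"
      unfolding v1_def by (intro order_trans[OF norm_triangle_ineq] add_mono norm_triangle_ineq) (simp add: norm_mult norm_divide)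
    also have "\<dots> \<le> R + R + 1 * (R * R)" using p sN[OF that(1)] R by (intro add_mono mult_mono) auto
    finally show ?thesis by (simp add: B_def power2_eq_square)
  qed
  have b2: "v2 N z \<in> cball 0 B" if "N > 0" "cmod z \<le> R" for N z
  proof -
    have "cmod (v2 N z) \<le> sqrt 2 * cmod z + 1 / sqrt (2 * real N) * (cmod z * cmod z)"
      unfolding v2_def by (intro order_trans[OF norm_triangle_ineq] add_mono) (simp_all add: norm_mult norm_divide power2_eq_square)
    also have "\<dots> \<le> 2 * R + 1 * (R * R)" using that sN[OF that(1)] R sqrt2_less_2 by (intro add_mono mult_mono) auto
    finally show ?thesis by (simp add: B_def power2_eq_square)
  qed
  have ev1: "\<forall>\<^sub>F N in sequentially. \<forall>p\<in>?X. v1 N p \<in> cball 0 B"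
    using eventually_gt_at_top[of 0] by eventually_elim (use b1 in blast)
  have ev2: "\<forall>\<^sub>F N in sequentially. \<forall>p\<in>?X. v2 N (fst p) \<in> cball 0 B" "\<forall>\<^sub>F N in sequentially. \<forall>p\<in>?X. v2 N (snd p) \<in> cball 0 B"
    using eventually_gt_at_top[of 0] by (eventually_elim, use b2 in auto)+
  have uc: "uniformly_continuous_on (cball 0 B) (\<lambda>v. erfc v / 2)" "uniformly_continuous_on (cball 0 B) (\<lambda>v::complex. exp (- v\<^sup>2))"
    by (intro compact_uniformly_continuous continuous_intros; simp)+
  have f2: "filterlim (\<lambda>N::nat. 2 * N) sequentially sequentially"
    by (rule filterlim_subseq) (simp add: strict_mono_def)
  have l1: "uniform_limit ?X (\<lambda>N p. poisson_tail (2*N) (laplace_point (2*N) (v1 N p))) (\<lambda>p. erfc (fst p + snd p + complex_of_real 0 * (fst p * snd p)) / 2) sequentially"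
    by (rule uniform_limit_compose_both[OF filterlim_compose[OF poisson_tail_uniform_limit[OF B] f2] uc(1) _ u1 ev1]) simp
  have l2: "uniform_limit ?X (\<lambda>N p. poisson_tail N (laplace_point N (v2 N (snd p)))) (\<lambda>p. erfc (complex_of_real (sqrt 2) * snd p + complex_of_real 0 * (snd p)\<^sup>2) / 2) sequentially"
    by (rule uniform_limit_compose_both[OF poisson_tail_uniform_limit[OF B] uc(1) _ u2 ev2(2)]) (auto intro!: continuous_intros)
  have l3: "uniform_limit ?X (\<lambda>N p. laplace_fun N (v2 N (fst p))) (\<lambda>p. exp (- (complex_of_real (sqrt 2) * fst p + complex_of_real 0 * (fst p)\<^sup>2)\<^sup>2)) sequentially"
    by (rule uniform_limit_compose_both[OF laplace_fun_uniform_limit[OF B] uc(2) _ u2 ev2(1)]) (auto intro!: continuous_intros)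
  have cr: "(\<lambda>N. laplace_coeff (2*N) / (sqrt 2 * laplace_coeff N)) \<longlonglongrightarrow> (1 / sqrt pi) / (sqrt 2 * (1 / sqrt pi))"
    by (intro tendsto_intros laplace_coeff_tendsto filterlim_compose[OF laplace_coeff_tendsto f2]) auto
  have lim: "uniform_limit ?X (\<lambda>N p. 2 * (exp (- (fst p - snd p)\<^sup>2) * poisson_tail (2*N) (laplace_point (2*N) (v1 N p))
        - complex_of_real (laplace_coeff (2*N) / (sqrt 2 * laplace_coeff N)) * laplace_fun N (v2 N (fst p)) * poisson_tail N (laplace_point N (v2 N (snd p)))))
      (\<lambda>p. 2 * (exp (- (fst p - snd p)\<^sup>2) * (erfc (fst p + snd p + complex_of_real 0 * (fst p * snd p)) / 2)
        - complex_of_real ((1 / sqrt pi) / (sqrt 2 * (1 / sqrt pi))) * exp (- (complex_of_real (sqrt 2) * fst p + complex_of_real 0 * (fst p)\<^sup>2)\<^sup>2) *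
          (erfc (complex_of_real (sqrt 2) * snd p + complex_of_real 0 * (snd p)\<^sup>2) / 2))) sequentially"
    by (intro uniform_limit_minus uniform_limit_const uniform_lim_mult_compact l1 l2 l3 tendsto_imp_uniform_limit tendsto_of_real[OF cr] X continuous_intros) auto
  have rhs: "2 * (exp (- (\<zeta> - \<eta>)\<^sup>2) * (erfc (\<zeta> + \<eta> + complex_of_real 0 * (\<zeta> * \<eta>)) / 2)
        - complex_of_real ((1 / sqrt pi) / (sqrt 2 * (1 / sqrt pi))) * exp (- (complex_of_real (sqrt 2) * \<zeta> + complex_of_real 0 * \<zeta>\<^sup>2)\<^sup>2) *
          (erfc (complex_of_real (sqrt 2) * \<eta> + complex_of_real 0 * \<eta>\<^sup>2) / 2)) = edge_int_deriv \<zeta> \<eta>" for \<zeta> \<eta>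
    by (simp add: edge_int_deriv_def sqrt2_square algebra_simps)
  have lhs: "2 * (exp (- (\<zeta> - \<eta>)\<^sup>2) * poisson_tail (2*N) (laplace_point (2*N) (v1 N (\<zeta>, \<eta>)))
        - complex_of_real (laplace_coeff (2*N) / (sqrt 2 * laplace_coeff N)) * laplace_fun N (v2 N \<zeta>) * poisson_tail N (laplace_point N (v2 N \<eta>)))
      = edge_pre_kernel_deriv N \<zeta> \<eta>" if N: "N > 0" for N \<zeta> \<eta>
  proof -
    define r where "r = complex_of_real (sqrt (real N))"
    have r2: "r * r = of_nat N" unfolding r_def by (simp flip: of_real_mult)
    have rn: "r \<noteq> 0" using N by (simp add: r_def)
    have lp1: "laplace_point (2*N) (v1 N (\<zeta>, \<eta>)) = 2 * (r + \<zeta>) * (r + \<eta>)"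
    proof -
      have "sqrt (2 * real (2*N)) = 2 * sqrt (real N)" by (simp add: real_sqrt_mult)
      then have "laplace_point (2*N) (v1 N (\<zeta>, \<eta>)) = 2 * (r * r) + 2 * r * (\<zeta> + \<eta> + 1 / r * (\<zeta> * \<eta>))"
        unfolding laplace_point_def v1_def r2 by (simp add: r_def)
      also have "\<dots> = 2 * (r + \<zeta>) * (r + \<eta>)" using rn by (simp add: field_simps)
      finally show ?thesis .
    qed
    have lp2: "laplace_point N (v2 N x) = (r + x)\<^sup>2" for x
    proof -
      have "laplace_point N (v2 N x) = r * r + (complex_of_real (sqrt 2) * r) * (complex_of_real (sqrt 2) * x + 1 / (complex_of_real (sqrt 2) * r) * x\<^sup>2)"
        unfolding laplace_point_def v2_def r2 by (simp add: r_def real_sqrt_mult)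
      also have "\<dots> = r * r + (complex_of_real (sqrt 2))\<^sup>2 * r * x + x\<^sup>2" using rn by (simp add: field_simps power2_eq_square)
      finally show ?thesis unfolding sqrt2_square(1) by (simp add: power2_eq_square algebra_simps)
    qed
    have "complex_of_real (laplace_coeff (2*N) / (sqrt 2 * laplace_coeff N)) * laplace_fun N (v2 N \<zeta>) =
        4 ^ N * fact N / fact (2*N) * (complex_of_real (real N ^ N * exp (- real N)) * laplace_fun N (v2 N \<zeta>))"
      unfolding laplace_coeff_ratio[OF N, symmetric] by simp
    also have "\<dots> = 4 ^ N * fact N / fact (2*N) * (exp (- (r + \<zeta>)\<^sup>2) * ((r + \<zeta>)\<^sup>2) ^ N)"
      unfolding exp_power_laplace[OF N, symmetric] lp2 ..
    finally show ?thesis unfolding edge_pre_kernel_deriv_def Let_def lp1 lp2 r_def by simp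
  qed
  show ?thesis
    using lim
  proof (rule uniform_limit_cong[THEN iffD1, rotated 2])
    show "\<forall>\<^sub>F N in sequentially. \<forall>p\<in>?X. 2 * (exp (- (fst p - snd p)\<^sup>2) * poisson_tail (2*N) (laplace_point (2*N) (v1 N p))
        - complex_of_real (laplace_coeff (2*N) / (sqrt 2 * laplace_coeff N)) * laplace_fun N (v2 N (fst p)) * poisson_tail N (laplace_point N (v2 N (snd p))))
        = edge_pre_kernel_deriv N (fst p) (snd p)"
      using eventually_gt_at_top[of 0]
    proof eventually_elim
      case (elim N)
      show ?case using lhs[OF elim] by (metis prod.collapse)
    qed
  qed (rule rhs)
qed

lemma edge_pre_kernel_uniform_limit:
  assumes R: "R > 0"
  shows "uniform_limit (cball 0 R \<times> cball 0 R) (\<lambda>N p. edge_pre_kernel N (fst p) (snd p)) (\<lambda>p. edge_int (fst p) (snd p)) sequentially"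
proof (rule uniform_limitI)
  fix e :: real assume e: "e > 0"
  \<comment> \<open>The comparison starts at the point \<open>\<zeta> = \<eta>\<close>, where both
    kernels vanish and which is at most \<open>2 * R\<close> away.\<close>
  have "e / (4 * R) > 0" using e R by simp
  from uniform_limitD[OF edge_pre_kernel_deriv_uniform_limit[OF R] this]
  show "\<forall>\<^sub>F N in sequentially. \<forall>p\<in>cball 0 R \<times> cball 0 R. dist (edge_pre_kernel N (fst p) (snd p)) (edge_int (fst p) (snd p)) < e"
  proof eventually_elim
    case (elim N)
    show ?case
    proof
      fix p :: "complex \<times> complex" assume p: "p \<in> cball 0 R \<times> cball 0 R"
      define \<zeta> \<eta> where "\<zeta> = fst p" and "\<eta> = snd p"
      have c: "\<zeta> \<in> cball 0 R" "\<eta> \<in> cball 0 R" using p by (auto simp: \<zeta>_def \<eta>_def)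
      define h where "h = (\<lambda>z. edge_pre_kernel N z \<eta> - edge_int z \<eta>)"
      have "norm (h \<zeta> - h \<eta>) \<le> e / (4 * R) * norm (\<zeta> - \<eta>)"
      proof (rule field_differentiable_bound[where S = "cball 0 R"])
        fix z :: complex assume z: "z \<in> cball 0 R"
        show "(h has_field_derivative edge_pre_kernel_deriv N z \<eta> - edge_int_deriv z \<eta>) (at z within cball 0 R)"
          unfolding h_def by (intro DERIV_diff edge_pre_kernel_has_derivative has_field_derivative_at_within[OF edge_int_has_field_derivative])
        have "(z, \<eta>) \<in> cball 0 R \<times> cball 0 R" using z c by simp
        then have "dist (edge_pre_kernel_deriv N z \<eta>) (edge_int_deriv z \<eta>) < e / (4 * R)" using elim by fastforce
        then show "norm (edge_pre_kernel_deriv N z \<eta> - edge_int_deriv z \<eta>) \<le> e / (4 * R)" by (simp add: dist_norm)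
      qed (use c in auto)
      also have "\<dots> \<le> e / (4 * R) * (2 * R)"
        using c norm_triangle_ineq4[of \<zeta> \<eta>] e R by (intro mult_left_mono) auto
      also have "\<dots> < e" using R e by simp
      finally have "norm (h \<zeta> - h \<eta>) < e" .
      moreover have "h \<eta> = 0" by (simp add: h_def edge_int_refl edge_pre_kernel_def Let_def pre_kernel_refl)
      ultimately show "dist (edge_pre_kernel N (fst p) (snd p)) (edge_int (fst p) (snd p)) < e"
        by (simp add: h_def \<zeta>_def \<eta>_def dist_norm)
    qed
  qed
qed

section \<open>Passage to the limit inside the Pfaffian\<close>

definition bounded_uniform_limit where
  "bounded_uniform_limit X f l F \<longleftrightarrow> uniform_limit X f l F \<and> bounded (l ` X)"

lemma bounded_uniform_limit_const:
  fixes c :: "'b::metric_space"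
  shows "bounded_uniform_limit X (\<lambda>n x. c) (\<lambda>x. c) F"
  unfolding bounded_uniform_limit_def by (auto intro: uniform_limit_const bounded_subset[of "{c}"])

text \<open>Uniform convergence can fail for products of unbounded limits; carrying boundedness
  along makes the notion closed under sums and products, hence under \<open>pf\<close>.\<close>

lemma bounded_uniform_limit_mult:
  fixes f :: "'a \<Rightarrow> 'b \<Rightarrow> complex"
  assumes "bounded_uniform_limit X f l F" "bounded_uniform_limit X g m F"
  shows "bounded_uniform_limit X (\<lambda>n x. f n x * g n x) (\<lambda>x. l x * m x) F"
proof -
  obtain A B where AB: "\<And>x. x \<in> X \<Longrightarrow> norm (l x) \<le> A" "\<And>x. x \<in> X \<Longrightarrow> norm (m x) \<le> B"
    using assms unfolding bounded_uniform_limit_def bounded_iff by blast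
  have "norm (l x * m x) \<le> A * B" if "x \<in> X" for x
    unfolding norm_mult using AB[OF that] by (intro mult_mono) (auto intro: order_trans[OF norm_ge_zero])
  then have "bounded ((\<lambda>x. l x * m x) ` X)" unfolding bounded_iff by blast
  then show ?thesis using assms unfolding bounded_uniform_limit_def by (auto intro: uniform_lim_mult)
qed

lemma bounded_uniform_limit_prod:
  fixes f :: "'i \<Rightarrow> 'a \<Rightarrow> 'b \<Rightarrow> complex"
  assumes "finite I" "\<And>i. i \<in> I \<Longrightarrow> bounded_uniform_limit X (f i) (l i) F"
  shows "bounded_uniform_limit X (\<lambda>n x. \<Prod>i\<in>I. f i n x) (\<lambda>x. \<Prod>i\<in>I. l i x) F"
  using assms by (induction I rule: finite_induct) (auto intro: bounded_uniform_limit_const bounded_uniform_limit_mult)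

lemma bounded_uniform_limit_add:
  fixes f :: "'a \<Rightarrow> 'b \<Rightarrow> complex"
  assumes "bounded_uniform_limit X f l F" "bounded_uniform_limit X g m F"
  shows "bounded_uniform_limit X (\<lambda>n x. f n x + g n x) (\<lambda>x. l x + m x) F"
proof -
  obtain A B where AB: "\<And>x. x \<in> X \<Longrightarrow> norm (l x) \<le> A" "\<And>x. x \<in> X \<Longrightarrow> norm (m x) \<le> B"
    using assms unfolding bounded_uniform_limit_def bounded_iff by blast
  have "norm (l x + m x) \<le> A + B" if "x \<in> X" for x
    using AB[OF that] norm_triangle_mono by blast
  then have "bounded ((\<lambda>x. l x + m x) ` X)" unfolding bounded_iff by blast
  then show ?thesis using assms unfolding bounded_uniform_limit_def by (auto intro: uniform_limit_add)
qed

lemma bounded_uniform_limit_sum: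
  fixes f :: "'i \<Rightarrow> 'a \<Rightarrow> 'b \<Rightarrow> complex"
  assumes "finite I" "\<And>i. i \<in> I \<Longrightarrow> bounded_uniform_limit X (f i) (l i) F"
  shows "bounded_uniform_limit X (\<lambda>n x. \<Sum>i\<in>I. f i n x) (\<lambda>x. \<Sum>i\<in>I. l i x) F"
  using assms by (induction I rule: finite_induct) (auto intro: bounded_uniform_limit_const bounded_uniform_limit_add)

lemma bounded_uniform_limit_pf:
  assumes "\<And>a b. a < 2*k \<Longrightarrow> b < 2*k \<Longrightarrow> bounded_uniform_limit X (\<lambda>n x. A n x a b) (\<lambda>x. L x a b) F"
  shows "bounded_uniform_limit X (\<lambda>n x. pf k (A n x)) (\<lambda>x. pf k (L x)) F"
  unfolding pf_def
  by (intro bounded_uniform_limit_mult bounded_uniform_limit_const bounded_uniform_limit_sum bounded_uniform_limit_prod)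
     (auto intro: assms[OF permutes_lessThan_pair(1) permutes_lessThan_pair(2)] simp del: One_nat_def)

text \<open>The weight after it has taken up the Gaussian factors of the kernel entries. The
  exponent is \<open>- 4 * (Im Z)\<^sup>2\<close>, so only the position relative to the real axis
  matters.\<close>

definition edge_weight :: "complex \<Rightarrow> complex" where
  "edge_weight Z = (cnj Z - Z) * exp ((Z - cnj Z)\<^sup>2)"

lemma edge_weight_continuous: "continuous_on A edge_weight"
  unfolding edge_weight_def by (intro continuous_intros)

lemma exp_norm_square:
  "complex_of_real (exp (- (2 * (cmod z)\<^sup>2))) * (exp (z\<^sup>2) * exp ((cnj z)\<^sup>2)) = exp ((z - cnj z)\<^sup>2)"
proof -
  have "complex_of_real (exp (- (2 * (cmod z)\<^sup>2))) = exp (- (2 * (z * cnj z)))"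
    by (simp add: exp_of_real[symmetric] complex_norm_square[symmetric])
  then show ?thesis by (simp add: mult_exp_exp power2_eq_square algebra_simps)
qed

text \<open>Gives the limit the shape that \<open>rescaled_correlation_edge\<close> gives to finite
  \<open>N\<close>. The Gaussian factors of \<open>K_edge\<close> and of \<open>kappa_edge\<close>
  are products of weights of single indices, so \<open>pf_scale\<close> collects them.\<close>

lemma R_edge_eq:
  "R_edge t k z = (\<Prod>j<k. edge_weight (z j + \<i> * complex_of_real t)) *
     pf k (\<lambda>a b. edge_int (with_conj (\<lambda>j. z j + \<i> * complex_of_real t) a) (with_conj (\<lambda>j. z j + \<i> * complex_of_real t) b))"
proof -
  define Y where "Y = (\<lambda>j. z j + \<i> * complex_of_real t)"
  define c where "c = (\<lambda>a. complex_of_real (exp (- (cmod (Y (a div 2)))\<^sup>2)) * exp ((with_conj Y a)\<^sup>2))"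
  have cY: "cnj (Y j) = cnj (z j) - \<i> * complex_of_real t" for j by (simp add: Y_def)
  have "K_edge t (z (a div 2)) (z (b div 2)) $$ (a mod 2, b mod 2) = c a * c b * edge_int (with_conj Y a) (with_conj Y b)" for a b
  proof -
    have e: "complex_of_real (exp (- (cmod (Y (a div 2)))\<^sup>2 - (cmod (Y (b div 2)))\<^sup>2)) =
        complex_of_real (exp (- (cmod (Y (a div 2)))\<^sup>2)) * complex_of_real (exp (- (cmod (Y (b div 2)))\<^sup>2))"
      by (simp flip: of_real_mult exp_add)
    have "K_edge t (z (a div 2)) (z (b div 2)) $$ (a mod 2, b mod 2) =
        complex_of_real (exp (- (cmod (Y (a div 2)))\<^sup>2 - (cmod (Y (b div 2)))\<^sup>2)) * kappa_edge (with_conj Y a) (with_conj Y b)"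
    proof -
      have w: "with_conj Y a = (if a mod 2 = 0 then Y (a div 2) else cnj (Y (a div 2)))" for a
        by (simp add: with_conj_def even_iff_mod_2_eq_zero)
      have K: "K_edge t (z i) (z j) = complex_of_real (exp (- (cmod (Y i))\<^sup>2 - (cmod (Y j))\<^sup>2)) \<cdot>\<^sub>m
          mat_of_rows_list 2 [[kappa_edge (Y i) (Y j), kappa_edge (Y i) (cnj (Y j))], [kappa_edge (cnj (Y i)) (Y j), kappa_edge (cnj (Y i)) (cnj (Y j))]]" for i j
        unfolding K_edge_def Let_def cY unfolding Y_def ..
      have E: "(c \<cdot>\<^sub>m mat_of_rows_list 2 [[p, q], [r, s]]) $$ (i, j) =
          c * (if i = 0 then (if j = 0 then p else q) else (if j = 0 then r else s))" if "i < 2" "j < 2" for c p q r s :: complex and i j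
      proof -
        have "i = 0 \<or> i = 1" "j = 0 \<or> j = 1" using that by auto
        then show ?thesis by (auto simp: mat_of_rows_list_def)
      qed
      show ?thesis unfolding K w by (subst E) simp_all
    qed
    then show ?thesis unfolding e kappa_edge_eq exp_add c_def by (simp add: mult_ac)
  qed
  then have "pfaffian (block_mat k (\<lambda>j l. K_edge t (z j) (z l))) = (\<Prod>a<2*k. c a) * pf k (\<lambda>a b. edge_int (with_conj Y a) (with_conj Y b))"
    unfolding pfaffian_block_mat by (simp only: pf_scale)
  also have "(\<Prod>a<2*k. c a) = (\<Prod>j<k. exp ((Y j - cnj (Y j))\<^sup>2))"
    unfolding prod_pairs
  proof (rule prod.cong[OF refl])
    fix j
    have "exp (- (cmod (Y j))\<^sup>2) * exp (- (cmod (Y j))\<^sup>2) = exp (- (2 * (cmod (Y j))\<^sup>2))" by (simp flip: exp_add)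
    then have E: "complex_of_real (exp (- (cmod (Y j))\<^sup>2)) * complex_of_real (exp (- (cmod (Y j))\<^sup>2)) = complex_of_real (exp (- (2 * (cmod (Y j))\<^sup>2)))"
      by (simp flip: of_real_mult)
    have c01: "c (2*j) = complex_of_real (exp (- (cmod (Y j))\<^sup>2)) * exp ((Y j)\<^sup>2)"
      "c (2*j+1) = complex_of_real (exp (- (cmod (Y j))\<^sup>2)) * exp ((cnj (Y j))\<^sup>2)"
      by (simp_all add: c_def)
    show "c (2*j) * c (2*j+1) = exp ((Y j - cnj (Y j))\<^sup>2)"
      unfolding c01 exp_norm_square[symmetric] E[symmetric] by (simp only: mult_ac)
  qed
  finally show ?thesis
    unfolding R_edge_def edge_weight_def prod.distrib Y_def[symmetric] cY
    by (simp add: Y_def algebra_simps)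
qed

text \<open>\<open>Z\<close> lists the positions relative to the real edge point, in units of the
  micro-scale. The rotation \<open>e\<close> is confined to this change of coordinate.\<close>

lemma rescaled_correlation_edge:
  fixes N k :: nat and z :: "nat \<Rightarrow> complex" and e p :: complex
  assumes N: "N > 0" and k: "k \<le> N" and e: "cmod e = 1"
    and p: "p = complex_of_real (sqrt 2) * e \<or> p = - (complex_of_real (sqrt 2) * e)"
  defines "Z \<equiv> (\<lambda>j. e * (complex_of_real (sqrt (real N)) + z j) - complex_of_real (sqrt (real N)))"
  shows "complex_of_real (rescaled_correlation (\<lambda>\<zeta>. (cmod \<zeta>)\<^sup>2) p N k z) =
     (\<Prod>j<k. edge_weight (Z j)) * pf k (\<lambda>a b. edge_pre_kernel N (with_conj Z a) (with_conj Z b))"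
proof -
  define r where "r = complex_of_real (sqrt (real N))"
  define x where "x = (\<lambda>j. e * (complex_of_real (sqrt (real N)) + z j))"
  have x: "x j = r + Z j" for j by (simp add: x_def Z_def r_def)
  have rr: "cnj r = r" by (simp add: r_def)
  have wx: "with_conj x a = r + with_conj Z a" for a by (simp add: with_conj_def x rr)
  have "2 * pre_kernel N (with_conj x a) (with_conj x b) =
      exp ((with_conj x a)\<^sup>2) * exp ((with_conj x b)\<^sup>2) * edge_pre_kernel N (with_conj Z a) (with_conj Z b)" for a b
  proof -
    have "exp (u\<^sup>2) * exp (v\<^sup>2) * exp (- u\<^sup>2 - v\<^sup>2) = 1" for u v :: complex by (simp add: mult_exp_exp)
    then have "exp (u\<^sup>2) * exp (v\<^sup>2) * (2 * (exp (- u\<^sup>2 - v\<^sup>2) * P)) = 2 * P" for u v P :: complex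
      by (metis (no_types, opaque_lifting) mult.assoc mult.left_commute mult_1)
    then show ?thesis unfolding edge_pre_kernel_def Let_def r_def[symmetric] wx[symmetric] by simp
  qed
  then have 1: "pf k (\<lambda>a b. 2 * pre_kernel N (with_conj x a) (with_conj x b)) =
      (\<Prod>a<2*k. exp ((with_conj x a)\<^sup>2)) * pf k (\<lambda>a b. edge_pre_kernel N (with_conj Z a) (with_conj Z b))"
    by (simp only: pf_scale)
  have 2: "(\<Prod>j<k. gauss_weight 2 (x j)) * (\<Prod>a<2*k. exp ((with_conj x a)\<^sup>2)) = (\<Prod>j<k. edge_weight (Z j))"
    unfolding prod_pairs prod.distrib[symmetric]
  proof (rule prod.cong[OF refl])
    fix j
    have d: "cnj (Z j) - Z j = cnj (x j) - x j" "Z j - cnj (Z j) = x j - cnj (x j)" by (auto simp: x rr)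
    show "gauss_weight 2 (x j) * (exp ((with_conj x (2*j))\<^sup>2) * exp ((with_conj x (2*j+1))\<^sup>2)) = edge_weight (Z j)"
      unfolding edge_weight_def d exp_norm_square[symmetric] gauss_weight_def by simp
  qed
  have xj: "e * (complex_of_real (sqrt (real N)) + z j) = x j" for j by (simp add: x_def)
  show ?thesis
    unfolding rescaled_correlation_pf[OF N k e p] xj 1 mult.assoc[symmetric] 2 ..
qed

text \<open>A difference quotient of \<open>exp (\<i> * t * h)\<close> at
  \<open>h = 1 / sqrt N\<close>; its limit is the shift by \<open>\<i> * t\<close> in
  \<open>K_edge\<close>.\<close>

lemma cis_shift_tendsto:
  "(\<lambda>N. complex_of_real (sqrt (real N)) * (cis (t / sqrt (real N)) - 1)) \<longlonglongrightarrow> \<i> * complex_of_real t"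
  "(\<lambda>N. cis (t / sqrt (real N))) \<longlonglongrightarrow> 1"
proof -
  have d: "((\<lambda>h. exp (\<i> * complex_of_real t * h)) has_field_derivative \<i> * complex_of_real t) (at 0)"
    by (auto intro!: derivative_eq_intros)
  have f: "filterlim (\<lambda>N. complex_of_real (1 / sqrt (real N))) (at 0) sequentially"
  proof (rule filterlim_atI)
    have "(\<lambda>N. 1 / sqrt (real N)) \<longlonglongrightarrow> 0" by real_asymp
    then have "(\<lambda>N. complex_of_real (1 / sqrt (real N))) \<longlonglongrightarrow> complex_of_real 0" by (rule tendsto_of_real)
    then show "(\<lambda>N. complex_of_real (1 / sqrt (real N))) \<longlonglongrightarrow> 0" by (simp only: of_real_0)
    show "\<forall>\<^sub>F N in sequentially. complex_of_real (1 / sqrt (real N)) \<noteq> 0"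
      using eventually_gt_at_top[of 0] by eventually_elim simp
  qed
  have c: "exp (\<i> * complex_of_real t * complex_of_real (1 / sqrt (real N))) = cis (t / sqrt (real N))" for N
    by (simp add: cis_conv_exp)
  have "((\<lambda>h. (exp (\<i> * complex_of_real t * h) - exp (\<i> * complex_of_real t * 0)) / (h - 0)) \<longlongrightarrow> \<i> * complex_of_real t) (at 0)"
    using d unfolding has_field_derivative_iff .
  from filterlim_compose[OF this f]
  have "(\<lambda>N. (cis (t / sqrt (real N)) - 1) / complex_of_real (1 / sqrt (real N))) \<longlonglongrightarrow> \<i> * complex_of_real t"
    unfolding c by simp
  then show "(\<lambda>N. complex_of_real (sqrt (real N)) * (cis (t / sqrt (real N)) - 1)) \<longlonglongrightarrow> \<i> * complex_of_real t"
    by (simp add: mult.commute)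
  have "(\<lambda>N. t / sqrt (real N)) \<longlonglongrightarrow> 0"
  proof -
    have "(\<lambda>N. 1 / sqrt (real N)) \<longlonglongrightarrow> 0" by real_asymp
    from tendsto_mult_left[OF this, of t] show ?thesis by simp
  qed
  then have "(\<lambda>N. cis (t / sqrt (real N))) \<longlonglongrightarrow> cis 0" by (intro tendsto_intros)
  then show "(\<lambda>N. cis (t / sqrt (real N))) \<longlonglongrightarrow> 1" by simp
qed

text \<open>Joint continuity comes from the uniform limit just proved: the approximants are
  polynomials times Gaussians.\<close>

lemma edge_int_continuous: "R > 0 \<Longrightarrow> continuous_on (cball 0 R \<times> cball 0 R) (\<lambda>p. edge_int (fst p) (snd p))"
proof (rule uniform_limit_theorem[OF _ edge_pre_kernel_uniform_limit])
  show "\<forall>\<^sub>F N in sequentially. continuous_on (cball 0 R \<times> cball 0 R) (\<lambda>p. edge_pre_kernel N (fst p) (snd p))"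
    unfolding edge_pre_kernel_def Let_def pre_kernel_def exp_trunc_def
    by (intro always_eventually allI continuous_intros) auto
qed auto

lemma rescaled_correlation_uniform_limit:
  fixes k :: nat and t :: real and p :: "nat \<Rightarrow> complex"
  assumes p: "\<And>N. p N = complex_of_real (sqrt 2) * cis (t / sqrt (real N)) \<or> p N = - (complex_of_real (sqrt 2) * cis (t / sqrt (real N)))"
    and C: "compact C"
  shows "uniform_limit {z. \<forall>j<k. z j \<in> C} (\<lambda>N z. complex_of_real (rescaled_correlation (\<lambda>\<zeta>. (cmod \<zeta>)\<^sup>2) (p N) N k z)) (R_edge t k) sequentially"
proof -
  define X where "X = {z. \<forall>j<k. z j \<in> C}"
  obtain R where R: "R > 0" "\<And>y. y \<in> C \<Longrightarrow> cmod y \<le> R"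
    using compact_imp_bounded[OF C] unfolding bounded_pos by blast
  define it where "it = \<i> * complex_of_real t"
  \<comment> \<open>The 1 is room for the points \<open>Zf N y\<close>, which approach
    \<open>y + it\<close> but need not lie in the disc of radius
    \<open>R + \<bar>t\<bar>\<close>.\<close>
  define B where "B = R + \<bar>t\<bar> + 1"
  have B: "B > 0" using R by (simp add: B_def)
  define Zf where "Zf = (\<lambda>N y. cis (t / sqrt (real N)) * (complex_of_real (sqrt (real N)) + y) - complex_of_real (sqrt (real N)))"
  have Zlim: "uniform_limit C Zf (\<lambda>y. y + it) sequentially"
  proof (rule uniform_limitI)
    fix e :: real assume e: "e > 0"
    have 1: "\<forall>\<^sub>F N in sequentially. dist (complex_of_real (sqrt (real N)) * (cis (t / sqrt (real N)) - 1)) it < e / 2"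
      unfolding it_def using e by (intro tendstoD[OF cis_shift_tendsto(1)]) auto
    have 2: "\<forall>\<^sub>F N in sequentially. dist (cis (t / sqrt (real N))) 1 < e / (2 * R)"
      using e R by (intro tendstoD[OF cis_shift_tendsto(2)]) auto
    show "\<forall>\<^sub>F N in sequentially. \<forall>y\<in>C. dist (Zf N y) (y + it) < e"
      using 1 2
    proof eventually_elim
      case (elim N)
      show ?case
      proof
        fix y assume y: "y \<in> C"
        have "Zf N y - (y + it) = (complex_of_real (sqrt (real N)) * (cis (t / sqrt (real N)) - 1) - it) + (cis (t / sqrt (real N)) - 1) * y"
          by (simp add: Zf_def algebra_simps)
        then have "dist (Zf N y) (y + it) \<le> dist (complex_of_real (sqrt (real N)) * (cis (t / sqrt (real N)) - 1)) it + dist (cis (t / sqrt (real N))) 1 * cmod y"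
          unfolding dist_norm by (metis norm_mult norm_triangle_ineq)
        also have "dist (cis (t / sqrt (real N))) 1 * cmod y \<le> e / (2 * R) * R"
          using elim R y e by (intro mult_mono) auto
        also have "e / (2 * R) * R = e / 2" using R by simp
        finally show "dist (Zf N y) (y + it) < e" using elim by linarith
      qed
    qed
  qed
  have inB: "cmod (y + it) \<le> R + \<bar>t\<bar>" if "y \<in> C" for y
    using norm_triangle_ineq[of y it] R(2)[OF that] by (simp add: it_def norm_mult)
  have Zev: "\<forall>\<^sub>F N in sequentially. \<forall>y\<in>C. Zf N y \<in> cball 0 B"
  proof -
    have "\<forall>\<^sub>F N in sequentially. \<forall>y\<in>C. dist (Zf N y) (y + it) < 1" by (rule uniform_limitD[OF Zlim]) simp
    then show ?thesis
    proof eventually_elim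
      case (elim N)
      show ?case
      proof
        fix y assume y: "y \<in> C"
        have "cmod (Zf N y) \<le> cmod (Zf N y - (y + it)) + cmod (y + it)" by (metis diff_add_cancel norm_triangle_ineq)
        moreover have "cmod (Zf N y - (y + it)) < 1" using elim y by (simp only: dist_norm)
        ultimately have "cmod (Zf N y) \<le> B" using inB[OF y] unfolding B_def by linarith
        then show "Zf N y \<in> cball 0 B" by simp
      qed
    qed
  qed
  have wl: "uniform_limit X (\<lambda>N z. with_conj (\<lambda>j. Zf N (z j)) a) (\<lambda>z. with_conj (\<lambda>j. z j + it) a) sequentially" if a: "a < 2*k" for a
  proof (rule uniform_limitI)
    fix e :: real assume "e > 0"
    from uniform_limitD[OF Zlim this]
    show "\<forall>\<^sub>F N in sequentially. \<forall>z\<in>X. dist (with_conj (\<lambda>j. Zf N (z j)) a) (with_conj (\<lambda>j. z j + it) a) < e"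
    proof eventually_elim
      case (elim N)
      show ?case
      proof
        fix z assume "z \<in> X"
        then have "z (a div 2) \<in> C" using a by (auto simp: X_def)
        then have "dist (Zf N (z (a div 2))) (z (a div 2) + it) < e" using elim by blast
        moreover have "dist (cnj u) (cnj v) = dist u v" for u v
          by (metis complex_cnj_diff complex_mod_cnj dist_norm)
        ultimately show "dist (with_conj (\<lambda>j. Zf N (z j)) a) (with_conj (\<lambda>j. z j + it) a) < e"
          unfolding with_conj_def by (cases "even a") (simp_all only: if_True if_False simp_thms)
      qed
    qed
  qed
  have wev: "\<forall>\<^sub>F N in sequentially. \<forall>z\<in>X. with_conj (\<lambda>j. Zf N (z j)) a \<in> cball 0 B" if a: "a < 2*k" for a
    using Zev
  proof eventually_elim
    case (elim N)
    show ?case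
    proof
      fix z assume "z \<in> X"
      then have "Zf N (z (a div 2)) \<in> cball 0 B" using a elim by (auto simp: X_def)
      then show "with_conj (\<lambda>j. Zf N (z j)) a \<in> cball 0 B" by (simp add: with_conj_def)
    qed
  qed
  have wB: "with_conj (\<lambda>j. z j + it) a \<in> cball 0 B" if "a < 2*k" "z \<in> X" for a z
  proof -
    have "z (a div 2) \<in> C" using that by (auto simp: X_def)
    from inB[OF this] have "cmod (z (a div 2) + it) \<le> B" unfolding B_def by linarith
    moreover from this have "cmod (cnj (z (a div 2) + it)) \<le> B" by (simp only: complex_mod_cnj)
    ultimately show ?thesis unfolding with_conj_def mem_cball_0 by (cases "even a") (simp_all only: if_True if_False simp_thms)
  qed
  have pl: "bounded_uniform_limit X (\<lambda>N z. pf k (\<lambda>a b. edge_pre_kernel N (with_conj (\<lambda>j. Zf N (z j)) a) (with_conj (\<lambda>j. Zf N (z j)) b)))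
      (\<lambda>z. pf k (\<lambda>a b. edge_int (with_conj (\<lambda>j. z j + it) a) (with_conj (\<lambda>j. z j + it) b))) sequentially"
  proof (rule bounded_uniform_limit_pf)
    fix a b assume ab: "a < 2*k" "b < 2*k"
    let ?P = "cball (0::complex) B \<times> cball (0::complex) B"
    have cont: "continuous_on ?P (\<lambda>p. edge_int (fst p) (snd p))" by (rule edge_int_continuous[OF B])
    have cP: "compact ?P" by (intro compact_Times compact_cball)
    have "uniform_limit X (\<lambda>N z. (\<lambda>p. edge_pre_kernel N (fst p) (snd p)) (with_conj (\<lambda>j. Zf N (z j)) a, with_conj (\<lambda>j. Zf N (z j)) b))
        (\<lambda>z. (\<lambda>p. edge_int (fst p) (snd p)) (with_conj (\<lambda>j. z j + it) a, with_conj (\<lambda>j. z j + it) b)) sequentially"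
    proof (rule uniform_limit_compose_both[OF edge_pre_kernel_uniform_limit[OF B]])
      show "uniformly_continuous_on ?P (\<lambda>p. edge_int (fst p) (snd p))" by (rule compact_uniformly_continuous[OF cont cP])
      show "closed ?P" by (rule compact_imp_closed[OF cP])
      show "uniform_limit X (\<lambda>N z. (with_conj (\<lambda>j. Zf N (z j)) a, with_conj (\<lambda>j. Zf N (z j)) b)) (\<lambda>z. (with_conj (\<lambda>j. z j + it) a, with_conj (\<lambda>j. z j + it) b)) sequentially"
      proof (rule uniform_limitI)
        fix e :: real assume e: "e > 0"
        then have e2: "e / 2 > 0" by simp
        show "\<forall>\<^sub>F N in sequentially. \<forall>z\<in>X. dist (with_conj (\<lambda>j. Zf N (z j)) a, with_conj (\<lambda>j. Zf N (z j)) b) (with_conj (\<lambda>j. z j + it) a, with_conj (\<lambda>j. z j + it) b) < e"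
          using uniform_limitD[OF wl[OF ab(1)] e2] uniform_limitD[OF wl[OF ab(2)] e2]
        proof eventually_elim
          case (elim N)
          have "dist (u, v) (u', v') < e" if "dist u u' < e / 2" "dist v v' < e / 2" for u v u' v' :: complex
          proof -
            have "dist (u, v) (u', v') \<le> dist u u' + dist v v'"
              unfolding dist_Pair_Pair by (rule sqrt_sum_squares_le_sum) auto
            then show ?thesis using that by linarith
          qed
          then show ?case using elim by blast
        qed
      qed
      show "\<forall>\<^sub>F N in sequentially. \<forall>z\<in>X. (with_conj (\<lambda>j. Zf N (z j)) a, with_conj (\<lambda>j. Zf N (z j)) b) \<in> ?P"
        using wev[OF ab(1)] wev[OF ab(2)] by eventually_elim blast
    qed
    moreover have "bounded ((\<lambda>z. edge_int (with_conj (\<lambda>j. z j + it) a) (with_conj (\<lambda>j. z j + it) b)) ` X)"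
    proof (rule bounded_subset[OF compact_imp_bounded[OF compact_continuous_image[OF cont cP]]])
      show "(\<lambda>z. edge_int (with_conj (\<lambda>j. z j + it) a) (with_conj (\<lambda>j. z j + it) b)) ` X \<subseteq> (\<lambda>p. edge_int (fst p) (snd p)) ` ?P"
      proof
        fix u assume "u \<in> (\<lambda>z. edge_int (with_conj (\<lambda>j. z j + it) a) (with_conj (\<lambda>j. z j + it) b)) ` X"
        then obtain z where z: "z \<in> X" "u = edge_int (with_conj (\<lambda>j. z j + it) a) (with_conj (\<lambda>j. z j + it) b)" by blast
        show "u \<in> (\<lambda>p. edge_int (fst p) (snd p)) ` ?P"
          unfolding z(2) using wB[OF ab(1) z(1)] wB[OF ab(2) z(1)]
          by (intro image_eqI[where x = "(with_conj (\<lambda>j. z j + it) a, with_conj (\<lambda>j. z j + it) b)"]) simp_all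
      qed
    qed
    ultimately show "bounded_uniform_limit X (\<lambda>N z. edge_pre_kernel N (with_conj (\<lambda>j. Zf N (z j)) a) (with_conj (\<lambda>j. Zf N (z j)) b))
        (\<lambda>z. edge_int (with_conj (\<lambda>j. z j + it) a) (with_conj (\<lambda>j. z j + it) b)) sequentially"
      unfolding bounded_uniform_limit_def by simp
  qed
  have wgt: "bounded_uniform_limit X (\<lambda>N z. \<Prod>j<k. edge_weight (Zf N (z j))) (\<lambda>z. \<Prod>j<k. edge_weight (z j + it)) sequentially"
  proof (rule bounded_uniform_limit_prod)
    fix j assume j: "j \<in> {..<k}"
    have jj: "2 * j < 2 * k" using j by auto
    have "uniform_limit X (\<lambda>N z. edge_weight (with_conj (\<lambda>j. Zf N (z j)) (2*j))) (\<lambda>z. edge_weight (with_conj (\<lambda>j. z j + it) (2*j))) sequentially"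
      by (rule uniform_limit_compose_uniformly_continuous_on[OF wl[OF jj] compact_uniformly_continuous[OF edge_weight_continuous compact_cball] wev[OF jj]]) simp
    moreover have "bounded ((\<lambda>z. edge_weight (with_conj (\<lambda>j. z j + it) (2*j))) ` X)"
      by (rule bounded_subset[OF compact_imp_bounded[OF compact_continuous_image[OF edge_weight_continuous compact_cball[of 0 B]]]])
         (use wB[OF jj] in blast)
    ultimately show "bounded_uniform_limit X (\<lambda>N z. edge_weight (Zf N (z j))) (\<lambda>z. edge_weight (z j + it)) sequentially"
      unfolding bounded_uniform_limit_def by simp
  qed simp
  have lim: "uniform_limit X (\<lambda>N z. (\<Prod>j<k. edge_weight (Zf N (z j))) * pf k (\<lambda>a b. edge_pre_kernel N (with_conj (\<lambda>j. Zf N (z j)) a) (with_conj (\<lambda>j. Zf N (z j)) b)))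
      (R_edge t k) sequentially"
    using bounded_uniform_limit_mult[OF wgt pl] unfolding bounded_uniform_limit_def R_edge_eq[abs_def] it_def by blast
  then show ?thesis unfolding X_def[symmetric]
  proof (rule uniform_limit_cong[THEN iffD1, rotated 2])
    show "\<forall>\<^sub>F N in sequentially. \<forall>z\<in>X. (\<Prod>j<k. edge_weight (Zf N (z j))) * pf k (\<lambda>a b. edge_pre_kernel N (with_conj (\<lambda>j. Zf N (z j)) a) (with_conj (\<lambda>j. Zf N (z j)) b)) =
        complex_of_real (rescaled_correlation (\<lambda>\<zeta>. (cmod \<zeta>)\<^sup>2) (p N) N k z)"
      using eventually_gt_at_top[of 0] eventually_ge_at_top[of k]
    proof eventually_elim
      case (elim N)
      have "cmod (cis (t / sqrt (real N))) = 1" by simp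
      from rescaled_correlation_edge[OF elim this p] show ?case unfolding Zf_def by simp
    qed
  qed simp
qed

section \<open>A lower bound for the determinant\<close>

text \<open>Divide out the zeros one at a time. On the circle of radius \<open>R + 1\<close> each
  \<open>x - a\<close> has modulus at least 1, so a division does not increase the bound there, and
  the maximum principle carries it into the disc.\<close>

lemma holomorphic_vanishing_bound:
  fixes f :: "complex \<Rightarrow> complex"
  assumes "finite S" "f holomorphic_on UNIV" "\<And>a. a \<in> S \<Longrightarrow> f a = 0" "S \<subseteq> cball 0 R"
    and "\<And>x. cmod x = R + 1 \<Longrightarrow> cmod (f x) \<le> B" "cmod z \<le> R" "0 \<le> R"
  shows "cmod (f z) \<le> B * (\<Prod>a\<in>S. cmod (z - a))"
  using assms
proof (induction S arbitrary: f rule: finite_induct)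
  case empty
  have "cmod (f z) \<le> B"
  proof (rule maximum_modulus_frontier[where S = "cball 0 (R+1)" and f = f])
    show "f holomorphic_on interior (cball 0 (R + 1))"
      using empty(1) holomorphic_on_subset by blast
    show "continuous_on (closure (cball 0 (R + 1))) f"
      using empty(1) holomorphic_on_imp_continuous_on continuous_on_subset by blast
    show "cmod (f z) \<le> B" if "z \<in> frontier (cball 0 (R + 1))" for z
      using that empty by (auto simp: frontier_cball dist_norm)
    show "z \<in> cball 0 (R+1)" using empty by auto
  qed auto
  then show ?case by simp
next
  case (insert a S)
  define g where "g = (\<lambda>x. if x = a then deriv f a else f x / (x - a))"
  have fg: "f x = (x - a) * g x" for x using insert.prems(2)[of a] by (simp add: g_def)
  have hg: "g holomorphic_on UNIV"
  proof -
    have "f a = 0" using insert.prems(2) by simp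
    then show ?thesis
      by (rule pole_theorem_open_0[OF insert.prems(1) open_UNIV fg, rotated]) (simp add: g_def)
  qed
  have "cmod (g z) \<le> B * (\<Prod>a\<in>S. cmod (z - a))"
  proof (rule insert.IH[OF hg])
    show "g b = 0" if "b \<in> S" for b
      using that insert by (auto simp: g_def)
    show "S \<subseteq> cball 0 R" using insert.prems by auto
    show "cmod (g x) \<le> B" if "cmod x = R + 1" for x
    proof -
      have "cmod a \<le> R" using insert.prems(3) by (auto simp: dist_norm)
      then have "cmod (x - a) \<ge> 1" using norm_triangle_ineq2[of x a] that by linarith
      then have "cmod (g x) \<le> cmod (x - a) * cmod (g x)"
        by (simp add: mult_le_cancel_right1)
      also have "\<dots> = cmod (f x)" unfolding fg[of x] norm_mult ..
      also have "\<dots> \<le> B" using insert.prems(4) that by blast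
      finally show ?thesis .
    qed
  qed (use insert.prems in auto)
  then have "cmod (z - a) * cmod (g z) \<le> cmod (z - a) * (B * (\<Prod>a\<in>S. cmod (z - a)))"
    by (intro mult_left_mono) auto
  then show ?case unfolding fg[of z] norm_mult using insert.hyps by (simp add: mult_ac)
qed

text \<open>\<open>holomorphic_vanishing_bound\<close> in one variable after the other, the last one
  first: variable \<open>i\<close> has its zeros at the \<open>z j\<close> with
  \<open>j > i\<close>. The variables before it are still allowed in the larger disc, so that the
  bound already obtained is available on the circle of radius \<open>R + 1\<close>.\<close>

lemma diagonal_vanishing_bound:
  fixes F :: "(nat \<Rightarrow> complex) \<Rightarrow> complex"
  assumes hol: "\<And>z j. j < k \<Longrightarrow> (\<lambda>x. F (z(j := x))) holomorphic_on UNIV"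
    and zero: "\<And>z i j. i < k \<Longrightarrow> j < k \<Longrightarrow> i \<noteq> j \<Longrightarrow> z i = z j \<Longrightarrow> F z = 0"
    and bound: "\<And>z. (\<And>j. j < k \<Longrightarrow> cmod (z j) \<le> R + 1) \<Longrightarrow> cmod (F z) \<le> B"
    and R: "0 \<le> R" and z: "\<And>j. j < k \<Longrightarrow> cmod (z j) \<le> R"
  shows "cmod (F z) \<le> B * (\<Prod>i<k. \<Prod>j\<in>{i<..<k}. cmod (z i - z j))"
proof -
  have B: "B \<ge> 0"
    using order_trans[OF norm_ge_zero bound[of "\<lambda>_. 0"]] R by simp
  have "cmod (F z) \<le> B * (\<Prod>i\<in>{k - m..<k}. \<Prod>j\<in>{i<..<k}. cmod (z i - z j))"
    if "m \<le> k" "\<And>j. j < k - m \<Longrightarrow> cmod (z j) \<le> R + 1" "\<And>j. k - m \<le> j \<Longrightarrow> j < k \<Longrightarrow> cmod (z j) \<le> R" for m z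
    using that
  proof (induction m arbitrary: z)
    case 0
    then show ?case using bound[of z] by simp
  next
    case (Suc m)
    define i where "i = k - Suc m"
    have i: "i < k" "k - m = Suc i" "Suc i \<le> k" using Suc.prems(1) by (auto simp: i_def)
    let ?P = "\<lambda>z. \<Prod>i\<in>{Suc i..<k}. \<Prod>j\<in>{i<..<k}. cmod (z i - z j)"
    have iv: "{i..<k} = insert i {Suc i..<k}" using i by auto
    \<comment> \<open>If two later points coincide, the image set has too few elements to supply all
      factors, but then \<open>F z = 0\<close>.\<close>
    show ?case
    proof (cases "inj_on z {i<..<k}")
      case False
      then obtain a b where ab: "a \<in> {i<..<k}" "b \<in> {i<..<k}" "a \<noteq> b" "z a = z b" unfolding inj_on_def by blast
      then have "F z = 0" using zero[of a b z] by auto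
      then show ?thesis using B by (auto intro!: mult_nonneg_nonneg prod_nonneg)
    next
      case True
      have "cmod ((\<lambda>x. F (z(i := x))) (z i)) \<le> (B * ?P z) * (\<Prod>a\<in>z ` {i<..<k}. cmod (z i - a))"
      proof (rule holomorphic_vanishing_bound[where R = R])
        show "(\<lambda>x. F (z(i := x))) holomorphic_on UNIV" by (rule hol[OF i(1)])
        show "F (z(i := a)) = 0" if a: "a \<in> z ` {i<..<k}" for a
        proof -
          obtain j where "j \<in> {i<..<k}" "a = z j" using a by auto
          then show ?thesis using zero[of i j "z(i := a)"] i by auto
        qed
        show "z ` {i<..<k} \<subseteq> cball 0 R" using Suc.prems(3) unfolding i_def by auto
        show "cmod (F (z(i := x))) \<le> B * ?P z" if x: "cmod x = R + 1" for x
        proof -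
          have "cmod (F (z(i := x))) \<le> B * ?P (z(i := x))"
            unfolding i(2)[symmetric]
          proof (rule Suc.IH)
            show "cmod ((z(i := x)) j) \<le> R + 1" if "j < k - m" for j
              using that x Suc.prems(2)[of j] i(2) i_def by (cases "j = i") auto
            show "cmod ((z(i := x)) j) \<le> R" if "k - m \<le> j" "j < k" for j
              using that Suc.prems(3)[of j] i(2) i_def by auto
          qed (use Suc.prems in auto)
          also have "?P (z(i := x)) = ?P z"
            by (intro prod.cong refl) auto
          finally show ?thesis .
        qed
        show "cmod (z i) \<le> R" using Suc.prems(3)[of i] i unfolding i_def by auto
      qed (use R in auto)
      also have "(\<Prod>a\<in>z ` {i<..<k}. cmod (z i - a)) = (\<Prod>j\<in>{i<..<k}. cmod (z i - z j))"
        using True by (simp add: prod.reindex)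
      finally show ?thesis unfolding i_def[symmetric] iv by (simp add: mult_ac)
    qed
  qed
  from this[of k z] show ?thesis using z by (simp add: atLeast0LessThan)
qed

text \<open>The hypothesis bounds the eigenvalues of \<open>W * G * W\<^sup>*\<close>, where \<open>W\<close> is the inverse of \<open>V\<close>, from below.\<close>

lemma det_ge_of_quadratic_form:
  fixes G V :: "nat \<Rightarrow> nat \<Rightarrow> complex" and q :: "(nat \<Rightarrow> complex) \<Rightarrow> real"
  assumes c: "c > 0"
    and q: "\<And>x. complex_of_real (q x) = (\<Sum>j<k. \<Sum>l<k. x j * cnj (x l) * G j l)"
      "\<And>x. q x \<ge> c * (\<Sum>i<k. (cmod (\<Sum>j<k. x j * V j i))\<^sup>2)"
  shows "c ^ k * (cmod (Determinant.det (Matrix.mat k k (\<lambda>(j, i). V j i))))\<^sup>2 \<le> cmod (Determinant.det (Matrix.mat k k (\<lambda>(j, l). G j l)))"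
proof (cases "Determinant.det (Matrix.mat k k (\<lambda>(j, i). V j i)) = 0")
  case True
  show ?thesis
  proof (cases "k = 0")
    case True
    then show ?thesis using \<open>Determinant.det (Matrix.mat k k (\<lambda>(j, i). V j i)) = 0\<close> by simp
  next
    case False
    then show ?thesis using True by simp
  qed
next
  case False
  define GM where "GM = Matrix.mat k k (\<lambda>(j, l). G j l)"
  define VM where "VM = Matrix.mat k k (\<lambda>(j, i). V j i)"
  define cadj where "cadj = (\<lambda>A :: complex mat. Matrix.mat k k (\<lambda>(i, j). cnj (A $$ (j, i))))"
  have car: "GM \<in> carrier_mat k k" "VM \<in> carrier_mat k k" "cadj A \<in> carrier_mat k k" for A
    by (auto simp: GM_def VM_def cadj_def)
  have "VM \<in> Units (ring_mat TYPE(complex) k undefined)"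
    using det_non_zero_imp_unit[OF car(2)] False by (simp add: VM_def)
  then obtain W where W: "W \<in> carrier_mat k k" "W * VM = 1\<^sub>m k" "VM * W = 1\<^sub>m k"
    unfolding Units_def ring_mat_def by auto
  have adj_mult: "cadj (A * B) = cadj B * cadj A" if "A \<in> carrier_mat k k" "B \<in> carrier_mat k k" for A B
    using that unfolding cadj_def
    by (intro eq_matI) (auto simp: scalar_prod_def cnj_sum mult.commute intro!: sum.cong)
  have adj_one: "cadj (1\<^sub>m k) = 1\<^sub>m k" unfolding cadj_def by (intro eq_matI) auto
  have detadj: "Determinant.det (cadj A) = cnj (Determinant.det A)" if A: "A \<in> carrier_mat k k" for A
  proof -
    have "Determinant.det (cadj A) = (\<Sum>p | p permutes {0..<k}. of_int (sign p) * (\<Prod>i = 0..<k. cadj A $$ (i, p i)))"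
      by (rule det_def'[OF car(3)])
    also have "\<dots> = (\<Sum>p | p permutes {0..<k}. cnj (of_int (sign p) * (\<Prod>i<k. A $$ (p i, i))))"
    proof (intro sum.cong refl)
      fix p assume "p \<in> {p. p permutes {0..<k}}"
      then have pk: "p i < k" if "i < k" for i using permutes_in_image[of p "{0..<k}" i] that by auto
      have "(\<Prod>i = 0..<k. cadj A $$ (i, p i)) = (\<Prod>i<k. cnj (A $$ (p i, i)))"
        unfolding atLeast0LessThan using pk by (intro prod.cong) (auto simp: cadj_def)
      then show "of_int (sign p) * (\<Prod>i = 0..<k. cadj A $$ (i, p i)) = cnj (of_int (sign p) * (\<Prod>i<k. A $$ (p i, i)))"
        by simp
    qed
    also have "\<dots> = cnj (Determinant.det A)" unfolding det_col[OF A] cnj_sum ..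
    finally show ?thesis .
  qed
  define N where "N = W * GM * cadj W"
  have Nc: "N \<in> carrier_mat k k" unfolding N_def by (intro mult_carrier_mat[of _ k k] W(1) car)
  have eig: "cmod ev \<ge> c" if evN: "eigenvalue N ev" for ev
  proof -
    obtain v where v: "v \<in> carrier_vec k" "v \<noteq> 0\<^sub>v k" "N *\<^sub>v v = ev \<cdot>\<^sub>v v"
      using evN Nc unfolding eigenvalue_def eigenvector_def by auto
    \<comment> \<open>An eigenvector \<open>v\<close> is pulled back by the adjoint of
      \<open>W\<close>. For the conjugate \<open>x\<close> of \<open>y\<close> the linear forms in
      the hypothesis take the values \<open>cnj (v $ i)\<close>, and \<open>q x\<close> is
      \<open>ev\<close> times the squared norm of \<open>v\<close>.\<close>
    define y where "y = cadj W *\<^sub>v v"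
    have yc: "y \<in> carrier_vec k" using car(3)[of W] v(1) unfolding y_def by auto
    have Gy: "GM *\<^sub>v y = ev \<cdot>\<^sub>v (VM *\<^sub>v v)"
    proof -
      have "W *\<^sub>v (GM *\<^sub>v y) = N *\<^sub>v v"
        unfolding N_def assoc_mult_mat_vec[OF mult_carrier_mat[OF W(1) car(1)] car(3) v(1)] y_def[symmetric]
          assoc_mult_mat_vec[OF W(1) car(1) yc] ..
      then have "VM *\<^sub>v (W *\<^sub>v (GM *\<^sub>v y)) = VM *\<^sub>v (ev \<cdot>\<^sub>v v)" using v(3) by simp
      moreover have "VM *\<^sub>v (W *\<^sub>v (GM *\<^sub>v y)) = GM *\<^sub>v y"
      proof -
        have "GM *\<^sub>v y \<in> carrier_vec k" using car(1) yc by auto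
        then show ?thesis using W car(2) assoc_mult_mat_vec[of VM k k W k "GM *\<^sub>v y"] by simp
      qed
      moreover have "VM *\<^sub>v (ev \<cdot>\<^sub>v v) = ev \<cdot>\<^sub>v (VM *\<^sub>v v)" using car(2) v(1) by (simp add: mult_mat_vec)
      ultimately show ?thesis by simp
    qed
    have "cadj VM *\<^sub>v y = (cadj VM * cadj W) *\<^sub>v v"
      unfolding y_def using car v(1) by (simp add: assoc_mult_mat_vec[of _ k k _ k])
    also have "cadj VM * cadj W = 1\<^sub>m k" unfolding adj_mult[OF W(1) car(2), symmetric] W(2) adj_one ..
    finally have Vy: "cadj VM *\<^sub>v y = v" using v(1) by simp
    have vi: "v $ i = (\<Sum>j<k. cnj (V j i) * y $ j)" if "i < k" for i
    proof -
      have "v $ i = (cadj VM *\<^sub>v y) $ i" unfolding Vy ..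
      also have "\<dots> = (\<Sum>j = 0..<k. cnj (V j i) * y $ j)"
        using that yc car(3)[of VM] by (simp add: scalar_prod_def cadj_def VM_def)
      finally show ?thesis by (simp add: atLeast0LessThan)
    qed
    define x where "x = (\<lambda>j. cnj (y $ j))"
    have xV: "(\<Sum>j<k. x j * V j i) = cnj (v $ i)" if "i < k" for i
      unfolding vi[OF that] x_def by (simp add: mult.commute)
    define s where "s = (\<Sum>i<k. (cmod (v $ i))\<^sup>2)"
    have Gj: "(\<Sum>l<k. G j l * y $ l) = ev * (\<Sum>i<k. V j i * v $ i)" if "j < k" for j
    proof -
      have "(GM *\<^sub>v y) $ j = (ev \<cdot>\<^sub>v (VM *\<^sub>v v)) $ j" unfolding Gy ..
      then show ?thesis using that yc v(1) by (simp add: scalar_prod_def GM_def VM_def atLeast0LessThan)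
    qed
    have "complex_of_real (q x) = (\<Sum>j<k. x j * (\<Sum>l<k. G j l * y $ l))"
      unfolding q(1) x_def by (simp add: sum_distrib_left mult_ac)
    also have "\<dots> = (\<Sum>j<k. x j * (ev * (\<Sum>i<k. V j i * v $ i)))"
      by (intro sum.cong refl) (simp add: Gj)
    also have "\<dots> = ev * (\<Sum>j<k. \<Sum>i<k. x j * V j i * v $ i)"
      by (simp add: sum_distrib_left mult_ac)
    also have "(\<Sum>j<k. \<Sum>i<k. x j * V j i * v $ i) = (\<Sum>i<k. (\<Sum>j<k. x j * V j i) * v $ i)"
      by (subst sum.swap) (simp add: sum_distrib_right)
    also have "\<dots> = (\<Sum>i<k. complex_of_real ((cmod (v $ i))\<^sup>2))"
      by (intro sum.cong refl) (simp add: xV complex_norm_square mult.commute del: of_real_power)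
    also have "\<dots> = complex_of_real s" unfolding s_def by simp
    finally have qe: "complex_of_real (q x) = ev * complex_of_real s" .
    have "c * (\<Sum>i<k. (cmod (\<Sum>j<k. x j * V j i))\<^sup>2) = c * s"
      unfolding s_def by (intro arg_cong2[where f="(*)"] sum.cong refl) (simp add: xV)
    then have qs: "q x \<ge> c * s" using q(2)[of x] by linarith
    have "s > 0"
    proof -
      obtain i where i: "i < k" "v $ i \<noteq> 0"
      proof (rule ccontr)
        assume "\<not> thesis"
        then have "\<forall>i<k. v $ i = 0" using that by blast
        then have "v = 0\<^sub>v k" using v(1) by (intro eq_vecI) auto
        then show False using v(2) by simp
      qed
      then show ?thesis unfolding s_def by (intro sum_pos2[of _ i]) auto
    qed
    have "cmod ev * s = \<bar>q x\<bar>" using arg_cong[OF qe, of cmod] \<open>s > 0\<close> by (simp add: norm_mult)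
    then have "c * s \<le> cmod ev * s" using qs by simp
    then show "c \<le> cmod ev" using \<open>s > 0\<close> by simp
  qed
  \<comment> \<open>The determinant is, up to sign, the product of the \<open>k\<close> roots of the
    characteristic polynomial, and each root is an eigenvalue.\<close>
  obtain as where as: "char_poly N = (\<Prod>a\<leftarrow>as. [:- a, 1:])" "length as = k"
    using char_poly_factorized[OF Nc] by blast
  have "c ^ k \<le> cmod (Determinant.det N)"
  proof -
    have "- char_matrix N 0 = (-1) \<cdot>\<^sub>m N" using Nc by (intro eq_matI) (auto simp: char_matrix_def)
    then have "poly (char_poly N) 0 = (-1) ^ k * Determinant.det N"
      unfolding char_poly_matrix[OF Nc] using Nc by simp
    then have "cmod (Determinant.det N) = cmod (poly (char_poly N) 0)" by (simp add: norm_mult norm_power)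
    also have "poly (char_poly N) 0 = (\<Prod>a\<leftarrow>as. - a)" unfolding as(1) by (simp add: poly_prod_list o_def)
    finally have dN: "cmod (Determinant.det N) = cmod (\<Prod>a\<leftarrow>as. - a)" .
    have "c \<le> cmod a" if "a \<in> set as" for a
    proof (rule eig)
      have "poly (char_poly N) a = 0" unfolding as(1) using that by (simp add: poly_prod_list prod_list_zero_iff)
      then show "eigenvalue N a" using eigenvalue_root_char_poly[OF Nc] by blast
    qed
    then have "c ^ length as \<le> cmod (\<Prod>a\<leftarrow>as. - a)"
    proof (induction as)
      case (Cons a as)
      then have "c * c ^ length as \<le> cmod a * cmod (\<Prod>a\<leftarrow>as. - a)" using c by (intro mult_mono) auto
      then show ?case by (simp add: norm_mult)
    qed simp
    then show ?thesis unfolding dN as(2) .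
  qed
  moreover have "Determinant.det N * (Determinant.det VM * cnj (Determinant.det VM)) = Determinant.det GM"
  proof -
    have d: "Determinant.det N = Determinant.det W * Determinant.det GM * cnj (Determinant.det W)"
      unfolding N_def using W(1) car detadj[OF W(1)] by (simp add: det_mult[of _ k] mult_carrier_mat[of _ k k _ k])
    have w: "Determinant.det W * Determinant.det VM = 1"
      using det_mult[OF W(1) car(2)] unfolding W(2) by simp
    then have w': "cnj (Determinant.det W) * cnj (Determinant.det VM) = 1" by (metis complex_cnj_mult complex_cnj_one)
    have "a * g * b * (u * u') = g" if "a * u = 1" "b * u' = 1" for a b u u' g :: complex
    proof -
      have "a * g * b * (u * u') = g * (a * u) * (b * u')" by (simp only: mult_ac)
      then show ?thesis using that by simp
    qed
    from this[OF w w'] show ?thesis unfolding d .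
  qed
  then have "cmod (Determinant.det GM) = cmod (Determinant.det N) * (cmod (Determinant.det VM))\<^sup>2"
    by (metis complex_mod_cnj norm_mult power2_eq_square)
  ultimately show ?thesis unfolding GM_def[symmetric] VM_def[symmetric] by (simp add: mult_right_mono)
qed

text \<open>On this disc \<open>exp z - z\<close> has derivative of modulus at most
  \<open>1 / 2\<close>, so \<open>exp\<close> differs from the identity by a contraction.\<close>

lemma exp_difference_lower:
  fixes a b :: complex
  assumes "cmod a \<le> 1 / 4" "cmod b \<le> 1 / 4"
  shows "cmod (a - b) / 2 \<le> cmod (exp a - exp b)"
proof -
  have "norm ((\<lambda>z. exp z - z) a - (\<lambda>z. exp z - z) b) \<le> 1 / 2 * norm (a - b)"
  proof (rule field_differentiable_bound[where S = "cball 0 (1/4)"])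
    fix z :: complex assume z: "z \<in> cball 0 (1/4)"
    show "((\<lambda>z. exp z - z) has_field_derivative exp z - 1) (at z within cball 0 (1/4))"
      by (auto intro!: derivative_eq_intros)
    have "norm (exp z - exp 0) \<le> 3 / 2 * norm (z - 0)"
    proof (rule field_differentiable_bound[where S = "cball 0 (1/4)"])
      fix w :: complex assume w: "w \<in> cball 0 (1/4)"
      show "(exp has_field_derivative exp w) (at w within cball 0 (1/4))"
        by (auto intro!: derivative_eq_intros)
      have "norm (exp w) \<le> exp (norm w)" by (rule norm_exp)
      also have "\<dots> \<le> 1 + 2 * norm w" using w by (intro real_exp_bound_lemma) auto
      also have "\<dots> \<le> 3 / 2" using w by simp
      finally show "norm (exp w) \<le> 3 / 2" .
    qed (use z in auto)
    then have "norm (exp z - 1) \<le> 3 / 2 * norm z" by simp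
    also have "\<dots> \<le> 1 / 2" using z by simp
    finally show "norm (exp z - 1) \<le> 1 / 2" .
  qed (use assms in auto)
  then have "norm ((exp a - exp b) - (a - b)) \<le> norm (a - b) / 2" by (simp add: algebra_simps)
  moreover have "norm (a - b) \<le> norm (exp a - exp b) + norm ((exp a - exp b) - (a - b))"
    using norm_triangle_ineq4[of "exp a - exp b" "(exp a - exp b) - (a - b)"] by simp
  ultimately show ?thesis by linarith
qed

text \<open>The integral of \<open>exp (4 * z * u)\<close> over \<open>{- h..0}\<close>.\<close>

definition exp_block :: "real \<Rightarrow> complex \<Rightarrow> complex" where
  "exp_block h z = (if z = 0 then complex_of_real h else (1 - exp (- (4 * complex_of_real h * z))) / (4 * z))"

lemma exp_block_lower:
  assumes "h > 0" "4 * h * cmod z \<le> 1 / 4"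
  shows "cmod (exp_block h z) \<ge> h / 2"
proof (cases "z = 0")
  case False
  have "cmod (0 - (- (4 * complex_of_real h * z))) / 2 \<le> cmod (exp 0 - exp (- (4 * complex_of_real h * z)))"
    using assms by (intro exp_difference_lower) (auto simp: norm_mult)
  then have "4 * h * cmod z / 2 \<le> cmod (1 - exp (- (4 * complex_of_real h * z)))"
    using assms by (simp add: norm_mult)
  then have "(4 * h * cmod z / 2) / (4 * cmod z) \<le> cmod (1 - exp (- (4 * complex_of_real h * z))) / (4 * cmod z)"
    by (intro divide_right_mono) auto
  then show ?thesis using False by (simp add: exp_block_def norm_divide norm_mult)
qed (use assms in \<open>simp add: exp_block_def\<close>)

text \<open>The block is \<open>{- h..0}\<close> moved by \<open>- i * h\<close>, which multiplies
  the integral by the \<open>i\<close>-th power of a fixed factor.\<close>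

lemma exp_block_integral:
  assumes "h > 0"
  shows "((\<lambda>u. exp (4 * z * complex_of_real u)) has_integral (exp_block h z * exp (- (4 * complex_of_real h * z)) ^ i)) {- (real (Suc i) * h)..- (real i * h)}"
proof -
  let ?a = "- (real (Suc i) * h)" and ?b = "- (real i * h)"
  have ab: "?a \<le> ?b" using assms by (simp add: mult_right_mono)
  show ?thesis
  proof (cases "z = 0")
    case True
    have "((\<lambda>u::real. 1::complex) has_integral (?b - ?a) *\<^sub>R 1) {?a..?b}"
      using has_integral_const_real[of "1::complex" ?a ?b] ab by simp
    then show ?thesis using True by (simp add: exp_block_def algebra_simps scaleR_conv_of_real)
  next
    case False
    have "((\<lambda>u. exp (4 * z * complex_of_real u)) has_integral
        (exp (4 * z * complex_of_real ?b) / (4 * z) - exp (4 * z * complex_of_real ?a) / (4 * z))) {?a..?b}"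
    proof (rule fundamental_theorem_of_calculus[OF ab])
      fix x
      have "((\<lambda>u. exp (4 * z * u) / (4 * z)) has_field_derivative exp (4 * z * complex_of_real x)) (at (complex_of_real x))"
        using False by (auto intro!: derivative_eq_intros)
      then show "((\<lambda>u. exp (4 * z * complex_of_real u) / (4 * z)) has_vector_derivative exp (4 * z * complex_of_real x)) (at x within {?a..?b})"
        using has_vector_derivative_real_field has_vector_derivative_at_within by blast
    qed
    moreover have "exp (4 * z * complex_of_real ?b) = exp (- (4 * complex_of_real h * z)) ^ i"
      unfolding exp_of_nat_mult[symmetric] by (rule arg_cong[where f=exp]) (simp add: mult_ac)
    moreover have "exp (4 * z * complex_of_real ?a) = exp (- (4 * complex_of_real h * z)) ^ Suc i"
      unfolding exp_of_nat_mult[symmetric] by (rule arg_cong[where f=exp]) (simp add: algebra_simps)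
    ultimately have "((\<lambda>u. exp (4 * z * complex_of_real u)) has_integral
        (exp (- (4 * complex_of_real h * z)) ^ i / (4 * z) - exp (- (4 * complex_of_real h * z)) ^ Suc i / (4 * z))) {?a..?b}" by (simp only:)
    moreover have "exp (- (4 * complex_of_real h * z)) ^ i / (4 * z) - exp (- (4 * complex_of_real h * z)) ^ Suc i / (4 * z) =
        exp_block h z * exp (- (4 * complex_of_real h * z)) ^ i"
    proof -
      have "e ^ i / d - e ^ Suc i / d = (1 - e) / d * e ^ i" for e d :: complex by (simp add: algebra_simps diff_divide_distrib)
      then show ?thesis unfolding exp_block_def using False by (simp only: if_False)
    qed
    ultimately show ?thesis by (simp only:)
  qed
qed

text \<open>Cauchy-Schwarz against a constant: the mean value minimises the mean square deviation.\<close>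

lemma integral_square_le:
  fixes f :: "real \<Rightarrow> complex"
  assumes f: "continuous_on {a..b} f" and ab: "a < b"
  shows "(cmod (integral {a..b} f))\<^sup>2 \<le> (b - a) * integral {a..b} (\<lambda>u. (cmod (f u))\<^sup>2)"
proof -
  define J where "J = integral {a..b} f"
  define m where "m = J / complex_of_real (b - a)"
  have fi: "(f has_integral J) {a..b}" unfolding J_def by (intro integrable_integral integrable_continuous_real f)
  have f2: "((\<lambda>u. (cmod (f u))\<^sup>2) has_integral integral {a..b} (\<lambda>u. (cmod (f u))\<^sup>2)) {a..b}"
    by (intro integrable_integral integrable_continuous_real continuous_intros f)
  have "((\<lambda>u. f u * cnj m) has_integral J * cnj m) {a..b}" by (rule has_integral_mult_left[OF fi])
  then have re: "((\<lambda>u. Re (f u * cnj m)) has_integral Re (J * cnj m)) {a..b}" by (rule has_integral_Re)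
  have cc: "((\<lambda>u. (cmod m)\<^sup>2) has_integral (b - a) *\<^sub>R (cmod m)\<^sup>2) {a..b}"
    using has_integral_const_real[of "(cmod m)\<^sup>2" a b] ab by simp
  have "((\<lambda>u. (cmod (f u))\<^sup>2 - 2 * Re (f u * cnj m) + (cmod m)\<^sup>2) has_integral
      (integral {a..b} (\<lambda>u. (cmod (f u))\<^sup>2) - 2 * Re (J * cnj m) + (b - a) *\<^sub>R (cmod m)\<^sup>2)) {a..b}"
    by (intro has_integral_add has_integral_diff f2 has_integral_mult_right re cc)
  moreover have "(cmod (f u))\<^sup>2 - 2 * Re (f u * cnj m) + (cmod m)\<^sup>2 \<ge> 0" for u
  proof -
    have "(cmod (f u))\<^sup>2 - 2 * Re (f u * cnj m) + (cmod m)\<^sup>2 = (cmod (f u - m))\<^sup>2"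
      unfolding cmod_power2 by (simp add: power2_eq_square algebra_simps)
    then show ?thesis by simp
  qed
  ultimately have "0 \<le> integral {a..b} (\<lambda>u. (cmod (f u))\<^sup>2) - 2 * Re (J * cnj m) + (b - a) *\<^sub>R (cmod m)\<^sup>2"
    by (rule has_integral_nonneg)
  moreover have "J * cnj m = complex_of_real ((cmod J)\<^sup>2 / (b - a))"
    unfolding m_def complex_cnj_divide complex_cnj_complex_of_real of_real_divide complex_norm_square by simp
  then have "Re (J * cnj m) = (cmod J)\<^sup>2 / (b - a)" by (simp only: Re_complex_of_real)
  moreover have "cmod m = cmod J / (b - a)" unfolding m_def norm_divide norm_of_real using ab by simp
  then have "(b - a) *\<^sub>R (cmod m)\<^sup>2 = (cmod J)\<^sup>2 / (b - a)"
    using ab by (simp add: power_divide power2_eq_square)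
  ultimately have "(cmod J)\<^sup>2 / (b - a) \<le> integral {a..b} (\<lambda>u. (cmod (f u))\<^sup>2)" by simp
  then show ?thesis unfolding J_def using ab by (simp add: divide_le_eq mult.commute)
qed

section \<open>The Gram matrix of Gaussians on the half-line\<close>

lemma integral_blocks:
  fixes F :: "real \<Rightarrow> real"
  assumes "continuous_on UNIV F" "h > 0"
  shows "integral {- (real k * h)..0} F = (\<Sum>i<k. integral {- (real (Suc i) * h)..- (real i * h)} F)"
proof (induction k)
  case (Suc k)
  have "integral {- (real (Suc k) * h)..- (real k * h)} F + integral {- (real k * h)..0} F = integral {- (real (Suc k) * h)..0} F"
    using assms by (intro Henstock_Kurzweil_Integration.integral_combine integrable_continuous_real continuous_on_subset[OF assms(1)]) (auto simp: mult_right_mono)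
  then show ?case using Suc by simp
qed simp

text \<open>\<open>edge_gram z (cnj w)\<close> is the inner product of the Gaussians centred at
  \<open>z\<close> and \<open>w\<close>. Without the conjugation the function is holomorphic in both
  arguments.\<close>

definition edge_gram :: "complex \<Rightarrow> complex \<Rightarrow> complex" where
  "edge_gram z w = (LINT u:{..0}|lborel. edge_pair z w u)"

lemma edge_pair_integrable: "set_integrable lborel {..0} (edge_pair z w)"
proof (rule gauss_dominated_integrable)
  show "continuous_on UNIV (edge_pair z w)" unfolding edge_pair_def by (intro continuous_intros)
  show "cmod (edge_pair z w u) \<le> exp (12 * (max (cmod z) (cmod w))\<^sup>2) * exp (- (2 * u\<^sup>2))" for u
    by (rule edge_pair_bound) auto
qed

lemma edge_pair_cnj:
  "edge_pair z (cnj w) u = exp (- 2 * (z - complex_of_real u)\<^sup>2) * cnj (exp (- 2 * (w - complex_of_real u)\<^sup>2))"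
proof -
  have "cnj (exp (- 2 * (w - complex_of_real u)\<^sup>2)) = exp (- 2 * (cnj w - complex_of_real u)\<^sup>2)"
    unfolding exp_cnj by simp
  then show ?thesis by (simp add: edge_pair_def mult_exp_exp)
qed

lemma set_integral_double_sum:
  fixes g :: "'j \<Rightarrow> 'l \<Rightarrow> 'a \<Rightarrow> complex"
  assumes "\<And>j l. set_integrable M A (g j l)"
  shows "set_integrable M A (\<lambda>u. \<Sum>j\<in>J. \<Sum>l\<in>L. a j l * g j l u)"
    "(LINT u:A|M. (\<Sum>j\<in>J. \<Sum>l\<in>L. a j l * g j l u)) = (\<Sum>j\<in>J. \<Sum>l\<in>L. a j l * (LINT u:A|M. g j l u))"
proof -
  have e: "indicat_real A u *\<^sub>R (\<Sum>j\<in>J. \<Sum>l\<in>L. a j l * g j l u) = (\<Sum>j\<in>J. \<Sum>l\<in>L. a j l * (indicat_real A u *\<^sub>R g j l u))" for u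
    by (simp only: scaleR_sum_right mult_scaleR_right)
  have i: "integrable M (\<lambda>u. indicat_real A u *\<^sub>R g j l u)" for j l
    using assms unfolding set_integrable_def .
  show "set_integrable M A (\<lambda>u. \<Sum>j\<in>J. \<Sum>l\<in>L. a j l * g j l u)"
    unfolding set_integrable_def e by (intro Bochner_Integration.integrable_sum integrable_mult_right i)
  show "(LINT u:A|M. (\<Sum>j\<in>J. \<Sum>l\<in>L. a j l * g j l u)) = (\<Sum>j\<in>J. \<Sum>l\<in>L. a j l * (LINT u:A|M. g j l u))"
    unfolding set_lebesgue_integral_def e
    by (simp only: Bochner_Integration.integral_sum Bochner_Integration.integrable_sum integrable_mult_right i integral_mult_right_zero)
qed

lemma edge_gram_quadratic_form:
  fixes z x :: "nat \<Rightarrow> complex" and k :: nat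
  defines "p \<equiv> (\<lambda>u. \<Sum>j<k. x j * exp (- 2 * (z j - complex_of_real u)\<^sup>2))"
  shows "complex_of_real (LINT u:{..0}|lborel. (cmod (p u))\<^sup>2) = (\<Sum>j<k. \<Sum>l<k. x j * cnj (x l) * edge_gram (z j) (cnj (z l)))"
    "set_integrable lborel {..0} (\<lambda>u. (cmod (p u))\<^sup>2)"
proof -
  have e: "complex_of_real ((cmod (p u))\<^sup>2) = (\<Sum>j<k. \<Sum>l<k. x j * cnj (x l) * edge_pair (z j) (cnj (z l)) u)" for u
  proof -
    have "complex_of_real ((cmod (p u))\<^sup>2) = p u * cnj (p u)" by (rule complex_norm_square)
    also have "\<dots> = (\<Sum>j<k. \<Sum>l<k. (x j * exp (- 2 * (z j - complex_of_real u)\<^sup>2)) * cnj (x l * exp (- 2 * (z l - complex_of_real u)\<^sup>2)))"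
      unfolding p_def cnj_sum sum_product ..
    also have "\<dots> = (\<Sum>j<k. \<Sum>l<k. x j * cnj (x l) * edge_pair (z j) (cnj (z l)) u)"
      unfolding edge_pair_cnj complex_cnj_mult by (intro sum.cong refl) (simp only: mult_ac)
    finally show ?thesis .
  qed
  have i: "set_integrable lborel {..0} (\<lambda>u. \<Sum>j<k. \<Sum>l<k. x j * cnj (x l) * edge_pair (z j) (cnj (z l)) u)"
    by (rule set_integral_double_sum(1)[OF edge_pair_integrable])
  then have i': "set_integrable lborel {..0} (\<lambda>u. complex_of_real ((cmod (p u))\<^sup>2))" unfolding e .
  then show "set_integrable lborel {..0} (\<lambda>u. (cmod (p u))\<^sup>2)"
    unfolding set_integrable_def by (auto dest!: integrable_Re)
  have "complex_of_real (LINT u:{..0}|lborel. (cmod (p u))\<^sup>2) = (LINT u:{..0}|lborel. complex_of_real ((cmod (p u))\<^sup>2))"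
    by (rule set_integral_complex_of_real[symmetric])
  also have "\<dots> = (\<Sum>j<k. \<Sum>l<k. x j * cnj (x l) * edge_gram (z j) (cnj (z l)))"
    unfolding e edge_gram_def by (rule set_integral_double_sum(2)[OF edge_pair_integrable])
  finally show "complex_of_real (LINT u:{..0}|lborel. (cmod (p u))\<^sup>2) = (\<Sum>j<k. \<Sum>l<k. x j * cnj (x l) * edge_gram (z j) (cnj (z l)))" .
qed

text \<open>Bessel's inequality against the indicator functions of the blocks \<open>{- (i + 1) * h..- i * h}\<close>, after
  multiplication by \<open>exp (2 * u\<^sup>2)\<close>; the integrals over the blocks form a geometric sequence in \<open>i\<close>,
  so that a Vandermonde determinant appears again.\<close>

lemma edge_gram_form_lower:
  fixes z x :: "nat \<Rightarrow> complex" and k :: nat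
  assumes h: "h > 0" and k: "k > 0"
  defines "p \<equiv> (\<lambda>u. \<Sum>j<k. x j * exp (- 2 * (z j - complex_of_real u)\<^sup>2))"
  defines "V \<equiv> (\<lambda>j i. exp (- 2 * (z j)\<^sup>2) * exp_block h (z j) * exp (- (4 * complex_of_real h * z j)) ^ i)"
  shows "1 / (h * exp (4 * (real k * h)\<^sup>2)) * (\<Sum>i<k. (cmod (\<Sum>j<k. x j * V j i))\<^sup>2) \<le> (LINT u:{..0}|lborel. (cmod (p u))\<^sup>2)"
proof -
  let ?I = "\<lambda>i. {- (real (Suc i) * h)..- (real i * h)}"
  \<comment> \<open>The largest value on the blocks of \<open>exp (4 * u\<^sup>2)\<close>, the
    square of the multiplier in \<open>f\<close>.\<close>
  define C where "C = exp (4 * (real k * h)\<^sup>2)"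
  define f where "f = (\<lambda>u. p u * complex_of_real (exp (2 * u\<^sup>2)))"
  have pc: "continuous_on A p" for A unfolding p_def by (intro continuous_intros)
  have fc: "continuous_on A f" for A unfolding f_def by (intro continuous_intros pc)
  have fe: "f u = (\<Sum>j<k. x j * exp (- 2 * (z j)\<^sup>2) * exp (4 * z j * complex_of_real u))" for u
  proof -
    have "exp (- 2 * (w - complex_of_real u)\<^sup>2) * complex_of_real (exp (2 * u\<^sup>2)) = exp (- 2 * w\<^sup>2) * exp (4 * w * complex_of_real u)" for w
      unfolding exp_of_real[symmetric] mult_exp_exp by (rule arg_cong[where f=exp]) (simp add: power2_eq_square algebra_simps)
    then show ?thesis unfolding f_def p_def sum_distrib_right by (intro sum.cong refl) (simp only: mult.assoc)
  qed
  have Lf: "integral (?I i) f = (\<Sum>j<k. x j * V j i)" for i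
  proof -
    have "(f has_integral (\<Sum>j<k. x j * exp (- 2 * (z j)\<^sup>2) * (exp_block h (z j) * exp (- (4 * complex_of_real h * z j)) ^ i))) (?I i)"
      unfolding fe by (intro has_integral_sum has_integral_mult_right exp_block_integral h) simp
    then show ?thesis by (simp add: integral_unique V_def mult.assoc)
  qed
  have "(cmod (\<Sum>j<k. x j * V j i))\<^sup>2 \<le> h * C * integral (?I i) (\<lambda>u. (cmod (p u))\<^sup>2)" if i: "i < k" for i
  proof -
    have len: "- (real i * h) - (- (real (Suc i) * h)) = h" by (simp add: algebra_simps)
    then have lt: "- (real (Suc i) * h) < - (real i * h)" using h by linarith
    have "(cmod (\<Sum>j<k. x j * V j i))\<^sup>2 \<le> h * integral (?I i) (\<lambda>u. (cmod (f u))\<^sup>2)"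
      using integral_square_le[OF fc lt] unfolding len Lf .
    also have "integral (?I i) (\<lambda>u. (cmod (f u))\<^sup>2) \<le> integral (?I i) (\<lambda>u. C * (cmod (p u))\<^sup>2)"
    proof (rule integral_le)
      fix u assume u: "u \<in> ?I i"
      have "real (Suc i) * h \<le> real k * h" using i h by (intro mult_right_mono) auto
      moreover have "0 \<le> real i * h" using h by simp
      ultimately have "\<bar>u\<bar> \<le> real k * h" using u by auto
      then have "u\<^sup>2 \<le> (real k * h)\<^sup>2" using abs_le_square_iff[of u "real k * h"] h by simp
      then have "exp (4 * u\<^sup>2) \<le> C" unfolding C_def by simp
      moreover have "(cmod (f u))\<^sup>2 = exp (4 * u\<^sup>2) * (cmod (p u))\<^sup>2"
      proof -
        have "(exp (2 * u\<^sup>2))\<^sup>2 = exp (4 * u\<^sup>2)" by (simp add: power2_eq_square flip: exp_add)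
        then show ?thesis unfolding f_def norm_mult power_mult_distrib by simp
      qed
      ultimately show "(cmod (f u))\<^sup>2 \<le> C * (cmod (p u))\<^sup>2" by (simp add: mult_right_mono)
    qed (intro integrable_continuous_real continuous_intros fc pc)+
    also have "integral (?I i) (\<lambda>u. C * (cmod (p u))\<^sup>2) = C * integral (?I i) (\<lambda>u. (cmod (p u))\<^sup>2)" by simp
    finally show ?thesis using h by (simp add: mult.assoc)
  qed
  then have "(\<Sum>i<k. (cmod (\<Sum>j<k. x j * V j i))\<^sup>2) \<le> (\<Sum>i<k. h * C * integral (?I i) (\<lambda>u. (cmod (p u))\<^sup>2))"
    by (intro sum_mono) auto
  also have "\<dots> = h * C * integral {- (real k * h)..0} (\<lambda>u. (cmod (p u))\<^sup>2)"
    using integral_blocks[of "\<lambda>u. (cmod (p u))\<^sup>2" h k] h pc by (simp add: sum_distrib_left continuous_intros)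
  also have "integral {- (real k * h)..0} (\<lambda>u. (cmod (p u))\<^sup>2) \<le> (LINT u:{..0}|lborel. (cmod (p u))\<^sup>2)"
  proof -
    have I: "set_integrable lborel {..0} (\<lambda>u. (cmod (p u))\<^sup>2)" unfolding p_def by (rule edge_gram_quadratic_form(2))
    have s: "set_integrable lborel {- (real k * h)..0} (\<lambda>u. (cmod (p u))\<^sup>2)" by (rule set_integrable_subset[OF I]) auto
    have "(LINT u:{- (real k * h)..0}|lborel. (cmod (p u))\<^sup>2) \<le> (LINT u:{..0}|lborel. (cmod (p u))\<^sup>2)"
      unfolding set_lebesgue_integral_def using I s unfolding set_integrable_def
      by (intro integral_mono) (auto simp: indicator_def)
    then show ?thesis unfolding set_borel_integral_eq_integral(2)[OF s] .
  qed
  finally have "(\<Sum>i<k. (cmod (\<Sum>j<k. x j * V j i))\<^sup>2) \<le> h * C * (LINT u:{..0}|lborel. (cmod (p u))\<^sup>2)"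
    using h by (simp add: C_def)
  then show ?thesis unfolding C_def[symmetric] using h by (simp add: C_def divide_le_eq mult.commute)
qed

text \<open>The matrix of block integrals is a diagonal matrix times the Vandermonde matrix of the
  numbers \<open>exp (- 4 * h * z j)\<close>. Since \<open>h\<close> is so small that
  \<open>exp\<close> is nearly linear on the exponents, the differences of these numbers are bounded
  below by a multiple of those of the \<open>z j\<close>.\<close>

lemma edge_gram_det_lower:
  assumes R: "R > 0" and k: "k > 0"
  obtains c where "c > 0"
    "\<And>z :: nat \<Rightarrow> complex. (\<And>j. j < k \<Longrightarrow> cmod (z j) \<le> R) \<Longrightarrow>
      c * (\<Prod>j<k. \<Prod>i<j. cmod (z j - z i))\<^sup>2 \<le> cmod (Determinant.det (Matrix.mat k k (\<lambda>(j, l). edge_gram (z j) (cnj (z l)))))"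
proof -
  \<comment> \<open>Makes \<open>4 * h * cmod (z j) \<le> 1 / 4\<close>, the range required by
    \<open>exp_difference_lower\<close> and \<open>exp_block_lower\<close>.\<close>
  define h where "h = 1 / (16 * R)"
  have h: "h > 0" using R by (simp add: h_def)
  define c1 where "c1 = 1 / (h * exp (4 * (real k * h)\<^sup>2))"
  have c1: "c1 > 0" using h by (simp add: c1_def)
  define m where "m = exp (- 2 * R\<^sup>2) * (h / 2)"
  have m: "m > 0" using h by (simp add: m_def)
  define c where "c = c1 ^ k * (m ^ k * (\<Prod>j<k. \<Prod>i<j. 2 * h))\<^sup>2"
  have pp: "(\<Prod>j<k. \<Prod>i<j. 2 * h) > 0" using h by (intro prod_pos) auto
  have "c > 0" unfolding c_def by (intro mult_pos_pos zero_less_power c1 m pp)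
  moreover have "c * (\<Prod>j<k. \<Prod>i<j. cmod (z j - z i))\<^sup>2 \<le> cmod (Determinant.det (Matrix.mat k k (\<lambda>(j, l). edge_gram (z j) (cnj (z l)))))"
    if z: "\<And>j. j < k \<Longrightarrow> cmod (z j) \<le> R" for z :: "nat \<Rightarrow> complex"
  proof -
    define d where "d = (\<lambda>j. exp (- 2 * (z j)\<^sup>2) * exp_block h (z j))"
    define e where "e = (\<lambda>j. exp (- (4 * complex_of_real h * z j)))"
    define V where "V = (\<lambda>j i. d j * e j ^ i)"
    have 1: "c1 ^ k * (cmod (Determinant.det (Matrix.mat k k (\<lambda>(j, i). V j i))))\<^sup>2 \<le> cmod (Determinant.det (Matrix.mat k k (\<lambda>(j, l). edge_gram (z j) (cnj (z l)))))"
      by (rule det_ge_of_quadratic_form[OF c1 edge_gram_quadratic_form(1)])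
         (use edge_gram_form_lower[OF h k, of _ z] in \<open>simp add: c1_def V_def d_def e_def\<close>)
    have detV: "Determinant.det (Matrix.mat k k (\<lambda>(j, i). V j i)) = (\<Prod>j<k. d j) * (\<Prod>j<k. \<Prod>i<j. e j - e i)"
    proof -
      have "Determinant.det (Matrix.mat k k (\<lambda>(j, i). V j i)) = (\<Sum>s | s permutes {0..<k}. of_int (sign s) * (\<Prod>j = 0..<k. d j * e j ^ s j))"
        using permutes_in_image by (subst det_def'[of _ k]) (fastforce simp: V_def intro!: sum.cong prod.cong)+
      also have "\<dots> = (\<Prod>j<k. d j) * (\<Sum>s | s permutes {0..<k}. of_int (sign s) * (\<Prod>j<k. e j ^ s j))"
        unfolding prod.distrib sum_distrib_left atLeast0LessThan by (simp only: mult_ac)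
      also have "(\<Sum>s | s permutes {0..<k}. of_int (sign s) * (\<Prod>j<k. e j ^ s j)) = Determinant.det (Matrix.mat k k (\<lambda>(a, j). e j ^ a))"
        using permutes_in_image by (subst det_col[of _ k]) (fastforce intro!: sum.cong prod.cong)+
      finally show ?thesis unfolding vandermonde_det .
    qed
    have dl: "cmod (d j) \<ge> m" if "j < k" for j
    proof -
      have "cmod (z j) ^ 2 \<le> R\<^sup>2" using z[OF that] by (intro power_mono) auto
      then have "Re ((z j)\<^sup>2) \<le> R\<^sup>2" using complex_Re_le_cmod[of "(z j)\<^sup>2"] by (simp add: norm_power)
      then have "exp (- 2 * R\<^sup>2) \<le> cmod (exp (- 2 * (z j)\<^sup>2))" by (simp add: norm_exp_eq_Re)
      moreover have "h / 2 \<le> cmod (exp_block h (z j))"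
        using z[OF that] R by (intro exp_block_lower h) (simp add: h_def field_simps)
      ultimately show ?thesis unfolding m_def d_def norm_mult using h by (intro mult_mono) auto
    qed
    have el: "2 * h * cmod (z j - z i) \<le> cmod (e j - e i)" if "i < k" "j < k" for i j
    proof -
      have "cmod (- (4 * complex_of_real h * z j) - (- (4 * complex_of_real h * z i))) / 2 \<le> cmod (e j - e i)"
        unfolding e_def
      proof (rule exp_difference_lower)
        have "cmod (- (4 * complex_of_real h * z n)) \<le> 1 / 4" if "n < k" for n
        proof -
          have "4 * h * cmod (z n) \<le> 4 * h * R" using z[OF that] h by (intro mult_left_mono) auto
          also have "4 * h * R = 1 / 4" using R by (simp add: h_def)
          finally show ?thesis using h by (simp add: norm_mult)
        qed
        then show "cmod (- (4 * complex_of_real h * z j)) \<le> 1 / 4" "cmod (- (4 * complex_of_real h * z i)) \<le> 1 / 4"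
          using that by auto
      qed
      moreover have "- (4 * complex_of_real h * z j) - (- (4 * complex_of_real h * z i)) = - (4 * complex_of_real h * (z j - z i))"
        by (simp add: algebra_simps)
      ultimately show ?thesis using h by (simp add: norm_mult)
    qed
    have "m ^ k * (\<Prod>j<k. \<Prod>i<j. 2 * h * cmod (z j - z i)) \<le> cmod (Determinant.det (Matrix.mat k k (\<lambda>(j, i). V j i)))"
      unfolding detV norm_mult prod_norm[symmetric]
    proof (intro mult_mono)
      show "m ^ k \<le> (\<Prod>j<k. cmod (d j))"
        using prod_mono[of "{..<k}" "\<lambda>_. m" "\<lambda>j. cmod (d j)"] dl m by simp
      show "(\<Prod>j<k. \<Prod>i<j. 2 * h * cmod (z j - z i)) \<le> (\<Prod>j<k. \<Prod>i<j. cmod (e j - e i))"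
        using el h by (intro prod_mono conjI prod_nonneg) auto
    qed (use h in \<open>auto intro!: prod_nonneg\<close>)
    then have "(m ^ k * (\<Prod>j<k. \<Prod>i<j. 2 * h * cmod (z j - z i)))\<^sup>2 \<le> (cmod (Determinant.det (Matrix.mat k k (\<lambda>(j, i). V j i))))\<^sup>2"
      using m h by (intro power_mono mult_nonneg_nonneg prod_nonneg) auto
    then have "c1 ^ k * (m ^ k * (\<Prod>j<k. \<Prod>i<j. 2 * h * cmod (z j - z i)))\<^sup>2 \<le> c1 ^ k * (cmod (Determinant.det (Matrix.mat k k (\<lambda>(j, i). V j i))))\<^sup>2"
      using c1 by (intro mult_left_mono) auto
    moreover have "c * (\<Prod>j<k. \<Prod>i<j. cmod (z j - z i))\<^sup>2 = c1 ^ k * (m ^ k * (\<Prod>j<k. \<Prod>i<j. 2 * h * cmod (z j - z i)))\<^sup>2"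
      unfolding c_def prod.distrib power_mult_distrib by (simp only: mult_ac)
    ultimately show ?thesis using 1 by linarith
  qed
  ultimately show ?thesis using that by blast
qed

section \<open>The limit of large t\<close>

text \<open>The argument \<open>s\<close> differs from \<open>r = sqrt 2 * \<i> * \<tau>\<close> by
  at most a constant times \<open>1 + \<bar>u\<bar>\<close>, and both have modulus at least a
  multiple of \<open>\<bar>\<tau>\<bar>\<close>. So \<open>1 / s - 1 / r\<close> has the stated
  order, as has the error of \<open>1 / s\<close> from \<open>scaled_erfc_asymptotic\<close>. The
  condition \<open>2 * R \<le> \<bar>\<tau>\<bar>\<close> prevents \<open>Im z\<close> from
  cancelling more than half of \<open>\<tau>\<close>.\<close>

lemma scaled_erfc_shift:
  assumes z: "cmod z \<le> R" and R: "0 \<le> R" and u: "u \<le> 0" and \<tau>: "2 * R \<le> \<bar>\<tau>\<bar>" "\<tau> \<noteq> 0"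
  shows "cmod (scaled_erfc (complex_of_real (sqrt 2) * (z + \<i> * complex_of_real \<tau> - complex_of_real u)) - 1 / (complex_of_real (sqrt 2) * (\<i> * complex_of_real \<tau>)))
     \<le> (2 * scaled_erfc_max (sqrt 2 * R + 1) + 2 * R + 2) * (1 + \<bar>u\<bar>) / \<tau>\<^sup>2"
proof -
  define s where "s = complex_of_real (sqrt 2) * (z + \<i> * complex_of_real \<tau> - complex_of_real u)"
  define r where "r = complex_of_real (sqrt 2) * (\<i> * complex_of_real \<tau>)"
  define M where "M = scaled_erfc_max (sqrt 2 * R + 1)"
  have M: "M \<ge> 0" unfolding M_def by (rule scaled_erfc_max_nonneg)
  have "- R \<le> Re z - u" using z u abs_Re_le_cmod[of z] by linarith
  then have "sqrt 2 * (- R) \<le> sqrt 2 * (Re z - u)" by (intro mult_left_mono) auto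
  then have Re: "Re s \<ge> - (sqrt 2 * R)" by (simp add: s_def)
  have "\<bar>\<tau>\<bar> / 2 \<le> \<bar>Im z + \<tau>\<bar>" using z \<tau> abs_Im_le_cmod[of z] by linarith
  then have "sqrt 2 * (\<bar>\<tau>\<bar> / 2) \<le> sqrt 2 * \<bar>Im z + \<tau>\<bar>" by (intro mult_left_mono) auto
  also have "\<dots> = \<bar>Im s\<bar>" by (simp add: s_def abs_mult)
  also have "\<dots> \<le> cmod s" by (rule abs_Im_le_cmod)
  finally have s: "sqrt 2 * \<bar>\<tau>\<bar> / 2 \<le> cmod s" by simp
  then have "(sqrt 2 * \<bar>\<tau>\<bar> / 2)\<^sup>2 \<le> (cmod s)\<^sup>2" by (intro power_mono) auto
  then have s2: "\<tau>\<^sup>2 / 2 \<le> (cmod s)\<^sup>2" by (simp add: power_divide power_mult_distrib)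
  have t2: "\<tau>\<^sup>2 > 0" using \<tau> by simp
  have s0: "s \<noteq> 0" using s2 t2 by auto
  have r0: "r \<noteq> 0" "cmod r = sqrt 2 * \<bar>\<tau>\<bar>" using \<tau> by (auto simp: r_def norm_mult)
  have "cmod (scaled_erfc s - 1 / s) \<le> M / (cmod s)\<^sup>2"
    unfolding M_def by (rule scaled_erfc_asymptotic[OF Re s0])
  also have "\<dots> \<le> M / (\<tau>\<^sup>2 / 2)" using s2 t2 M s0 by (intro divide_left_mono mult_pos_pos) auto
  finally have 1: "cmod (scaled_erfc s - 1 / s) \<le> 2 * M / \<tau>\<^sup>2" by (simp add: mult.commute)
  have "1 / s - 1 / r = (r - s) / (s * r)" using s0 r0 by (simp add: field_simps)
  moreover have "r - s = - complex_of_real (sqrt 2) * (z - complex_of_real u)" by (simp add: r_def s_def algebra_simps)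
  ultimately have "cmod (1 / s - 1 / r) = sqrt 2 * cmod (z - complex_of_real u) / (cmod s * cmod r)"
    by (simp add: norm_mult norm_divide)
  also have "\<dots> \<le> sqrt 2 * (R + \<bar>u\<bar>) / ((sqrt 2 * \<bar>\<tau>\<bar> / 2) * (sqrt 2 * \<bar>\<tau>\<bar>))"
  proof (intro frac_le mult_left_mono)
    show "cmod (z - complex_of_real u) \<le> R + \<bar>u\<bar>" using norm_triangle_ineq4[of z "complex_of_real u"] z by simp
    show "0 < sqrt 2 * \<bar>\<tau>\<bar> / 2 * (sqrt 2 * \<bar>\<tau>\<bar>)" using \<tau> by simp
    show "sqrt 2 * \<bar>\<tau>\<bar> / 2 * (sqrt 2 * \<bar>\<tau>\<bar>) \<le> cmod s * cmod r" unfolding r0 using s by (intro mult_right_mono) auto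
  qed (use R in auto)
  also have "(sqrt 2 * \<bar>\<tau>\<bar> / 2) * (sqrt 2 * \<bar>\<tau>\<bar>) = \<tau>\<^sup>2"
  proof -
    have "(sqrt 2 * \<bar>\<tau>\<bar> / 2) * (sqrt 2 * \<bar>\<tau>\<bar>) = (sqrt 2 * sqrt 2) * (\<bar>\<tau>\<bar> * \<bar>\<tau>\<bar>) / 2" by (simp only: mult_ac times_divide_eq_left times_divide_eq_right)
    then show ?thesis by (simp add: power2_eq_square)
  qed
  also have "sqrt 2 * (R + \<bar>u\<bar>) / \<tau>\<^sup>2 \<le> 2 * (R + \<bar>u\<bar>) / \<tau>\<^sup>2"
    using t2 R sqrt2_less_2 by (intro divide_right_mono mult_right_mono) auto
  finally have 2: "cmod (1 / s - 1 / r) \<le> 2 * (R + \<bar>u\<bar>) / \<tau>\<^sup>2" .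
  have "cmod (scaled_erfc s - 1 / r) \<le> cmod (scaled_erfc s - 1 / s) + cmod (1 / s - 1 / r)"
    using norm_triangle_ineq[of "scaled_erfc s - 1 / s" "1 / s - 1 / r"] by simp
  also have "\<dots> \<le> (2 * M + 2 * (R + \<bar>u\<bar>)) / \<tau>\<^sup>2" using 1 2 by (simp add: add_divide_distrib)
  also have "\<dots> \<le> (2 * M + 2 * R + 2) * (1 + \<bar>u\<bar>) / \<tau>\<^sup>2"
  proof (rule divide_right_mono)
    have "0 \<le> (2 * M + 2 * R) * \<bar>u\<bar>" using M R by simp
    then show "2 * M + 2 * (R + \<bar>u\<bar>) \<le> (2 * M + 2 * R + 2) * (1 + \<bar>u\<bar>)" by (simp add: algebra_simps)
  qed (use t2 in simp)
  finally show ?thesis unfolding s_def r_def M_def .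
qed

text \<open>The factor that compensates the growth of \<open>edge_int\<close> at height \<open>\<tau>\<close>.\<close>

definition edge_osc :: "real \<Rightarrow> complex \<Rightarrow> complex" where
  "edge_osc \<tau> x = exp (4 * \<i> * complex_of_real \<tau> * x - 2 * (complex_of_real \<tau>)\<^sup>2)"

text \<open>What is left of the heights is a phase in \<open>u\<close>, and it is 1 when they are
  opposite.\<close>

lemma edge_pair_osc:
  "edge_osc \<tau> x * edge_osc \<tau>' y * edge_pair (x + \<i> * complex_of_real \<tau>) (y + \<i> * complex_of_real \<tau>') u =
     edge_pair x y u * exp (4 * \<i> * complex_of_real (\<tau> + \<tau>') * complex_of_real u)"
  unfolding edge_osc_def edge_pair_def mult_exp_exp
  by (rule arg_cong[where f=exp]) (simp add: power2_eq_square algebra_simps)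

lemma edge_int_osc:
  "edge_osc \<tau> x * edge_osc \<tau>' y * edge_int (x + \<i> * complex_of_real \<tau>) (y + \<i> * complex_of_real \<tau>') =
     1 / complex_of_real (sqrt (2 * pi)) * (LINT u:{..0}|lborel. edge_pair x y u * exp (4 * \<i> * complex_of_real (\<tau> + \<tau>') * complex_of_real u) *
       (scaled_erfc (complex_of_real (sqrt 2) * (y + \<i> * complex_of_real \<tau>' - complex_of_real u)) -
        scaled_erfc (complex_of_real (sqrt 2) * (x + \<i> * complex_of_real \<tau> - complex_of_real u))))"
    (is "?A * edge_int ?X ?Y = _ * (LINT u:_|_. ?f u)")
  and edge_int_osc_integrable:
  "set_integrable lborel {..0} (\<lambda>u. edge_pair x y u * exp (4 * \<i> * complex_of_real (\<tau> + \<tau>') * complex_of_real u) *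
       (scaled_erfc (complex_of_real (sqrt 2) * (y + \<i> * complex_of_real \<tau>' - complex_of_real u)) -
        scaled_erfc (complex_of_real (sqrt 2) * (x + \<i> * complex_of_real \<tau> - complex_of_real u))))"
proof -
  have w: "?f u = complex_of_real (sqrt 2 * pi) * ?A * wronskian (edge_fun ?Y) (edge_fun ?X) u" for u
    unfolding wronskian_edge_pair edge_pair_osc[symmetric] by simp
  show "set_integrable lborel {..0} ?f"
    unfolding w by (intro set_integrable_mult_right wronskian_edge_integrable)
  have "(LINT u:{..0}|lborel. ?f u) = complex_of_real (sqrt 2 * pi) * ?A * (LINT u:{..0}|lborel. wronskian (edge_fun ?Y) (edge_fun ?X) u)"
    unfolding w by (rule set_integral_mult_right)
  then have "1 / complex_of_real (sqrt (2 * pi)) * (LINT u:{..0}|lborel. ?f u) =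
      complex_of_real (sqrt 2 * pi / sqrt (2 * pi)) * ?A * (LINT u:{..0}|lborel. wronskian (edge_fun ?Y) (edge_fun ?X) u)"
    by simp
  also have "sqrt 2 * pi / sqrt (2 * pi) = sqrt pi" by (simp add: real_sqrt_mult real_div_sqrt)
  finally show "?A * edge_int ?X ?Y = 1 / complex_of_real (sqrt (2 * pi)) * (LINT u:{..0}|lborel. ?f u)"
    by (simp add: edge_int_def)
qed

text \<open>Substitute \<open>s = - 2 * u\<close> in the integral representation of
  \<open>scaled_erfc\<close>.\<close>

lemma edge_gram_eq: "edge_gram x y = complex_of_real (sqrt pi) / 4 * exp (- (x - y)\<^sup>2) * erfc (x + y)"
proof -
  define g where "g = (\<lambda>s. indicat_real {0..} s *\<^sub>R exp (- (complex_of_real s)\<^sup>2 - 2 * (x + y) * complex_of_real s))"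
  have "edge_pair x y u = exp (- 2 * x\<^sup>2 - 2 * y\<^sup>2) * exp (- (complex_of_real (- 2 * u))\<^sup>2 - 2 * (x + y) * complex_of_real (- 2 * u))" for u
    unfolding edge_pair_def mult_exp_exp by (rule arg_cong[where f=exp]) (simp add: power2_eq_square algebra_simps)
  then have "indicat_real {..0} u *\<^sub>R edge_pair x y u = exp (- 2 * x\<^sup>2 - 2 * y\<^sup>2) * g (- 2 * u)" for u
    by (simp add: g_def indicator_def)
  then have "edge_gram x y = exp (- 2 * x\<^sup>2 - 2 * y\<^sup>2) * (\<integral>u. g (- 2 * u) \<partial>lborel)"
    unfolding edge_gram_def set_lebesgue_integral_def by simp
  also have "(\<integral>u. g (- 2 * u) \<partial>lborel) = (\<integral>s. g s \<partial>lborel) / 2"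
    using lborel_integral_real_affine[of "-2" g 0] by (simp add: scaleR_conv_of_real)
  also have "(\<integral>s. g s \<partial>lborel) = scaled_erfc (x + y) / 2"
    unfolding scaled_erfc_integral(2) g_def set_lebesgue_integral_def by simp
  also have "exp (- 2 * x\<^sup>2 - 2 * y\<^sup>2) * (scaled_erfc (x + y) / 2 / 2) =
      complex_of_real (sqrt pi) / 4 * (exp (- 2 * x\<^sup>2 - 2 * y\<^sup>2) * exp ((x + y)\<^sup>2)) * erfc (x + y)"
    by (simp add: scaled_erfc_def)
  also have "exp (- 2 * x\<^sup>2 - 2 * y\<^sup>2) * exp ((x + y)\<^sup>2) = exp (- (x - y)\<^sup>2)"
    unfolding mult_exp_exp by (rule arg_cong[where f=exp]) (simp add: power2_eq_square algebra_simps)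
  finally show ?thesis .
qed

text \<open>Insert the leading terms \<open>1 / (sqrt 2 * \<i> * \<tau>)\<close> of the two scaled
  functions in \<open>edge_int_osc\<close>. At equal heights they cancel; at opposite heights they
  add up and the phase is 1, so the integral of \<open>edge_pair\<close> remains. The errors are of
  order \<open>1 / \<tau>\<^sup>2\<close>.\<close>

lemma edge_int_asymptotic:
  assumes R: "0 \<le> R"
  obtains K where "K \<ge> 0" "\<And>x y \<tau> \<tau>'. cmod x \<le> R \<Longrightarrow> cmod y \<le> R \<Longrightarrow> 2 * R \<le> \<bar>\<tau>\<bar> \<Longrightarrow> \<tau> \<noteq> 0 \<Longrightarrow> \<tau>' = \<tau> \<or> \<tau>' = - \<tau> \<Longrightarrow>
    cmod (edge_osc \<tau> x * edge_osc \<tau>' y * edge_int (x + \<i> * complex_of_real \<tau>) (y + \<i> * complex_of_real \<tau>')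
      - (if \<tau>' = \<tau> then 0 else \<i> / (complex_of_real (sqrt pi) * complex_of_real \<tau>) * edge_gram x y)) \<le> K / \<tau>\<^sup>2"
proof -
  define C where "C = 2 * scaled_erfc_max (sqrt 2 * R + 1) + 2 * R + 2"
  have C: "C \<ge> 0" using R scaled_erfc_max_nonneg[of "sqrt 2 * R + 1"] by (simp add: C_def)
  define J where "J = (\<integral>u. exp (- u\<^sup>2) \<partial>lborel :: real)"
  have Ji: "integrable lborel (\<lambda>u::real. exp (- u\<^sup>2))" using gaussian_integral_real(1)[of 1] by simp
  have J: "J \<ge> 0" unfolding J_def by (intro Bochner_Integration.integral_nonneg) auto
  define K where "K = 1 / sqrt (2 * pi) * (4 * C * exp (12 * R\<^sup>2) * J)"
  have "K \<ge> 0" using C J by (simp add: K_def)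
  moreover have "cmod (edge_osc \<tau> x * edge_osc \<tau>' y * edge_int (x + \<i> * complex_of_real \<tau>) (y + \<i> * complex_of_real \<tau>')
      - (if \<tau>' = \<tau> then 0 else \<i> / (complex_of_real (sqrt pi) * complex_of_real \<tau>) * edge_gram x y)) \<le> K / \<tau>\<^sup>2"
    if x: "cmod x \<le> R" and y: "cmod y \<le> R" and \<tau>: "2 * R \<le> \<bar>\<tau>\<bar>" "\<tau> \<noteq> 0" and \<tau>': "\<tau>' = \<tau> \<or> \<tau>' = - \<tau>" for x y \<tau> \<tau>'
  proof -
    define S where "S = (\<lambda>z (\<tau>::real) u. scaled_erfc (complex_of_real (sqrt 2) * (z + \<i> * complex_of_real \<tau> - complex_of_real u)))"
    define r where "r = (\<lambda>\<tau>. 1 / (complex_of_real (sqrt 2) * (\<i> * complex_of_real \<tau>)))"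
    define f where "f = (\<lambda>u. edge_pair x y u * exp (4 * \<i> * complex_of_real (\<tau> + \<tau>') * complex_of_real u) * (S y \<tau>' u - S x \<tau> u))"
    define g where "g = (\<lambda>u. (r \<tau>' - r \<tau>) * edge_pair x y u)"
    have ph: "cmod (exp (4 * \<i> * complex_of_real (\<tau> + \<tau>') * complex_of_real u)) = 1" for u
      by (simp add: norm_exp_eq_Re)
    \<comment> \<open>The phase is absent from \<open>g\<close> because either the heights are
      opposite and it is 1, or they are equal and \<open>r \<tau>' - r \<tau>\<close> is 0.\<close>
    have gf: "g u = edge_pair x y u * exp (4 * \<i> * complex_of_real (\<tau> + \<tau>') * complex_of_real u) * (r \<tau>' - r \<tau>)" for u
      using \<tau>' by (auto simp: g_def)
    have I: "set_integrable lborel {..0} f" unfolding f_def S_def by (rule edge_int_osc_integrable)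
    have Ig: "set_integrable lborel {..0} g" unfolding g_def by (intro set_integrable_mult_right edge_pair_integrable)
    have Ld: "(if \<tau>' = \<tau> then 0 else \<i> / (complex_of_real (sqrt pi) * complex_of_real \<tau>) * edge_gram x y) =
        1 / complex_of_real (sqrt (2 * pi)) * (LINT u:{..0}|lborel. g u)"
    proof -
      have "(LINT u:{..0}|lborel. g u) = (r \<tau>' - r \<tau>) * edge_gram x y"
        unfolding g_def edge_gram_def by (rule set_integral_mult_right)
      moreover have "1 / complex_of_real (sqrt (2 * pi)) * (r (- \<tau>) - r \<tau>) = \<i> / (complex_of_real (sqrt pi) * complex_of_real \<tau>)"
      proof -
        have "r (- \<tau>) - r \<tau> = 2 * \<i> / (complex_of_real (sqrt 2) * complex_of_real \<tau>)"
          using \<tau>(2) by (simp add: r_def field_simps)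
        then have "1 / complex_of_real (sqrt (2 * pi)) * (r (- \<tau>) - r \<tau>) = 2 * \<i> / ((complex_of_real (sqrt 2) * complex_of_real (sqrt 2)) * (complex_of_real (sqrt pi) * complex_of_real \<tau>))"
          by (simp add: real_sqrt_mult mult_ac)
        also have "complex_of_real (sqrt 2) * complex_of_real (sqrt 2) = 2" by (simp flip: of_real_mult)
        finally show ?thesis by simp
      qed
      ultimately show ?thesis using \<tau>' \<tau>(2) by (metis (no_types, lifting) diff_self mult.assoc mult_zero_left mult_zero_right)
    qed
    have fg: "cmod (f u - g u) \<le> 4 * C * exp (12 * R\<^sup>2) / \<tau>\<^sup>2 * exp (- u\<^sup>2)" if u: "u \<le> 0" for u
    proof -
      have t2: "\<tau>'\<^sup>2 = \<tau>\<^sup>2" "2 * R \<le> \<bar>\<tau>'\<bar>" "\<tau>' \<noteq> 0" using \<tau>' \<tau> by auto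
      have a: "cmod (S x \<tau> u - r \<tau>) \<le> C * (1 + \<bar>u\<bar>) / \<tau>\<^sup>2"
        unfolding S_def r_def C_def by (rule scaled_erfc_shift[OF x R u \<tau>])
      have b: "cmod (S y \<tau>' u - r \<tau>') \<le> C * (1 + \<bar>u\<bar>) / \<tau>\<^sup>2"
        unfolding S_def r_def C_def t2(1)[symmetric] by (rule scaled_erfc_shift[OF y R u t2(2,3)])
      have "cmod ((S y \<tau>' u - S x \<tau> u) - (r \<tau>' - r \<tau>)) \<le> cmod (S y \<tau>' u - r \<tau>') + cmod (S x \<tau> u - r \<tau>)"
        using norm_triangle_ineq4[of "S y \<tau>' u - r \<tau>'" "S x \<tau> u - r \<tau>"] by (simp add: algebra_simps)
      also have "\<dots> \<le> 2 * C / \<tau>\<^sup>2 * (1 + \<bar>u\<bar>)" using a b by simp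
      \<comment> \<open>The linear growth in \<open>u\<close> is paid for with half of the Gaussian
        decay of \<open>edge_pair\<close>.\<close>
      also have "\<dots> \<le> 2 * C / \<tau>\<^sup>2 * (2 * exp (u\<^sup>2))"
      proof (rule mult_left_mono)
        have "0 \<le> (\<bar>u\<bar> - 1)\<^sup>2" by simp
        then have "\<bar>u\<bar> \<le> 1 + u\<^sup>2" by (simp add: power2_eq_square algebra_simps)
        moreover have "1 + u\<^sup>2 \<le> exp (u\<^sup>2)" by (rule exp_ge_add_one_self)
        ultimately show "1 + \<bar>u\<bar> \<le> 2 * exp (u\<^sup>2)" using zero_le_power2[of u] by linarith
      qed (use C in simp)
      finally have d: "cmod ((S y \<tau>' u - S x \<tau> u) - (r \<tau>' - r \<tau>)) \<le> 2 * C / \<tau>\<^sup>2 * (2 * exp (u\<^sup>2))" .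
      have "f u - g u = edge_pair x y u * exp (4 * \<i> * complex_of_real (\<tau> + \<tau>') * complex_of_real u) * ((S y \<tau>' u - S x \<tau> u) - (r \<tau>' - r \<tau>))"
        unfolding f_def gf by (simp only: right_diff_distrib)
      then have "cmod (f u - g u) = cmod (edge_pair x y u) * cmod ((S y \<tau>' u - S x \<tau> u) - (r \<tau>' - r \<tau>))"
        by (simp only: norm_mult ph mult_1_right)
      also have "\<dots> \<le> exp (12 * R\<^sup>2) * exp (- (2 * u\<^sup>2)) * (2 * C / \<tau>\<^sup>2 * (2 * exp (u\<^sup>2)))"
        by (intro mult_mono edge_pair_bound x y d) auto
      also have "\<dots> = 4 * C * exp (12 * R\<^sup>2) / \<tau>\<^sup>2 * (exp (- (2 * u\<^sup>2)) * exp (u\<^sup>2))" by simp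
      also have "exp (- (2 * u\<^sup>2)) * exp (u\<^sup>2) = exp (- u\<^sup>2)" by (simp flip: exp_add)
      finally show ?thesis .
    qed
    have "cmod (LINT u:{..0}|lborel. f u - g u) \<le> (\<integral>u. 4 * C * exp (12 * R\<^sup>2) / \<tau>\<^sup>2 * exp (- u\<^sup>2) \<partial>lborel)"
      unfolding set_lebesgue_integral_def
    proof (rule Bochner_Integration.integral_norm_bound_integral)
      show "integrable lborel (\<lambda>u. indicat_real {..0} u *\<^sub>R (f u - g u))"
        using set_integral_diff(1)[OF I Ig] unfolding set_integrable_def .
      show "integrable lborel (\<lambda>u. 4 * C * exp (12 * R\<^sup>2) / \<tau>\<^sup>2 * exp (- u\<^sup>2))" by (intro integrable_mult_right Ji)
      show "norm (indicat_real {..0} u *\<^sub>R (f u - g u)) \<le> 4 * C * exp (12 * R\<^sup>2) / \<tau>\<^sup>2 * exp (- u\<^sup>2)" for u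
        using fg[of u] C by (cases "u \<le> 0") (auto simp: indicator_def)
    qed
    also have "\<dots> = 4 * C * exp (12 * R\<^sup>2) / \<tau>\<^sup>2 * J" unfolding J_def by simp
    finally have "cmod (1 / complex_of_real (sqrt (2 * pi)) * (LINT u:{..0}|lborel. f u - g u)) \<le> 1 / sqrt (2 * pi) * (4 * C * exp (12 * R\<^sup>2) / \<tau>\<^sup>2 * J)"
      unfolding norm_mult by (intro mult_mono) (auto simp: norm_divide)
    also have "\<dots> = K / \<tau>\<^sup>2" by (simp add: K_def)
    finally show ?thesis
      unfolding set_integral_diff(2)[OF I Ig] right_diff_distrib[of "1 / complex_of_real (sqrt (2 * pi))"]
      unfolding edge_int_osc Ld f_def S_def .
  qed
  ultimately show ?thesis using that by blast
qed

section \<open>Convergence of the rescaled Pfaffian\<close>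

definition edge_sign :: "nat \<Rightarrow> real" where
  "edge_sign a = (if even a then 1 else - 1)"

text \<open>The factor \<open>t\<close> offsets the decay \<open>1 / t\<close> of the entries that
  survive. The signs account for \<open>cnj (z + \<i> * t) = cnj z - \<i> * t\<close>, so that the
  variables \<open>y\<close> do not depend on \<open>t\<close>.\<close>

definition edge_osc_kernel :: "real \<Rightarrow> (nat \<Rightarrow> complex) \<Rightarrow> nat \<Rightarrow> nat \<Rightarrow> complex" where
  "edge_osc_kernel t y a b = complex_of_real t *
     (edge_osc (edge_sign a * t) (y a) * edge_osc (edge_sign b * t) (y b) *
      edge_int (y a + \<i> * complex_of_real (edge_sign a * t)) (y b + \<i> * complex_of_real (edge_sign b * t)))"

definition edge_bulk_kernel :: "(nat \<Rightarrow> complex) \<Rightarrow> nat \<Rightarrow> nat \<Rightarrow> complex" where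
  "edge_bulk_kernel y a b =
     (if even a = even b then 0 else complex_of_real (edge_sign a) * (\<i> / complex_of_real (sqrt pi) * edge_gram (y a) (y b)))"

lemma edge_gram_continuous: "continuous_on A (\<lambda>p. edge_gram (fst p) (snd p))"
  unfolding edge_gram_eq by (intro continuous_intros) auto

lemma edge_osc_kernel_limit:
  assumes R: "0 \<le> R"
  shows "bounded_uniform_limit {y. \<forall>a<2*k. cmod (y a) \<le> R} (\<lambda>t y. pf k (edge_osc_kernel t y)) (\<lambda>y. pf k (edge_bulk_kernel y)) at_top"
proof (rule bounded_uniform_limit_pf)
  fix a b assume ab: "a < 2 * k" "b < 2 * k"
  let ?X = "{y. \<forall>a<2*k. cmod (y a) \<le> R}"
  obtain K where K: "K \<ge> 0" "\<And>x y \<tau> \<tau>'. cmod x \<le> R \<Longrightarrow> cmod y \<le> R \<Longrightarrow> 2 * R \<le> \<bar>\<tau>\<bar> \<Longrightarrow> \<tau> \<noteq> 0 \<Longrightarrow> \<tau>' = \<tau> \<or> \<tau>' = - \<tau> \<Longrightarrow>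
    cmod (edge_osc \<tau> x * edge_osc \<tau>' y * edge_int (x + \<i> * complex_of_real \<tau>) (y + \<i> * complex_of_real \<tau>')
      - (if \<tau>' = \<tau> then 0 else \<i> / (complex_of_real (sqrt pi) * complex_of_real \<tau>) * edge_gram x y)) \<le> K / \<tau>\<^sup>2"
    using edge_int_asymptotic[OF R] by blast
  have d: "cmod (edge_osc_kernel t y a b - edge_bulk_kernel y a b) \<le> K / t" if t: "t > 0" "2 * R \<le> t" and y: "y \<in> ?X" for t y
  proof -
    let ?A = "edge_osc (edge_sign a * t) (y a) * edge_osc (edge_sign b * t) (y b) *
      edge_int (y a + \<i> * complex_of_real (edge_sign a * t)) (y b + \<i> * complex_of_real (edge_sign b * t))"
    let ?L = "if edge_sign b * t = edge_sign a * t then 0 else \<i> / (complex_of_real (sqrt pi) * complex_of_real (edge_sign a * t)) * edge_gram (y a) (y b)"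
    have sg: "(edge_sign a)\<^sup>2 = 1" "edge_sign a \<noteq> 0" "\<bar>edge_sign a\<bar> = 1" for a by (auto simp: edge_sign_def)
    have "cmod (?A - ?L) \<le> K / (edge_sign a * t)\<^sup>2"
      using y ab t by (intro K(2)) (auto simp: abs_mult sg, auto simp: edge_sign_def split: if_splits)
    then have A: "cmod (?A - ?L) \<le> K / t\<^sup>2" by (simp add: power_mult_distrib sg)
    have "edge_bulk_kernel y a b = complex_of_real t * ?L"
    proof (cases "even a = even b")
      case False
      have "1 / complex_of_real (edge_sign a) = complex_of_real (edge_sign a)" by (simp add: edge_sign_def)
      moreover have "edge_sign b * t \<noteq> edge_sign a * t" using False t by (auto simp: edge_sign_def)
      ultimately show ?thesis using False t by (simp add: edge_bulk_kernel_def edge_sign_def)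
    qed (auto simp: edge_bulk_kernel_def edge_sign_def)
    then have "edge_osc_kernel t y a b - edge_bulk_kernel y a b = complex_of_real t * (?A - ?L)"
      unfolding edge_osc_kernel_def by (simp only: right_diff_distrib)
    then have "cmod (edge_osc_kernel t y a b - edge_bulk_kernel y a b) = t * cmod (?A - ?L)"
      using t by (simp only: norm_mult norm_of_real abs_of_pos)
    also have "\<dots> \<le> t * (K / t\<^sup>2)" using t A by (intro mult_left_mono) auto
    also have "\<dots> = K / t" using t by (simp add: power2_eq_square)
    finally show ?thesis .
  qed
  have "uniform_limit ?X (\<lambda>t y. edge_osc_kernel t y a b) (\<lambda>y. edge_bulk_kernel y a b) at_top"
  proof (rule uniform_limitI)
    fix e :: real assume e: "e > 0"
    have "((\<lambda>t. K / t) \<longlongrightarrow> 0) at_top" by real_asymp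
    then have "\<forall>\<^sub>F t in at_top. K / t < e" using e by (rule order_tendstoD(2))
    then show "\<forall>\<^sub>F t in at_top. \<forall>y\<in>?X. dist (edge_osc_kernel t y a b) (edge_bulk_kernel y a b) < e"
      using eventually_gt_at_top[of 0] eventually_ge_at_top[of "2 * R"]
    proof eventually_elim
      case (elim t)
      then show ?case using d[of t] unfolding dist_norm by fastforce
    qed
  qed
  moreover have "bounded ((\<lambda>y. edge_bulk_kernel y a b) ` ?X)"
  proof -
    have "compact ((\<lambda>p. edge_gram (fst p) (snd p)) ` (cball 0 R \<times> cball 0 R))"
      by (intro compact_continuous_image edge_gram_continuous compact_Times compact_cball)
    then have "\<exists>B. \<forall>w\<in>(\<lambda>p. edge_gram (fst p) (snd p)) ` (cball 0 R \<times> cball 0 R). cmod w \<le> B"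
      using compact_imp_bounded bounded_iff by blast
    then obtain B where B': "\<forall>p\<in>cball 0 R \<times> cball 0 R. cmod (edge_gram (fst p) (snd p)) \<le> B"
      unfolding ball_simps(9) ..
    have B: "cmod (edge_gram x y) \<le> B" if "cmod x \<le> R" "cmod y \<le> R" for x y
      using bspec[OF B', of "(x, y)"] that by simp
    have "cmod (edge_bulk_kernel y a b) \<le> 1 / sqrt pi * B" if y: "y \<in> ?X" for y
    proof -
      have b: "cmod (edge_gram (y a) (y b)) \<le> B" using y ab by (intro B) auto
      then have "B \<ge> 0" using norm_ge_zero order_trans by blast
      then show ?thesis using b
        by (auto simp: edge_bulk_kernel_def edge_sign_def norm_mult norm_divide intro!: divide_right_mono)
    qed
    then show ?thesis unfolding bounded_iff by blast
  qed
  ultimately show "bounded_uniform_limit ?X (\<lambda>t y. edge_osc_kernel t y a b) (\<lambda>y. edge_bulk_kernel y a b) at_top"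
    unfolding bounded_uniform_limit_def by blast
qed

text \<open>Interchanging two indices leaves \<open>A\<close> as it is and changes the sign of its
  Pfaffian.\<close>

lemma pf_eq_0:
  assumes "a < 2*k" "b < 2*k" "a \<noteq> b"
    and "\<And>c d. A (Transposition.transpose a b c) (Transposition.transpose a b d) = A c d"
  shows "pf k A = 0"
proof -
  have "Transposition.transpose a b permutes {..<2*k}" using assms by (intro permutes_swap_id) auto
  from pf_permute[OF this, of A] have "pf k A = - pf k A" using assms(3) by (simp add: assms(4) sign_swap_id)
  then show ?thesis by simp
qed

lemma holomorphic_pf:
  assumes "\<And>a b. a < 2*k \<Longrightarrow> b < 2*k \<Longrightarrow> (\<lambda>x. A x a b) holomorphic_on S"
  shows "(\<lambda>x. pf k (A x)) holomorphic_on S"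
  unfolding pf_def
  by (intro holomorphic_intros assms) (auto intro: permutes_lessThan_pair simp del: One_nat_def)

text \<open>Holomorphy of \<open>edge_int\<close> in each argument separately is enough: both
  arguments move together only on the diagonal, where the entry vanishes.\<close>

lemma edge_osc_kernel_holomorphic: "(\<lambda>x. edge_osc_kernel t (y(c := x)) a b) holomorphic_on UNIV"
proof -
  have sh: "(\<lambda>x. x + u) holomorphic_on UNIV" for u :: complex by (intro holomorphic_intros)
  have h1: "(\<lambda>x. edge_int (x + u) v) holomorphic_on UNIV" for u v
    using holomorphic_on_compose[OF sh edge_int_holomorphic(1)] by (simp add: o_def)
  have h2: "(\<lambda>x. edge_int v (x + u)) holomorphic_on UNIV" for u v
    using holomorphic_on_compose[OF sh edge_int_holomorphic(2)] by (simp add: o_def)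
  consider "a = c" "b = c" | "a = c" "b \<noteq> c" | "a \<noteq> c" "b = c" | "a \<noteq> c" "b \<noteq> c" by blast
  then show ?thesis
  proof cases
    case 1
    then show ?thesis by (simp add: edge_osc_kernel_def edge_int_refl)
  qed (auto simp: edge_osc_kernel_def edge_osc_def intro!: holomorphic_intros h1 h2)
qed

lemma edge_bulk_kernel_holomorphic: "(\<lambda>x. edge_bulk_kernel (y(c := x)) a b) holomorphic_on UNIV"
proof (cases "even a = even b")
  case True
  then show ?thesis by (simp add: edge_bulk_kernel_def)
next
  case False
  then have "\<not> (a = c \<and> b = c)" by auto
  then consider "a = c" "b \<noteq> c" | "a \<noteq> c" "b = c" | "a \<noteq> c" "b \<noteq> c" by blast
  then show ?thesis using False
    by cases (auto simp: edge_bulk_kernel_def edge_gram_eq intro!: holomorphic_intros)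
qed

text \<open>The entries \<open>y (2 * j)\<close> and \<open>y (2 * j + 1)\<close>, which are \<open>z j\<close> and \<open>cnj (z j)\<close> in the conclusion, are
  independent variables; the bound for coinciding points is applied to each kind in turn.\<close>

lemma edge_pf_difference_bound:
  assumes R: "0 \<le> R" and \<delta>: "\<And>y. (\<And>a. a < 2*k \<Longrightarrow> cmod (y a) \<le> R + 1) \<Longrightarrow> cmod (pf k (edge_osc_kernel t y) - pf k (edge_bulk_kernel y)) \<le> \<delta>"
    and z: "\<And>j. j < k \<Longrightarrow> cmod (z j) \<le> R"
  shows "cmod (pf k (edge_osc_kernel t (with_conj z)) - pf k (edge_bulk_kernel (with_conj z))) \<le> \<delta> * (\<Prod>i<k. \<Prod>j\<in>{i<..<k}. cmod (z i - z j))\<^sup>2"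
proof -
  define F where "F = (\<lambda>y. pf k (edge_osc_kernel t y) - pf k (edge_bulk_kernel y))"
  define mix where "mix = (\<lambda>x v (a::nat). if even a then x (a div 2) else v (a div 2) :: complex)"
  define V where "V = (\<lambda>x. \<Prod>i<k. \<Prod>j\<in>{i<..<k}. cmod (x i - x j))"
  have hol: "(\<lambda>x. F (y(c := x))) holomorphic_on UNIV" for y c
    unfolding F_def by (intro holomorphic_intros holomorphic_pf edge_osc_kernel_holomorphic edge_bulk_kernel_holomorphic)
  \<comment> \<open>The indices must have equal parity, since the interchange has to preserve
    \<open>edge_sign\<close> as well as the values of \<open>y\<close>.\<close>
  have zero: "F y = 0" if ab: "a < 2*k" "b < 2*k" "a \<noteq> b" "even a = even b" "y a = y b" for y a b
  proof -
    let ?p = "Transposition.transpose a b"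
    have e: "even (?p c) = even c" "y (?p c) = y c" for c
      using ab by (auto simp: Transposition.transpose_def)
    have s: "edge_sign (?p c) = edge_sign c" for c unfolding edge_sign_def e ..
    have "pf k (edge_osc_kernel t y) = 0" "pf k (edge_bulk_kernel y) = 0"
      by (rule pf_eq_0[OF ab(1-3)], simp only: edge_osc_kernel_def edge_bulk_kernel_def e s)+
    then show ?thesis by (simp add: F_def)
  qed
  have upd: "mix (x(j := \<xi>)) v = (mix x v)(2*j := \<xi>)" "mix x (v(j := \<xi>)) = (mix x v)(2*j+1 := \<xi>)" for x v j \<xi>
    by (auto simp: mix_def fun_eq_iff elim!: evenE oddE)
  \<comment> \<open>First the conjugated variables, with the others ranging over the larger disc:
    the result is the uniform bound that the second application starts from.\<close>
  have inner: "cmod (F (mix x v)) \<le> \<delta> * V v" if x: "\<And>j. j < k \<Longrightarrow> cmod (x j) \<le> R + 1" and v: "\<And>j. j < k \<Longrightarrow> cmod (v j) \<le> R" for x v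
    unfolding V_def
  proof (rule diagonal_vanishing_bound[where F = "\<lambda>v. F (mix x v)", OF _ _ _ R v])
    show "(\<lambda>\<xi>. F (mix x (w(j := \<xi>)))) holomorphic_on UNIV" for w j unfolding upd by (rule hol)
    show "F (mix x w) = 0" if "i < k" "j < k" "i \<noteq> j" "w i = w j" for w i j
      using that by (intro zero[of "2*i+1" "2*j+1"]) (auto simp: mix_def)
    show "cmod (F (mix x w)) \<le> \<delta>" if "\<And>j. j < k \<Longrightarrow> cmod (w j) \<le> R + 1" for w
      unfolding F_def using that x by (intro \<delta>) (auto simp: mix_def)
  qed auto
  have "cmod (F (mix z (\<lambda>j. cnj (z j)))) \<le> (\<delta> * V (\<lambda>j. cnj (z j))) * V z"
    unfolding fun_cong[OF V_def, of z]
  proof (rule diagonal_vanishing_bound[where F = "\<lambda>x. F (mix x (\<lambda>j. cnj (z j)))", OF _ _ _ R z])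
    show "(\<lambda>\<xi>. F (mix (w(j := \<xi>)) (\<lambda>j. cnj (z j)))) holomorphic_on UNIV" for w j unfolding upd by (rule hol)
    show "F (mix w (\<lambda>j. cnj (z j))) = 0" if "i < k" "j < k" "i \<noteq> j" "w i = w j" for w i j
      using that by (intro zero[of "2*i" "2*j"]) (auto simp: mix_def)
    show "cmod (F (mix w (\<lambda>j. cnj (z j)))) \<le> \<delta> * V (\<lambda>j. cnj (z j))" if "\<And>j. j < k \<Longrightarrow> cmod (w j) \<le> R + 1" for w
      using that z by (intro inner) auto
  qed auto
  moreover have "mix z (\<lambda>j. cnj (z j)) = with_conj z" by (simp add: mix_def with_conj_def fun_eq_iff)
  moreover have "V (\<lambda>j. cnj (z j)) = V z" unfolding V_def complex_cnj_diff[symmetric] complex_mod_cnj ..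
  ultimately show ?thesis unfolding F_def fun_cong[OF V_def, symmetric] by (simp add: power2_eq_square mult.assoc)
qed

section \<open>Comparison with the determinant\<close>

lemma prod_upper_eq_lower:
  fixes f :: "nat \<Rightarrow> nat \<Rightarrow> 'a::comm_monoid_mult"
  shows "(\<Prod>i<k. \<Prod>j\<in>{i<..<k}. f i j) = (\<Prod>j<k. \<Prod>i<j. f i j)"
proof (induction k)
  case (Suc k)
  have "(\<Prod>j\<in>{i<..<Suc k}. f i j) = f i k * (\<Prod>j\<in>{i<..<k}. f i j)" if "i < k" for i
  proof -
    have "{i<..<Suc k} = insert k {i<..<k}" using that by auto
    then show ?thesis by simp
  qed
  then have "(\<Prod>i<k. \<Prod>j\<in>{i<..<Suc k}. f i j) = (\<Prod>i<k. f i k * (\<Prod>j\<in>{i<..<k}. f i j))"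
    by (intro prod.cong refl) auto
  moreover have "{k<..<Suc k} = {}" by auto
  ultimately show ?case using Suc by (simp add: prod.distrib mult.commute)
qed simp

text \<open>A nonvanishing factor common to \<open>R_edge\<close> and the determinant; splitting it
  off leaves Pfaffians to be compared.\<close>

definition edge_scale :: "nat \<Rightarrow> (nat \<Rightarrow> complex) \<Rightarrow> complex" where
  "edge_scale k z = (\<Prod>j<k. - 2 * \<i> * exp ((z j - cnj (z j))\<^sup>2))"

lemma pf_edge_bulk_kernel:
  "pf k (edge_bulk_kernel (with_conj z)) =
     Determinant.det (Matrix.mat k k (\<lambda>(j, l). \<i> / complex_of_real (sqrt pi) * edge_gram (z j) (cnj (z l))))"
proof (rule pf_eq_det)
  fix i j
  have "edge_gram (cnj (z j)) (z i) = edge_gram (z i) (cnj (z j))"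
    unfolding edge_gram_def edge_pair_commute[of "cnj (z j)"] ..
  then show "edge_bulk_kernel (with_conj z) (2 * j + 1) (2 * i) = - (\<i> / complex_of_real (sqrt pi) * edge_gram (z i) (cnj (z j)))"
    by (simp add: edge_bulk_kernel_def edge_sign_def)
qed (simp_all add: edge_bulk_kernel_def edge_sign_def)

text \<open>One weight per index turns one matrix into the other. The factor
  \<open>- 2 * \<i>\<close> sits on the even indices only, because each surviving entry involves
  exactly one of them.\<close>

lemma det_K_edge_complex:
  "Determinant.det (Matrix.mat k k (\<lambda>(j, l). K_edge_complex (z j) (z l))) = edge_scale k z * pf k (edge_bulk_kernel (with_conj z))"
proof -
  define c where "c = (\<lambda>a. (if even a then - 2 * \<i> else 1) * exp ((with_conj z a)\<^sup>2 - complex_of_real ((cmod (z (a div 2)))\<^sup>2)))"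
  have K: "c (2*i) * c (2*j+1) * (\<i> / complex_of_real (sqrt pi) * edge_gram (z i) (cnj (z j))) = K_edge_complex (z i) (z j)" for i j
  proof -
    have cc: "c (2*i) = - 2 * \<i> * exp ((z i)\<^sup>2 - complex_of_real ((cmod (z i))\<^sup>2))"
      "c (2*j+1) = exp ((cnj (z j))\<^sup>2 - complex_of_real ((cmod (z j))\<^sup>2))"
      by (simp_all add: c_def)
    have e: "exp ((z i)\<^sup>2 - complex_of_real ((cmod (z i))\<^sup>2)) * exp ((cnj (z j))\<^sup>2 - complex_of_real ((cmod (z j))\<^sup>2)) * exp (- (z i - cnj (z j))\<^sup>2)
      = exp (- complex_of_real ((cmod (z i))\<^sup>2) - complex_of_real ((cmod (z j))\<^sup>2) + 2 * z i * cnj (z j))"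
      unfolding mult_exp_exp by (rule arg_cong[where f=exp]) (simp add: power2_eq_square algebra_simps)
    show ?thesis unfolding cc K_edge_complex_def edge_gram_eq e[symmetric] by (simp add: mult_ac)
  qed
  have "Determinant.det (Matrix.mat k k (\<lambda>(j, l). K_edge_complex (z j) (z l))) = pf k (\<lambda>a b. c a * c b * edge_bulk_kernel (with_conj z) a b)"
  proof (rule pf_eq_det[symmetric])
    fix i j
    have "edge_gram (cnj (z j)) (z i) = edge_gram (z i) (cnj (z j))"
      unfolding edge_gram_def edge_pair_commute[of "cnj (z j)"] ..
    then show "c (2 * j + 1) * c (2 * i) * edge_bulk_kernel (with_conj z) (2 * j + 1) (2 * i) = - K_edge_complex (z i) (z j)"
      unfolding K[of i j, symmetric] by (simp add: edge_bulk_kernel_def edge_sign_def)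
    show "c (2 * i) * c (2 * j + 1) * edge_bulk_kernel (with_conj z) (2 * i) (2 * j + 1) = K_edge_complex (z i) (z j)"
      unfolding K[of i j, symmetric] by (simp add: edge_bulk_kernel_def edge_sign_def)
  qed (simp_all add: edge_bulk_kernel_def)
  also have "\<dots> = (\<Prod>a<2*k. c a) * pf k (edge_bulk_kernel (with_conj z))" by (rule pf_scale)
  also have "(\<Prod>a<2*k. c a) = edge_scale k z"
    unfolding prod_pairs edge_scale_def
  proof (rule prod.cong[OF refl])
    fix j
    have "exp ((z j)\<^sup>2 - complex_of_real ((cmod (z j))\<^sup>2)) * exp ((cnj (z j))\<^sup>2 - complex_of_real ((cmod (z j))\<^sup>2)) = exp ((z j - cnj (z j))\<^sup>2)"
      unfolding mult_exp_exp complex_norm_square by (rule arg_cong[where f=exp]) (simp add: power2_eq_square algebra_simps)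
    then show "c (2 * j) * c (2 * j + 1) = - 2 * \<i> * exp ((z j - cnj (z j))\<^sup>2)" by (simp add: c_def)
  qed
  finally show ?thesis .
qed

text \<open>Write \<open>cnj Z - Z\<close> as
  \<open>- 2 * \<i> * t * (1 + \<i> * (cnj z - z) / (2 * t))\<close> and give \<open>sqrt t\<close>
  to each index of the pair; \<open>exp ((Z - cnj Z)\<^sup>2)\<close> is the product of
  \<open>exp ((z - cnj z)\<^sup>2)\<close> and the two factors \<open>edge_osc\<close> of the
  pair.\<close>

lemma R_edge_osc:
  assumes t: "t > 0"
  shows "R_edge t k z = edge_scale k z * (\<Prod>j<k. 1 + \<i> * (cnj (z j) - z j) / (2 * complex_of_real t)) * pf k (edge_osc_kernel t (with_conj z))"
proof -
  define c where "c = (\<lambda>a. complex_of_real (sqrt t) * edge_osc (edge_sign a * t) (with_conj z a))"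
  define Z where "Z = (\<lambda>j. z j + \<i> * complex_of_real t)"
  have st: "complex_of_real (sqrt t) * complex_of_real (sqrt t) = complex_of_real t" using t by (simp flip: of_real_mult)
  have wc: "with_conj Z a = with_conj z a + \<i> * complex_of_real (edge_sign a * t)" for a
    by (simp add: Z_def with_conj_def edge_sign_def)
  have "edge_osc_kernel t (with_conj z) = (\<lambda>a b. c a * c b * edge_int (with_conj Z a) (with_conj Z b))"
    unfolding edge_osc_kernel_def wc c_def st[symmetric] by (simp add: fun_eq_iff mult_ac)
  then have "pf k (edge_osc_kernel t (with_conj z)) = (\<Prod>a<2*k. c a) * pf k (\<lambda>a b. edge_int (with_conj Z a) (with_conj Z b))"
    by (simp only: pf_scale)
  moreover have "(\<Prod>j<k. edge_weight (Z j)) = edge_scale k z * (\<Prod>j<k. 1 + \<i> * (cnj (z j) - z j) / (2 * complex_of_real t)) * (\<Prod>a<2*k. c a)"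
    unfolding prod_pairs edge_scale_def prod.distrib[symmetric]
  proof (rule prod.cong[OF refl])
    fix j
    have c2: "c (2*j) * c (2*j+1) = complex_of_real t * (edge_osc t (z j) * edge_osc (- t) (cnj (z j)))"
    proof -
      have "c (2*j) = complex_of_real (sqrt t) * edge_osc t (z j)" "c (2*j+1) = complex_of_real (sqrt t) * edge_osc (- t) (cnj (z j))"
        by (simp_all add: c_def edge_sign_def)
      then show ?thesis unfolding st[symmetric] by (simp only: mult_ac)
    qed
    have e2: "exp ((z j - cnj (z j))\<^sup>2) * (edge_osc t (z j) * edge_osc (- t) (cnj (z j))) = exp ((Z j - cnj (Z j))\<^sup>2)"
      unfolding edge_osc_def mult_exp_exp Z_def by (rule arg_cong[where f=exp]) (simp add: power2_eq_square algebra_simps)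
    have z2: "cnj (Z j) - Z j = - 2 * \<i> * (1 + \<i> * (cnj (z j) - z j) / (2 * complex_of_real t)) * complex_of_real t"
      using t by (simp add: Z_def field_simps)
    have "(q * r * s) * E' = q * E * r * (s * O')" if "E * O' = E'" for q r s E E' O' :: complex
      unfolding that[symmetric] by (simp only: mult_ac)
    from this[OF e2] show "edge_weight (Z j) = - 2 * \<i> * exp ((z j - cnj (z j))\<^sup>2) * (1 + \<i> * (cnj (z j) - z j) / (2 * complex_of_real t)) * (c (2*j) * c (2*j+1))"
      unfolding edge_weight_def z2 c2 .
  qed
  moreover have "R_edge t k z = (\<Prod>j<k. edge_weight (Z j)) * pf k (\<lambda>a b. edge_int (with_conj Z a) (with_conj Z b))"
    unfolding R_edge_eq Z_def ..
  ultimately show ?thesis by (simp only: mult_ac)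
qed

lemma edge_prefactor_limit:
  fixes k :: nat
  assumes R: "\<And>y. y \<in> C \<Longrightarrow> cmod y \<le> R"
  shows "uniform_limit {z. \<forall>j<k. z j \<in> C} (\<lambda>t z. \<Prod>j<k. 1 + \<i> * (cnj (z j) - z j) / (2 * complex_of_real t)) (\<lambda>z. 1) at_top"
proof -
  have "bounded_uniform_limit {z. \<forall>j<k. z j \<in> C} (\<lambda>t z. \<Prod>j<k. 1 + \<i> * (cnj (z j) - z j) / (2 * complex_of_real t)) (\<lambda>z. \<Prod>j<k. 1) at_top"
  proof (rule bounded_uniform_limit_prod)
    fix j assume j: "j \<in> {..<k}"
    have "uniform_limit {z. \<forall>j<k. z j \<in> C} (\<lambda>t z. 1 + \<i> * (cnj (z j) - z j) / (2 * complex_of_real t)) (\<lambda>z. 1) at_top"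
    proof (rule uniform_limitI)
      fix e :: real assume e: "e > 0"
      have "((\<lambda>t. R / t) \<longlongrightarrow> 0) at_top" by real_asymp
      then have "\<forall>\<^sub>F t in at_top. R / t < e" using e by (rule order_tendstoD(2))
      then show "\<forall>\<^sub>F t in at_top. \<forall>z\<in>{z. \<forall>j<k. z j \<in> C}. dist (1 + \<i> * (cnj (z j) - z j) / (2 * complex_of_real t)) 1 < e"
        using eventually_gt_at_top[of 0]
      proof eventually_elim
        case (elim t)
        show ?case
        proof
          fix z assume "z \<in> {z. \<forall>j<k. z j \<in> C}"
          then have "cmod (z j) \<le> R" using j R by auto
          then have "cmod (cnj (z j) - z j) \<le> 2 * R" using norm_triangle_ineq4[of "cnj (z j)" "z j"] by simp
          then have "cmod (cnj (z j) - z j) / (2 * t) \<le> 2 * R / (2 * t)" using elim by (intro divide_right_mono) auto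
          then show "dist (1 + \<i> * (cnj (z j) - z j) / (2 * complex_of_real t)) 1 < e"
            using elim by (simp add: dist_norm norm_divide norm_mult)
        qed
      qed
    qed
    then show "bounded_uniform_limit {z. \<forall>j<k. z j \<in> C} (\<lambda>t z. 1 + \<i> * (cnj (z j) - z j) / (2 * complex_of_real t)) (\<lambda>z. 1) at_top"
      using bounded_uniform_limit_const[of _ "1::complex" "at_top::real filter"] unfolding bounded_uniform_limit_def by blast
  qed auto
  then show ?thesis by (simp add: bounded_uniform_limit_def)
qed

text \<open>Where \<open>d\<close> does not vanish, the quotient is \<open>P * (1 + F / d)\<close>.
  Eventually \<open>cmod F \<le> \<delta> * V\<^sup>2\<close> for any given
  \<open>\<delta> > 0\<close>, while \<open>c * V\<^sup>2 \<le> cmod d\<close>, so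
  \<open>F / d\<close> is uniformly small even near coinciding points.\<close>

lemma R_edge_asymptotic:
  assumes k: "k > 0" and C: "compact C"
  shows "\<exists>\<epsilon> :: real \<Rightarrow> (nat \<Rightarrow> complex) \<Rightarrow> complex.
    (\<forall>\<^sub>F t in at_top. \<forall>z. (\<forall>j<k. z j \<in> C) \<longrightarrow>
      R_edge t k z = Determinant.det (Matrix.mat k k (\<lambda>(j, l). K_edge_complex (z j) (z l))) * (1 + \<epsilon> t z)) \<and>
    uniform_limit {z. \<forall>j<k. z j \<in> C} \<epsilon> (\<lambda>_. 0) at_top"
proof -
  obtain R where R: "R > 0" "\<And>y. y \<in> C \<Longrightarrow> cmod y \<le> R"
    using compact_imp_bounded[OF C] unfolding bounded_pos by blast
  obtain c0 where c0: "c0 > 0" "\<And>z :: nat \<Rightarrow> complex. (\<And>j. j < k \<Longrightarrow> cmod (z j) \<le> R) \<Longrightarrow>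
      c0 * (\<Prod>j<k. \<Prod>i<j. cmod (z j - z i))\<^sup>2 \<le> cmod (Determinant.det (Matrix.mat k k (\<lambda>(j, l). edge_gram (z j) (cnj (z l)))))"
    using edge_gram_det_lower[OF R(1) k] by blast
  define X where "X = {z. \<forall>j<k. z j \<in> C}"
  define V where "V = (\<lambda>z. \<Prod>i<k. \<Prod>j\<in>{i<..<k}. cmod (z i - z j))"
  define c where "c = c0 * (1 / sqrt pi) ^ k"
  have c: "c > 0" using c0 by (simp add: c_def)
  define P where "P = (\<lambda>t (z :: nat \<Rightarrow> complex). \<Prod>j<k. 1 + \<i> * (cnj (z j) - z j) / (2 * complex_of_real t))"
  define d where "d = (\<lambda>z. pf k (edge_bulk_kernel (with_conj z)))"
  define F where "F = (\<lambda>t z. pf k (edge_osc_kernel t (with_conj z)) - d z)"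
  txt \<open>Where \<open>d z = 0\<close>, the lower bound forces \<open>V z = 0\<close>, hence \<open>F t z = 0\<close>, and \<open>R_edge\<close> vanishes as well.\<close>
  define \<epsilon> where "\<epsilon> = (\<lambda>t z. if d z = 0 then 0 else P t z * (1 + F t z / d z) - 1)"
  have zR: "cmod (z j) \<le> R" if "z \<in> X" "j < k" for z j using that R unfolding X_def by auto
  have d: "c * (V z)\<^sup>2 \<le> cmod (d z)" if z: "z \<in> X" for z
  proof -
    have "Matrix.mat k k (\<lambda>(j, l). \<i> / complex_of_real (sqrt pi) * edge_gram (z j) (cnj (z l))) =
        (\<i> / complex_of_real (sqrt pi)) \<cdot>\<^sub>m Matrix.mat k k (\<lambda>(j, l). edge_gram (z j) (cnj (z l)))"
      by (intro eq_matI) auto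
    then have "cmod (d z) = (1 / sqrt pi) ^ k * cmod (Determinant.det (Matrix.mat k k (\<lambda>(j, l). edge_gram (z j) (cnj (z l)))))"
      unfolding d_def pf_edge_bulk_kernel by (simp add: norm_mult norm_power norm_divide)
    moreover have "V z = (\<Prod>j<k. \<Prod>i<j. cmod (z j - z i))"
      unfolding V_def prod_upper_eq_lower by (simp add: norm_minus_commute)
    moreover have "c0 * (\<Prod>j<k. \<Prod>i<j. cmod (z j - z i))\<^sup>2 \<le> cmod (Determinant.det (Matrix.mat k k (\<lambda>(j, l). edge_gram (z j) (cnj (z l)))))"
      by (rule c0(2)) (rule zR[OF z])
    from mult_left_mono[OF this, of "(1 / sqrt pi) ^ k"]
    have "c * (\<Prod>j<k. \<Prod>i<j. cmod (z j - z i))\<^sup>2 \<le> (1 / sqrt pi) ^ k * cmod (Determinant.det (Matrix.mat k k (\<lambda>(j, l). edge_gram (z j) (cnj (z l)))))"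
      unfolding c_def by (simp add: mult_ac)
    ultimately show ?thesis by simp
  qed
  have F: "\<forall>\<^sub>F t in at_top. \<forall>z\<in>X. cmod (F t z) \<le> \<delta> * (V z)\<^sup>2" if "\<delta> > 0" for \<delta>
  proof -
    have "uniform_limit {y. \<forall>a<2*k. cmod (y a) \<le> R + 1} (\<lambda>t y. pf k (edge_osc_kernel t y)) (\<lambda>y. pf k (edge_bulk_kernel y)) at_top"
      using edge_osc_kernel_limit[of "R + 1" k] R(1) unfolding bounded_uniform_limit_def by simp
    from uniform_limitD[OF this that] show ?thesis
    proof eventually_elim
      case (elim t)
      show ?case
        unfolding F_def d_def V_def
      proof (intro ballI edge_pf_difference_bound[where R = R] zR)
        show "cmod (pf k (edge_osc_kernel t y) - pf k (edge_bulk_kernel y)) \<le> \<delta>" if "\<And>a. a < 2*k \<Longrightarrow> cmod (y a) \<le> R + 1" for y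
          using elim that by (auto simp: dist_norm intro: less_imp_le)
      qed (use R in auto)
    qed
  qed
  have F1: "\<forall>\<^sub>F t in at_top. \<forall>z\<in>X. cmod (F t z) \<le> (V z)\<^sup>2" using F[of 1] by simp
  have "\<forall>\<^sub>F t in at_top. \<forall>z. (\<forall>j<k. z j \<in> C) \<longrightarrow>
      R_edge t k z = Determinant.det (Matrix.mat k k (\<lambda>(j, l). K_edge_complex (z j) (z l))) * (1 + \<epsilon> t z)"
    using F1 eventually_gt_at_top[of 0]
  proof eventually_elim
    case (elim t)
    show ?case
    proof (intro allI impI)
      fix z assume "\<forall>j<k. z j \<in> C"
      then have z: "z \<in> X" by (simp add: X_def)
      have "P t z * (d z + F t z) = d z * (1 + \<epsilon> t z)"
      proof (cases "d z = 0")
        case True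
        then have "(V z)\<^sup>2 \<le> 0" using d[OF z] c by (simp add: mult_le_0_iff)
        then have "F t z = 0" using elim z by auto
        then show ?thesis using True by simp
      qed (simp add: \<epsilon>_def field_simps)
      then show "R_edge t k z = Determinant.det (Matrix.mat k k (\<lambda>(j, l). K_edge_complex (z j) (z l))) * (1 + \<epsilon> t z)"
        using R_edge_osc[OF elim(2), of k z] unfolding det_K_edge_complex by (simp add: F_def P_def d_def)
    qed
  qed
  moreover have "uniform_limit X \<epsilon> (\<lambda>_. 0) at_top"
  proof (rule uniform_limitI)
    fix e :: real assume e: "e > 0"
    \<comment> \<open>The modulus of \<open>\<epsilon>\<close> will be at most
      \<open>\<eta> + 2 * \<eta>\<close>, hence below \<open>e\<close>; the bound
      \<open>\<eta> \<le> 1\<close> serves to get \<open>cmod (P t z) \<le> 2\<close>.\<close>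
    define \<eta> where "\<eta> = min 1 (e / 4)"
    have \<eta>: "\<eta> > 0" "\<eta> \<le> 1" "\<eta> \<le> e / 4" using e by (auto simp: \<eta>_def)
    have Pl: "uniform_limit X P (\<lambda>z. 1) at_top"
      unfolding X_def P_def by (rule edge_prefactor_limit[OF R(2)])
    have Fl: "\<forall>\<^sub>F t in at_top. \<forall>z\<in>X. cmod (F t z) \<le> c * \<eta> * (V z)\<^sup>2" using F c \<eta> by simp
    from uniform_limitD[OF Pl \<eta>(1)] Fl
    show "\<forall>\<^sub>F t in at_top. \<forall>z\<in>X. dist (\<epsilon> t z) 0 < e"
    proof eventually_elim
      case (elim t)
      show ?case
      proof
        fix z assume z: "z \<in> X"
        show "dist (\<epsilon> t z) 0 < e"
        proof (cases "d z = 0")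
          case False
          have p: "cmod (P t z - 1) < \<eta>" using elim z by (auto simp: dist_norm)
          have "cmod (P t z) \<le> cmod (P t z - 1) + 1" using norm_triangle_ineq[of "P t z - 1" 1] by simp
          then have P2: "cmod (P t z) \<le> 2" using p \<eta> by linarith
          have "cmod (F t z) \<le> \<eta> * (c * (V z)\<^sup>2)" using elim z by (simp add: mult_ac)
          also have "\<dots> \<le> \<eta> * cmod (d z)" using d[OF z] \<eta> by (intro mult_left_mono) auto
          finally have q: "cmod (F t z / d z) \<le> \<eta>" using False by (simp add: norm_divide divide_le_eq)
          have "\<epsilon> t z = (P t z - 1) + P t z * (F t z / d z)" using False by (simp add: \<epsilon>_def algebra_simps)
          then have "cmod (\<epsilon> t z) \<le> cmod (P t z - 1) + cmod (P t z) * cmod (F t z / d z)"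
            by (metis norm_mult norm_triangle_ineq)
          also have "cmod (P t z) * cmod (F t z / d z) \<le> 2 * \<eta>" using P2 q by (intro mult_mono) auto
          finally show ?thesis using p \<eta> e by simp
        qed (use e in \<open>simp add: \<epsilon>_def\<close>)
      qed
    qed
  qed
  ultimately show ?thesis unfolding X_def by blast
qed

theorem corollary2p2:
  fixes k :: nat
  assumes "k \<ge> 1"
  shows "(\<forall>(t::real) (p :: nat \<Rightarrow> complex).
            (\<forall>N. p N = complex_of_real (sqrt 2) * cis (t / sqrt (real N))) \<or>
            (\<forall>N. p N = - (complex_of_real (sqrt 2) * cis (t / sqrt (real N)))) \<longrightarrow>
            (\<forall>C. compact C \<longrightarrow>
               uniform_limit {z. \<forall>j<k. z j \<in> C}
                 (\<lambda>N z. complex_of_real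
                    (rescaled_correlation (\<lambda>\<zeta>. (cmod \<zeta>)\<^sup>2) (p N) N k z))
                 (R_edge t k) sequentially))
       \<and> (\<forall>C. compact C \<longrightarrow>
            (\<exists>\<epsilon> :: real \<Rightarrow> (nat \<Rightarrow> complex) \<Rightarrow> complex.
               (\<forall>\<^sub>F t in at_top. \<forall>z. (\<forall>j<k. z j \<in> C) \<longrightarrow>
                  R_edge t k z =
                    Determinant.det (Matrix.mat k k (\<lambda>(j, l). K_edge_complex (z j) (z l))) * (1 + \<epsilon> t z)) \<and>
               uniform_limit {z. \<forall>j<k. z j \<in> C} \<epsilon> (\<lambda>_. 0) at_top))"
proof (intro conjI allI impI)
  fix t :: real and p :: "nat \<Rightarrow> complex" and C :: "complex set"
  assume "(\<forall>N. p N = complex_of_real (sqrt 2) * cis (t / sqrt (real N))) \<or>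
      (\<forall>N. p N = - (complex_of_real (sqrt 2) * cis (t / sqrt (real N))))" and "compact C"
  then show "uniform_limit {z. \<forall>j<k. z j \<in> C}
      (\<lambda>N z. complex_of_real (rescaled_correlation (\<lambda>\<zeta>. (cmod \<zeta>)\<^sup>2) (p N) N k z))
      (R_edge t k) sequentially"
    by (intro rescaled_correlation_uniform_limit) auto
next
  fix C :: "complex set"
  assume "compact C"
  then show "\<exists>\<epsilon> :: real \<Rightarrow> (nat \<Rightarrow> complex) \<Rightarrow> complex.
      (\<forall>\<^sub>F t in at_top. \<forall>z. (\<forall>j<k. z j \<in> C) \<longrightarrow>
         R_edge t k z = Determinant.det (Matrix.mat k k (\<lambda>(j, l). K_edge_complex (z j) (z l))) * (1 + \<epsilon> t z)) \<and>
      uniform_limit {z. \<forall>j<k. z j \<in> C} \<epsilon> (\<lambda>_. 0) at_top"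
    using assms by (intro R_edge_asymptotic) auto
qed

end
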